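(* The EDNR problem on grids is NP-hard even when $d_v\in\{0,1\}$ for all non-root vertices $v\neq r$ and $r_e\in\{0,1,\infty\}$ for all edges $e$, where a resistance $\infty$ is interpreted as a sufficiently large integer whose value is bounded by a polynomial in the size of the instance.
   Context: The electrical distribution network reconfiguration (EDNR) problem: given a connected undirected graph $G=(V,E)$ with a fixed root $r\in V$, a demand $d_v\ge 0$ for each $v\in V\setminus\{r\}$, and a resistance $r_e\ge 0$ for each $e\in E$, find a spanning tree $T=(V,F)$ of $G$ minimizing the loss $L(T)=\sum_{e\in F} r_e\big(\sum_{v\in D_T(e)} d_v\big)^2$, where $D_T(e)$ is the vertex set of the connected component of $T-e$ not containing $r$. (NP-hardness refers to the associated decision version with a loss bound $B$.) An $n\times m$-grid is the graph with vertex set $\{(i,j): 0\le i\le n-1,\ 0\le j\le m-1\}$ and edges $\{(i,j),(i',j')\}$ with $|i-i'|+|j-j'|=1$, or any graph isomorphic to it. *)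

theory Defs
  imports Complex_Main "HOL-Computational_Algebra.Polynomial"
begin

section \<open>Turing machines and NP-hardness\<close>

text \<open>
  Deterministic multi-tape Turing machines. States are \<open>{0..<states M}\<close> with start state \<open>0\<close>;
  \<open>states M\<close> itself is the halting state. Tape symbols are \<open>{0..<symbols M}\<close>, where \<open>0\<close> is the
  blank, \<open>1\<close> the bit \<open>False\<close> and \<open>2\<close> the bit \<open>True\<close>. A tape is two-way infinite and is
  represented by its head position and its contents.
\<close>

datatype direction = Go_Left | Stay | Go_Right

record turing_machine =
  tapes :: nat
  states :: nat
  symbols :: nat
  delta :: "nat \<Rightarrow> nat list \<Rightarrow> nat \<times> (nat \<times> direction) list"

definition wf_tm :: "turing_machine \<Rightarrow> bool" where
  "wf_tm M \<longleftrightarrow> tapes M \<ge> 1 \<and> states M \<ge> 1 \<and> symbols M \<ge> 3 \<and>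
     (\<forall>q ss. q < states M \<and> length ss = tapes M \<and> set ss \<subseteq> {..<symbols M} \<longrightarrow>
        fst (delta M q ss) \<le> states M \<and>
        length (snd (delta M q ss)) = tapes M \<and>
        fst ` set (snd (delta M q ss)) \<subseteq> {..<symbols M})"

type_synonym tape = "int \<times> (int \<Rightarrow> nat)"

fun act :: "nat \<times> direction \<Rightarrow> tape \<Rightarrow> tape" where
  "act (s, Go_Left) (h, c) = (h - 1, c(h := s))"
| "act (s, Stay) (h, c) = (h, c(h := s))"
| "act (s, Go_Right) (h, c) = (h + 1, c(h := s))"

definition tm_step :: "turing_machine \<Rightarrow> nat \<times> tape list \<Rightarrow> nat \<times> tape list" where
  "tm_step M = (\<lambda>(q, ts).
     if q = states M then (q, ts)
     else let (q', as) = delta M q (map (\<lambda>(h, c). c h) ts) in (q', map2 act as ts))"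

definition string_contents :: "bool list \<Rightarrow> int \<Rightarrow> nat" where
  "string_contents x i =
     (if 0 \<le> i \<and> i < int (length x) then (if x ! nat i then 2 else 1) else 0)"

text \<open>The input is written on the first tape; the output is read off the last one.\<close>

definition tm_init :: "turing_machine \<Rightarrow> bool list \<Rightarrow> nat \<times> tape list" where
  "tm_init M x = (0, (0, string_contents x) # replicate (tapes M - 1) (0, string_contents []))"

definition computes_in_time ::
  "turing_machine \<Rightarrow> (bool list \<Rightarrow> bool list) \<Rightarrow> (nat \<Rightarrow> nat) \<Rightarrow> bool" where
  "computes_in_time M f T \<longleftrightarrow>
     (\<forall>x. \<exists>t \<le> T (length x). \<exists>ts.
        (tm_step M ^^ t) (tm_init M x) = (states M, ts) \<and>
        snd (last ts) = string_contents (f x))"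

definition poly_time :: "(bool list \<Rightarrow> bool list) \<Rightarrow> bool" where
  "poly_time f \<longleftrightarrow> (\<exists>M (p :: nat poly). wf_tm M \<and> computes_in_time M f (poly p))"

text \<open>Self-delimiting code: every bit is preceded by \<open>True\<close>, the end is marked by \<open>False\<close>.\<close>

definition delimit :: "bool list \<Rightarrow> bool list" where
  "delimit x = concat (map (\<lambda>b. [True, b]) x) @ [False]"

definition NP :: "bool list set set" where
  "NP = {L. \<exists>V (p :: nat poly). poly_time V \<and>
     (\<forall>x. x \<in> L \<longleftrightarrow> (\<exists>u. length u \<le> poly p (length x) \<and> V (delimit x @ u) = [True]))}"

text \<open>
  A decision problem is given by the set of (codes of) its instances and the subset of its
  yes-instances. A reduction must always produce an instance of the problem, so hardness of a
  restricted problem cannot exploit strings that violate the restriction.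
\<close>

definition NP_hard :: "bool list set \<Rightarrow> bool list set \<Rightarrow> bool" where
  "NP_hard instances yes \<longleftrightarrow>
     (\<forall>L \<in> NP. \<exists>f. poly_time f \<and> (\<forall>x. f x \<in> instances \<and> (x \<in> L \<longleftrightarrow> f x \<in> yes)))"


section \<open>Graphs, spanning trees and loss\<close>

definition reach :: "'a set set \<Rightarrow> ('a \<times> 'a) set" where
  "reach F = {(u, v). {u, v} \<in> F}\<^sup>*"

definition simple_graph :: "'a set \<Rightarrow> 'a set set \<Rightarrow> bool" where
  "simple_graph V E \<longleftrightarrow> finite V \<and> (\<forall>e \<in> E. \<exists>u \<in> V. \<exists>v \<in> V. u \<noteq> v \<and> e = {u, v})"

definition connected_graph :: "'a set \<Rightarrow> 'a set set \<Rightarrow> bool" where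
  "connected_graph V E \<longleftrightarrow> (\<forall>u \<in> V. \<forall>v \<in> V. (u, v) \<in> reach E)"

definition is_cycle :: "'a set set \<Rightarrow> 'a list \<Rightarrow> bool" where
  "is_cycle E vs \<longleftrightarrow> length vs \<ge> 3 \<and> distinct vs \<and>
     (\<forall>i < length vs. {vs ! i, vs ! (Suc i mod length vs)} \<in> E)"

definition spanning_tree :: "'a set \<Rightarrow> 'a set set \<Rightarrow> 'a set set \<Rightarrow> bool" where
  "spanning_tree V E F \<longleftrightarrow> F \<subseteq> E \<and> connected_graph V F \<and> (\<nexists>vs. is_cycle F vs)"

text \<open>
  Removing an edge from a tree leaves exactly two components, so the vertices not connected to
  the root form the component that does not contain it.
\<close>

definition downstream :: "'a set \<Rightarrow> 'a \<Rightarrow> 'a set set \<Rightarrow> 'a set \<Rightarrow> 'a set" where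
  "downstream V r F e = {v \<in> V. (r, v) \<notin> reach (F - {e})}"

definition loss ::
  "'a set \<Rightarrow> 'a \<Rightarrow> ('a \<Rightarrow> real) \<Rightarrow> ('a set \<Rightarrow> real) \<Rightarrow> 'a set set \<Rightarrow> real" where
  "loss V r d res F = (\<Sum>e \<in> F. res e * (\<Sum>v \<in> downstream V r F e. d v)\<^sup>2)"

definition grid_graph :: "nat \<Rightarrow> nat \<Rightarrow> 'a set \<Rightarrow> 'a set set \<Rightarrow> bool" where
  "grid_graph n m V E \<longleftrightarrow> simple_graph V E \<and>
     (\<exists>\<phi>. bij_betw \<phi> V ({0..<n} \<times> {0..<m}) \<and>
        (\<forall>u \<in> V. \<forall>v \<in> V. {u, v} \<in> E \<longleftrightarrow>
           \<bar>int (fst (\<phi> u)) - int (fst (\<phi> v))\<bar> + \<bar>int (snd (\<phi> u)) - int (snd (\<phi> v))\<bar> = 1))"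


section \<open>The decision version of EDNR\<close>

text \<open>
  Vertices are \<open>{0..<num_verts I}\<close>. A link \<open>(u, v, w)\<close> is the edge \<open>{u, v}\<close> with resistance \<open>w\<close>.
  The root has no demand; its entry, fixed to \<open>0\<close>, is present only for uniform indexing and never
  enters the loss.
\<close>

record ednr =
  num_verts :: nat
  root :: nat
  demands :: "nat list"
  links :: "(nat \<times> nat \<times> nat) list"
  bound :: nat

definition verts :: "ednr \<Rightarrow> nat set" where
  "verts I = {0..<num_verts I}"

definition edges :: "ednr \<Rightarrow> nat set set" where
  "edges I = (\<lambda>(u, v, w). {u, v}) ` set (links I)"

definition resistance :: "ednr \<Rightarrow> nat set \<Rightarrow> nat" where
  "resistance I e = the (map_of (map (\<lambda>(u, v, w). ({u, v}, w)) (links I)) e)"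

definition ednr_instance :: "ednr \<Rightarrow> bool" where
  "ednr_instance I \<longleftrightarrow>
     root I \<in> verts I \<and> length (demands I) = num_verts I \<and> demands I ! root I = 0 \<and>
     (\<forall>(u, v, w) \<in> set (links I). u < v \<and> v < num_verts I) \<and>
     distinct (map (\<lambda>(u, v, w). (u, v)) (links I)) \<and>
     connected_graph (verts I) (edges I)"

definition ednr_yes :: "ednr \<Rightarrow> bool" where
  "ednr_yes I \<longleftrightarrow> (\<exists>F. spanning_tree (verts I) (edges I) F \<and>
     loss (verts I) (root I) (\<lambda>v. real (demands I ! v)) (\<lambda>e. real (resistance I e)) F
       \<le> real (bound I))"

text \<open>Binary numerals, least significant bit first.\<close>

fun binary :: "nat \<Rightarrow> bool list" where
  "binary n = (if n = 0 then [] else odd n # binary (n div 2))"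

declare binary.simps [simp del]

definition encode :: "ednr \<Rightarrow> bool list" where
  "encode I = concat (map (delimit \<circ> binary)
     (num_verts I # root I # bound I # demands I @ concat (map (\<lambda>(u, v, w). [u, v, w]) (links I))))"

text \<open>
  The integer \<open>M\<close> stands for the resistance \<open>\<infinity>\<close>. It is sufficiently large if it exceeds the loss
  bound: as demands are integers, a tree that sends any demand through an edge of resistance
  \<open>M\<close> then has loss at least \<open>M\<close> and misses the bound, just as for an infinite resistance.
\<close>

definition restricted_grid_ednr :: "nat poly \<Rightarrow> ednr set" where
  "restricted_grid_ednr p = {I. ednr_instance I \<and>
     (\<exists>n m. grid_graph n m (verts I) (edges I)) \<and>
     (\<forall>v \<in> verts I - {root I}. demands I ! v \<in> {0, 1}) \<and>
     (\<exists>M. bound I < M \<and> M \<le> poly p (length (encode I)) \<and>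
        (\<forall>e \<in> edges I. resistance I e \<in> {0, 1, M}))}"


section \<open>The encoding is unambiguous\<close>

lemma binary_inject: "binary m = binary n \<longleftrightarrow> m = n"
proof
  show "binary m = binary n \<Longrightarrow> m = n"
  proof (induction m arbitrary: n rule: less_induct)
    case (less m)
    show ?case
    proof (cases "m = 0 \<or> n = 0")
      case True
      with less.prems show ?thesis
        by (auto simp: binary.simps[of m] binary.simps[of n] split: if_splits)
    next
      case False
      with less.prems have "odd m = odd n" "binary (m div 2) = binary (n div 2)"
        by (auto simp: binary.simps[of m] binary.simps[of n])
      with less.IH[of "m div 2" "n div 2"] False have "m div 2 = n div 2" "m mod 2 = n mod 2"
        by (auto simp: mod2_eq_if)
      then show ?thesis by (metis div_mult_mod_eq)
    qed
  qed
qed simp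

lemma delimit_append_inject: "delimit x @ u = delimit y @ v \<longleftrightarrow> x = y \<and> u = v"
proof (induction x arbitrary: y)
  case Nil
  show ?case by (cases y) (auto simp: delimit_def)
next
  case (Cons b x)
  show ?case using Cons.IH by (cases y) (auto simp: delimit_def)
qed

lemma encode_nats_inject:
  "concat (map (delimit \<circ> binary) xs) = concat (map (delimit \<circ> binary) ys) \<longleftrightarrow> xs = ys"
proof (induction xs arbitrary: ys)
  case Nil
  show ?case by (cases ys) (auto simp: delimit_def)
next
  case (Cons x xs)
  show ?case
  proof (cases ys)
    case Nil
    then show ?thesis by (auto simp: delimit_def)
  next
    case (Cons y ys')
    then show ?thesis using Cons.IH by (simp add: delimit_append_inject binary_inject)
  qed
qed

lemma encode_inject:
  assumes "ednr_instance I" "ednr_instance J" "encode I = encode J"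
  shows "I = J"
proof -
  have triples: "concat (map (\<lambda>(u, v, w). [u, v, w]) xs) = concat (map (\<lambda>(u, v, w). [u, v, w]) ys)
      \<Longrightarrow> xs = ys" for xs ys :: "(nat \<times> nat \<times> nat) list"
  proof (induction xs arbitrary: ys)
    case Nil
    then show ?case by (cases ys) auto
  next
    case (Cons x xs)
    then show ?case by (cases x; cases ys) auto
  qed
  have "num_verts I = num_verts J" "root I = root J" "bound I = bound J"
    and rest: "demands I @ concat (map (\<lambda>(u, v, w). [u, v, w]) (links I)) =
         demands J @ concat (map (\<lambda>(u, v, w). [u, v, w]) (links J))"
    using assms(3) unfolding encode_def encode_nats_inject by auto
  moreover have "length (demands I) = length (demands J)"
    using assms(1,2) \<open>num_verts I = num_verts J\<close> by (simp add: ednr_instance_def)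
  ultimately have "demands I = demands J" "links I = links J"
    using triples by auto
  with \<open>num_verts I = num_verts J\<close> \<open>root I = root J\<close> \<open>bound I = bound J\<close> show ?thesis
    by simp
qed

end

theory Submission
  imports Defs
begin

text \<open>
  Any language in NP is reduced to the grid problem by way of tilings. In the grids used here every second row of
  horizontal edges is free and the demand can only get from one free row to the next through the odd columns, at
  cost one. A tree within the loss bound must spread the demand as evenly as possible, so each of these
  columns carries one of two consecutive loads, that is, a bit. The first rows of demands let the tree choose
  the bits, and groups of further rows enforce equations between sums of bits. This suffices to describe the tilings
  of a rectangle with prescribed sets of admissible tiles, which encode the accepting computations of a verifier. The
  reduction is computed by a loop program whose loops only modify registers above those they run over, and such programs
  compile to polynomial-time Turing machines.
\<close>

section \<open>Spanning trees as rooted trees carrying a flow\<close>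

text \<open>Why a bound on the loss produces bits: for integers the product (g - t)(g - t - 1) is
  never negative and vanishes only at g = t and g = t + 1. Summed over all cost-one columns it
  equals the sum of the squared loads minus the bound. The obstacle is that the number of heavy
  columns in a layer is thereby fixed, so no bit can change alone. Hence each variable owns two
  columns, its value and its negation, and exactly one of them is heavy. Equations are tested by a
  carry: an even column holding two units must send both to the same side, since a vertex has one
  parent, and this direction travels along the row as the prefix sum of signed variables. Prefix
  sums must therefore stay in {0, 1}, which suits tilings, whose constraints compare one site with a
  later one. Reading a bit flips the column it sits in; further rows flip it back, so that all
  constraints share the same variables. Since the demand above a layer is prescribed, every
  constraint needs as many positive as negative signs; the set of all tiles is symmetric enough to
  guarantee this.\<close>

definition rooted_tree :: "'a set \<Rightarrow> 'a \<Rightarrow> ('a \<Rightarrow> 'a) \<Rightarrow> ('a \<Rightarrow> nat) \<Rightarrow> bool" where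
  "rooted_tree V r p rk \<longleftrightarrow> finite V \<and> r \<in> V \<and> p r = r \<and>
     (\<forall>v \<in> V - {r}. p v \<in> V \<and> rk (p v) < rk v)"

definition tree_edges :: "'a set \<Rightarrow> 'a \<Rightarrow> ('a \<Rightarrow> 'a) \<Rightarrow> 'a set set" where
  "tree_edges V r p = (\<lambda>v. {v, p v}) ` (V - {r})"

text \<open>The inflow is written as an indicator sum over all non-root vertices, so that it can be
  reindexed along a bijection of the vertex set.\<close>

definition flow_on :: "'a set \<Rightarrow> 'a \<Rightarrow> ('a \<Rightarrow> 'a) \<Rightarrow> ('a \<Rightarrow> nat) \<Rightarrow> ('a \<Rightarrow> nat) \<Rightarrow> bool" where
  "flow_on V r p d \<phi> \<longleftrightarrow>
     (\<forall>v \<in> V - {r}. \<phi> v = d v + (\<Sum>u \<in> V - {r}. if p u = v then \<phi> u else 0))"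

definition descendants :: "'a set \<Rightarrow> ('a \<Rightarrow> 'a) \<Rightarrow> 'a \<Rightarrow> 'a set" where
  "descendants V p v = {u \<in> V. \<exists>n. (p ^^ n) u = v}"

lemma sym_reach: "(u, v) \<in> reach F \<Longrightarrow> (v, u) \<in> reach F"
proof -
  have "sym {(u, v). {u, v} \<in> F}" by (auto simp: sym_def insert_commute)
  then have "sym (reach F)" unfolding reach_def by (rule sym_rtrancl)
  then show "(u, v) \<in> reach F \<Longrightarrow> (v, u) \<in> reach F" by (rule symD)
qed

lemma reach_trans: "(u, v) \<in> reach F \<Longrightarrow> (v, w) \<in> reach F \<Longrightarrow> (u, w) \<in> reach F"
  unfolding reach_def by (rule rtrancl_trans)

lemma reach_edge: "{u, v} \<in> F \<Longrightarrow> (u, v) \<in> reach F"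
  unfolding reach_def by auto

lemma reach_mono: "F \<subseteq> F' \<Longrightarrow> reach F \<subseteq> reach F'"
  unfolding reach_def by (rule rtrancl_mono) auto

lemma rooted_treeD:
  assumes "rooted_tree V r p rk" "v \<in> V" "v \<noteq> r"
  shows "p v \<in> V" "rk (p v) < rk v"
  using assms unfolding rooted_tree_def by auto

lemma rank_funpow_le:
  assumes "rooted_tree V r p rk" "v \<in> V"
  shows "(p ^^ n) v \<in> V \<and> rk ((p ^^ n) v) \<le> rk v"
proof (induction n)
  case 0 show ?case using assms by simp
next
  case (Suc n)
  show ?case
  proof (cases "(p ^^ n) v = r")
    case True
    then show ?thesis using Suc assms(1) by (simp add: rooted_tree_def)
  next
    case False
    then show ?thesis using Suc rooted_treeD[OF assms(1)] by (metis funpow.simps(2) comp_apply less_imp_le order.trans)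
  qed
qed

lemma funpow_root: "rooted_tree V r p rk \<Longrightarrow> (p ^^ n) r = r"
  by (induction n) (auto simp: rooted_tree_def)

text \<open>Induction on the rank: the parent of a vertex outside the subtree of \<open>v\<close> is
  again outside, and the edge to it is not the removed one, since the vertex is not \<open>v\<close>
  and the ranks exclude the reversed edge.\<close>

lemma reach_root_avoiding:
  assumes T: "rooted_tree V r p rk" and "v \<in> V" "v \<noteq> r" "u \<in> V" "u \<notin> descendants V p v"
  shows "(u, r) \<in> reach (tree_edges V r p - {{v, p v}})"
  using assms(4,5)
proof (induction "rk u" arbitrary: u rule: less_induct)
  case less
  show ?case
  proof (cases "u = r")
    case True then show ?thesis by (simp add: reach_def)
  next
    case False
    note pu = rooted_treeD[OF T less.prems(1) False]
    have "p u \<notin> descendants V p v"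
    proof
      assume "p u \<in> descendants V p v"
      then obtain n where "(p ^^ n) (p u) = v" by (auto simp: descendants_def)
      then have "(p ^^ Suc n) u = v" by (simp add: funpow_swap1)
      then show False using less.prems by (auto simp: descendants_def simp del: funpow.simps)
    qed
    then have IH: "(p u, r) \<in> reach (tree_edges V r p - {{v, p v}})"
      using less.hyps pu by blast
    have "v \<in> descendants V p v" using assms(2) by (auto simp: descendants_def intro: exI[of _ "0::nat"])
    then have "u \<noteq> v" using less.prems by auto
    moreover have "\<not> (u = p v \<and> p u = v)"
      using rooted_treeD(2)[OF T assms(2,3)] pu(2) by auto
    ultimately have "{u, p u} \<noteq> {v, p v}" by (auto simp: doubleton_eq_iff)
    then have "{u, p u} \<in> tree_edges V r p - {{v, p v}}"
      using less.prems False by (auto simp: tree_edges_def)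
    then show ?thesis using IH reach_edge reach_trans by metis
  qed
qed

lemma reach_root:
  assumes T: "rooted_tree V r p rk" and "u \<in> V"
  shows "(u, r) \<in> reach (tree_edges V r p)"
  using assms(2)
proof (induction "rk u" arbitrary: u rule: less_induct)
  case less
  show ?case
  proof (cases "u = r")
    case True then show ?thesis by (simp add: reach_def)
  next
    case False
    note pu = rooted_treeD[OF T less.prems(1) False]
    have "{u, p u} \<in> tree_edges V r p" using less.prems False by (auto simp: tree_edges_def)
    then show ?thesis using less.hyps[OF pu(2,1)] reach_edge reach_trans by metis
  qed
qed

lemma downstream_tree:
  assumes T: "rooted_tree V r p rk" and v: "v \<in> V" "v \<noteq> r"
  shows "downstream V r (tree_edges V r p) {v, p v} = descendants V p v"
proof (intro equalityI subsetI)
  fix u assume "u \<in> downstream V r (tree_edges V r p) {v, p v}"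
  then have "u \<in> V" "(r, u) \<notin> reach (tree_edges V r p - {{v, p v}})"
    by (auto simp: downstream_def)
  then show "u \<in> descendants V p v"
    using reach_root_avoiding[OF T v] sym_reach by metis
next
  fix u assume u: "u \<in> descendants V p v"
  \<comment> \<open>A walk that starts in the subtree of \<open>v\<close> can leave it only along
    the edge from \<open>v\<close> to its parent, which has been removed.\<close>
  have "w \<in> descendants V p v" if "(u, w) \<in> reach (tree_edges V r p - {{v, p v}})" for w
    using that unfolding reach_def
  proof (induction rule: rtrancl_induct)
    case base show ?case by (rule u)
  next
    case (step x y)
    from step.hyps(2) have "{x, y} \<in> tree_edges V r p" and ne: "{x, y} \<noteq> {v, p v}" by auto
    then obtain z where z: "z \<in> V" "z \<noteq> r" "{x, y} = {z, p z}" unfolding tree_edges_def by blast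
    from step.IH obtain n where n: "(p ^^ n) x = v" by (auto simp: descendants_def)
    from z(3) consider "x = z" "y = p z" | "x = p z" "y = z" by (auto simp: doubleton_eq_iff)
    then show ?case
    proof cases
      case 1
      then have "x \<noteq> v" using ne by auto
      then obtain n' where "n = Suc n'" using n by (cases n) auto
      then have "(p ^^ n') y = v" using n 1 by (simp add: funpow_swap1)
      then show ?thesis using 1 rooted_treeD(1)[OF T z(1,2)] by (auto simp: descendants_def)
    next
      case 2
      then have "(p ^^ Suc n) y = v" using n by (simp add: funpow_swap1)
      then show ?thesis using 2 z(1) by (auto simp: descendants_def simp del: funpow.simps)
    qed
  qed
  moreover have "r \<notin> descendants V p v" using funpow_root[OF T] v(2) by (auto simp: descendants_def)
  ultimately show "u \<in> downstream V r (tree_edges V r p) {v, p v}"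
    using u sym_reach by (fastforce simp: downstream_def descendants_def)
qed

text \<open>On a cycle, both neighbours of a vertex of maximal rank must be its parent, which
  contradicts distinctness as soon as the length is at least three.\<close>

lemma tree_acyclic:
  assumes T: "rooted_tree V r p rk"
  shows "\<not> is_cycle (tree_edges V r p) vs"
proof
  assume C: "is_cycle (tree_edges V r p) vs"
  let ?n = "length vs"
  have n: "?n \<ge> 3" and dist: "distinct vs"
    and e: "\<And>i. i < ?n \<Longrightarrow> {vs ! i, vs ! (Suc i mod ?n)} \<in> tree_edges V r p"
    using C by (auto simp: is_cycle_def)
  have "finite ((\<lambda>i. rk (vs ! i)) ` {..<?n})" "(\<lambda>i. rk (vs ! i)) ` {..<?n} \<noteq> {}"
    using n by (auto simp: lessThan_empty_iff)
  from Max_in[OF this] obtain i where i: "i < ?n"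
    and mx: "rk (vs ! i) = Max ((\<lambda>i. rk (vs ! i)) ` {..<?n})" by auto
  have ge: "rk (vs ! j) \<le> rk (vs ! i)" if "j < ?n" for j
    unfolding mx using that by (intro Max_ge) auto
  have par: "w = p (vs ! i)" if "{vs ! i, w} \<in> tree_edges V r p" "rk w \<le> rk (vs ! i)" for w
  proof -
    from that(1) obtain z where z: "z \<in> V" "z \<noteq> r" "{vs ! i, w} = {z, p z}"
      by (auto simp: tree_edges_def)
    then show ?thesis using that(2) rooted_treeD(2)[OF T z(1,2)] by (auto simp: doubleton_eq_iff)
  qed
  let ?j = "Suc i mod ?n" and ?k = "(i + ?n - 1) mod ?n"
  have jk: "?j < ?n" "?k < ?n" using n by (auto intro!: mod_less_divisor)
  have kn: "?k = (if i = 0 then ?n - 1 else i - 1)"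
    using i n by (cases "i = 0") (auto simp: mod_if)
  have jn: "?j = (if Suc i = ?n then 0 else Suc i)" using i by (auto simp: mod_if)
  have "Suc ?k mod ?n = i" using i n kn by auto
  then have "{vs ! i, vs ! ?k} \<in> tree_edges V r p" using e[OF jk(2)] by (simp add: insert_commute)
  then have "vs ! ?k = p (vs ! i)" using par ge[OF jk(2)] by blast
  moreover have "vs ! ?j = p (vs ! i)" using par e[OF i] ge[OF jk(1)] by blast
  ultimately have "?k = ?j" using dist jk nth_eq_iff_index_eq by metis
  then show False using kn jn n i by (auto split: if_splits)
qed

lemma rooted_tree_spanning:
  assumes "rooted_tree V r p rk" "tree_edges V r p \<subseteq> E"
  shows "spanning_tree V E (tree_edges V r p)"
  using assms tree_acyclic[OF assms(1)] reach_root[OF assms(1)] sym_reach reach_trans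
  unfolding spanning_tree_def connected_graph_def by metis

text \<open>Add up the flow equation over the whole subtree. Each descendant other than
  \<open>v\<close> is a child of exactly one descendant, so its flow cancels; what is left is the
  flow of \<open>v\<close>.\<close>

lemma flow_eq_sum_descendants:
  assumes T: "rooted_tree V r p rk" and f: "flow_on V r p d \<phi>" and v: "v \<in> V" "v \<noteq> r"
  shows "\<phi> v = (\<Sum>u \<in> descendants V p v. d u)"
proof -
  let ?D = "descendants V p v"
  have fin: "finite V" using T by (simp add: rooted_tree_def)
  then have finD: "finite ?D" by (simp add: descendants_def)
  have vD: "v \<in> ?D" using v by (auto simp: descendants_def intro: exI[of _ "0::nat"])
  have rD: "r \<notin> ?D" using funpow_root[OF T] v(2) by (auto simp: descendants_def)
  have DV: "?D \<subseteq> V" by (auto simp: descendants_def)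
  have child: "{u \<in> V - {r}. p u = w} = {u \<in> ?D - {v}. p u = w}" if "w \<in> ?D" for w
  proof (intro equalityI subsetI)
    fix u assume u: "u \<in> {u \<in> V - {r}. p u = w}"
    from that obtain n where n: "(p ^^ n) w = v" by (auto simp: descendants_def)
    then have "(p ^^ Suc n) u = v" using u by (simp add: funpow_swap1)
    then have "u \<in> ?D" using u by (auto simp: descendants_def simp del: funpow.simps)
    moreover have "u \<noteq> v"
    proof
      assume "u = v"
      then have "rk w < rk v" using u rooted_treeD(2)[OF T v] by auto
      moreover have "rk v \<le> rk w" using rank_funpow_le[OF T, of w n] n that DV by auto
      ultimately show False by simp
    qed
    ultimately show "u \<in> {u \<in> ?D - {v}. p u = w}" using u by auto
  qed (use DV rD in auto)
  have img: "p ` (?D - {v}) \<subseteq> ?D"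
  proof
    fix w assume "w \<in> p ` (?D - {v})"
    then obtain u n where u: "u \<in> V" "u \<noteq> v" "(p ^^ n) u = v" "w = p u" by (auto simp: descendants_def)
    then obtain n' where "n = Suc n'" by (cases n) auto
    then have "(p ^^ n') w = v" using u by (simp add: funpow_swap1)
    moreover have "u \<noteq> r" using u funpow_root[OF T] v(2) by metis
    ultimately show "w \<in> ?D" using u rooted_treeD(1)[OF T] by (auto simp: descendants_def)
  qed
  have "(\<Sum>w \<in> ?D. \<phi> w) = (\<Sum>w \<in> ?D. d w + (\<Sum>u \<in> {u \<in> V - {r}. p u = w}. \<phi> u))"
  proof (rule sum.cong[OF refl])
    fix w assume w: "w \<in> ?D"
    then have "\<phi> w = d w + (\<Sum>u \<in> V - {r}. if p u = w then \<phi> u else 0)"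
      using f DV rD unfolding flow_on_def by blast
    also have "(\<Sum>u \<in> V - {r}. if p u = w then \<phi> u else 0) = (\<Sum>u \<in> {u \<in> V - {r}. p u = w}. \<phi> u)"
      by (rule sum.inter_filter[symmetric]) (use fin in auto)
    finally show "\<phi> w = d w + (\<Sum>u \<in> {u \<in> V - {r}. p u = w}. \<phi> u)" .
  qed
  also have "\<dots> = (\<Sum>w \<in> ?D. d w) + (\<Sum>w \<in> ?D. \<Sum>u \<in> {u \<in> ?D - {v}. p u = w}. \<phi> u)"
    unfolding sum.distrib by (intro arg_cong2[of _ _ _ _ "(+)"] refl sum.cong child)
  also have "(\<Sum>w \<in> ?D. \<Sum>u \<in> {u \<in> ?D - {v}. p u = w}. \<phi> u) = (\<Sum>u \<in> ?D - {v}. \<phi> u)"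
    by (rule sum.group) (use finD img in auto)
  finally show ?thesis using sum.remove[OF finD vD, of \<phi>] by simp
qed

text \<open>A subtree consists of its top vertex and the disjoint subtrees of the children, so
  subtree sums of demands satisfy the flow equation.\<close>

lemma flow_exists:
  assumes T: "rooted_tree V r p rk"
  shows "flow_on V r p d (\<lambda>v. \<Sum>u \<in> descendants V p v. d u)"
  unfolding flow_on_def
proof
  fix v assume v: "v \<in> V - {r}"
  let ?D = "descendants V p" and ?C = "{u \<in> V - {r}. p u = v}"
  have fin: "finite V" using T by (simp add: rooted_tree_def)
  have "?D v = {v} \<union> (\<Union>w \<in> ?C. ?D w)"
  proof (intro equalityI subsetI)
    fix u assume "u \<in> ?D v"
    then obtain n where u: "u \<in> V" "(p ^^ n) u = v" by (auto simp: descendants_def)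
    show "u \<in> {v} \<union> (\<Union>w \<in> ?C. ?D w)"
    proof (cases n)
      case (Suc n')
      then have "p ((p ^^ n') u) = v" using u by simp
      moreover have "(p ^^ n') u \<in> V" using rank_funpow_le[OF T] u by blast
      moreover have "(p ^^ n') u \<noteq> r" using calculation(1) v T by (auto simp: rooted_tree_def)
      ultimately show ?thesis using u(1) by (auto simp: descendants_def)
    qed (use u in auto)
  next
    fix u assume "u \<in> {v} \<union> (\<Union>w \<in> ?C. ?D w)"
    then show "u \<in> ?D v"
    proof
      assume "u \<in> {v}" then show ?thesis using v by (auto simp: descendants_def intro: exI[of _ "0::nat"])
    next
      assume "u \<in> (\<Union>w \<in> ?C. ?D w)"
      then obtain n where "u \<in> V" "p ((p ^^ n) u) = v" by (auto simp: descendants_def)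
      then show ?thesis by (auto simp: descendants_def intro!: exI[of _ "Suc n"])
    qed
  qed
  moreover have "v \<notin> (\<Union>w \<in> ?C. ?D w)"
  proof
    assume "v \<in> (\<Union>w \<in> ?C. ?D w)"
    then obtain w n where w: "w \<in> V" "w \<noteq> r" "p w = v" "(p ^^ n) v = w" by (auto simp: descendants_def)
    then show False using rank_funpow_le[OF T, of v n] rooted_treeD(2)[OF T w(1,2)] v by auto
  qed
  moreover have "?D w \<inter> ?D w' = {}" if w: "w \<in> ?C" "w' \<in> ?C" "w \<noteq> w'" for w w'
  proof -
    \<comment> \<open>One child would be an ancestor of the other, hence of rank at most that of
      their common parent \<open>v\<close>.\<close>
    have *: False if h: "u \<in> V" "(p ^^ n) u = w" "(p ^^ (n + Suc k)) u = w'" "w \<in> ?C" "w' \<in> ?C" for u n k w w'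
    proof -
      have "w' = (p ^^ k) (p ((p ^^ n) u))"
        using h(3) by (metis add.commute add_Suc_shift comp_apply funpow.simps(2) funpow_add funpow_swap1)
      then have "w' = (p ^^ k) v" using h by auto
      then show False using rank_funpow_le[OF T, of v k] rooted_treeD(2)[OF T, of w'] h(5) v by auto
    qed
    show ?thesis
    proof (rule ccontr)
      assume "?D w \<inter> ?D w' \<noteq> {}"
      then obtain u n n' where u: "u \<in> V" "(p ^^ n) u = w" "(p ^^ n') u = w'" by (auto simp: descendants_def)
      then have "n \<noteq> n'" using w(3) by auto
      then consider k where "n' = n + Suc k" | k where "n = n' + Suc k"
        by (metis add_Suc_right less_imp_Suc_add linorder_neqE_nat)
      then show False using *[of u n w _ w'] *[of u n' w' _ w] u w by cases blast+
    qed
  qed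
  ultimately have "(\<Sum>u \<in> ?D v. d u) = d v + (\<Sum>w \<in> ?C. \<Sum>u \<in> ?D w. d u)"
    using fin by (simp add: descendants_def sum.UNION_disjoint)
  also have "(\<Sum>w \<in> ?C. \<Sum>u \<in> ?D w. d u) = (\<Sum>u \<in> V - {r}. if p u = v then \<Sum>u \<in> ?D u. d u else 0)"
    by (rule sum.inter_filter) (use fin in auto)
  finally show "(\<Sum>u \<in> ?D v. d u) = d v + (\<Sum>u \<in> V - {r}. if p u = v then \<Sum>u \<in> ?D u. d u else 0)" .
qed

text \<open>Each tree edge is indexed by its endpoint of larger rank, which is injective. This
  replaces reachability in the definition of the loss by a flow.\<close>

lemma loss_tree:
  assumes T: "rooted_tree V r p rk" and f: "flow_on V r p d \<phi>"
  shows "loss V r (\<lambda>v. real (d v)) (\<lambda>e. real (c e)) (tree_edges V r p) =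
    real (\<Sum>v \<in> V - {r}. c {v, p v} * (\<phi> v)\<^sup>2)"
proof -
  have inj: "inj_on (\<lambda>v. {v, p v}) (V - {r})"
  proof (rule inj_onI)
    fix v w assume h: "v \<in> V - {r}" "w \<in> V - {r}" "{v, p v} = {w, p w}"
    show "v = w"
      using h rooted_treeD(2)[OF T, of v] rooted_treeD(2)[OF T, of w] by (auto simp: doubleton_eq_iff)
  qed
  have "loss V r (\<lambda>v. real (d v)) (\<lambda>e. real (c e)) (tree_edges V r p) =
    (\<Sum>v \<in> V - {r}. real (c {v, p v}) *
       (\<Sum>u \<in> downstream V r (tree_edges V r p) {v, p v}. real (d u))\<^sup>2)"
    unfolding loss_def by (subst (1) tree_edges_def) (simp add: sum.reindex[OF inj])
  also have "\<dots> = (\<Sum>v \<in> V - {r}. real (c {v, p v} * (\<phi> v)\<^sup>2))"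
    by (rule sum.cong[OF refl])
       (auto simp: downstream_tree[OF T] flow_eq_sum_descendants[OF T f])
  finally show ?thesis by simp
qed

section \<open>From spanning trees to rooted trees\<close>

lemma distinct_path:
  assumes "(u, w) \<in> S\<^sup>*"
  shows "\<exists>vs. vs \<noteq> [] \<and> hd vs = u \<and> last vs = w \<and> distinct vs \<and>
    (\<forall>i. Suc i < length vs \<longrightarrow> (vs ! i, vs ! Suc i) \<in> S)"
  using assms
proof (induction rule: rtrancl_induct)
  case base
  then show ?case by (intro exI[of _ "[u]"]) auto
next
  case (step w w')
  then obtain vs where vs: "vs \<noteq> []" "hd vs = u" "last vs = w" "distinct vs"
    "\<And>i. Suc i < length vs \<Longrightarrow> (vs ! i, vs ! Suc i) \<in> S" by blast
  show ?case
  proof (cases "w' \<in> set vs")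
    case True
    then obtain k where k: "k < length vs" "vs ! k = w'" by (auto simp: in_set_conv_nth)
    have "last (take (Suc k) vs) = w'" using k by (simp add: take_Suc_conv_app_nth)
    then show ?thesis using vs k by (intro exI[of _ "take (Suc k) vs"]) auto
  next
    case False
    have "((vs @ [w']) ! i, (vs @ [w']) ! Suc i) \<in> S" if "Suc i < length (vs @ [w'])" for i
    proof (cases "Suc i < length vs")
      case True then show ?thesis using vs(5) by (simp add: nth_append)
    next
      case c: False
      then have "i = length vs - 1" using that by simp
      then show ?thesis using vs(1,3) step.hyps(2) that by (auto simp: nth_append last_conv_nth)
    qed
    then show ?thesis using vs False by (intro exI[of _ "vs @ [w']"]) auto
  qed
qed

text \<open>A simple path between the ends of an edge closes up to a cycle; it has at least three
  vertices because it avoids that edge.\<close>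

lemma cycle_of_redundant_edge:
  assumes "{u, w} \<in> F" "u \<noteq> w" "(u, w) \<in> reach (F - {{u, w}})"
  shows "\<exists>vs. is_cycle F vs"
proof -
  obtain vs where vs: "vs \<noteq> []" "hd vs = u" "last vs = w" "distinct vs"
    "\<And>i. Suc i < length vs \<Longrightarrow> {vs ! i, vs ! Suc i} \<in> F - {{u, w}}"
    using distinct_path[OF assms(3)[unfolded reach_def]] by auto
  have u: "vs ! 0 = u" and w: "vs ! (length vs - 1) = w" using vs by (auto simp: hd_conv_nth last_conv_nth)
  have "length vs \<noteq> 1" using u w assms(2) by auto
  moreover have "length vs \<noteq> 2"
  proof
    assume "length vs = 2"
    then have "{u, w} \<in> F - {{u, w}}" using vs(5)[of 0] u w by simp
    then show False by simp
  qed
  ultimately have l: "length vs \<ge> 3" using vs(1) by (metis One_nat_def Suc_1 Suc_leI length_greater_0_conv nat_less_le numeral_3_eq_3)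
  moreover have "{vs ! i, vs ! (Suc i mod length vs)} \<in> F" if "i < length vs" for i
  proof (cases "Suc i < length vs")
    case True then show ?thesis using vs(5)[of i] by simp
  next
    case False
    then have "Suc i = length vs" using that by simp
    moreover have "vs ! i = w" using w calculation by (metis diff_Suc_1)
    ultimately show ?thesis using u assms(1) by (simp add: insert_commute)
  qed
  ultimately show ?thesis using vs(4) unfolding is_cycle_def by blast
qed

text \<open>The rank is the distance from the root within \<open>F\<close>. The edges that lead to a
  closer neighbour already connect all vertices, so any further edge of \<open>F\<close> would close
  a cycle.\<close>

lemma spanning_tree_rooted:
  assumes S: "spanning_tree V E F" and V: "finite V" "r \<in> V"
    and E: "\<And>e. e \<in> E \<Longrightarrow> \<exists>u \<in> V. \<exists>v \<in> V. u \<noteq> v \<and> e = {u, v}"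
  shows "\<exists>p rk. rooted_tree V r p rk \<and> F = tree_edges V r p"
proof -
  let ?R = "{(u, v). {u, v} \<in> F}"
  define rk where "rk v = (LEAST n. (r, v) \<in> ?R ^^ n)" for v
  have FE: "F \<subseteq> E" and con: "\<And>u v. u \<in> V \<Longrightarrow> v \<in> V \<Longrightarrow> (u, v) \<in> reach F" and ac: "\<not> is_cycle F vs" for vs
    using S by (auto simp: spanning_tree_def connected_graph_def)
  have ex: "\<exists>w. w \<in> V \<and> {v, w} \<in> F \<and> rk w < rk v" if v: "v \<in> V" "v \<noteq> r" for v
  proof -
    have "(r, v) \<in> ?R\<^sup>*" using con[OF V(2) v(1)] by (simp add: reach_def)
    then obtain n where "(r, v) \<in> ?R ^^ n" using rtrancl_imp_relpow by metis
    then have *: "(r, v) \<in> ?R ^^ rk v" unfolding rk_def by (rule LeastI)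
    then obtain k where k: "rk v = Suc k" using v(2) by (cases "rk v") auto
    then obtain w where w: "(r, w) \<in> ?R ^^ k" "(w, v) \<in> ?R" using * by auto
    then have "rk w \<le> k" unfolding rk_def by (intro Least_le)
    moreover have "w \<in> V" using w(2) FE E[of "{w, v}"] by (fastforce simp: doubleton_eq_iff)
    ultimately show ?thesis using w(2) k by (auto simp: insert_commute)
  qed
  define p where "p v = (if v \<in> V \<and> v \<noteq> r then SOME w. w \<in> V \<and> {v, w} \<in> F \<and> rk w < rk v else r)" for v
  have p: "p v \<in> V \<and> {v, p v} \<in> F \<and> rk (p v) < rk v" if "v \<in> V" "v \<noteq> r" for v
    using someI_ex[OF ex[OF that]] that by (simp add: p_def)
  have T: "rooted_tree V r p rk" using V p by (auto simp: rooted_tree_def p_def)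
  have sub: "tree_edges V r p \<subseteq> F" using p by (auto simp: tree_edges_def)
  have "F \<subseteq> tree_edges V r p"
  proof (rule ccontr)
    assume "\<not> F \<subseteq> tree_edges V r p"
    then obtain e where e: "e \<in> F" "e \<notin> tree_edges V r p" by auto
    then obtain u w where uw: "u \<in> V" "w \<in> V" "u \<noteq> w" "e = {u, w}" using FE E by blast
    have "(u, w) \<in> reach (tree_edges V r p)"
      using reach_root[OF T] uw sym_reach reach_trans by metis
    moreover have "tree_edges V r p \<subseteq> F - {{u, w}}" using sub e uw by auto
    ultimately have "(u, w) \<in> reach (F - {{u, w}})" using reach_mono by blast
    then show False using cycle_of_redundant_edge[of u w F] uw e ac by auto
  qed
  then show ?thesis using T sub by blast
qed

section \<open>Grid instances\<close>

text \<open>Instances number their vertices, while the flow argument works with coordinates; both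
  directions of the translation relabel a tree together with its flow.\<close>

lemma rooted_tree_transfer:
  fixes e :: "'a \<Rightarrow> 'b"
  assumes e: "bij_betw e V V'" and T: "rooted_tree V r p rk" and f: "flow_on V r p d \<phi>"
    and d: "\<And>v. v \<in> V \<Longrightarrow> d' (e v) = d v"
  shows "rooted_tree V' (e r) (\<lambda>v. e (p (inv_into V e v))) (\<lambda>v. rk (inv_into V e v))"
    "flow_on V' (e r) (\<lambda>v. e (p (inv_into V e v))) d' (\<lambda>v. \<phi> (inv_into V e v))"
    "\<And>c :: 'b \<Rightarrow> nat. (\<Sum>v \<in> V' - {e r}. c v) = (\<Sum>v \<in> V - {r}. c (e v))"
    "\<And>v. v \<in> V \<Longrightarrow> inv_into V e (e v) = v"
proof -
  have inj: "inj_on e V" and im: "e ` V = V'" using e by (auto simp: bij_betw_def)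
  show inv: "\<And>v. v \<in> V \<Longrightarrow> inv_into V e (e v) = v" using inj by simp
  have r: "r \<in> V" using T by (simp add: rooted_tree_def)
  have pV: "p v \<in> V" if "v \<in> V" for v using T that by (cases "v = r") (auto simp: rooted_tree_def)
  have ball: "(\<forall>v \<in> V' - {e r}. P v) \<longleftrightarrow> (\<forall>v \<in> V - {r}. P (e v))" for P
    unfolding im[symmetric] using inj r by (auto simp: inj_on_eq_iff)
  have "V' - {e r} = e ` (V - {r})" unfolding im[symmetric] using inj r by (auto simp: inj_on_eq_iff)
  then show sm: "(\<Sum>v \<in> V' - {e r}. c v) = (\<Sum>v \<in> V - {r}. c (e v))" for c :: "'b \<Rightarrow> nat"
    using sum.reindex[of e "V - {r}" c] inj by (simp add: inj_on_subset[of e V] comp_def)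
  show "rooted_tree V' (e r) (\<lambda>v. e (p (inv_into V e v))) (\<lambda>v. rk (inv_into V e v))"
    using T inj im r pV unfolding rooted_tree_def ball by (auto simp: inv)
  show "flow_on V' (e r) (\<lambda>v. e (p (inv_into V e v))) d' (\<lambda>v. \<phi> (inv_into V e v))"
    unfolding flow_on_def ball sm
  proof
    fix v assume v: "v \<in> V - {r}"
    have "(\<Sum>u \<in> V - {r}. if p u = v then \<phi> u else 0) =
        (\<Sum>u \<in> V - {r}. if e (p (inv_into V e (e u))) = e v then \<phi> (inv_into V e (e u)) else 0)"
      using v by (intro sum.cong) (auto simp: inv inj_on_eq_iff[OF inj] pV)
    then show "\<phi> (inv_into V e (e v)) = d' (e v) +
        (\<Sum>u \<in> V - {r}. if e (p (inv_into V e (e u))) = e v then \<phi> (inv_into V e (e u)) else 0)"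
      using f v d by (auto simp: flow_on_def inv)
  qed
qed

text \<open>\<open>Suc B\<close> acts as the infinite resistance: a single unit sent through such an
  edge already exceeds the bound \<open>B\<close>. Movement along a row is thus possible only in odd
  rows.\<close>

definition hres :: "nat \<Rightarrow> nat \<Rightarrow> nat" where
  "hres B y = (if odd y then 0 else Suc B)"

text \<open>Vertical edges below odd rows are free, so every even row except the top one is attached
  to the free row above it. Demand proceeds towards the last row only through the cost-one edges
  below even rows, at odd columns.\<close>

definition vres :: "nat \<Rightarrow> nat \<Rightarrow> nat \<Rightarrow> nat" where
  "vres B y x = (if odd y then 0 else if odd x then 1 else Suc B)"

text \<open>The root lies at the left end of the last row, so all demand has to pass every layer of
  cost-one edges below it.\<close>

definition grid_inst :: "nat \<Rightarrow> nat \<Rightarrow> (nat \<Rightarrow> nat \<Rightarrow> nat) \<Rightarrow> nat \<Rightarrow> ednr" where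
  "grid_inst H W D B = \<lparr>num_verts = H * W, root = (H - 1) * W,
     demands = map (\<lambda>v. D (v div W) (v mod W)) [0..<H * W],
     links = concat (map (\<lambda>v.
         (if Suc (v mod W) < W then [(v, v + 1, hres B (v div W))] else []) @
         (if Suc (v div W) < H then [(v, v + W, vres B (v div W) (v mod W))] else [])) [0..<H * W]),
     bound = B\<rparr>"

definition vert :: "nat \<Rightarrow> nat \<times> nat \<Rightarrow> nat" where
  "vert W v = fst v * W + snd v"

definition adj :: "nat \<times> nat \<Rightarrow> nat \<times> nat \<Rightarrow> bool" where
  "adj u v \<longleftrightarrow> fst u = fst v \<and> (snd v = Suc (snd u) \<or> snd u = Suc (snd v)) \<or>
     snd u = snd v \<and> (fst v = Suc (fst u) \<or> fst u = Suc (fst v))"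

definition cost :: "nat \<Rightarrow> nat \<times> nat \<Rightarrow> nat \<times> nat \<Rightarrow> nat" where
  "cost B u v = (if fst u = fst v then hres B (fst u) else vres B (min (fst u) (fst v)) (snd u))"

lemma adj_sym: "adj u v \<longleftrightarrow> adj v u" by (auto simp: adj_def)

text \<open>\<open>map_of\<close> returns the first entry for the unordered edge; since endpoints
  are listed in increasing order, distinctness of the ordered pairs leaves only one
  candidate.\<close>

lemma resistance_link:
  assumes "distinct (map (\<lambda>(u, v, w). (u, v)) (links I))"
    and "\<forall>(u, v, w) \<in> set (links I). u < v" and "(u, v, w) \<in> set (links I)"
  shows "resistance I {u, v} = w"
proof -
  let ?L = "map (\<lambda>(u, v, w). ({u, v}, w)) (links I)"
  have "({u, v}, w) \<in> set ?L" using assms(3) by force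
  then obtain w' where w': "map_of ?L {u, v} = Some w'"
    by (metis (no_types, lifting) domIff dom_map_of_conv_image_fst fst_conv image_eqI not_None_eq)
  then have "({u, v}, w') \<in> set ?L" by (rule map_of_SomeD)
  then obtain u' v' where l: "(u', v', w') \<in> set (links I)" "{u', v'} = {u, v}" by auto
  moreover have "u < v" "u' < v'" using assms(2,3) l(1) by auto
  ultimately have "u' = u" "v' = v" by (auto simp: doubleton_eq_iff)
  with l(1) assms(1,3) have "w' = w"
    using inj_onD[of "\<lambda>(u, v, w). (u, v)" "set (links I)" "(u, v, w')" "(u, v, w)"] by (simp add: distinct_map)
  then show ?thesis by (simp add: resistance_def w')
qed

section \<open>The grid in coordinates\<close>

locale grid_shape =
  fixes H W :: nat and D :: "nat \<Rightarrow> nat \<Rightarrow> nat" and B :: nat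
  assumes H: "1 \<le> H" and W: "2 \<le> W"
begin

abbreviation "V \<equiv> {..<H} \<times> {..<W}"
abbreviation "I \<equiv> grid_inst H W D B"
abbreviation "rt \<equiv> (H - 1, 0 :: nat)"

lemma vert_less: "v \<in> V \<Longrightarrow> vert W v < H * W"
proof -
  assume v: "v \<in> V"
  then have "vert W v < fst v * W + W" by (auto simp: vert_def)
  also have "\<dots> = Suc (fst v) * W" by simp
  also have "\<dots> \<le> H * W" using v by (intro mult_le_mono1) auto
  finally show ?thesis .
qed

lemma vert_div_mod: "v \<in> V \<Longrightarrow> vert W v div W = fst v" "v \<in> V \<Longrightarrow> vert W v mod W = snd v"
  by (auto simp: vert_def)

lemma div_mod_less: "u < H * W \<Longrightarrow> (u div W, u mod W) \<in> V"
  using W by (auto simp: less_mult_imp_div_less)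

lemma vert_surj: "vert W (u div W, u mod W) = u"
  by (simp add: vert_def)

lemma bij_vert: "bij_betw (vert W) V {0..<H * W}"
proof (rule bij_betw_byWitness[where f' = "\<lambda>u. (u div W, u mod W)"])
  show "\<forall>v \<in> V. (vert W v div W, vert W v mod W) = v" by (simp add: vert_div_mod)
  show "\<forall>u \<in> {0..<H * W}. vert W (u div W, u mod W) = u" by (simp add: vert_surj)
  show "vert W ` V \<subseteq> {0..<H * W}" using vert_less by auto
  show "(\<lambda>u. (u div W, u mod W)) ` {0..<H * W} \<subseteq> V" using div_mod_less by auto
qed

lemma in_links: "(u, v, w) \<in> set (links I) \<longleftrightarrow> u < H * W \<and>
   (Suc (u mod W) < W \<and> v = u + 1 \<and> w = hres B (u div W) \<or>
    Suc (u div W) < H \<and> v = u + W \<and> w = vres B (u div W) (u mod W))"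
  by (auto simp: grid_inst_def split: if_splits)

lemma distinct_links: "distinct (map (\<lambda>(u, v, w). (u, v)) (links I))"
proof -
  let ?f = "\<lambda>v. (if Suc (v mod W) < W then [(v, v + 1, hres B (v div W))] else []) @
         (if Suc (v div W) < H then [(v, v + W, vres B (v div W) (v mod W))] else [])"
  define f where "f = ?f"
  have f: "l \<in> set (f v) \<Longrightarrow> fst l = v" "distinct (map (\<lambda>(u, v, w). (u, v)) (f v))" for v l
    using W by (auto simp: f_def split: if_splits)
  have "distinct (map (\<lambda>(u, v, w). (u, v)) (concat (map f [0..<n])))" for n
  proof (induction n)
    case (Suc n)
    have "(\<lambda>(u, v, w). (u, v)) ` set (concat (map f [0..<n])) \<inter> (\<lambda>(u, v, w). (u, v)) ` set (f n) = {}"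
    proof (rule ccontr)
      assume "\<not> ?thesis"
      then obtain u v w w' k where l: "(u, v, w) \<in> set (f k)" "k < n" "(u, v, w') \<in> set (f n)" by auto
      then show False using f(1)[OF l(1)] f(1)[OF l(3)] by simp
    qed
    then show ?case using Suc f(2) by (simp del: set_concat)
  qed simp
  then have "distinct (map (\<lambda>(u, v, w). (u, v)) (concat (map ?f [0..<H * W])))" unfolding f_def .
  then show ?thesis by (simp add: grid_inst_def)
qed

lemma links_less: "\<forall>(u, v, w) \<in> set (links I). u < v \<and> v < H * W"
proof (clarify, unfold in_links, safe)
  fix u assume "u < H * W" "Suc (u mod W) < W"
  then have "vert W (u div W, Suc (u mod W)) < H * W" using div_mod_less[of u] by (intro vert_less) auto
  then show "u + 1 < H * W" by (simp add: vert_def)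
next
  fix u assume "u < H * W" "Suc (u div W) < H"
  then have "vert W (Suc (u div W), u mod W) < H * W" using div_mod_less[of u] by (intro vert_less) auto
  then show "u + W < H * W" by (simp add: vert_def)
qed (use W in auto)

lemma link_of_adj:
  assumes "u \<in> V" "v \<in> V" "adj u v"
  shows "{vert W u, vert W v} \<in> edges I \<and> resistance I {vert W u, vert W v} = cost B u v"
proof -
  have main: "{vert W u, vert W v} \<in> edges I \<and> resistance I {vert W u, vert W v} = cost B u v"
    if h: "u \<in> V" "v \<in> V" "fst u = fst v \<and> snd v = Suc (snd u) \<or> snd u = snd v \<and> fst v = Suc (fst u)" for u v
  proof -
    have "vert W v = (if fst u = fst v then vert W u + 1 else vert W u + W)"
      using h(3) by (cases "fst u = fst v") (auto simp: vert_def)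
    then have "(vert W u, vert W v, cost B u v) \<in> set (links I)"
      unfolding in_links vert_div_mod[OF h(1)] using vert_less[OF h(1)] h
      by (cases "fst u = fst v") (auto simp: cost_def)
    moreover have "\<forall>(u, v, w) \<in> set (links I). u < v" using links_less by auto
    ultimately show ?thesis using resistance_link[OF distinct_links]
      unfolding edges_def by (metis (no_types, lifting) case_prod_conv image_eqI)
  qed
  from assms(3) consider "fst u = fst v \<and> snd v = Suc (snd u) \<or> snd u = snd v \<and> fst v = Suc (fst u)"
    | "fst v = fst u \<and> snd u = Suc (snd v) \<or> snd v = snd u \<and> fst u = Suc (fst v)"
    by (auto simp: adj_def)
  then show ?thesis
  proof cases
    case 1 then show ?thesis using main assms by blast
  next
    case 2
    then have "cost B v u = cost B u v" by (auto simp: cost_def min_def)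
    then show ?thesis using main[OF assms(2,1) 2] by (simp add: insert_commute)
  qed
qed

lemma edges_iff_adj:
  assumes "u \<in> V" "v \<in> V"
  shows "{vert W u, vert W v} \<in> edges I \<longleftrightarrow> adj u v"
proof
  assume "{vert W u, vert W v} \<in> edges I"
  then obtain a b w where l: "(a, b, w) \<in> set (links I)" "{a, b} = {vert W u, vert W v}"
    by (auto simp: edges_def)
  have main: "adj u v" if h: "u \<in> V" "v \<in> V" "(vert W u, vert W v, w) \<in> set (links I)" for u v
  proof -
    from h(3) consider "Suc (snd u) < W" "vert W v = vert W u + 1" | "Suc (fst u) < H" "vert W v = vert W u + W"
      unfolding in_links using vert_div_mod[OF h(1)] by auto
    then show ?thesis
    proof cases
      case 1
      then have "vert W v = vert W (fst u, Suc (snd u))" by (simp add: vert_def)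
      moreover have "(fst u, Suc (snd u)) \<in> V" using h(1) 1 by auto
      ultimately have "v = (fst u, Suc (snd u))"
        using bij_vert h(2) unfolding bij_betw_def by (metis inj_onD)
      then show ?thesis by (auto simp: adj_def)
    next
      case 2
      then have "vert W v = vert W (Suc (fst u), snd u)" by (simp add: vert_def)
      moreover have "(Suc (fst u), snd u) \<in> V" using h(1) 2 by auto
      ultimately have "v = (Suc (fst u), snd u)"
        using bij_vert h(2) unfolding bij_betw_def by (metis inj_onD)
      then show ?thesis by (auto simp: adj_def)
    qed
  qed
  from l(2) consider "a = vert W u" "b = vert W v" | "a = vert W v" "b = vert W u" by (auto simp: doubleton_eq_iff)
  then show "adj u v"
  proof cases
    case 1 then show ?thesis using main[OF assms] l(1) by blast
  next
    case 2 then show ?thesis using main[OF assms(2,1)] l(1) adj_sym by blast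
  qed
qed (use link_of_adj[OF assms] in blast)

lemma edges_verts: "e \<in> edges I \<Longrightarrow> \<exists>u \<in> {0..<H * W}. \<exists>v \<in> {0..<H * W}. u \<noteq> v \<and> e = {u, v}"
proof -
  assume "e \<in> edges I"
  then obtain u v w where l: "(u, v, w) \<in> set (links I)" "e = {u, v}" by (auto simp: edges_def)
  then have "u < v \<and> v < H * W" using links_less by blast
  then show ?thesis using l(2) by (intro bexI[of _ u] bexI[of _ v]) auto
qed

text \<open>Relabelling by \<open>vert\<close> turns spanning trees into parent functions between
  adjacent coordinate pairs, the only form of the problem used in the flow argument.\<close>

lemma yes_iff_tree:
  "ednr_yes I \<longleftrightarrow> (\<exists>p rk \<phi>. rooted_tree V rt p rk \<and> (\<forall>v \<in> V - {rt}. adj v (p v)) \<and>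
     flow_on V rt p (\<lambda>(y, x). D y x) \<phi> \<and> (\<Sum>v \<in> V - {rt}. cost B v (p v) * (\<phi> v)\<^sup>2) \<le> B)"
proof
  let ?N = "{0..<H * W}" and ?r = "(H - 1) * W"
  have rV: "rt \<in> V" using H W by auto
  have vr: "vert W rt = ?r" by (simp add: vert_def)
  have dem: "demands I ! vert W v = (case v of (y, x) \<Rightarrow> D y x)" if "v \<in> V" for v
    using vert_less[OF that] vert_div_mod[OF that] by (auto simp: grid_inst_def split: prod.split)
  let ?L = "loss (verts I) (root I) (\<lambda>v. real (demands I ! v)) (\<lambda>e. real (resistance I e))"
  have ver: "verts I = ?N" "root I = ?r" "bound I = B" by (auto simp: verts_def grid_inst_def)
  {
    assume "ednr_yes I"
    then obtain F where F: "spanning_tree ?N (edges I) F" and L: "?L F \<le> real B"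
      unfolding ednr_yes_def by (auto simp: ver)
    have "?r \<in> ?N" using vert_less[OF rV] vr by simp
    then obtain p rk where T: "rooted_tree ?N ?r p rk" and FF: "F = tree_edges ?N ?r p"
      using spanning_tree_rooted[OF F finite_atLeastLessThan _ edges_verts] by blast
    have fl: "flow_on ?N ?r p (\<lambda>v. demands I ! v) (\<lambda>v. \<Sum>u \<in> descendants ?N p v. demands I ! u)"
      by (rule flow_exists[OF T])
    let ?\<phi> = "\<lambda>v. \<Sum>u \<in> descendants ?N p v. demands I ! u"
    let ?e = "inv_into V (vert W)"
    have be: "bij_betw ?e ?N V" using bij_betw_inv_into[OF bij_vert] .
    have er: "?e ?r = rt" using bij_betw_inv_into_left[OF bij_vert rV] vr by simp
    have ve: "vert W (?e v) = v" "?e v \<in> V" if "v \<in> ?N" for v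
      using bij_betw_inv_into_right[OF bij_vert that] bij_betw_imp_surj_on[OF be] that by (simp, metis imageI)
    have d: "(case ?e v of (y, x) \<Rightarrow> D y x) = demands I ! v" if "v \<in> ?N" for v
      using dem[OF ve(2)[OF that]] ve(1)[OF that] by simp
    note tr = rooted_tree_transfer[OF be T fl, where d' = "\<lambda>(y, x). D y x", OF d]
    let ?p = "\<lambda>v. ?e (p (inv_into ?N ?e v))" and ?f = "\<lambda>v. ?\<phi> (inv_into ?N ?e v)"
    have sub: "{v, p v} \<in> edges I" if "v \<in> ?N - {?r}" for v
      using F FF that by (auto simp: spanning_tree_def tree_edges_def)
    have pN: "p v \<in> ?N" if "v \<in> ?N - {?r}" for v using T that by (auto simp: rooted_tree_def)
    have ad: "adj (?e v) (?e (p v))" if "v \<in> ?N - {?r}" for v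
      using edges_iff_adj[of "?e v" "?e (p v)"] sub[OF that] ve pN[OF that] that by auto
    have co: "cost B (?e v) (?e (p v)) = resistance I {v, p v}" if "v \<in> ?N - {?r}" for v
      using link_of_adj[OF _ _ ad[OF that]] ve pN[OF that] that by auto
    have "(\<Sum>v \<in> V - {rt}. cost B v (?p v) * (?f v)\<^sup>2) = (\<Sum>v \<in> ?N - {?r}. resistance I {v, p v} * (?\<phi> v)\<^sup>2)"
    proof -
      have "(\<Sum>v \<in> V - {rt}. cost B v (?p v) * (?f v)\<^sup>2) = (\<Sum>v \<in> ?N - {?r}. cost B (?e v) (?p (?e v)) * (?f (?e v))\<^sup>2)"
        using tr(3)[of "\<lambda>v. cost B v (?p v) * (?f v)\<^sup>2"] unfolding er .
      also have "\<dots> = (\<Sum>v \<in> ?N - {?r}. resistance I {v, p v} * (?\<phi> v)\<^sup>2)"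
      proof (rule sum.cong[OF refl])
        fix v assume v: "v \<in> ?N - {?r}"
        then have "inv_into ?N ?e (?e v) = v" by (intro tr(4)) auto
        then show "cost B (?e v) (?p (?e v)) * (?f (?e v))\<^sup>2 = resistance I {v, p v} * (?\<phi> v)\<^sup>2"
          by (simp only: co[OF v])
      qed
      finally show ?thesis .
    qed
    moreover have "real (\<Sum>v \<in> ?N - {?r}. resistance I {v, p v} * (?\<phi> v)\<^sup>2) \<le> real B"
      using loss_tree[OF T fl, of "resistance I"] L FF by (simp add: ver)
    ultimately have "(\<Sum>v \<in> V - {rt}. cost B v (?p v) * (?f v)\<^sup>2) \<le> B"
      by (simp only: of_nat_le_iff)
    moreover have "adj v (?p v)" if v: "v \<in> V - {rt}" for v
    proof -
      obtain u where u: "u \<in> ?N" "v = ?e u"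
        using bij_betw_imp_surj_on[OF be] v by (metis DiffD1 imageE)
      then have "u \<noteq> ?r" using v er by auto
      then show ?thesis using ad[of u] u tr(4) by auto
    qed
    ultimately show "\<exists>p rk \<phi>. rooted_tree V rt p rk \<and> (\<forall>v \<in> V - {rt}. adj v (p v)) \<and>
     flow_on V rt p (\<lambda>(y, x). D y x) \<phi> \<and> (\<Sum>v \<in> V - {rt}. cost B v (p v) * (\<phi> v)\<^sup>2) \<le> B"
      using tr(1,2)[unfolded er] by (intro exI[of _ ?p] exI[of _ "\<lambda>v. rk (inv_into ?N ?e v)"] exI[of _ ?f]) auto
  next
    assume "\<exists>p rk \<phi>. rooted_tree V rt p rk \<and> (\<forall>v \<in> V - {rt}. adj v (p v)) \<and>
     flow_on V rt p (\<lambda>(y, x). D y x) \<phi> \<and> (\<Sum>v \<in> V - {rt}. cost B v (p v) * (\<phi> v)\<^sup>2) \<le> B"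
    then obtain p rk \<phi> where T: "rooted_tree V rt p rk" and ad: "\<And>v. v \<in> V - {rt} \<Longrightarrow> adj v (p v)"
      and fl: "flow_on V rt p (\<lambda>(y, x). D y x) \<phi>" and L: "(\<Sum>v \<in> V - {rt}. cost B v (p v) * (\<phi> v)\<^sup>2) \<le> B"
      by blast
    note tr = rooted_tree_transfer[OF bij_vert T fl, where d' = "\<lambda>v. demands I ! v", OF dem, unfolded vr]
    let ?i = "inv_into V (vert W)"
    let ?p = "\<lambda>v. vert W (p (?i v))"
    have pV: "p v \<in> V" if "v \<in> V - {rt}" for v using T that unfolding rooted_tree_def by blast
    have E: "{vert W v, ?p (vert W v)} \<in> edges I"
      "resistance I {vert W v, ?p (vert W v)} = cost B v (p v)" if "v \<in> V - {rt}" for v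
      using link_of_adj[OF _ pV[OF that] ad[OF that]] that tr(4) by auto
    have "tree_edges ?N ?r ?p \<subseteq> edges I"
    proof
      fix e assume "e \<in> tree_edges ?N ?r ?p"
      then obtain u where u: "u \<in> ?N" "u \<noteq> ?r" "e = {u, ?p u}"
        unfolding tree_edges_def by blast
      then obtain v where v: "v \<in> V" "u = vert W v" using bij_vert unfolding bij_betw_def by blast
      then have "v \<noteq> rt" using u vr by auto
      then show "e \<in> edges I" using E(1)[of v] u v by auto
    qed
    from rooted_tree_spanning[OF tr(1) this]
    have S: "spanning_tree ?N (edges I) (tree_edges ?N ?r ?p)" .
    have "(\<Sum>v \<in> ?N - {?r}. resistance I {v, ?p v} * (\<phi> (?i v))\<^sup>2) = (\<Sum>v \<in> V - {rt}. cost B v (p v) * (\<phi> v)\<^sup>2)"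
    proof -
      have "(\<Sum>v \<in> ?N - {?r}. resistance I {v, ?p v} * (\<phi> (?i v))\<^sup>2) =
          (\<Sum>v \<in> V - {rt}. resistance I {vert W v, ?p (vert W v)} * (\<phi> (?i (vert W v)))\<^sup>2)"
        by (rule tr(3))
      also have "\<dots> = (\<Sum>v \<in> V - {rt}. cost B v (p v) * (\<phi> v)\<^sup>2)"
      proof (rule sum.cong[OF refl])
        fix v assume v: "v \<in> V - {rt}"
        then have "?i (vert W v) = v" by (intro tr(4)) auto
        then show "resistance I {vert W v, ?p (vert W v)} * (\<phi> (?i (vert W v)))\<^sup>2 = cost B v (p v) * (\<phi> v)\<^sup>2"
          using E(2)[OF v] by (simp only:)
      qed
      finally show ?thesis .
    qed
    moreover have "?L (tree_edges ?N ?r ?p) = real (\<Sum>v \<in> ?N - {?r}. resistance I {v, ?p v} * (\<phi> (?i v))\<^sup>2)"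
      unfolding ver by (rule loss_tree[OF tr(1,2)])
    ultimately have "?L (tree_edges ?N ?r ?p) \<le> real B" using L by (simp only: of_nat_le_iff)
    then show "ednr_yes I" unfolding ednr_yes_def ver using S by blast
  }
qed

text \<open>Exhibiting one spanning tree is enough: the comb that runs left along every row and then
  down the first column.\<close>

lemma grid_connected: "connected_graph (verts I) (edges I)"
proof -
  let ?N = "{0..<H * W}" and ?r = "(H - 1) * W"
  let ?p = "\<lambda>v. if v = ?r then v else if v mod W > 0 then v - 1 else v + W"
  let ?rk = "\<lambda>v. (H - 1 - v div W) * W + v mod W"
  have T: "?p v \<in> ?N \<and> ?rk (?p v) < ?rk v \<and> {v, ?p v} \<in> edges I" if v: "v \<in> ?N - {?r}" for v
  proof -
    obtain y x where yx: "v = vert W (y, x)" "y < H" "x < W"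
      using v bij_vert unfolding bij_betw_def by fastforce
    then have dm: "v div W = y" "v mod W = x" using vert_div_mod[of "(y, x)"] by auto
    show ?thesis
    proof (cases "x > 0")
      case True
      then have p: "?p v = vert W (y, x - 1)" using v yx dm by (auto simp: vert_def)
      have m: "(y, x - 1) \<in> V" "(y, x) \<in> V" using yx by auto
      show ?thesis unfolding p using vert_less[OF m(1)] vert_div_mod[OF m(1)] dm True link_of_adj[OF m(2,1)] yx
        by (auto simp: adj_def)
    next
      case False
      then have y: "Suc y < H" using v yx by (auto simp: vert_def)
      then have p: "?p v = vert W (Suc y, 0)" using v yx dm False by (auto simp: vert_def)
      have m: "(Suc y, 0) \<in> V" "(y, 0) \<in> V" using yx y W by auto
      have "(H - 1 - Suc y) * W < (H - 1 - y) * W" using y W by (intro mult_less_mono1) auto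
      then show ?thesis unfolding p using vert_less[OF m(1)] vert_div_mod[OF m(1)] dm False link_of_adj[OF m(2,1)] yx
        by (auto simp: adj_def)
    qed
  qed
  have "?r \<in> ?N" using H W by auto
  then have T': "rooted_tree ?N ?r ?p ?rk" using T unfolding rooted_tree_def by auto
  have sub: "tree_edges ?N ?r ?p \<subseteq> edges I" using T unfolding tree_edges_def by blast
  show ?thesis
    using rooted_tree_spanning[OF T' sub] reach_mono[OF sub]
    by (auto simp: spanning_tree_def connected_graph_def verts_def grid_inst_def)
qed

lemma grid_ednr_instance: "D (H - 1) 0 = 0 \<Longrightarrow> ednr_instance I"
proof -
  assume D0: "D (H - 1) 0 = 0"
  have r: "(H - 1) * W < H * W" using H W by simp
  then have "demands I ! root I = 0" using D0 W by (simp add: grid_inst_def)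
  moreover have "root I \<in> verts I" "length (demands I) = num_verts I"
    using r by (auto simp: grid_inst_def verts_def)
  moreover have "\<forall>(u, v, w) \<in> set (links I). u < v \<and> v < num_verts I"
    using links_less by (simp add: grid_inst_def)
  ultimately show ?thesis unfolding ednr_instance_def using distinct_links grid_connected by blast
qed

lemma grid_is_grid: "grid_graph H W (verts I) (edges I)"
proof -
  let ?\<phi> = "inv_into V (vert W)"
  have ver: "verts I = {0..<H * W}" by (auto simp: verts_def grid_inst_def)
  have "bij_betw ?\<phi> (verts I) ({0..<H} \<times> {0..<W})"
    using bij_betw_inv_into[OF bij_vert] by (simp add: ver atLeast0LessThan)
  moreover have "{u, v} \<in> edges I \<longleftrightarrow>
      \<bar>int (fst (?\<phi> u)) - int (fst (?\<phi> v))\<bar> + \<bar>int (snd (?\<phi> u)) - int (snd (?\<phi> v))\<bar> = 1"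
    if "u \<in> verts I" "v \<in> verts I" for u v
  proof -
    have uv: "?\<phi> u \<in> V" "?\<phi> v \<in> V" "vert W (?\<phi> u) = u" "vert W (?\<phi> v) = v"
      using that bij_betw_imp_surj_on[OF bij_betw_inv_into[OF bij_vert]] bij_betw_inv_into_right[OF bij_vert]
      unfolding ver by (metis imageI)+
    have "adj (?\<phi> u) (?\<phi> v) \<longleftrightarrow> \<bar>int (fst (?\<phi> u)) - int (fst (?\<phi> v))\<bar> + \<bar>int (snd (?\<phi> u)) - int (snd (?\<phi> v))\<bar> = 1"
      unfolding adj_def by linarith
    then show ?thesis using edges_iff_adj[OF uv(1,2)] uv(3,4) by simp
  qed
  ultimately show ?thesis
    unfolding grid_graph_def simple_graph_def using edges_verts by (auto simp: ver)
qed

end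

section \<open>Optimal flows through the grid\<close>

lemma sum_neighbours:
  fixes f :: "nat \<times> nat \<Rightarrow> 'b :: comm_monoid_add"
  assumes "y < H" "x < W" and f: "\<And>w. w \<in> {..<H} \<times> {..<W} \<Longrightarrow> f w \<noteq> 0 \<Longrightarrow> adj (y, x) w"
  shows "(\<Sum>w \<in> {..<H} \<times> {..<W}. f w) =
    (if Suc x < W then f (y, Suc x) else 0) + (if 0 < x then f (y, x - 1) else 0) +
    (if Suc y < H then f (Suc y, x) else 0) + (if 0 < y then f (y - 1, x) else 0)"
proof -
  let ?V = "{..<H} \<times> {..<W}"
  have "(\<Sum>w \<in> ?V. f w) = (\<Sum>w \<in> ?V. (if w = (y, Suc x) then f w else 0) +
      (if w = (y, x - 1) then (if 0 < x then f w else 0) else 0) +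
      (if w = (Suc y, x) then f w else 0) + (if w = (y - 1, x) then (if 0 < y then f w else 0) else 0))"
  proof (rule sum.cong[OF refl])
    fix w assume "w \<in> ?V"
    show "f w = (if w = (y, Suc x) then f w else 0) +
      (if w = (y, x - 1) then (if 0 < x then f w else 0) else 0) +
      (if w = (Suc y, x) then f w else 0) + (if w = (y - 1, x) then (if 0 < y then f w else 0) else 0)"
    proof (cases "f w = 0")
      case True then show ?thesis by (simp only: if_cancel add_0)
    next
      case False
      then have "adj (y, x) w" by (rule f[OF \<open>w \<in> ?V\<close>])
      then consider "w = (y, Suc x)" | "0 < x" "w = (y, x - 1)" | "w = (Suc y, x)" | "0 < y" "w = (y - 1, x)"
        by (cases w) (auto simp: adj_def)
      then show ?thesis by cases auto
    qed
  qed
  also have "\<dots> = (if Suc x < W then f (y, Suc x) else 0) + (if 0 < x then f (y, x - 1) else 0) +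
    (if Suc y < H then f (Suc y, x) else 0) + (if 0 < y then f (y - 1, x) else 0)"
    unfolding sum.distrib using assms(1,2) by (auto simp: sum.delta less_imp_diff_less)
  finally show ?thesis .
qed

lemma sum_odd_even: "(\<Sum>x < 2 * K + 1. f x) = (\<Sum>j < K. f (2 * j + 1)) + (\<Sum>j \<le> K. f (2 * j))"
  for f :: "nat \<Rightarrow> 'b :: comm_monoid_add"
  by (induction K) (auto simp: ac_simps)

text \<open>Integrality in the place of convexity: this is the slack between the square of a load
  \<open>g\<close> and its best affine lower bound on the integers, touched at \<open>t\<close> and
  \<open>t + 1\<close>.\<close>

lemma consecutive_product_nonneg: "0 \<le> (g - t) * (g - t - 1)" for g t :: int
  by (cases "g \<le> t") (auto simp: mult_nonpos_nonpos)

text \<open>Layer \<open>h\<close> is the set of cost-one edges between rows \<open>2 * h\<close>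
  and \<open>2 * h + 1\<close>, through which the demand \<open>K * t h + m\<close> has to pass. If
  \<open>m\<close> of its \<open>K\<close> columns carry \<open>t h + 1\<close> and the others
  \<open>t h\<close>, the squares add up to \<open>K * (t h)^2 + m * (2 * t h + 1)\<close>;
  \<open>B\<close> is the sum of these minima. The assumption \<open>t2\<close> keeps the odd
  columns of free rows draining downwards.\<close>

locale flow_grid =
  fixes R K m :: nat and D :: "nat \<Rightarrow> nat \<Rightarrow> nat" and t :: "nat \<Rightarrow> nat" and B :: nat
  assumes R: "1 \<le> R" and K: "1 \<le> K"
    and D1: "\<And>y x. D y x \<le> 1" and D_top: "\<And>i. D 0 (2 * i) = 0" and D_root: "\<And>x. D (2 * R - 1) x = 0"
    and t0: "t 0 = 0" and t2: "\<And>h. 1 \<le> h \<Longrightarrow> h < R \<Longrightarrow> 2 \<le> t h"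
    and total: "\<And>h. h < R \<Longrightarrow> (\<Sum>y \<le> 2 * h. \<Sum>x < 2 * K + 1. D y x) = K * t h + m"
    and B_def: "B = (\<Sum>h < R. K * (t h)\<^sup>2 + m * (2 * t h + 1))"
begin

sublocale grid_shape "2 * R" "2 * K + 1" D B
  by unfold_locales (use R K in auto)

text \<open>At an even column the vertex in row \<open>2 * h\<close> can send demand only upwards
  into the free row \<open>2 * h - 1\<close>, so both demands travel together.\<close>

definition w :: "nat \<Rightarrow> nat \<Rightarrow> nat" where
  "w h i = D (2 * h - 1) (2 * i) + D (2 * h) (2 * i)"

text \<open>\<open>a h j\<close> is the excess of column \<open>2 * j + 1\<close> over
  \<open>t h\<close> in layer \<open>h\<close>; \<open>l h i = 1\<close> says that the even column
  \<open>2 * i\<close> drains to the right in the free row \<open>2 * h - 1\<close>, and 0 to the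
  left. The boundary values express that the outermost columns can only drain inwards.\<close>

definition local_solution :: "(nat \<Rightarrow> nat \<Rightarrow> nat) \<Rightarrow> (nat \<Rightarrow> nat \<Rightarrow> nat) \<Rightarrow> bool" where
  "local_solution a l \<longleftrightarrow> (\<forall>h < R. \<forall>j < K. a h j \<le> 1) \<and> (\<forall>h < R. \<forall>i \<le> K. l h i \<le> 1) \<and>
     (\<forall>j < K. a 0 j = D 0 (2 * j + 1)) \<and>
     (\<forall>h. 1 \<le> h \<and> h < R \<longrightarrow> l h 0 = 1 \<and> l h K = 0 \<and>
       (\<forall>j < K. t h + a h j = t (h - 1) + a (h - 1) j + D (2 * h - 1) (2 * j + 1) + D (2 * h) (2 * j + 1) +
          w h j * l h j + w h (Suc j) * (1 - l h (Suc j))))"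

text \<open>Infinite edges carry no flow, so conservation fixes the sum of the loads in each layer,
  and the loss bound forces each load to be \<open>t h\<close> or \<open>t h + 1\<close>. That an
  even column drains to one side only is the single point where the tree property, rather than just
  a flow, is needed.\<close>

lemma yes_imp_local:
  assumes "ednr_yes I"
  shows "\<exists>a l. local_solution a l"
proof -
  obtain p rk \<phi> where T: "rooted_tree V rt p rk" and ad: "\<And>v. v \<in> V - {rt} \<Longrightarrow> adj v (p v)"
    and fl: "flow_on V rt p (\<lambda>(y, x). D y x) \<phi>" and L: "(\<Sum>v \<in> V - {rt}. cost B v (p v) * (\<phi> v)\<^sup>2) \<le> B"
    using assms unfolding yes_iff_tree by blast
  have finV: "finite (V - {rt})" by simp
  have rV: "rt \<in> V" using R by auto
  have pV: "p v \<in> V" if "v \<in> V" "v \<noteq> rt" for v using T that by (auto simp: rooted_tree_def)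
  \<comment> \<open>Signed flow on ordered pairs, so that conservation need not distinguish which
    end of an edge is the parent.\<close>
  define net :: "nat \<times> nat \<Rightarrow> nat \<times> nat \<Rightarrow> int" where
    "net u v = (if u \<noteq> rt \<and> p u = v then int (\<phi> u) else 0) - (if v \<noteq> rt \<and> p v = u then int (\<phi> v) else 0)" for u v
  have anti: "net u v = - net v u" for u v by (simp add: net_def)
  have net_pos: "p u = v" if "net u v > 0" for u v
    using that by (auto simp: net_def split: if_splits)
  have net_adj: "adj u v" if "u \<in> V" "v \<in> V" "net u v \<noteq> 0" for u v
    using that ad[of u] ad[of v] adj_sym by (auto simp: net_def split: if_splits)
  have cons: "(\<Sum>v \<in> V. net u v) = int (D (fst u) (snd u))" if u: "u \<in> V" "u \<noteq> rt" for u
  proof -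
    have "(\<Sum>v \<in> V. net u v) = (\<Sum>v \<in> V. if p u = v then int (\<phi> u) else 0) - (\<Sum>v \<in> V. if v \<noteq> rt \<and> p v = u then int (\<phi> v) else 0)"
      using u by (simp add: net_def sum_subtractf)
    also have "(\<Sum>v \<in> V. if p u = v then int (\<phi> u) else 0) = int (\<phi> u)" using pV[OF u] by simp
    also have "(\<Sum>v \<in> V. if v \<noteq> rt \<and> p v = u then int (\<phi> v) else 0) = (\<Sum>v \<in> V - {rt}. if p v = u then int (\<phi> v) else 0)"
      by (rule sum.mono_neutral_cong_right) auto
    also have "\<dots> = int (\<Sum>v \<in> V - {rt}. if p v = u then \<phi> v else 0)"
      unfolding of_nat_sum by (rule sum.cong) auto
    finally show ?thesis using fl u unfolding flow_on_def by (auto simp: split_beta)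
  qed
  have trm: "cost B v (p v) * (\<phi> v)\<^sup>2 \<le> B" if "v \<in> V - {rt}" for v
    using member_le_sum[OF that, of "\<lambda>v. cost B v (p v) * (\<phi> v)\<^sup>2"] L finV by fastforce
  \<comment> \<open>One unit on an edge of resistance \<open>Suc B\<close> would already exceed the
    bound.\<close>
  have inf: "\<phi> v = 0" if "v \<in> V - {rt}" "cost B v (p v) = Suc B" for v
  proof (rule ccontr)
    assume "\<phi> v \<noteq> 0"
    then have "Suc B * 1 \<le> Suc B * (\<phi> v)\<^sup>2" by (intro mult_le_mono2) auto
    then show False using trm[OF that(1)] that(2) by simp
  qed
  have net0: "net u v = 0" if "u \<in> V" "v \<in> V" "cost B u v = Suc B" "cost B v u = Suc B" for u v
  proof -
    have "\<phi> u = 0" if "u \<noteq> rt" "p u = v" using inf[of u] that \<open>u \<in> V\<close> \<open>cost B u v = Suc B\<close> by simp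
    moreover have "\<phi> v = 0" if "v \<noteq> rt" "p v = u" using inf[of v] that \<open>v \<in> V\<close> \<open>cost B v u = Suc B\<close> by simp
    ultimately show ?thesis unfolding net_def by simp
  qed
  define hx where "hx y x = (if Suc x < 2 * K + 1 then net (y, x) (y, Suc x) else 0)" for y x
  define vy where "vy y x = (if Suc y < 2 * R then net (y, x) (Suc y, x) else 0)" for y x
  have hx0: "hx y x = 0" if "even y" "y < 2 * R" for y x
    using net0[of "(y, x)" "(y, Suc x)"] that by (auto simp: hx_def cost_def hres_def)
  have vy0: "vy y x = 0" if "even y" "even x" "x < 2 * K + 1" for y x
    using net0[of "(y, x)" "(Suc y, x)"] that by (auto simp: vy_def cost_def vres_def)
  have cons': "hx y x - (if 0 < x then hx y (x - 1) else 0) + vy y x - (if 0 < y then vy (y - 1) x else 0) = int (D y x)"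
    if "y < 2 * R" "x < 2 * K + 1" "(y, x) \<noteq> rt" for y x
  proof -
    have "int (D y x) = (\<Sum>v \<in> V. net (y, x) v)" using cons[of "(y, x)"] that by simp
    also have "\<dots> = (if Suc x < 2 * K + 1 then net (y, x) (y, Suc x) else 0) + (if 0 < x then net (y, x) (y, x - 1) else 0) +
      (if Suc y < 2 * R then net (y, x) (Suc y, x) else 0) + (if 0 < y then net (y, x) (y - 1, x) else 0)"
      by (rule sum_neighbours) (use that net_adj in auto)
    finally show ?thesis
      using that anti[of "(y, x)" "(y, x - 1)"] anti[of "(y, x)" "(y - 1, x)"] by (auto simp: hx_def vy_def)
  qed
  have tele: "(\<Sum>x < n. hx y x - (if 0 < x then hx y (x - 1) else 0)) = (if n = 0 then 0 else hx y (n - 1))" for n y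
    by (induction n) auto
  \<comment> \<open>Horizontal flow telescopes within a row, so whatever leaves a row downwards is
    the demand of this row and all rows above it.\<close>
  have rows: "(\<Sum>x < 2 * K + 1. vy y x) = int (\<Sum>y' \<le> y. \<Sum>x < 2 * K + 1. D y' x)" if "Suc y < 2 * R" for y
    using that
  proof (induction y)
    case 0
    have "(\<Sum>x < 2 * K + 1. int (D 0 x)) = (\<Sum>x < 2 * K + 1. hx 0 x - (if 0 < x then hx 0 (x - 1) else 0)) + (\<Sum>x < 2 * K + 1. vy 0 x)"
      unfolding sum.distrib[symmetric] 
    proof (rule sum.cong[OF refl])
      fix x assume "x \<in> {..<2 * K + 1}"
      then show "int (D 0 x) = hx 0 x - (if 0 < x then hx 0 (x - 1) else 0) + vy 0 x"
        using cons'[of 0 x] 0 by simp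
    qed
    then show ?case unfolding tele by (simp add: hx_def)
  next
    case (Suc y)
    have "(\<Sum>x < 2 * K + 1. int (D (Suc y) x)) = (\<Sum>x < 2 * K + 1. hx (Suc y) x - (if 0 < x then hx (Suc y) (x - 1) else 0)) +
        ((\<Sum>x < 2 * K + 1. vy (Suc y) x) - (\<Sum>x < 2 * K + 1. vy y x))"
      unfolding sum.distrib[symmetric] sum_subtractf[symmetric] 
    proof (rule sum.cong[OF refl])
      fix x assume "x \<in> {..<2 * K + 1}"
      then show "int (D (Suc y) x) = hx (Suc y) x - (if 0 < x then hx (Suc y) (x - 1) else 0) + (vy (Suc y) x - vy y x)"
        using cons'[of "Suc y" x] Suc.prems by (cases "x = 0") (simp, linarith, simp)
    qed
    then show ?case unfolding tele using Suc by (simp add: hx_def)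
  qed
  define g where "g h j = vy (2 * h) (2 * j + 1)" for h j
  have gsum: "(\<Sum>j < K. g h j) = int (K * t h + m)" if "h < R" for h
  proof -
    have "(\<Sum>x < 2 * K + 1. vy (2 * h) x) = (\<Sum>j < K. g h j) + (\<Sum>i \<le> K. vy (2 * h) (2 * i))"
      unfolding sum_odd_even g_def ..
    also have "(\<Sum>i \<le> K. vy (2 * h) (2 * i)) = 0" by (rule sum.neutral) (auto intro: vy0)
    finally have "(\<Sum>j < K. g h j) = (\<Sum>x < 2 * K + 1. vy (2 * h) x)" by simp
    also have "\<dots> = int (\<Sum>y \<le> 2 * h. \<Sum>x < 2 * K + 1. D y x)" by (rule rows) (use that in simp)
    finally show ?thesis by (simp only: total[OF that])
  qed
  \<comment> \<open>Either end of a vertical edge may be the child, so a load is compared with the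
    costs charged to both ends.\<close>
  have gloss: "(\<Sum>h < R. \<Sum>j < K. (g h j)\<^sup>2) \<le> int B"
  proof -
    let ?P = "{..<R} \<times> {..<K}"
    let ?a = "\<lambda>(h, j). (2 * h, 2 * j + 1) :: nat \<times> nat" and ?b = "\<lambda>(h, j). (2 * h + 1, 2 * j + 1) :: nat \<times> nat"
    let ?c = "\<lambda>v. int (cost B v (p v) * (\<phi> v)\<^sup>2)"
    have inj: "inj_on ?a ?P" "inj_on ?b ?P" by (auto simp: inj_on_def)
    have dis: "?a ` ?P \<inter> ?b ` ?P = {}" by (auto, presburger)
    have le: "(g h j)\<^sup>2 \<le> ?c (?a (h, j)) + ?c (?b (h, j))" if "h < R" "j < K" for h j
    proof -
      let ?u = "?a (h, j)" and ?v = "?b (h, j)"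
      have ne: "?u \<in> V" "?v \<in> V" "?u \<noteq> rt" "?v \<noteq> rt" "cost B ?u ?v = 1" "cost B ?v ?u = 1"
        using that by (auto simp: cost_def vres_def)
      have G: "g h j = net ?u ?v" using that by (simp add: g_def vy_def)
      have "\<not> (p ?u = ?v \<and> p ?v = ?u)"
        using rooted_treeD(2)[OF T ne(1,3)] rooted_treeD(2)[OF T ne(2,4)] by auto
      then consider "p ?u = ?v" "p ?v \<noteq> ?u" | "p ?v = ?u" "p ?u \<noteq> ?v" | "p ?u \<noteq> ?v" "p ?v \<noteq> ?u" by blast
      then show ?thesis
      proof cases
        case 1
        then have "g h j = int (\<phi> ?u)" unfolding G net_def using ne by simp
        moreover have "?c ?u = (int (\<phi> ?u))\<^sup>2" using 1 ne by simp
        ultimately have "(g h j)\<^sup>2 = ?c ?u" by (simp only:)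
        moreover have "0 \<le> ?c ?v" by (rule of_nat_0_le_iff)
        ultimately show ?thesis by linarith
      next
        case 2
        then have "g h j = - int (\<phi> ?v)" unfolding G net_def using ne by simp
        moreover have "?c ?v = (int (\<phi> ?v))\<^sup>2" using 2 ne by simp
        ultimately have "(g h j)\<^sup>2 = ?c ?v" by (simp only: power2_minus)
        moreover have "0 \<le> ?c ?u" by (rule of_nat_0_le_iff)
        ultimately show ?thesis by linarith
      next
        case 3
        then have "g h j = 0" unfolding G net_def by simp
        then show ?thesis by simp
      qed
    qed
    have "(\<Sum>h < R. \<Sum>j < K. (g h j)\<^sup>2) = (\<Sum>(h, j) \<in> ?P. (g h j)\<^sup>2)" by (simp add: sum.cartesian_product)
    also have "\<dots> \<le> (\<Sum>q \<in> ?P. ?c (?a q) + ?c (?b q))"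
      by (rule sum_mono) (use le in auto)
    also have "\<dots> = (\<Sum>v \<in> ?a ` ?P. ?c v) + (\<Sum>v \<in> ?b ` ?P. ?c v)"
      unfolding sum.distrib sum.reindex[OF inj(1)] sum.reindex[OF inj(2)] comp_def ..
    also have "\<dots> = (\<Sum>v \<in> ?a ` ?P \<union> ?b ` ?P. ?c v)"
      by (rule sum.union_disjoint[symmetric]) (use dis in auto)
    also have "\<dots> \<le> (\<Sum>v \<in> V - {rt}. ?c v)"
    proof (rule sum_mono2)
      show "?a ` ?P \<union> ?b ` ?P \<subseteq> V - {rt}" by auto
    qed (simp, rule of_nat_0_le_iff)
    also have "\<dots> \<le> int B" unfolding of_nat_sum[symmetric] of_nat_le_iff by (rule L)
    finally show ?thesis .
  qed
  \<comment> \<open>After expanding, the terms linear in the loads are known from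
    \<open>gsum\<close>; what remains is the sum of squares minus \<open>B\<close>.\<close>
  have exc: "(\<Sum>h < R. \<Sum>j < K. (g h j - int (t h)) * (g h j - int (t h) - 1)) \<le> 0"
  proof -
    have "(\<Sum>j < K. (g h j - int (t h)) * (g h j - int (t h) - 1)) =
        (\<Sum>j < K. (g h j)\<^sup>2) - int (K * (t h)\<^sup>2 + m * (2 * t h + 1))" if "h < R" for h
    proof -
      have "(\<Sum>j < K. (g h j - int (t h)) * (g h j - int (t h) - 1)) =
        (\<Sum>j < K. (g h j)\<^sup>2 - (2 * int (t h) + 1) * g h j + (int (t h) * (int (t h) + 1)))"
        by (rule sum.cong) (auto simp: algebra_simps power2_eq_square)
      also have "\<dots> = (\<Sum>j < K. (g h j)\<^sup>2) - (2 * int (t h) + 1) * (\<Sum>j < K. g h j) + int K * (int (t h) * (int (t h) + 1))"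
        by (simp add: sum.distrib sum_subtractf sum_distrib_left)
      also have "\<dots> = (\<Sum>j < K. (g h j)\<^sup>2) - int (K * (t h)\<^sup>2 + m * (2 * t h + 1))"
        unfolding gsum[OF that] by (simp add: algebra_simps power2_eq_square)
      finally show ?thesis .
    qed
    then have "(\<Sum>h < R. \<Sum>j < K. (g h j - int (t h)) * (g h j - int (t h) - 1)) =
       (\<Sum>h < R. (\<Sum>j < K. (g h j)\<^sup>2) - int (K * (t h)\<^sup>2 + m * (2 * t h + 1)))" by (intro sum.cong) auto
    also have "\<dots> = (\<Sum>h < R. \<Sum>j < K. (g h j)\<^sup>2) - int B" by (simp add: sum_subtractf B_def)
    finally show ?thesis using gloss by simp
  qed
  have gt: "g h j = int (t h) \<or> g h j = int (t h) + 1" if "h < R" "j < K" for h j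
  proof -
    let ?e = "\<lambda>h j. (g h j - int (t h)) * (g h j - int (t h) - 1)"
    have nn: "0 \<le> (\<Sum>j < K. ?e h j)" for h by (intro sum_nonneg consecutive_product_nonneg)
    have "(\<Sum>h < R. \<Sum>j < K. ?e h j) = 0" using exc nn by (metis (no_types, lifting) dual_order.antisym sum_nonneg)
    then have "(\<Sum>j < K. ?e h j) = 0" using nn that(1) by (subst (asm) sum_nonneg_eq_0_iff) auto
    then have "?e h j = 0" using that(2) by (subst (asm) sum_nonneg_eq_0_iff) (auto intro: consecutive_product_nonneg)
    then show ?thesis by auto
  qed
  define a where "a h j = nat (g h j - int (t h))" for h j
  have ga: "g h j = int (t h) + int (a h j)" "a h j \<le> 1" if "h < R" "j < K" for h j
    using gt[OF that] by (auto simp: a_def)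
  have a0: "a 0 j = D 0 (2 * j + 1)" if "j < K" for j
    using cons'[of 0 "2 * j + 1"] hx0[of 0] R that by (simp add: a_def g_def t0)
  \<comment> \<open>A column that sends nothing to the right counts as draining left, except the
    first one, which counts as draining right even if it carries nothing.\<close>
  define l where "l h i = (if i = 0 then 1 else if i < K \<and> hx (2 * h - 1) (2 * i) > 0 then 1 else 0 :: nat)" for h i
  have step: "w h i * l h i = nat (hx (2 * h - 1) (2 * i)) \<and> hx (2 * h - 1) (2 * i) \<ge> 0"
    "i < K \<Longrightarrow> w h (Suc i) * (1 - l h (Suc i)) = nat (- hx (2 * h - 1) (2 * i + 1)) \<and> hx (2 * h - 1) (2 * i + 1) \<le> 0"
    if h: "1 \<le> h" "h < R" and i: "i \<le> K" for h i
  proof -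
    let ?y = "2 * h - 1"
    have even_ne: "2 * h \<noteq> 2 * R - 1" using h by presburger
    have y: "?y < 2 * R - 1" "odd ?y" "Suc ?y = 2 * h" "?y - 1 = 2 * (h - 1)" "?y < 2 * R" using h by auto
    have wsum: "hx ?y (2 * i) - (if 0 < i then hx ?y (2 * i - 1) else 0) = int (w h i)" if "i \<le> K" for i
    proof -
      have "vy ?y (2 * i) = - int (D (2 * h) (2 * i))"
        using cons'[of "2 * h" "2 * i"] hx0[of "2 * h"] vy0[of "2 * h" "2 * i"] h that even_ne by (cases "i = 0") auto
      moreover have "vy (?y - 1) (2 * i) = 0" using vy0[of "?y - 1" "2 * i"] y that by simp
      moreover have "hx ?y (2 * i) - (if 0 < 2 * i then hx ?y (2 * i - 1) else 0) + vy ?y (2 * i) - vy (?y - 1) (2 * i) = int (D ?y (2 * i))"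
        using cons'[of ?y "2 * i"] y that h by simp
      ultimately show ?thesis by (simp add: w_def)
    qed
    \<comment> \<open>At least two units cross the layer in this column and row \<open>2 * h\<close>
      contributes at most one of them, so the vertex above sends positive flow down. Its only parent
      is therefore below, and it sends nothing sideways.\<close>
    have down: "p (?y, 2 * j + 1) = (2 * h, 2 * j + 1)" if "j < K" for j
    proof (rule net_pos)
      have "vy ?y (2 * j + 1) = g h j - int (D (2 * h) (2 * j + 1))"
        using cons'[of "2 * h" "2 * j + 1"] hx0[of "2 * h"] h that even_ne by (simp add: g_def)
      then have "vy ?y (2 * j + 1) > 0" using gt[OF h(2) that] t2[OF h] D1[of "2 * h" "2 * j + 1"] by auto
      then show "0 < net (?y, 2 * j + 1) (2 * h, 2 * j + 1)" using y by (auto simp: vy_def split: if_splits)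
    qed
    have Rr: "hx ?y (2 * i) \<ge> 0" if "i \<le> K" for i
    proof (rule ccontr)
      assume n: "\<not> ?thesis"
      then have iK: "i < K" by (auto simp: hx_def split: if_splits)
      have "net (?y, 2 * i + 1) (?y, 2 * i) > 0" using n anti[of "(?y, 2 * i + 1)"] by (auto simp: hx_def split: if_splits)
      from net_pos[OF this] down[OF iK] show False by simp
    qed
    have Lr: "hx ?y (2 * i + 1) \<le> 0" if "i < K" for i
    proof (rule ccontr)
      assume n: "\<not> ?thesis"
      then have "net (?y, 2 * i + 1) (?y, 2 * i + 2) > 0" by (auto simp: hx_def split: if_splits)
      from net_pos[OF this] down[OF that] show False by simp
    qed
    \<comment> \<open>Positive flow to both sides would require two parents.\<close>
    have both: "\<not> (hx ?y (2 * i) > 0 \<and> hx ?y (2 * i - 1) < 0)" if "0 < i" for i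
    proof
      assume n: "hx ?y (2 * i) > 0 \<and> hx ?y (2 * i - 1) < 0"
      have "Suc (2 * i - 1) = 2 * i" using that by simp
      then have "net (?y, 2 * i) (?y, 2 * i - 1) > 0" using n anti[of "(?y, 2 * i)" "(?y, 2 * i - 1)"]
        by (auto simp: hx_def split: if_splits)
      moreover have "net (?y, 2 * i) (?y, Suc (2 * i)) > 0" using n by (auto simp: hx_def split: if_splits)
      ultimately have "(?y, 2 * i - 1) = (?y, Suc (2 * i))" using net_pos by metis
      then show False by auto
    qed
    have hxK: "hx ?y (2 * K) = 0" by (simp add: hx_def)
    have *: "w h i * l h i = nat (hx ?y (2 * i)) \<and> (0 < i \<longrightarrow> w h i * (1 - l h i) = nat (- hx ?y (2 * i - 1)))" if "i \<le> K" for i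
    proof (cases "i = 0")
      case True
      then show ?thesis using wsum[of 0] by (simp add: l_def)
    next
      case False
      then obtain i' where i': "i = Suc i'" by (cases i) auto
      have n1: "hx ?y (2 * i - 1) \<le> 0" using Lr[of i'] that i' by simp
      show ?thesis
      proof (cases "i < K \<and> hx ?y (2 * i) > 0")
        case True
        then have "hx ?y (2 * i - 1) = 0" using both[of i] n1 False by auto
        then show ?thesis using True False wsum[OF that] by (simp add: l_def)
      next
        case c: False
        then have "hx ?y (2 * i) = 0" using Rr[OF that] hxK that by (cases "i = K") auto
        then show ?thesis using c False wsum[OF that] by (auto simp: l_def)
      qed
    qed
    show "w h i * l h i = nat (hx ?y (2 * i)) \<and> hx ?y (2 * i) \<ge> 0" using *[OF i] Rr[OF i] by blast
    show "w h (Suc i) * (1 - l h (Suc i)) = nat (- hx ?y (2 * i + 1)) \<and> hx ?y (2 * i + 1) \<le> 0" if "i < K"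
      using *[of "Suc i"] Lr[OF that] that by simp
  qed
  have eqn: "t h + a h j = t (h - 1) + a (h - 1) j + D (2 * h - 1) (2 * j + 1) + D (2 * h) (2 * j + 1) +
          w h j * l h j + w h (Suc j) * (1 - l h (Suc j))" if h: "1 \<le> h" "h < R" and j: "j < K" for h j
  proof -
    let ?y = "2 * h - 1"
    have even_ne: "2 * h \<noteq> 2 * R - 1" using h by presburger
    have y: "?y < 2 * R - 1" "odd ?y" "Suc ?y = 2 * h" "?y - 1 = 2 * (h - 1)" "?y < 2 * R" using h by auto
    have "vy ?y (2 * j + 1) = g h j - int (D (2 * h) (2 * j + 1))"
      using cons'[of "2 * h" "2 * j + 1"] hx0[of "2 * h"] h j even_ne by (simp add: g_def)
    moreover have "hx ?y (2 * j + 1) - hx ?y (2 * j) + vy ?y (2 * j + 1) - g (h - 1) j = int (D ?y (2 * j + 1))"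
      using cons'[of ?y "2 * j + 1"] y h j by (auto simp: g_def)
    moreover have "g h j = int (t h) + int (a h j)" "g (h - 1) j = int (t (h - 1)) + int (a (h - 1) j)"
      using ga[of h j] ga[of "h - 1" j] h j by auto
    moreover have "int (w h j * l h j) = hx ?y (2 * j)" "int (w h (Suc j) * (1 - l h (Suc j))) = - hx ?y (2 * j + 1)"
      using step[OF h, of j] j by auto
    ultimately have "int (t h + a h j) = int (t (h - 1) + a (h - 1) j + D (2 * h - 1) (2 * j + 1) + D (2 * h) (2 * j + 1) +
          w h j * l h j + w h (Suc j) * (1 - l h (Suc j)))" unfolding of_nat_add by linarith
    then show ?thesis by (simp only: of_nat_eq_iff)
  qed
  have "local_solution a l"
    unfolding local_solution_def using ga a0 eqn K by (auto simp: l_def)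
  then show ?thesis by blast
qed

text \<open>The tree is read off from \<open>l\<close> and its flow is written down explicitly.
  Conservation gives each layer exactly \<open>m\<close> columns of excess one, so the loss is not
  only bounded by \<open>B\<close> but equal to it.\<close>

lemma local_imp_yes:
  assumes "local_solution a l"
  shows "ednr_yes I"
proof -
  have a1: "\<And>h j. h < R \<Longrightarrow> j < K \<Longrightarrow> a h j \<le> 1" and l1: "\<And>h i. h < R \<Longrightarrow> i \<le> K \<Longrightarrow> l h i \<le> 1"
    and a0: "\<And>j. j < K \<Longrightarrow> a 0 j = D 0 (2 * j + 1)"
    and lb: "\<And>h. 1 \<le> h \<Longrightarrow> h < R \<Longrightarrow> l h 0 = 1" "\<And>h. 1 \<le> h \<Longrightarrow> h < R \<Longrightarrow> l h K = 0"
    and eqn: "\<And>h j. 1 \<le> h \<Longrightarrow> h < R \<Longrightarrow> j < K \<Longrightarrow> t h + a h j = t (h - 1) + a (h - 1) j + D (2 * h - 1) (2 * j + 1) + D (2 * h) (2 * j + 1) +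
          w h j * l h j + w h (Suc j) * (1 - l h (Suc j))"
    using assms unfolding local_solution_def by blast+
  let ?W = "2 * K + 1"
  define g where "g h j = t h + a h j" for h j
  \<comment> \<open>The flow at column \<open>x\<close> of the last row: everything that arrives
    there or further to the right moves left towards the root.\<close>
  define gs where "gs x = (\<Sum>j \<in> {j. j < K \<and> x \<le> 2 * j + 1}. g (R - 1) j)" for x
  \<comment> \<open>Even columns of the top row are attached downwards through an infinite edge,
    which is harmless as they have no demand; later even rows drain up into their free row.\<close>
  define p :: "nat \<times> nat \<Rightarrow> nat \<times> nat" where
    "p = (\<lambda>(y, x). if y = 2 * R - 1 then (y, x - 1) else if odd x \<or> y = 0 then (Suc y, x)
       else if even y then (y - 1, x) else if l (Suc y div 2) (x div 2) = 1 then (y, Suc x) else (y, x - 1))"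
  \<comment> \<open>Three per row leaves room for the one step upwards: it raises the row term by 3
    while the offset falls from 5 to 1. The summand \<open>?W\<close> puts everything above the last
    row, where the rank is the column.\<close>
  define rk :: "nat \<times> nat \<Rightarrow> nat" where
    "rk = (\<lambda>(y, x). if y = 2 * R - 1 then x
       else ?W + 3 * (2 * R - y) + (if odd x then 0 else if even y then 5 else 1))"
  define \<phi> :: "nat \<times> nat \<Rightarrow> nat" where
    "\<phi> = (\<lambda>(y, x). if y = 2 * R - 1 then gs x
       else if odd x then (if even y then g (y div 2) (x div 2) else g (Suc y div 2) (x div 2) - D (Suc y) x)
       else if even y then D y x else w (Suc y div 2) (x div 2))"
  have gD: "D (2 * h) (2 * j + 1) \<le> g h j" if "1 \<le> h" "h < R" for h j
    using t2[OF that] D1[of "2 * h" "2 * j + 1"] by (simp add: g_def)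
  have kinds: "\<exists>i. x = 2 * i \<and> i \<le> K \<or> x = 2 * i + 1 \<and> i < K" if "x < ?W" for x
    using that by (cases "even x") (auto elim!: evenE oddE)
  have ev: "2 * h \<noteq> 2 * R - 1" if "h < R" for h using that by presburger
  have rows: "y = 0 \<or> (\<exists>h. 1 \<le> h \<and> h < R \<and> (y = 2 * h \<or> y = 2 * h - 1)) \<or> y = 2 * R - 1" if "y < 2 * R" for y
  proof (cases "even y")
    case True
    then obtain h where "y = 2 * h" by (elim evenE)
    then show ?thesis using that by (cases "h = 0") (auto intro!: exI[of _ h])
  next
    case False
    then obtain h where "y = 2 * h + 1" by (elim oddE)
    then show ?thesis using that by (cases "h + 1 = R") (auto intro!: exI[of _ "Suc h"])
  qed
  have pv: "p (y, x) \<in> V \<and> adj (y, x) (p (y, x)) \<and> rk (p (y, x)) < rk (y, x)" if v: "(y, x) \<in> V" "(y, x) \<noteq> rt" for y x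
  proof -
    have yx: "y < 2 * R" "x < ?W" using v by auto
    obtain i where i: "x = 2 * i \<and> i \<le> K \<or> x = 2 * i + 1 \<and> i < K" using kinds[OF yx(2)] by blast
    consider "y = 2 * R - 1" | "y \<noteq> 2 * R - 1" "odd x \<or> y = 0" | h where "1 \<le> h" "h < R" "y = 2 * h" "x = 2 * i" "i \<le> K"
      | h where "1 \<le> h" "h < R" "y = 2 * h - 1" "x = 2 * i" "i \<le> K"
      using rows[OF yx(1)] i by auto
    then show ?thesis
    proof cases
      case 1
      then have "0 < x" using v by auto
      then show ?thesis using 1 yx by (auto simp: p_def adj_def rk_def)
    next
      case 2
      then have "p (y, x) = (Suc y, x)" by (auto simp: p_def)
      moreover have "Suc y < 2 * R" using 2 yx by auto
      moreover have "rk (Suc y, x) < rk (y, x)" using 2 yx \<open>Suc y < 2 * R\<close> by (auto simp: rk_def)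
      ultimately show ?thesis using yx by (simp add: adj_def)
    next
      case 3
      then have "p (y, x) = (y - 1, x)" by (auto simp: p_def)
      moreover have "rk (y - 1, x) < rk (y, x)" using 3 by (auto simp: rk_def)
      ultimately show ?thesis using yx 3 by (simp add: adj_def)
    next
      case 4
      then have y: "odd y" "Suc y div 2 = h" "y \<noteq> 2 * R - 1" "y \<noteq> 0" by auto
      have p: "p (y, x) = (if l h i = 1 then (y, Suc x) else (y, x - 1))" using y 4 by (simp add: p_def)
      show ?thesis
      proof (cases "l h i = 1")
        case True
        then have "i \<noteq> K" using lb(2)[OF 4(1,2)] by auto
        then show ?thesis using True p y yx 4 by (auto simp: adj_def rk_def)
      next
        case False
        then have "i \<noteq> 0" using lb(1)[OF 4(1,2)] by metis
        then show ?thesis using False p y yx 4 by (auto simp: adj_def rk_def)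
      qed
    qed
  qed
  have pv': "p v \<in> V \<and> adj v (p v) \<and> rk (p v) < rk v" if "v \<in> V - {rt}" for v
    using pv[of "fst v" "snd v"] that by (metis DiffE prod.collapse singletonI)
  have T: "rooted_tree V rt p rk"
  proof -
    have "p rt = rt" by (simp add: p_def)
    moreover have "rt \<in> V" using R by auto
    ultimately show ?thesis unfolding rooted_tree_def using pv' by blast
  qed
  have gs_step: "gs x = (if odd x \<and> x < ?W then g (R - 1) (x div 2) else 0) + gs (Suc x)" for x
  proof (cases "odd x \<and> x < ?W")
    case True
    then have "{j. j < K \<and> x \<le> 2 * j + 1} = insert (x div 2) {j. j < K \<and> Suc x \<le> 2 * j + 1}"
      by (auto elim!: oddE)
    moreover have "x div 2 \<notin> {j. j < K \<and> Suc x \<le> 2 * j + 1}" using True by (auto elim!: oddE)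
    ultimately show ?thesis using True by (simp add: gs_def)
  next
    case False
    then have "{j. j < K \<and> x \<le> 2 * j + 1} = {j. j < K \<and> Suc x \<le> 2 * j + 1}"
      by (auto elim!: evenE)
    then show ?thesis using False by (auto simp: gs_def)
  qed
  have fl: "flow_on V rt p (\<lambda>(y, x). D y x) \<phi>"
    unfolding flow_on_def
  proof
    fix v assume v: "v \<in> V - {rt}"
    obtain y x where vyx: "v = (y, x)" by (cases v)
    have yx: "y < 2 * R" "x < ?W" using v vyx by auto
    define F where "F u = (if u \<noteq> rt \<and> p u = v then \<phi> u else 0)" for u
    have "(\<Sum>u \<in> V - {rt}. if p u = v then \<phi> u else 0) = (\<Sum>u \<in> V. F u)"
      by (rule sum.mono_neutral_cong_left) (auto simp: F_def)
    also have "\<dots> = (if Suc x < ?W then F (y, Suc x) else 0) + (if 0 < x then F (y, x - 1) else 0) +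
        (if Suc y < 2 * R then F (Suc y, x) else 0) + (if 0 < y then F (y - 1, x) else 0)"
    proof (rule sum_neighbours[OF yx])
      fix u assume "u \<in> V" "F u \<noteq> 0"
      then have "u \<in> V - {rt}" "p u = v" by (auto simp: F_def split: if_splits)
      then show "adj (y, x) u" using pv'[of u] vyx adj_sym by metis
    qed
    finally have S: "(\<Sum>u \<in> V - {rt}. if p u = v then \<phi> u else 0) =
        (if Suc x < ?W then F (y, Suc x) else 0) + (if 0 < x then F (y, x - 1) else 0) +
        (if Suc y < 2 * R then F (Suc y, x) else 0) + (if 0 < y then F (y - 1, x) else 0)" .
    obtain i where i: "x = 2 * i \<and> i \<le> K \<or> x = 2 * i + 1 \<and> i < K" using kinds[OF yx(2)] by blast
    consider "y = 2 * R - 1" | "y = 0" "y \<noteq> 2 * R - 1" | h where "1 \<le> h" "h < R" "y = 2 * h" "x = 2 * i" "i \<le> K"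
      | h where "1 \<le> h" "h < R" "y = 2 * h" "x = 2 * i + 1" "i < K"
      | h where "1 \<le> h" "h < R" "y = 2 * h - 1" "x = 2 * i" "i \<le> K"
      | h where "1 \<le> h" "h < R" "y = 2 * h - 1" "x = 2 * i + 1" "i < K"
      using rows[OF yx(1)] i by blast
    then show "\<phi> v = (case v of (y, x) \<Rightarrow> D y x) + (\<Sum>u \<in> V - {rt}. if p u = v then \<phi> u else 0)"
    proof cases
      case 1
      then have x: "0 < x" using v vyx by auto
      have y: "y - 1 = 2 * (R - 1)" "odd y" using 1 R by auto
      have "F (y, Suc x) = gs (Suc x)" using 1 vyx by (auto simp: F_def p_def \<phi>_def)
      moreover have "F (y, x - 1) = 0" using 1 vyx x by (auto simp: F_def p_def)
      moreover have "F (y - 1, x) = (if odd x then g (R - 1) (x div 2) else 0)"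
        using 1 R vyx y D_top by (auto simp: F_def p_def \<phi>_def elim!: evenE split: if_splits)
      moreover have "gs (Suc x) = 0" if "\<not> Suc x < ?W"
      proof -
        have "{j. j < K \<and> Suc x \<le> 2 * j + 1} = {}" using that by auto
        then show ?thesis unfolding gs_def by (simp only: sum.empty)
      qed
      moreover have "\<phi> v = gs x" using 1 vyx by (simp add: \<phi>_def)
      ultimately show ?thesis unfolding S using gs_step[of x] 1 yx vyx D_root x R
        by (cases "Suc x < ?W"; cases "odd x") simp_all
    next
      case 2
      have "F (y, Suc x) = 0" "F (y, x - 1) = 0" using 2 vyx R by (auto simp: F_def p_def)
      moreover have "F (Suc y, x) = 0" using 2 vyx R by (auto simp: F_def p_def split: if_splits)
      moreover have "\<phi> v = D 0 x" using 2 i vyx R a0[of i] by (auto simp: \<phi>_def g_def t0)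
      ultimately show ?thesis unfolding S using 2 vyx by (cases "x = 0") simp_all
    next
      case 3
      have "F (y, Suc x) = 0" "F (y, x - 1) = 0" "F (Suc y, x) = 0" "F (y - 1, x) = 0"
        using 3 vyx by (auto simp: F_def p_def split: if_splits)
      moreover have "\<phi> v = D y x" using 3 vyx ev[OF 3(2)] by (simp add: \<phi>_def)
      ultimately show ?thesis unfolding S using 3 vyx by (cases "x = 0") auto
    next
      case 4
      have y: "odd (y - 1)" "y - 1 \<noteq> 2 * R - 1" "Suc (y - 1) = 2 * h" "y \<noteq> 2 * R - 1" using 4 ev[OF 4(2)] by auto
      have "F (y, Suc x) = 0" "F (y, x - 1) = 0" "F (Suc y, x) = 0"
        using 4 vyx by (auto simp: F_def p_def split: if_splits)
      moreover have "F (y - 1, x) = g h i - D (2 * h) (2 * i + 1)"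
        using 4 vyx y by (auto simp: F_def p_def \<phi>_def)
      moreover have "\<phi> v = g h i" using 4 vyx y by (simp add: \<phi>_def)
      ultimately show ?thesis unfolding S using vyx 4 gD[OF 4(1,2), of i] by simp
    next
      case 5
      have y: "odd y" "y \<noteq> 2 * R - 1" "Suc y = 2 * h" "y \<noteq> 0" "even (y - 1)" using 5 by auto
      have "F (y, Suc x) = 0" "F (y, x - 1) = 0"
        using 5 vyx y lb(1)[OF 5(1,2)] by (auto simp: F_def p_def split: if_splits)
      moreover have "F (Suc y, x) = D (2 * h) (2 * i)" using 5 vyx y by (auto simp: F_def p_def \<phi>_def)
      moreover have "F (y - 1, x) = 0" using 5 vyx y D_top by (auto simp: F_def p_def \<phi>_def split: if_splits)
      moreover have "\<phi> v = w h i" using 5 vyx y by (simp add: \<phi>_def)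
      ultimately show ?thesis unfolding S using vyx 5 y yx by (cases "x = 0") (auto simp: w_def)
    next
      case 6
      have y: "odd y" "y \<noteq> 2 * R - 1" "Suc y = 2 * h" "y \<noteq> 0" "y - 1 = 2 * (h - 1)" using 6 by auto
      have "F (y, Suc x) = w h (Suc i) * (1 - l h (Suc i))"
        using 6 vyx y l1[OF 6(2), of "Suc i"] by (auto simp: F_def p_def \<phi>_def le_Suc_eq)
      moreover have "F (y, x - 1) = w h i * l h i"
        using 6 vyx y l1[OF 6(2), of i] by (auto simp: F_def p_def \<phi>_def le_Suc_eq)
      moreover have "F (Suc y, x) = 0" using 6 vyx y by (auto simp: F_def p_def)
      moreover have "F (y - 1, x) = g (h - 1) i" using 6 vyx y by (auto simp: F_def p_def \<phi>_def)
      moreover have "\<phi> v = g h i - D (2 * h) (2 * i + 1)" using 6 vyx y by (simp add: \<phi>_def)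
      moreover have "g h i = g (h - 1) i + D (2 * h - 1) (2 * i + 1) + D (2 * h) (2 * i + 1) +
          w h i * l h i + w h (Suc i) * (1 - l h (Suc i))" using eqn[OF 6(1,2,5)] by (simp add: g_def)
      ultimately show ?thesis unfolding S using vyx 6 y by simp
    qed
  qed
  have gsum: "(\<Sum>j < K. g h j) = K * t h + m" if "h < R" for h
    using that
  proof (induction h)
    case 0
    have "(\<Sum>x < ?W. D 0 x) = (\<Sum>j < K. D 0 (2 * j + 1))" unfolding sum_odd_even by (simp add: D_top)
    then show ?case using total[OF 0] a0 by (simp add: g_def t0)
  next
    case (Suc h)
    let ?h = "Suc h"
    \<comment> \<open>Each even column hands its demand to exactly one odd neighbour; at
      \<open>n = K\<close> the two boundary terms vanish because \<open>l\<close> is 1 at the first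
      and 0 at the last even column.\<close>
    have tele: "(\<Sum>j < n. w ?h j * l ?h j + w ?h (Suc j) * (1 - l ?h (Suc j))) + w ?h n * l ?h n + w ?h 0 * (1 - l ?h 0) = (\<Sum>i \<le> n. w ?h i)"
      if "n \<le> K" for n
      using that
    proof (induction n)
      case 0
      then show ?case using l1[OF Suc.prems, of 0] by (auto simp: le_Suc_eq)
    next
      case (Suc n)
      moreover have "w ?h (Suc n) * l ?h (Suc n) + w ?h (Suc n) * (1 - l ?h (Suc n)) = w ?h (Suc n)"
        using l1[OF \<open>?h < R\<close> Suc.prems] by (auto simp: le_Suc_eq)
      ultimately show ?case by simp
    qed
    have "(\<Sum>j < K. g ?h j) = (\<Sum>j < K. g h j + (D (2 * h + 1) (2 * j + 1) + D (2 * ?h) (2 * j + 1)) +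
          (w ?h j * l ?h j + w ?h (Suc j) * (1 - l ?h (Suc j))))"
      using eqn[of ?h] Suc.prems by (intro sum.cong) (auto simp: g_def)
    also have "\<dots> = (\<Sum>j < K. g h j) + ((\<Sum>j < K. D (2 * h + 1) (2 * j + 1)) + (\<Sum>j < K. D (2 * ?h) (2 * j + 1))) + (\<Sum>i \<le> K. w ?h i)"
      using tele[of K] lb[of ?h] Suc.prems by (simp add: sum.distrib)
    also have "(\<Sum>i \<le> K. w ?h i) = (\<Sum>i \<le> K. D (2 * h + 1) (2 * i)) + (\<Sum>i \<le> K. D (2 * ?h) (2 * i))"
      by (simp add: w_def sum.distrib)
    finally have "(\<Sum>j < K. g ?h j) = (\<Sum>j < K. g h j) + (\<Sum>x < ?W. D (2 * h + 1) x) + (\<Sum>x < ?W. D (2 * ?h) x)"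
      unfolding sum_odd_even by simp
    moreover have "(\<Sum>y \<le> 2 * ?h. \<Sum>x < ?W. D y x) = (\<Sum>y \<le> 2 * h. \<Sum>x < ?W. D y x) + (\<Sum>x < ?W. D (2 * h + 1) x) + (\<Sum>x < ?W. D (2 * ?h) x)"
      by simp
    ultimately show ?case using Suc total[OF Suc.prems] total[of h] by simp
  qed
  have "(\<Sum>v \<in> V - {rt}. cost B v (p v) * (\<phi> v)\<^sup>2) = B"
  proof -
    let ?P = "{..<R} \<times> {..<K}" and ?a = "\<lambda>(h, j). (2 * h, 2 * j + 1) :: nat \<times> nat"
    have inj: "inj_on ?a ?P" by (auto simp: inj_on_def)
    \<comment> \<open>All other tree edges are free, apart from those at the even columns of the top
      row, which carry nothing.\<close>
    have z: "cost B v (p v) * (\<phi> v)\<^sup>2 = 0" if v: "v \<in> V - {rt} - ?a ` ?P" for v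
    proof -
      obtain y x where vyx: "v = (y, x)" by (cases v)
      have yx: "y < 2 * R" "x < ?W" using v vyx by auto
      obtain i where i: "x = 2 * i \<and> i \<le> K \<or> x = 2 * i + 1 \<and> i < K" using kinds[OF yx(2)] by blast
      have "\<not> (even y \<and> odd x)"
      proof
        assume "even y \<and> odd x"
        then have "v = ?a (y div 2, i)" "(y div 2, i) \<in> ?P" using i yx vyx by auto
        then show False using v by blast
      qed
      moreover have "y = 0 \<Longrightarrow> even x \<Longrightarrow> \<phi> v = 0" using vyx D_top R by (auto simp: \<phi>_def elim!: evenE)
      ultimately show ?thesis using vyx R
        by (cases "even y"; cases "even x") (auto simp: p_def cost_def hres_def vres_def min_def split: if_splits)
    qed
    have "(\<Sum>v \<in> V - {rt}. cost B v (p v) * (\<phi> v)\<^sup>2) = (\<Sum>v \<in> ?a ` ?P. cost B v (p v) * (\<phi> v)\<^sup>2)"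
      by (rule sum.mono_neutral_right) (use z in auto)
    also have "\<dots> = (\<Sum>q \<in> ?P. cost B (?a q) (p (?a q)) * (\<phi> (?a q))\<^sup>2)"
      unfolding sum.reindex[OF inj] comp_def ..
    also have "\<dots> = (\<Sum>(h, j) \<in> ?P. (g h j)\<^sup>2)"
      by (rule sum.cong) (auto simp: p_def cost_def vres_def \<phi>_def)
    also have "\<dots> = (\<Sum>h < R. \<Sum>j < K. (g h j)\<^sup>2)" by (simp add: sum.cartesian_product)
    also have "\<dots> = (\<Sum>h < R. K * (t h)\<^sup>2 + m * (2 * t h + 1))"
    proof (rule sum.cong[OF refl])
      fix h assume "h \<in> {..<R}"
      then have h: "h < R" by simp
      have "(\<Sum>j < K. (g h j)\<^sup>2) = (\<Sum>j < K. (t h)\<^sup>2 + (2 * t h + 1) * a h j)"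
      proof (rule sum.cong[OF refl])
        fix j assume "j \<in> {..<K}"
        then have "a h j = 0 \<or> a h j = 1" using a1[OF h, of j] by (auto simp: le_Suc_eq)
        then show "(g h j)\<^sup>2 = (t h)\<^sup>2 + (2 * t h + 1) * a h j"
          by (auto simp: g_def power2_eq_square)
      qed
      also have "\<dots> = K * (t h)\<^sup>2 + (2 * t h + 1) * (\<Sum>j < K. a h j)"
        by (simp add: sum.distrib sum_distrib_left)
      also have "(\<Sum>j < K. a h j) = m" using gsum[OF h] by (simp add: g_def sum.distrib)
      finally show "(\<Sum>j < K. (g h j)\<^sup>2) = K * (t h)\<^sup>2 + m * (2 * t h + 1)" by simp
    qed
    finally show ?thesis by (simp add: B_def)
  qed
  moreover have "\<forall>v \<in> V - {rt}. adj v (p v)" using pv' by blast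
  ultimately show ?thesis unfolding yes_iff_tree using T fl by (intro exI[of _ p] exI[of _ rk] exI[of _ \<phi>]) auto
qed

theorem yes_iff_local: "ednr_yes I \<longleftrightarrow> (\<exists>a l. local_solution a l)"
  using yes_imp_local local_imp_yes by blast

end

section \<open>Linear constraints on bits\<close>

lemma sum_quadruples: "(\<Sum>x < 4 * m + 1. f x) =
    f 0 + (\<Sum>q < m. f (4 * q + 1) + f (4 * q + 2) + f (4 * q + 3) + f (4 * q + 4))"
  for f :: "nat \<Rightarrow> nat"
proof (induction m)
  case (Suc m)
  have "{..<4 * Suc m + 1} = insert (4 * m + 4) (insert (4 * m + 3) (insert (4 * m + 2) (insert (4 * m + 1) {..<4 * m + 1})))"
    by auto
  then show ?case using Suc by simp
qed simp

lemma sum_add_const: "(\<Sum>q < m. f q + c) = (\<Sum>q < m. f q) + m * c" for c :: nat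
  by (simp add: sum.distrib)

text \<open>\<open>knd q\<close> is 0 if bit \<open>q\<close> is forced to be 0, 1 if it is free,
  and anything else if it is forced to be 1. \<open>sg e q\<close> is 1 for a plus and 2 for a minus
  in constraint \<open>e\<close>. Balance keeps the total demand of the rows of a constraint at its
  prescribed value.\<close>

locale constraint_grid =
  fixes m E :: nat and knd :: "nat \<Rightarrow> nat" and sg :: "nat \<Rightarrow> nat \<Rightarrow> nat"
  assumes m: "1 \<le> m"
    and balanced: "\<And>e. e < E \<Longrightarrow> (\<Sum>q < m. of_bool (sg e q = 1)) = (\<Sum>q < m. of_bool (sg e q = 2) :: nat)"
    and sg2: "\<And>e q. sg e q \<le> 2"
begin

text \<open>
  Variable \<open>q\<close> owns the columns \<open>x = 4 q + 1\<close> (its value) and \<open>x = 4 q + 3\<close> (its negation); a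
  quadruple lists the demands in the four columns starting at \<open>4 q + 1\<close>.
\<close>

definition quad :: "nat \<Rightarrow> nat \<Rightarrow> nat \<times> nat \<times> nat \<times> nat" where
  "quad y q = (let e = (y - 3) div 4; k = (y - 3) mod 4 in
     if y = 0 then (if knd q = 0 then (0, 0, 1, 0) else (1, 0, 0, 0))
     else if y = 1 then (if knd q = 1 then (0, 1, 1, 0) else (1, 0, 1, 0))
     else if y = 2 then (1, 0, 1, 0)
     else if 3 + 4 * E \<le> y then (0, 0, 0, 0)
     else if k = 0 then (of_bool (sg e q = 1), 1, 0, 1)
     else if k = 1 then (1, 1, of_bool (sg e q \<noteq> 2), 1)
     else if k = 2 then (0, 1, of_bool (sg e q = 2), 1)
     else (of_bool (sg e q \<noteq> 1), 1, 1, 1))"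

text \<open>In phase one the right border column has demand and the left one has none; in phase two
  it is the other way round. So the default direction of the even columns is left in phase one and
  right in phase two, and every odd column receives one double load.\<close>

definition lft :: "nat \<Rightarrow> nat" where
  "lft y = of_bool (3 \<le> y \<and> y < 3 + 4 * E \<and> 2 \<le> (y - 3) mod 4)"

definition rgt :: "nat \<Rightarrow> nat" where
  "rgt y = of_bool (3 \<le> y \<and> y < 3 + 4 * E \<and> (y - 3) mod 4 < 2)"

definition D :: "nat \<Rightarrow> nat \<Rightarrow> nat" where
  "D y x = (if x = 0 then lft y else if x = 4 * m then rgt y else
     let (a, b, c, d) = quad y ((x - 1) div 4); k = (x - 1) mod 4 in
       if k = 0 then a else if k = 1 then b else if k = 2 then c else d)"

text \<open>Layer 0 lies below the top row, layer 1 completes the choice of the bits, and each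
  constraint takes two more layers.\<close>

definition R :: nat where "R = 2 + 2 * E"

text \<open>Each pair of columns contributes \<open>t^2 + (t + 1)^2\<close> at
  \<open>t = 3 * h - 1\<close>; truncated subtraction makes this 0 for the top layer.\<close>

definition B :: nat where "B = (\<Sum>h < R. m * (2 * (3 * h - 1)\<^sup>2 + 2 * (3 * h - 1) + 1))"

lemma D_cols:
  assumes "q < m"
  shows "D y (4 * q + 1) = fst (quad y q)" "D y (4 * q + 2) = fst (snd (quad y q))"
    "D y (4 * q + 3) = fst (snd (snd (quad y q)))"
    "D y (4 * q + 4) = (if Suc q = m then rgt y else snd (snd (snd (quad y q))))"
    "D y 0 = lft y"
proof -
  have *: "(4 * q + 3) div 4 = q" "(4 * q + 3) mod 4 = 3" "(4 * q + 2) div 4 = q" "(4 * q + 2) mod 4 = 2"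
    "(4 * q + 1) div 4 = q" "(4 * q + 1) mod 4 = 1" by presburger+
  show "D y (4 * q + 1) = fst (quad y q)" using assms by (cases "quad y q") (auto simp: D_def)
  show "D y (4 * q + 2) = fst (snd (quad y q))" using assms * by (cases "quad y q") (simp add: D_def)
  show "D y (4 * q + 3) = fst (snd (snd (quad y q)))" using assms * by (cases "quad y q") (simp add: D_def)
  show "D y (4 * q + 4) = (if Suc q = m then rgt y else snd (snd (snd (quad y q))))"
    using assms * by (cases "quad y q") (simp add: D_def)
  show "D y 0 = lft y" by (simp add: D_def)
qed

lemma quad_le: "quad y q = (a, b, c, d) \<Longrightarrow> a \<le> 1 \<and> b \<le> 1 \<and> c \<le> 1 \<and> d \<le> 1"
  unfolding quad_def Let_def by (simp split: if_splits; fastforce?)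

lemma D_le: "D y x \<le> 1"
proof -
  obtain a b c d where q: "quad y ((x - 1) div 4) = (a, b, c, d)" by (cases "quad y ((x - 1) div 4)")
  show ?thesis using quad_le[OF q] unfolding D_def q lft_def rgt_def Let_def by simp
qed

lemma D_top0: "D 0 (2 * i) = 0"
proof -
  have k: "(2 * i - 1) mod 4 = 1 \<or> (2 * i - 1) mod 4 = 3" if i: "0 < i"
  proof -
    obtain j where "2 * i - 1 = 2 * j + 1" using i by (cases i) auto
    moreover have "(2 * j + 1) mod 4 = 1 \<or> (2 * j + 1) mod 4 = 3" by presburger
    ultimately show ?thesis by simp
  qed
  obtain a c where "quad 0 ((2 * i - 1) div 4) = (a, 0, c, 0)" by (cases "knd ((2 * i - 1) div 4) = 0") (auto simp: quad_def)
  then show ?thesis using k unfolding D_def by (auto simp: lft_def rgt_def)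
qed

lemma D_root0: "D (2 * R - 1) x = 0"
  by (auto simp: D_def quad_def lft_def rgt_def Let_def R_def)

text \<open>Every odd column collects two units, the value \<open>t 1\<close>, and each pair gets
  one unit more. For a free bit this unit sits in column \<open>4 * q + 2\<close> between the pair
  and drains left for the value 1 and right for 0; for a forced bit it sits in one column of the
  pair.\<close>

lemma guess_rows:
  "quad 0 q = (if knd q = 0 then (0, 0, 1, 0) else (1, 0, 0, 0))"
  "quad 1 q = (if knd q = 1 then (0, 1, 1, 0) else (1, 0, 1, 0))"
  "quad 2 q = (1, 0, 1, 0)"
  by (simp_all add: quad_def)

text \<open>Without signs, every odd column gets one unit in each phase. In phase one a plus adds a
  unit in the value column and a minus removes one from the negation column; phase two makes the
  opposite change in the same column. Since all other demand moves in twos, each such change flips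
  the bit of its column.\<close>

lemma phase_rows:
  assumes "e < E"
  shows "quad (3 + 4 * e) q = (of_bool (sg e q = 1), 1, 0, 1)"
    "quad (4 + 4 * e) q = (1, 1, of_bool (sg e q \<noteq> 2), 1)"
    "quad (5 + 4 * e) q = (0, 1, of_bool (sg e q = 2), 1)"
    "quad (6 + 4 * e) q = (of_bool (sg e q \<noteq> 1), 1, 1, 1)"
    "lft (3 + 4 * e) = 0" "lft (4 + 4 * e) = 0" "lft (5 + 4 * e) = 1" "lft (6 + 4 * e) = 1"
    "rgt (3 + 4 * e) = 1" "rgt (4 + 4 * e) = 1" "rgt (5 + 4 * e) = 0" "rgt (6 + 4 * e) = 0"
proof -
  have *: "3 + 4 * e - 3 = 4 * e" "4 + 4 * e - 3 = 4 * e + 1" "5 + 4 * e - 3 = 4 * e + 2" "6 + 4 * e - 3 = 4 * e + 3" by auto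
  have **: "(4 * e + 1) div 4 = e" "(4 * e + 2) div 4 = e" "(4 * e + 3) div 4 = e"
    "(4 * e + 1) mod 4 = 1" "(4 * e + 2) mod 4 = 2" "(4 * e + 3) mod 4 = 3" by presburger+
  show "quad (3 + 4 * e) q = (of_bool (sg e q = 1), 1, 0, 1)" "quad (4 + 4 * e) q = (1, 1, of_bool (sg e q \<noteq> 2), 1)"
    "quad (5 + 4 * e) q = (0, 1, of_bool (sg e q = 2), 1)" "quad (6 + 4 * e) q = (of_bool (sg e q \<noteq> 1), 1, 1, 1)"
    "lft (3 + 4 * e) = 0" "lft (4 + 4 * e) = 0" "lft (5 + 4 * e) = 1" "lft (6 + 4 * e) = 1"
    "rgt (3 + 4 * e) = 1" "rgt (4 + 4 * e) = 1" "rgt (5 + 4 * e) = 0" "rgt (6 + 4 * e) = 0"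
    unfolding quad_def lft_def rgt_def Let_def * ** using assms by auto
qed

text \<open>The fourth entry of the last quadruple is replaced by the right border; adding
  \<open>d\<close> on the left avoids a subtraction.\<close>

lemma row_sum:
  assumes d: "\<And>q. q < m \<Longrightarrow> snd (snd (snd (quad y q))) = d"
    and f: "\<And>q. q < m \<Longrightarrow> fst (quad y q) + fst (snd (quad y q)) + fst (snd (snd (quad y q))) = f q"
  shows "(\<Sum>x < 4 * m + 1. D y x) + d = lft y + rgt y + d * m + (\<Sum>q < m. f q)"
proof -
  obtain m' where m': "m = Suc m'" using m by (cases m) auto
  have "(\<Sum>x < 4 * m + 1. D y x) = lft y + (\<Sum>q < m. D y (4 * q + 1) + D y (4 * q + 2) + D y (4 * q + 3) + D y (4 * q + 4))"
    unfolding sum_quadruples by (simp add: D_def)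
  also have "(\<Sum>q < m. D y (4 * q + 1) + D y (4 * q + 2) + D y (4 * q + 3) + D y (4 * q + 4)) =
      (\<Sum>q < m. f q + (if Suc q = m then rgt y else d))"
  proof (rule sum.cong[OF refl])
    fix q assume "q \<in> {..<m}"
    then have q: "q < m" by simp
    show "D y (4 * q + 1) + D y (4 * q + 2) + D y (4 * q + 3) + D y (4 * q + 4) = f q + (if Suc q = m then rgt y else d)"
      unfolding D_cols(1-4)[OF q] using d[OF q] f[OF q] by simp
  qed
  also have "lft y + (\<Sum>q < m. f q + (if Suc q = m then rgt y else d)) = lft y + (\<Sum>q < m. f q) + (\<Sum>q < m. if Suc q = m then rgt y else d)"
    by (simp add: sum.distrib)
  also have "(\<Sum>q < m. if Suc q = m then rgt y else d) = rgt y + m' * d" unfolding m' by simp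
  finally show ?thesis unfolding m' by simp
qed

text \<open>Layer 1 adds two units per odd column and every later layer three. The single units that
  signs add or remove cancel within a layer by \<open>balanced\<close>.\<close>

lemma total_demand: "h < R \<Longrightarrow> (\<Sum>y \<le> 2 * h. \<Sum>x < 4 * m + 1. D y x) = 2 * m * (3 * h - 1) + m"
proof (induction h)
  case 0
  have "(\<Sum>x < 4 * m + 1. D 0 x) = (\<Sum>q < m. 1)"
    using row_sum[of 0 0 "\<lambda>_. 1"] by (simp add: quad_def lft_def rgt_def)
  then show ?case by simp
next
  case (Suc h)
  let ?r = "\<lambda>y. \<Sum>x < 4 * m + 1. D y x"
  have "h = 0 \<or> (\<exists>e < E. h = 1 + 2 * e) \<or> (\<exists>e < E. h = 2 + 2 * e)"
    using Suc.prems unfolding R_def by presburger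
  then have "?r (2 * h + 1) + ?r (2 * h + 2) = (if h = 0 then 4 else 6) * m"
  proof (elim disjE exE conjE)
    assume h: "h = 0"
    have "?r 1 = (\<Sum>q < m. 2)" using row_sum[of 1 0 "\<lambda>_. 2"]
      by (simp add: quad_def lft_def rgt_def)
    moreover have "?r 2 = (\<Sum>q < m. 2)" using row_sum[of 2 0 "\<lambda>_. 2"]
      by (simp add: quad_def lft_def rgt_def)
    ultimately show ?thesis using h by (simp add: numeral_2_eq_2)
  next
    fix e assume e: "e < E" and h: "h = 1 + 2 * e"
    have 1: "?r (3 + 4 * e) + 1 = 1 + m + ((\<Sum>q < m. of_bool (sg e q = 1)) + m * 1)"
      unfolding sum_add_const[symmetric] using row_sum[of "3 + 4 * e" 1 "\<lambda>q. of_bool (sg e q = 1) + 1"] phase_rows[OF e] by simp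
    have 2: "?r (4 + 4 * e) + 1 = 1 + m + ((\<Sum>q < m. of_bool (sg e q \<noteq> 2)) + m * 2)"
      unfolding sum_add_const[symmetric] using row_sum[of "4 + 4 * e" 1 "\<lambda>q. of_bool (sg e q \<noteq> 2) + 2"] phase_rows[OF e] by simp
    have "(\<Sum>q < m. of_bool (sg e q \<noteq> 2)) + (\<Sum>q < m. of_bool (sg e q = 2)) = (\<Sum>q < m. 1 :: nat)"
      unfolding sum.distrib[symmetric] by (intro sum.cong) auto
    then have "?r (3 + 4 * e) + ?r (4 + 4 * e) = 6 * m" using 1 2 balanced[OF e] by (simp only: sum_constant card_lessThan of_nat_id)
    moreover have "2 * h + 1 = 3 + 4 * e" "2 * h + 2 = 4 + 4 * e" "(if h = 0 then 4 else 6) = (6 :: nat)"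
      using h by auto
    ultimately show ?thesis by (simp only:)
  next
    fix e assume e: "e < E" and h: "h = 2 + 2 * e"
    have 1: "?r (5 + 4 * e) + 1 = 1 + m + ((\<Sum>q < m. of_bool (sg e q = 2)) + m * 1)"
      unfolding sum_add_const[symmetric] using row_sum[of "5 + 4 * e" 1 "\<lambda>q. of_bool (sg e q = 2) + 1"] phase_rows[OF e] by simp
    have 2: "?r (6 + 4 * e) + 1 = 1 + m + ((\<Sum>q < m. of_bool (sg e q \<noteq> 1)) + m * 2)"
      unfolding sum_add_const[symmetric] using row_sum[of "6 + 4 * e" 1 "\<lambda>q. of_bool (sg e q \<noteq> 1) + 2"] phase_rows[OF e] by simp
    have "(\<Sum>q < m. of_bool (sg e q \<noteq> 1)) + (\<Sum>q < m. of_bool (sg e q = 1)) = (\<Sum>q < m. 1 :: nat)"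
      unfolding sum.distrib[symmetric] by (intro sum.cong) auto
    then have "?r (5 + 4 * e) + ?r (6 + 4 * e) = 6 * m" using 1 2 balanced[OF e] by (simp only: sum_constant card_lessThan of_nat_id)
    moreover have "2 * h + 1 = 5 + 4 * e" "2 * h + 2 = 6 + 4 * e" "(if h = 0 then 4 else 6) = (6 :: nat)"
      using h by auto
    ultimately show ?thesis by (simp only:)
  qed
  moreover have "(\<Sum>y \<le> 2 * Suc h. ?r y) = (\<Sum>y \<le> 2 * h. ?r y) + (?r (2 * h + 1) + ?r (2 * h + 2))" by simp
  ultimately have "(\<Sum>y \<le> 2 * Suc h. ?r y) = 2 * m * (3 * h - 1) + m + (if h = 0 then 4 else 6) * m"
    using Suc by simp
  also have "\<dots> = 2 * m * (3 * Suc h - 1) + m" by (cases h) (auto simp: algebra_simps)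
  finally show ?case .
qed

text \<open>There are \<open>2 * m\<close> odd columns, two for each variable, and the excess
  \<open>m\<close> is one unit per pair, whatever the values of the variables.\<close>

sublocale flow_grid R "2 * m" m D "\<lambda>h. 3 * h - 1" B
proof
  show "1 \<le> R" "1 \<le> 2 * m" using m by (auto simp: R_def)
  show "D y x \<le> 1" for y x by (rule D_le)
  show "D 0 (2 * i) = 0" for i by (rule D_top0)
  show "D (2 * R - 1) x = 0" for x by (rule D_root0)
  show "2 \<le> 3 * h - 1" if "1 \<le> h" "h < R" for h using that by simp
  show "(\<Sum>y \<le> 2 * h. \<Sum>x < 2 * (2 * m) + 1. D y x) = 2 * m * (3 * h - 1) + m" if "h < R" for h
    using total_demand[OF that] by simp
  show "B = (\<Sum>h < R. 2 * m * (3 * h - 1)\<^sup>2 + m * (2 * (3 * h - 1) + 1))"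
    unfolding B_def by (intro sum.cong) (auto simp: algebra_simps)
qed simp

text \<open>\<open>z\<close> is the running sum of the positive minus the negative terms. It must
  stay in {0, 1} because it is stored in the direction of a single even column.\<close>

definition row_ok :: "nat \<Rightarrow> (nat \<Rightarrow> nat) \<Rightarrow> bool" where
  "row_ok e b \<longleftrightarrow> (\<exists>z. z 0 = 0 \<and> z m = 0 \<and> (\<forall>q \<le> m. z q \<le> 1) \<and>
     (\<forall>q < m. z (Suc q) + of_bool (sg e q = 2) * b q = z q + of_bool (sg e q = 1) * b q))"

definition bits_ok :: "(nat \<Rightarrow> nat) \<Rightarrow> bool" where
  "bits_ok b \<longleftrightarrow> (\<forall>q < m. b q \<le> 1 \<and> (knd q = 0 \<longrightarrow> b q = 0) \<and> (knd q \<noteq> 0 \<and> knd q \<noteq> 1 \<longrightarrow> b q = 1)) \<and>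
     (\<forall>e < E. row_ok e b)"

lemma w_inner: "e < E \<Longrightarrow> 0 < i \<Longrightarrow> i < 2 * m \<Longrightarrow> w (2 + 2 * e) i = 2 \<and> w (3 + 2 * e) i = 2"
proof -
  assume e: "e < E" and i: "0 < i" "i < 2 * m"
  have y: "2 * (2 + 2 * e) - 1 = 3 + 4 * e" "2 * (2 + 2 * e) = 4 + 4 * e" "2 * (3 + 2 * e) - 1 = 5 + 4 * e" "2 * (3 + 2 * e) = 6 + 4 * e"
    by auto
  obtain q where "i = 2 * q + 1 \<or> i = 2 * q + 2" "q < m"
  proof (cases "even i")
    case True
    then obtain k where "i = 2 * k" by (elim evenE)
    then obtain k' where "i = 2 * k' + 2" using i by (cases k) auto
    then show ?thesis using that[of k'] i by auto
  next
    case False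
    then obtain k where "i = 2 * k + 1" by (elim oddE)
    then show ?thesis using that[of k] i by auto
  qed
  then show ?thesis
  proof (elim disjE)
    assume q: "q < m" and iq: "i = 2 * q + 1"
    have "2 * i = 4 * q + 2" using iq by simp
    then show ?thesis unfolding w_def y using D_cols[OF q] phase_rows[OF e] by simp
  next
    assume q: "q < m" and iq: "i = 2 * q + 2"
    have "2 * i = 4 * q + 4" "Suc q \<noteq> m" using iq i by auto
    then show ?thesis unfolding w_def y using D_cols[OF q] phase_rows[OF e] by simp
  qed
qed

lemma w_ends: "e < E \<Longrightarrow> w (2 + 2 * e) 0 = 0 \<and> w (3 + 2 * e) 0 = 2 \<and> w (2 + 2 * e) (2 * m) = 2 \<and> w (3 + 2 * e) (2 * m) = 0"
proof -
  assume e: "e < E"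
  have y: "2 * (2 + 2 * e) - 1 = 3 + 4 * e" "2 * (2 + 2 * e) = 4 + 4 * e" "2 * (3 + 2 * e) - 1 = 5 + 4 * e" "2 * (3 + 2 * e) = 6 + 4 * e"
    by auto
  have "D y (2 * (2 * m)) = rgt y" for y using m by (simp add: D_def)
  moreover have "D y (2 * 0) = lft y" for y by (simp add: D_def)
  ultimately show ?thesis unfolding w_def y using phase_rows[OF e] by simp
qed

lemma w_guess: "q < m \<Longrightarrow> w 1 (2 * q + 1) = of_bool (knd q = 1)" "q \<le> m \<Longrightarrow> w 1 (2 * q) = 0"
proof -
  show "q < m \<Longrightarrow> w 1 (2 * q + 1) = of_bool (knd q = 1)"
    using D_cols(2)[of q] by (simp add: w_def quad_def)
  show "q \<le> m \<Longrightarrow> w 1 (2 * q) = 0"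
  proof (cases q)
    case 0
    then show ?thesis by (simp add: w_def D_cols lft_def D_def)
  next
    case (Suc q')
    assume "q \<le> m"
    then have "D y (4 * q) = (if q = m then rgt y else snd (snd (snd (quad y q'))))" for y
      using D_cols(4)[of q' y] Suc by (simp add: add.commute)
    then show ?thesis by (simp add: w_def quad_def rgt_def)
  qed
qed

text \<open>Phase one of a constraint reads off the bits along the row, phase two restores them.\<close>

lemma local_imp_bits:
  assumes "local_solution a l"
  shows "\<exists>b. bits_ok b"
proof -
  let ?t = "\<lambda>h. 3 * h - 1 :: nat"
  have a1: "\<And>h j. h < R \<Longrightarrow> j < 2 * m \<Longrightarrow> a h j \<le> 1" and l1: "\<And>h i. h < R \<Longrightarrow> i \<le> 2 * m \<Longrightarrow> l h i \<le> 1"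
    and a0: "\<And>j. j < 2 * m \<Longrightarrow> a 0 j = D 0 (2 * j + 1)"
    and lb: "\<And>h. 1 \<le> h \<Longrightarrow> h < R \<Longrightarrow> l h 0 = 1" "\<And>h. 1 \<le> h \<Longrightarrow> h < R \<Longrightarrow> l h (2 * m) = 0"
    and eqn: "\<And>h j. 1 \<le> h \<Longrightarrow> h < R \<Longrightarrow> j < 2 * m \<Longrightarrow> ?t h + a h j = ?t (h - 1) + a (h - 1) j +
       D (2 * h - 1) (2 * j + 1) + D (2 * h) (2 * j + 1) + w h j * l h j + w h (Suc j) * (1 - l h (Suc j))"
    using assms unfolding local_solution_def by blast+
  define b where "b q = a 1 (2 * q)" for q
  have guess: "b q \<le> 1 \<and> a 1 (2 * q + 1) = 1 - b q \<and> (knd q = 0 \<longrightarrow> b q = 0) \<and> (knd q \<noteq> 0 \<and> knd q \<noteq> 1 \<longrightarrow> b q = 1)"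
    if q: "q < m" for q
  proof -
    have R1: "1 < R" by (simp add: R_def)
    have j: "2 * q < 2 * m" "2 * q + 1 < 2 * m" using q by auto
    have x: "2 * (2 * q) + 1 = 4 * q + 1" "2 * (2 * q + 1) + 1 = 4 * q + 3" "Suc (2 * q + 1) = 2 * Suc q" by auto
    have e: "2 + a 1 (2 * q) = a 0 (2 * q) + D 1 (4 * q + 1) + D 2 (4 * q + 1) + w 1 (2 * q) * l 1 (2 * q) + w 1 (2 * q + 1) * (1 - l 1 (2 * q + 1))"
      "2 + a 1 (2 * q + 1) = a 0 (2 * q + 1) + D 1 (4 * q + 3) + D 2 (4 * q + 3) + w 1 (2 * q + 1) * l 1 (2 * q + 1) + w 1 (2 * Suc q) * (1 - l 1 (2 * Suc q))"
      using eqn[OF _ R1 j(1)] eqn[OF _ R1 j(2)] unfolding x by (simp_all add: numeral_2_eq_2)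
    have i: "a 0 (2 * q) = D 0 (4 * q + 1)" "a 0 (2 * q + 1) = D 0 (4 * q + 3)"
      using a0[OF j(1)] a0[OF j(2)] unfolding x by simp_all
    show ?thesis
      using e i D_cols[OF q] w_guess(1)[OF q] w_guess(2)[of q] w_guess(2)[of "Suc q"] q l1[OF R1, of "2 * q + 1"]
      by (cases "knd q = 1") (auto simp: b_def quad_def le_Suc_eq split: if_splits)
  qed
  have restore: "row_ok e b \<and> (\<forall>q < m. a (3 + 2 * e) (2 * q) = b q \<and> a (3 + 2 * e) (2 * q + 1) = 1 - b q)"
    if e: "e < E" and IH: "\<forall>q < m. a (1 + 2 * e) (2 * q) = b q \<and> a (1 + 2 * e) (2 * q + 1) = 1 - b q" for e
  proof -
    let ?h = "2 + 2 * e" and ?k = "3 + 2 * e"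
    have hR: "?h < R" "?k < R" using e by (auto simp: R_def)
    have y: "2 * ?h - 1 = 3 + 4 * e" "2 * ?h = 4 + 4 * e" "2 * ?k - 1 = 5 + 4 * e" "2 * ?k = 6 + 4 * e"
      "?h - 1 = 1 + 2 * e" "?k - 1 = ?h" "?t ?h = 5 + 6 * e" "?t ?k = 8 + 6 * e" "?t (1 + 2 * e) = 2 + 6 * e"
      by auto
    \<comment> \<open>\<open>u\<close> and \<open>v\<close> are the directions, redefined at the
      border column without demand so that one formula covers all odd columns.\<close>
    define u where "u i = (if i = 0 then 0 else l ?h i)" for i
    define v where "v i = (if i = 2 * m then 1 else l ?k i)" for i
    have u1: "u i \<le> 1" "v i \<le> 1" if "i \<le> 2 * m" for i using that l1[OF hR(1)] l1[OF hR(2)] by (auto simp: u_def v_def)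
    have ends: "u 0 = 0" "u (2 * m) = 0" "v 0 = 1" "v (2 * m) = 1"
      using lb[OF _ hR(1)] lb[OF _ hR(2)] m by (auto simp: u_def v_def)
    have wu: "w ?h i * l ?h i = 2 * u i" "w ?k i * l ?k i = 2 * v i" if "i < 2 * m" for i
      using w_inner[OF e, of i] w_ends[OF e] lb[OF _ hR(2)] that by (cases "i = 0"; auto simp: u_def v_def)+
    have wv: "w ?h (Suc i) * (1 - l ?h (Suc i)) = 2 * (1 - u (Suc i))" "w ?k (Suc i) * (1 - l ?k (Suc i)) = 2 * (1 - v (Suc i))" if "i < 2 * m" for i
      using w_inner[OF e, of "Suc i"] w_ends[OF e] lb[OF _ hR(1)] that by (cases "Suc i = 2 * m"; auto simp: u_def v_def)+
    have e1: "3 + a ?h j = a (1 + 2 * e) j + D (3 + 4 * e) (2 * j + 1) + D (4 + 4 * e) (2 * j + 1) + 2 * u j + 2 * (1 - u (Suc j))"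
      if "j < 2 * m" for j using eqn[OF _ hR(1) that] unfolding y wu[OF that] wv[OF that] by simp
    have e2: "3 + a ?k j = a ?h j + D (5 + 4 * e) (2 * j + 1) + D (6 + 4 * e) (2 * j + 1) + 2 * v j + 2 * (1 - v (Suc j))"
      if "j < 2 * m" for j using eqn[OF _ hR(2) that] unfolding y wu[OF that] wv[OF that] by simp
    have pair: "u (2 * Suc q) + of_bool (sg e q = 2) * b q = u (2 * q) + of_bool (sg e q = 1) * b q \<and>
        a ?k (2 * q) = b q \<and> a ?k (2 * q + 1) = 1 - b q" if q: "q < m" for q
    proof -
      have j: "2 * q < 2 * m" "2 * q + 1 < 2 * m" using q by auto
      have x: "2 * (2 * q) + 1 = 4 * q + 1" "2 * (2 * q + 1) + 1 = 4 * q + 3" "Suc (2 * q + 1) = 2 * Suc q" "Suc (2 * q) = 2 * q + 1" by auto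
      have bits: "\<And>n. n \<le> 1 \<Longrightarrow> n = 0 \<or> n = (1 :: nat)" by auto
      have r1: "3 + a ?h (2 * q) = b q + of_bool (sg e q = 1) + 1 + 2 * u (2 * q) + 2 * (1 - u (2 * q + 1))"
        using e1[OF j(1)] IH q D_cols[OF q] phase_rows[OF e] unfolding x by simp
      have r2: "3 + a ?h (2 * q + 1) = 1 - b q + of_bool (sg e q \<noteq> 2) + 2 * u (2 * q + 1) + 2 * (1 - u (2 * Suc q))"
        using e1[OF j(2)] IH q D_cols[OF q] phase_rows[OF e] unfolding x by simp
      have r3: "3 + a ?k (2 * q) = a ?h (2 * q) + of_bool (sg e q \<noteq> 1) + 2 * v (2 * q) + 2 * (1 - v (2 * q + 1))"
        using e2[OF j(1)] D_cols[OF q] phase_rows[OF e] unfolding x by simp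
      have r4: "3 + a ?k (2 * q + 1) = a ?h (2 * q + 1) + of_bool (sg e q = 2) + 1 + 2 * v (2 * q + 1) + 2 * (1 - v (2 * Suc q))"
        using e2[OF j(2)] D_cols[OF q] phase_rows[OF e] unfolding x by simp
      have B: "b q \<le> 1" "a ?h (2 * q) \<le> 1" "a ?h (2 * q + 1) \<le> 1" "a ?k (2 * q) \<le> 1" "a ?k (2 * q + 1) \<le> 1"
        "u (2 * q) \<le> 1" "u (2 * q + 1) \<le> 1" "u (2 * Suc q) \<le> 1" "v (2 * q) \<le> 1" "v (2 * q + 1) \<le> 1" "v (2 * Suc q) \<le> 1"
        using guess[OF q] a1[OF hR(1) j(1)] a1[OF hR(1) j(2)] a1[OF hR(2) j(1)] a1[OF hR(2) j(2)]
          u1[of "2 * q"] u1[of "2 * q + 1"] u1[of "2 * Suc q"] q by auto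
      have s: "sg e q = 0 \<or> sg e q = 1 \<or> sg e q = 2" using sg2[of e q] by auto
      \<comment> \<open>A parity argument: even columns move two units at a time, so an extra unit
        flips the bit, and if the bit was 1 the surplus of two turns the next column to the right.
        Thus the carry \<open>u\<close> rises by \<open>b q\<close> at a plus, and in
        \<open>c2\<close> it falls by \<open>b q\<close> at a minus.\<close>
      have c1: "u (2 * q + 1) = u (2 * q) + of_bool (sg e q = 1) * b q \<and> a ?h (2 * q) = (if sg e q = 1 then 1 - b q else b q)"
        using r1 B(1,2,6,7) s by (auto simp: le_Suc_eq)
      have c2: "u (2 * Suc q) + of_bool (sg e q = 2) * b q = u (2 * q + 1) \<and> a ?h (2 * q + 1) = (if sg e q = 2 then b q else 1 - b q)"
        using r2 B(1,3,7,8) s by (auto simp: le_Suc_eq)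
      \<comment> \<open>The opposite change of demand in phase two flips the same column
        back.\<close>
      have c3: "a ?k (2 * q) = b q" using r3 c1 B(1,4,9,10) s by (auto simp: le_Suc_eq)
      have c4: "a ?k (2 * q + 1) = 1 - b q" using r4 c2 B(1,5,10,11) s by (auto simp: le_Suc_eq)
      show ?thesis using c1 c2 c3 c4 by simp
    qed
    have "row_ok e b" unfolding row_ok_def
      by (rule exI[of _ "\<lambda>q. u (2 * q)"]) (use pair ends u1 in auto)
    then show ?thesis using pair by blast
  qed
  have inv: "\<forall>q < m. a (1 + 2 * e) (2 * q) = b q \<and> a (1 + 2 * e) (2 * q + 1) = 1 - b q" if "e \<le> E" for e
    using that
  proof (induction e)
    case 0
    then show ?case using guess by (auto simp: b_def)
  next
    case (Suc e)
    then show ?case using restore[of e] by (simp add: numeral_3_eq_3)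
  qed
  have "bits_ok b" unfolding bits_ok_def using guess restore inv by auto
  then show ?thesis by blast
qed

text \<open>The carries prescribe the directions: phase one uses them as they are, phase two uses
  their complements.\<close>

lemma bits_imp_local:
  assumes "bits_ok b"
  shows "\<exists>a l. local_solution a l"
proof -
  let ?t = "\<lambda>h. 3 * h - 1 :: nat"
  have b: "\<And>q. q < m \<Longrightarrow> b q \<le> 1" "\<And>q. q < m \<Longrightarrow> knd q = 0 \<Longrightarrow> b q = 0" "\<And>q. q < m \<Longrightarrow> knd q \<noteq> 0 \<Longrightarrow> knd q \<noteq> 1 \<Longrightarrow> b q = 1"
    and rows: "\<forall>e < E. row_ok e b" using assms by (auto simp: bits_ok_def)
  obtain z where z: "\<And>e. e < E \<Longrightarrow> z e 0 = 0 \<and> z e m = 0 \<and> (\<forall>q \<le> m. z e q \<le> 1) \<and>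
     (\<forall>q < m. z e (Suc q) + of_bool (sg e q = 2) * b q = z e q + of_bool (sg e q = 1) * b q)"
    using rows unfolding row_ok_def by metis
  \<comment> \<open>At odd \<open>i\<close> the carry stands between the two columns of a variable:
    a plus has already been added, a minus is not yet subtracted.\<close>
  define u where "u e i = (if even i then z e (i div 2) else z e (i div 2) + of_bool (sg e (i div 2) = 1) * b (i div 2))" for e i
  define a where "a h j = (let q = j div 2; e = (h - 2) div 2 in
     if h = 0 then D 0 (2 * j + 1) else if odd h then (if even j then b q else 1 - b q)
     else if even j then (if sg e q = 1 then 1 - b q else b q) else (if sg e q = 2 then b q else 1 - b q))" for h j
  \<comment> \<open>Even layers from 2 on are first phases, odd ones from 3 on second phases. In
    layer 1 the unit between a pair goes right exactly if the bit is 0.\<close>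
  define l where "l h i = (let e = (h - 2) div 2 in if i = 0 then 1 else if i = 2 * m then 0
     else if h = 0 then 0 else if h = 1 then 1 - b (i div 2) else if even h then u e i else 1 - u e i)" for h i
  have u1: "u e i \<le> 1" if e: "e < E" and i: "i \<le> 2 * m" for e i
  proof (cases "even i")
    case True
    then show ?thesis using z[OF e] i by (auto simp: u_def)
  next
    case False
    then obtain q where q: "i = 2 * q + 1" by (elim oddE)
    then have "q < m" using i by auto
    then have "z e (Suc q) + of_bool (sg e q = 2) * b q = z e q + of_bool (sg e q = 1) * b q" "z e (Suc q) \<le> 1" "z e q \<le> 1"
      using z[OF e] by auto
    then show ?thesis using q by (auto simp: u_def split: if_splits)
  qed
  have b1: "b q = 0 \<or> b q = 1" if "q < m" for q using b(1)[OF that] by auto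
  have rows: "h = 0 \<or> h = 1 \<or> (\<exists>e < E. h = 2 + 2 * e) \<or> (\<exists>e < E. h = 3 + 2 * e)" if "h < R" for h
    using that unfolding R_def by presburger
  have a1: "a h j \<le> 1" if "h < R" "j < 2 * m" for h j
  proof -
    have "j div 2 < m" using that by auto
    then show ?thesis using b1[of "j div 2"] D_le by (auto simp: a_def Let_def)
  qed
  have l1: "l h i \<le> 1" if "h < R" "i \<le> 2 * m" for h i
    using rows[OF that(1)] u1[OF _ that(2)] by (auto simp: l_def Let_def u1)
  have eqn: "?t h + a h j = ?t (h - 1) + a (h - 1) j + D (2 * h - 1) (2 * j + 1) + D (2 * h) (2 * j + 1) +
          w h j * l h j + w h (Suc j) * (1 - l h (Suc j))" if h: "1 \<le> h" "h < R" and j: "j < 2 * m" for h j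
  proof -
    obtain q where qj: "j = 2 * q \<or> j = 2 * q + 1" and q: "q < m"
    proof (cases "even j")
      case True
      then show ?thesis using that[of "j div 2"] j by auto
    next
      case False
      then show ?thesis using that[of "j div 2"] j by auto
    qed
    have x: "2 * (2 * q) + 1 = 4 * q + 1" "2 * (2 * q + 1) + 1 = 4 * q + 3" "Suc (2 * q + 1) = 2 * Suc q" "Suc (2 * q) = 2 * q + 1" by auto
    have qq: "2 * q div 2 = q" "(2 * q + 1) div 2 = q" "2 * Suc q div 2 = Suc q" by auto
    consider "h = 1" | e where "e < E" "h = 2 + 2 * e" | e where "e < E" "h = 3 + 2 * e" using rows[OF h(2)] h(1) by auto
    then show ?thesis
    proof cases
      case 1
      have l: "l 1 (2 * q + 1) = 1 - b q"
        using q by (simp add: l_def)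
      have ah: "a 1 (2 * q) = b q" "a 1 (2 * q + 1) = 1 - b q" "a 0 (2 * q) = D 0 (4 * q + 1)" "a 0 (2 * q + 1) = D 0 (4 * q + 3)"
        by (auto simp: a_def Let_def numeral_3_eq_3)
      have y: "2 * (1 :: nat) - 1 = 1" "2 * (1 :: nat) = 2" "1 - 1 = (0 :: nat)" "?t 1 = 2" "?t 0 = 0" by auto
      have wz: "w 1 (2 * q) = 0" "w 1 (2 * Suc q) = 0" using w_guess(2)[of q] w_guess(2)[of "Suc q"] q by auto
      from qj show ?thesis
      proof
        assume "j = 2 * q"
        moreover have "2 + a 1 (2 * q) = 0 + a 0 (2 * q) + D 1 (4 * q + 1) + D 2 (4 * q + 1) + w 1 (2 * q) * l 1 (2 * q) + w 1 (2 * q + 1) * (1 - l 1 (2 * q + 1))"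
          unfolding ah D_cols[OF q] guess_rows wz w_guess(1)[OF q] l using b1[OF q] b(2,3)[OF q] by auto
        ultimately show ?thesis unfolding 1 y x by (simp add: numeral_3_eq_3)
      next
        assume "j = 2 * q + 1"
        moreover have "2 + a 1 (2 * q + 1) = 0 + a 0 (2 * q + 1) + D 1 (4 * q + 3) + D 2 (4 * q + 3) + w 1 (2 * q + 1) * l 1 (2 * q + 1) + w 1 (2 * Suc q) * (1 - l 1 (2 * Suc q))"
          unfolding ah D_cols[OF q] guess_rows wz w_guess(1)[OF q] l using b1[OF q] b(2,3)[OF q] by auto
        ultimately show ?thesis unfolding 1 y x by (simp add: numeral_3_eq_3)
      qed
    next
      case 2
      let ?k = "1 + 2 * e"
      have y: "2 * h - 1 = 3 + 4 * e" "2 * h = 4 + 4 * e" "h - 1 = ?k" "?t h = 5 + 6 * e" "?t ?k = 2 + 6 * e" "(h - 2) div 2 = e"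
        "even h" "h \<noteq> 0" "h \<noteq> 1" "odd ?k" using 2 by auto
      have wu: "w h i * l h i = 2 * u e i" if "i < 2 * m" for i
        using w_inner[OF 2(1), of i] w_ends[OF 2(1)] that z[OF 2(1)] y 2(2) by (cases "i = 0") (auto simp: l_def u_def)
      have wv: "w h (Suc i) * (1 - l h (Suc i)) = 2 * (1 - u e (Suc i))" if "i < 2 * m" for i
        using w_inner[OF 2(1), of "Suc i"] w_ends[OF 2(1)] that z[OF 2(1)] y 2(2) by (cases "Suc i = 2 * m") (auto simp: l_def u_def)
      have ah: "a h (2 * q) = (if sg e q = 1 then 1 - b q else b q)" "a h (2 * q + 1) = (if sg e q = 2 then b q else 1 - b q)"
        "a ?k (2 * q) = b q" "a ?k (2 * q + 1) = 1 - b q"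
        using y by (auto simp: a_def Let_def)
      have uq: "u e (2 * q) = z e q" "u e (2 * q + 1) = z e q + of_bool (sg e q = 1) * b q" "u e (2 * Suc q) = z e (Suc q)"
        by (auto simp: u_def)
      have zs: "z e (Suc q) + of_bool (sg e q = 2) * b q = z e q + of_bool (sg e q = 1) * b q" "z e (Suc q) \<le> 1" "z e q \<le> 1"
        using z[OF 2(1)] q by auto
      from qj show ?thesis
      proof
        assume "j = 2 * q"
        moreover have "3 + a h (2 * q) = a ?k (2 * q) + D (3 + 4 * e) (4 * q + 1) + D (4 + 4 * e) (4 * q + 1) + 2 * u e (2 * q) + 2 * (1 - u e (2 * q + 1))"
          unfolding ah uq D_cols[OF q] phase_rows[OF 2(1)] using b1[OF q] zs by (auto simp: le_Suc_eq split: if_splits)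
        ultimately show ?thesis unfolding y wu[OF j] wv[OF j] x by (simp add: numeral_3_eq_3)
      next
        assume "j = 2 * q + 1"
        moreover have "3 + a h (2 * q + 1) = a ?k (2 * q + 1) + D (3 + 4 * e) (4 * q + 3) + D (4 + 4 * e) (4 * q + 3) + 2 * u e (2 * q + 1) + 2 * (1 - u e (2 * Suc q))"
          unfolding ah uq D_cols[OF q] phase_rows[OF 2(1)] using b1[OF q] zs by (auto simp: le_Suc_eq split: if_splits)
        ultimately show ?thesis unfolding y wu[OF j] wv[OF j] x by (simp add: numeral_3_eq_3)
      qed
    next
      case 3
      let ?k = "2 + 2 * e"
      have y: "2 * h - 1 = 5 + 4 * e" "2 * h = 6 + 4 * e" "h - 1 = ?k" "?t h = 8 + 6 * e" "?t ?k = 5 + 6 * e" "(h - 2) div 2 = e" "(?k - 2) div 2 = e"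
        "odd h" "h \<noteq> 0" "h \<noteq> 1" "even ?k" using 3 by auto
      have wu: "w h i * l h i = 2 * (1 - u e i)" if "i < 2 * m" for i
        using w_inner[OF 3(1), of i] w_ends[OF 3(1)] that z[OF 3(1)] y 3(2) by (cases "i = 0") (auto simp: l_def u_def)
      have wv: "w h (Suc i) * (1 - l h (Suc i)) = 2 * u e (Suc i)" if "i < 2 * m" for i
        using w_inner[OF 3(1), of "Suc i"] w_ends[OF 3(1)] that z[OF 3(1)] y 3(2) u1[OF 3(1), of "Suc i"]
        by (cases "Suc i = 2 * m") (auto simp: l_def u_def)
      have ah: "a ?k (2 * q) = (if sg e q = 1 then 1 - b q else b q)" "a ?k (2 * q + 1) = (if sg e q = 2 then b q else 1 - b q)"
        "a h (2 * q) = b q" "a h (2 * q + 1) = 1 - b q"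
        using y by (auto simp: a_def Let_def)
      have uq: "u e (2 * q) = z e q" "u e (2 * q + 1) = z e q + of_bool (sg e q = 1) * b q" "u e (2 * Suc q) = z e (Suc q)"
        by (auto simp: u_def)
      have zs: "z e (Suc q) + of_bool (sg e q = 2) * b q = z e q + of_bool (sg e q = 1) * b q" "z e (Suc q) \<le> 1" "z e q \<le> 1"
        using z[OF 3(1)] q by auto
      from qj show ?thesis
      proof
        assume "j = 2 * q"
        moreover have "3 + a h (2 * q) = a ?k (2 * q) + D (5 + 4 * e) (4 * q + 1) + D (6 + 4 * e) (4 * q + 1) + 2 * (1 - u e (2 * q)) + 2 * u e (2 * q + 1)"
          unfolding ah uq D_cols[OF q] phase_rows[OF 3(1)] using b1[OF q] zs by (auto simp: le_Suc_eq split: if_splits)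
        ultimately show ?thesis unfolding y wu[OF j] wv[OF j] x by (simp add: numeral_3_eq_3)
      next
        assume "j = 2 * q + 1"
        moreover have "3 + a h (2 * q + 1) = a ?k (2 * q + 1) + D (5 + 4 * e) (4 * q + 3) + D (6 + 4 * e) (4 * q + 3) + 2 * (1 - u e (2 * q + 1)) + 2 * u e (2 * Suc q)"
          unfolding ah uq D_cols[OF q] phase_rows[OF 3(1)] using b1[OF q] zs by (auto simp: le_Suc_eq split: if_splits)
        ultimately show ?thesis unfolding y wu[OF j] wv[OF j] x by (simp add: numeral_3_eq_3)
      qed
    qed
  qed
  have "local_solution a l"
    unfolding local_solution_def
  proof (intro conjI allI impI)
    show "a 0 j = D 0 (2 * j + 1)" for j by (simp add: a_def)
    show "l h 0 = 1" "l h (2 * m) = 0" for h using m by (auto simp: l_def)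
  qed (use a1 l1 eqn in auto)
  then show ?thesis by blast
qed

theorem yes_iff_bits: "ednr_yes I \<longleftrightarrow> (\<exists>b. bits_ok b)"
  unfolding yes_iff_local using local_imp_bits bits_imp_local by blast

end

section \<open>Tilings\<close>

type_synonym 'c tile = "'c \<times> 'c \<times> 'c \<times> 'c"

definition left_of :: "'c tile \<Rightarrow> 'c" where "left_of x = fst x"
definition right_of :: "'c tile \<Rightarrow> 'c" where "right_of x = fst (snd x)"
definition top_of :: "'c tile \<Rightarrow> 'c" where "top_of x = fst (snd (snd x))"
definition bottom_of :: "'c tile \<Rightarrow> 'c" where "bottom_of x = snd (snd (snd x))"

text \<open>All quadruples of colours are listed, admissible or not, so that the list is closed
  under exchanging two sides; admissibility is expressed by forcing bits to be 0.\<close>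

definition all_tiles :: "'c list \<Rightarrow> 'c tile list" where
  "all_tiles cl = List.product cl (List.product cl (List.product cl cl))"

definition out_col :: "bool \<Rightarrow> 'c tile \<Rightarrow> 'c" where "out_col v = (if v then bottom_of else right_of)"
definition in_col :: "bool \<Rightarrow> 'c tile \<Rightarrow> 'c" where "in_col v = (if v then top_of else left_of)"

text \<open>
  A constraint \<open>(c, c', v, k)\<close> says that site \<open>c\<close> shows the colour \<open>k\<close> on its outgoing side (right, or
  bottom if \<open>v\<close>) iff site \<open>c'\<close> shows it on its ingoing side.
\<close>

definition sign :: "nat \<times> nat \<times> bool \<times> 'c \<Rightarrow> nat \<Rightarrow> 'c tile \<Rightarrow> nat" where
  "sign = (\<lambda>(c, c', v, k) s x. if s = c then of_bool (out_col v x = k)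
     else if s = c' then 2 * of_bool (in_col v x = k) else 0)"

definition offset_constraints :: "'c list \<Rightarrow> nat \<Rightarrow> bool \<Rightarrow> nat \<Rightarrow> (nat \<times> nat \<times> bool \<times> 'c) list" where
  "offset_constraints cl d v n = concat (map (\<lambda>c. map (\<lambda>k. (c, c + d, v, k)) cl) [0..<n])"

lemma sum_div_mod: "(\<Sum>q < N * g. f (q div g) (q mod g)) = (\<Sum>c < N. \<Sum>i < g. f c i)"
  for f :: "nat \<Rightarrow> nat \<Rightarrow> nat"
proof (induction N)
  case (Suc N)
  have "(\<Sum>q < Suc N * g. f (q div g) (q mod g)) =
      (\<Sum>q < N * g. f (q div g) (q mod g)) + (\<Sum>q \<in> {N * g..<N * g + g}. f (q div g) (q mod g))"
    by (subst sum.union_disjoint[symmetric]) (auto intro!: sum.cong)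
  also have "(\<Sum>q \<in> {N * g..<N * g + g}. f (q div g) (q mod g)) = (\<Sum>i < g. f N i)"
  proof -
    have "(\<Sum>q \<in> {N * g..<N * g + g}. f (q div g) (q mod g)) = (\<Sum>i \<in> {0..<g}. f ((i + N * g) div g) ((i + N * g) mod g))"
      using sum.shift_bounds_nat_ivl[of "\<lambda>q. f (q div g) (q mod g)" 0 "N * g" g] by (simp add: add.commute)
    also have "\<dots> = (\<Sum>i < g. f N i)" by (rule sum.cong) auto
    finally show ?thesis .
  qed
  finally show ?case using Suc by simp
qed simp

text \<open>Exchanging the outgoing with the ingoing side permutes the tiles. This is why a colour
  constraint has equally many positive and negative signs.\<close>

lemma sum_tiles_swap:
  assumes "distinct cl"
  shows "(\<Sum>i < length (all_tiles cl). f (out_col v (all_tiles cl ! i))) = (\<Sum>i < length (all_tiles cl). f (in_col v (all_tiles cl ! i)) :: nat)"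
proof -
  let ?S = "set (all_tiles cl)"
  have d: "distinct (all_tiles cl)" unfolding all_tiles_def using assms by (intro distinct_product)
  have S: "?S = set cl \<times> set cl \<times> set cl \<times> set cl" by (simp add: all_tiles_def)
  have sm: "(\<Sum>i < length (all_tiles cl). h (all_tiles cl ! i)) = (\<Sum>x \<in> ?S. h x)" for h :: "'a tile \<Rightarrow> nat"
    using sum.distinct_set_conv_list[OF d, of h] by (simp add: sum_list_sum_nth atLeast0LessThan)
  have "(\<Sum>x \<in> ?S. f (out_col v x)) = (\<Sum>x \<in> ?S. f (in_col v x))"
  proof (cases v)
    case True
    show ?thesis
      by (rule sum.reindex_bij_witness[of _ "\<lambda>(a, b, c, d). (a, b, d, c)" "\<lambda>(a, b, c, d). (a, b, d, c)"])
         (use True in \<open>auto simp: S out_col_def in_col_def bottom_of_def top_of_def\<close>)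
  next
    case False
    show ?thesis
      by (rule sum.reindex_bij_witness[of _ "\<lambda>(a, b, c, d). (b, a, c, d)" "\<lambda>(a, b, c, d). (b, a, c, d)"])
         (use False in \<open>auto simp: S out_col_def in_col_def right_of_def left_of_def\<close>)
  qed
  then show ?thesis unfolding sm[of "\<lambda>x. f (out_col v x)"] sm[of "\<lambda>x. f (in_col v x)"] .
qed

text \<open>Sites are numbered row by row, and horizontal matching also links the end of a row to
  the beginning of the next. \<open>kn\<close> classifies a tile at a site as forbidden (0), allowed
  (1) or forced (2); forcing is confined to site 0.\<close>

locale tiling_problem =
  fixes cl :: "'c list" and N W :: nat and cls :: "nat list" and kn :: "nat \<Rightarrow> 'c tile \<Rightarrow> nat" and start :: "'c tile"
  assumes cl: "distinct cl" "cl \<noteq> []" and NW: "1 \<le> N" "1 \<le> W"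
    and start: "start \<in> set (all_tiles cl)" "kn (cls ! 0) start = 2" "\<And>x. x \<noteq> start \<Longrightarrow> kn (cls ! 0) x = 0"
    and free: "\<And>c x. 0 < c \<Longrightarrow> c < N \<Longrightarrow> kn (cls ! c) x \<le> 1"
begin

definition tiling :: "(nat \<Rightarrow> 'c tile) \<Rightarrow> bool" where
  "tiling T \<longleftrightarrow> (\<forall>c < N. T c \<in> set (all_tiles cl) \<and> kn (cls ! c) (T c) \<noteq> 0) \<and>
     (\<forall>c. c + 1 < N \<longrightarrow> right_of (T c) = left_of (T (c + 1))) \<and>
     (\<forall>c. c + W < N \<longrightarrow> bottom_of (T c) = top_of (T (c + W)))"

definition g :: nat where "g = length (all_tiles cl)"

definition constraints :: "(nat \<times> nat \<times> bool \<times> 'c) list" where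
  "constraints = offset_constraints cl 1 False (N - 1) @ offset_constraints cl W True (N - W)"

text \<open>Bit \<open>c * g + i\<close> means that site \<open>c\<close> shows the tile with number
  \<open>i\<close>.\<close>

definition knd :: "nat \<Rightarrow> nat" where
  "knd q = kn (cls ! (q div g)) (all_tiles cl ! (q mod g))"

definition sg :: "nat \<Rightarrow> nat \<Rightarrow> nat" where
  "sg e q = sign (constraints ! e) (q div g) (all_tiles cl ! (q mod g))"

lemma g: "1 \<le> g" using cl(2) by (simp add: g_def all_tiles_def Suc_le_eq)

lemma set_offset_constraints:
  "(c, c', v, k) \<in> set (offset_constraints cl d v' n) \<longleftrightarrow> c < n \<and> c' = c + d \<and> v = v' \<and> k \<in> set cl"
  by (auto simp: offset_constraints_def)

lemma set_constraints: "set constraints = {(c, c', v, k). k \<in> set cl \<and> c' < N \<and>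
    (\<not> v \<and> c' = c + 1 \<or> v \<and> c' = c + W)}"
  by (auto simp: constraints_def set_offset_constraints)

lemma sum_out: "c < N \<Longrightarrow> c' < N \<Longrightarrow> c \<noteq> c' \<Longrightarrow> (\<Sum>q < N * g. of_bool (sign (c, c', v, k) (q div g) (all_tiles cl ! (q mod g)) = 1) * f q) =
    (\<Sum>i < g. of_bool (out_col v (all_tiles cl ! i) = k) * f (c * g + i) :: nat)"
  and sum_in: "c < N \<Longrightarrow> c' < N \<Longrightarrow> c \<noteq> c' \<Longrightarrow> (\<Sum>q < N * g. of_bool (sign (c, c', v, k) (q div g) (all_tiles cl ! (q mod g)) = 2) * f q) =
    (\<Sum>i < g. of_bool (in_col v (all_tiles cl ! i) = k) * f (c' * g + i) :: nat)"
proof -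
  assume c: "c < N" "c' < N" "c \<noteq> c'"
  have D: "(\<Sum>q < N * g. of_bool (sign (c, c', v, k) (q div g) (all_tiles cl ! (q mod g)) = n) * f q) =
    (\<Sum>s < N. \<Sum>i < g. of_bool (sign (c, c', v, k) s (all_tiles cl ! i) = n) * f (s * g + i))" for n
    using sum_div_mod[where N = N and g = g and f = "\<lambda>s i. of_bool (sign (c, c', v, k) s (all_tiles cl ! i) = n) * f (s * g + i)"]
    by simp
  have "(\<Sum>s < N. \<Sum>i < g. of_bool (sign (c, c', v, k) s (all_tiles cl ! i) = 1) * f (s * g + i)) =
    (\<Sum>s < N. if s = c then \<Sum>i < g. of_bool (out_col v (all_tiles cl ! i) = k) * f (c * g + i) else 0)"
    by (intro sum.cong refl) (auto simp: sign_def)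
  then show "(\<Sum>q < N * g. of_bool (sign (c, c', v, k) (q div g) (all_tiles cl ! (q mod g)) = 1) * f q) =
    (\<Sum>i < g. of_bool (out_col v (all_tiles cl ! i) = k) * f (c * g + i) :: nat)" using c unfolding D by simp
  have "(\<Sum>s < N. \<Sum>i < g. of_bool (sign (c, c', v, k) s (all_tiles cl ! i) = 2) * f (s * g + i)) =
    (\<Sum>s < N. if s = c' then \<Sum>i < g. of_bool (in_col v (all_tiles cl ! i) = k) * f (c' * g + i) else 0)"
    using c by (intro sum.cong refl) (auto simp: sign_def)
  then show "(\<Sum>q < N * g. of_bool (sign (c, c', v, k) (q div g) (all_tiles cl ! (q mod g)) = 2) * f q) =
    (\<Sum>i < g. of_bool (in_col v (all_tiles cl ! i) = k) * f (c' * g + i) :: nat)" using c unfolding D by simp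
qed

sublocale constraint_grid "N * g" "length constraints" knd sg
proof
  show "1 \<le> N * g" using NW g by simp
  show "sg e q \<le> 2" for e q unfolding sg_def sign_def by (cases "constraints ! e") auto
  fix e assume "e < length constraints"
  then have "constraints ! e \<in> set constraints" by simp
  then obtain c c' v k where e: "constraints ! e = (c, c', v, k)" and c: "c' < N" "c < c'"
    using NW unfolding set_constraints by auto
  have c3: "c < N" "c' < N" "c \<noteq> c'" using c by auto
  have "(\<Sum>q < N * g. of_bool (sg e q = 1)) = (\<Sum>i < g. of_bool (out_col v (all_tiles cl ! i) = k) :: nat)"
    using sum_out[OF c3, of v k "\<lambda>_. 1"] unfolding sg_def e by (simp only: mult_1_right)
  also have "\<dots> = (\<Sum>i < g. of_bool (in_col v (all_tiles cl ! i) = k))"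
    unfolding g_def by (rule sum_tiles_swap[OF cl(1)])
  also have "\<dots> = (\<Sum>q < N * g. of_bool (sg e q = 2))"
    using sum_in[OF c3, of v k "\<lambda>_. 1"] unfolding sg_def e by (simp only: mult_1_right)
  finally show "(\<Sum>q < N * g. of_bool (sg e q = 1)) = (\<Sum>q < N * g. of_bool (sg e q = 2) :: nat)" .
qed

text \<open>Summed over all colours, the horizontal constraints carry the number of tiles from each
  site to the next. Site 0 shows exactly one tile by force, so every site does, without a constraint
  that says so.\<close>

lemma bits_imp_tiling:
  assumes "bits_ok b"
  shows "\<exists>T. tiling T"
proof -
  let ?t = "\<lambda>i. all_tiles cl ! i"
  have bq: "b (c * g + i) \<le> 1" "kn (cls ! c) (?t i) = 0 \<Longrightarrow> b (c * g + i) = 0" "kn (cls ! c) (?t i) = 2 \<Longrightarrow> b (c * g + i) = 1"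
    if "c < N" "i < g" for c i
  proof -
    have "c * g + i < Suc c * g" using that by simp
    also have "\<dots> \<le> N * g" using that by (intro mult_le_mono1) auto
    finally have "c * g + i < N * g" .
    moreover have "knd (c * g + i) = kn (cls ! c) (?t i)" using that by (simp add: knd_def)
    ultimately show "b (c * g + i) \<le> 1" "kn (cls ! c) (?t i) = 0 \<Longrightarrow> b (c * g + i) = 0" "kn (cls ! c) (?t i) = 2 \<Longrightarrow> b (c * g + i) = 1"
      using assms unfolding bits_ok_def by auto
  qed
  \<comment> \<open>Only the end values of the carry matter here: a prefix sum from 0 to 0 makes the
    two totals equal.\<close>
  have eq: "(\<Sum>i < g. of_bool (out_col v (?t i) = k) * b (c * g + i)) = (\<Sum>i < g. of_bool (in_col v (?t i) = k) * b (c' * g + i))"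
    if con: "(c, c', v, k) \<in> set constraints" for c c' v k
  proof -
    obtain e where e: "e < length constraints" "constraints ! e = (c, c', v, k)" using con by (metis in_set_conv_nth)
    have c3: "c < N" "c' < N" "c \<noteq> c'" using con NW by (auto simp: set_constraints)
    from assms e(1) obtain z where z: "z 0 = 0" "z (N * g) = 0"
      "\<And>q. q < N * g \<Longrightarrow> z (Suc q) + of_bool (sg e q = 2) * b q = z q + of_bool (sg e q = 1) * b q"
      unfolding bits_ok_def row_ok_def by blast
    have "z n + (\<Sum>q < n. of_bool (sg e q = 2) * b q) = z 0 + (\<Sum>q < n. of_bool (sg e q = 1) * b q)" if "n \<le> N * g" for n
      using that
    proof (induction n)
      case (Suc n)
      then show ?case using z(3)[of n] by simp
    qed simp
    from this[of "N * g"] z(1,2) have "(\<Sum>q < N * g. of_bool (sg e q = 2) * b q) = (\<Sum>q < N * g. of_bool (sg e q = 1) * b q)" by simp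
    then show ?thesis unfolding sg_def e(2) sum_out[OF c3] sum_in[OF c3] by simp
  qed
  have tin: "?t i \<in> set (all_tiles cl)" if "i < g" for i using that by (simp add: g_def)
  have col: "out_col v (?t i) \<in> set cl" "in_col v (?t i) \<in> set cl" if "i < g" for v i
    using tin[OF that] by (auto simp: all_tiles_def out_col_def in_col_def bottom_of_def top_of_def left_of_def right_of_def)
  have split: "(\<Sum>k \<in> set cl. \<Sum>i < g. of_bool (f (?t i) = k) * h i) = (\<Sum>i < g. h i)" if "\<And>i. i < g \<Longrightarrow> f (?t i) \<in> set cl" for f and h :: "nat \<Rightarrow> nat"
  proof -
    have "(\<Sum>k \<in> set cl. \<Sum>i < g. of_bool (f (?t i) = k) * h i) = (\<Sum>i < g. \<Sum>k \<in> set cl. of_bool (f (?t i) = k) * h i)"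
      by (rule sum.swap)
    also have "\<dots> = (\<Sum>i < g. h i)"
    proof (rule sum.cong[OF refl])
      fix i assume "i \<in> {..<g}"
      then have "f (?t i) \<in> set cl" using that by simp
      moreover have "(\<Sum>k \<in> set cl. of_bool (f (?t i) = k) * h i) = (\<Sum>k \<in> set cl. if k = f (?t i) then h i else 0)"
        by (rule sum.cong) auto
      ultimately show "(\<Sum>k \<in> set cl. of_bool (f (?t i) = k) * h i) = h i" by simp
    qed
    finally show ?thesis .
  qed
  have cnt: "(\<Sum>i < g. b (c * g + i)) = 1" if "c < N" for c
    using that
  proof (induction c)
    case 0
    obtain i0 where i0: "i0 < g" "?t i0 = start" using start(1) by (auto simp: in_set_conv_nth g_def)
    have d: "distinct (all_tiles cl)" unfolding all_tiles_def using cl by (intro distinct_product)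
    have "b i = (if i = i0 then 1 else 0)" if "i < g" for i
    proof (cases "i = i0")
      case True
      then show ?thesis using bq(3)[OF 0 that] start(2) i0 by simp
    next
      case False
      then have "?t i \<noteq> start" using d i0 that by (metis g_def nth_eq_iff_index_eq)
      then show ?thesis using bq(2)[OF 0 that] start(3) False by simp
    qed
    then show ?case using i0 by simp
  next
    case (Suc c)
    have "(\<Sum>i < g. b (c * g + i)) = (\<Sum>k \<in> set cl. \<Sum>i < g. of_bool (out_col False (?t i) = k) * b (c * g + i))"
      using split[of "out_col False" "\<lambda>i. b (c * g + i)"] col by simp
    also have "\<dots> = (\<Sum>k \<in> set cl. \<Sum>i < g. of_bool (in_col False (?t i) = k) * b (Suc c * g + i))"
      using Suc.prems by (intro sum.cong refl eq) (auto simp: set_constraints)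
    also have "\<dots> = (\<Sum>i < g. b (Suc c * g + i))"
      using split[of "in_col False" "\<lambda>i. b (Suc c * g + i)"] col by simp
    finally show ?case using Suc by simp
  qed
  have "\<exists>i < g. b (c * g + i) = 1" if "c < N" for c
  proof (rule ccontr)
    assume "\<not> ?thesis"
    then have "b (c * g + i) = 0" if "i < g" for i using bq(1)[OF \<open>c < N\<close> that] that by (auto simp: le_Suc_eq)
    then have "(\<Sum>i < g. b (c * g + i)) = 0" by simp
    then show False using cnt[OF that] by simp
  qed
  then obtain ix where ix: "\<And>c. c < N \<Longrightarrow> ix c < g \<and> b (c * g + ix c) = 1" by metis
  have uniq: "i = ix c" if "c < N" "i < g" "b (c * g + i) \<noteq> 0" for c i
  proof (rule ccontr)
    assume ne: "i \<noteq> ix c"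
    have "b (c * g + i) + b (c * g + ix c) = (\<Sum>j \<in> {i, ix c}. b (c * g + j))" using ne by simp
    also have "\<dots> \<le> (\<Sum>i < g. b (c * g + i))" using that ix[OF that(1)] by (intro sum_mono2) auto
    finally show False using cnt[OF that(1)] ix[OF that(1)] that by simp
  qed
  \<comment> \<open>The count of this outgoing colour at \<open>c\<close> is positive, hence so is
    the ingoing count at \<open>c'\<close>, where only one tile is shown.\<close>
  have match: "out_col v (?t (ix c)) = in_col v (?t (ix c'))" if "(c, c', v, out_col v (?t (ix c))) \<in> set constraints" for c c' v
  proof -
    have c: "c < N" "c' < N" using that NW by (auto simp: set_constraints)
    let ?k = "out_col v (?t (ix c))"
    have "of_bool (out_col v (?t (ix c)) = ?k) * b (c * g + ix c) \<le> (\<Sum>i < g. of_bool (out_col v (?t i) = ?k) * b (c * g + i))"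
      by (rule member_le_sum) (use ix[OF c(1)] in auto)
    moreover have "of_bool (out_col v (?t (ix c)) = ?k) * b (c * g + ix c) = 1" using ix[OF c(1)] by simp
    ultimately have "(\<Sum>i < g. of_bool (in_col v (?t i) = ?k) * b (c' * g + i)) \<noteq> 0"
      unfolding eq[OF that] by linarith
    then obtain i where i: "i < g" "of_bool (in_col v (?t i) = ?k) * b (c' * g + i) \<noteq> 0" by (meson lessThan_iff sum.neutral)
    then have "i = ix c'" "in_col v (?t i) = ?k" using uniq[OF c(2) i(1)] by (auto split: if_splits)
    then show ?thesis by simp
  qed
  have "tiling (\<lambda>c. ?t (ix c))"
    unfolding tiling_def
  proof (intro conjI allI impI)
    fix c assume c: "c < N"
    then show "?t (ix c) \<in> set (all_tiles cl)" using ix tin by blast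
    show "kn (cls ! c) (?t (ix c)) \<noteq> 0" using bq(2)[OF c, of "ix c"] ix[OF c] by auto
  next
    fix c assume c: "c + 1 < N"
    then have "(c, c + 1, False, out_col False (?t (ix c))) \<in> set constraints"
      using col ix[of c] by (auto simp: set_constraints)
    from match[OF this] show "right_of (?t (ix c)) = left_of (?t (ix (c + 1)))" by (simp add: out_col_def in_col_def)
  next
    fix c assume c: "c + W < N"
    then have "(c, c + W, True, out_col True (?t (ix c))) \<in> set constraints"
      using col ix[of c] by (auto simp: set_constraints)
    from match[OF this] show "bottom_of (?t (ix c)) = top_of (?t (ix (c + W)))" by (simp add: out_col_def in_col_def)
  qed
  then show ?thesis by blast
qed

text \<open>With one tile per site a constraint meets at most one set bit with a plus and one with a
  minus. The outgoing site comes first, so the carry rises to 1 before it falls and never leaves {0,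
  1}.\<close>

lemma tiling_imp_bits:
  assumes T: "tiling T"
  shows "\<exists>b. bits_ok b"
proof -
  have d: "distinct (all_tiles cl)" unfolding all_tiles_def using cl by (intro distinct_product)
  have "\<exists>i < g. all_tiles cl ! i = T c" if "c < N" for c
    using T that unfolding tiling_def g_def by (metis in_set_conv_nth)
  then obtain ix where ix: "\<And>c. c < N \<Longrightarrow> ix c < g \<and> all_tiles cl ! ix c = T c" by metis
  define b :: "nat \<Rightarrow> nat" where "b q = of_bool (q mod g = ix (q div g))" for q
  have g0: "0 < g" using g by simp
  have qdiv: "q div g < N" if "q < N * g" for q using that by (simp add: less_mult_imp_div_less)
  have row: "row_ok e b" if e: "e < length constraints" for e
  proof -
    have "constraints ! e \<in> set constraints" using e by simp
    then obtain c c' v k where ce: "constraints ! e = (c, c', v, k)" and c: "c' < N" "c < c'"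
      and cc: "\<not> v \<and> c' = c + 1 \<or> v \<and> c' = c + W"
      using NW unfolding set_constraints by auto
    have cN: "c < N" using c by simp
    have match: "out_col v (T c) = in_col v (T c')"
      using T c cc unfolding tiling_def by (auto simp: out_col_def in_col_def)
    let ?p = "c * g + ix c" and ?p' = "c' * g + ix c'"
    have "?p < Suc c * g" using ix[OF cN] by simp
    also have "\<dots> \<le> c' * g" using c by (intro mult_le_mono1) auto
    finally have pp: "?p < ?p'" by simp
    have "?p' < Suc c' * g" using ix[OF c(1)] by simp
    also have "\<dots> \<le> N * g" using c by (intro mult_le_mono1) auto
    finally have pN: "?p' < N * g" .
    have pos: "q = s * g + ix s \<longleftrightarrow> q div g = s \<and> q mod g = ix s" if "s < N" for q s
      using ix[OF that] by (metis add.commute div_mult_mod_eq div_mult_self3 div_less add_0 mod_less mod_mult_self3 g0 less_not_refl2)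
    have o: "of_bool (sg e q = 1) * b q = of_bool (q = ?p \<and> out_col v (T c) = k)" for q
    proof (cases "b q = 0 \<or> q div g \<noteq> c")
      case True
      then show ?thesis using pos[OF cN, of q] by (auto simp: b_def sg_def ce sign_def)
    next
      case False
      then have "q mod g = ix c" "q = ?p" using pos[OF cN, of q] by (auto simp: b_def)
      then show ?thesis using False ix[OF cN] by (auto simp: sg_def ce sign_def b_def)
    qed
    have i: "of_bool (sg e q = 2) * b q = of_bool (q = ?p' \<and> in_col v (T c') = k)" for q
    proof (cases "b q = 0 \<or> q div g \<noteq> c'")
      case True
      then show ?thesis using pos[OF c(1), of q] by (auto simp: b_def sg_def ce sign_def)
    next
      case False
      then have "q mod g = ix c'" "q = ?p'" using pos[OF c(1), of q] by (auto simp: b_def)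
      then show ?thesis using False ix[OF c(1)] c(2) by (auto simp: sg_def ce sign_def b_def)
    qed
    show ?thesis
      unfolding row_ok_def
    proof (intro exI[of _ "\<lambda>q. of_bool (out_col v (T c) = k \<and> ?p < q \<and> q \<le> ?p')"] conjI allI impI)
      show "of_bool (out_col v (T c) = k \<and> ?p < N * g \<and> N * g \<le> ?p') = (0 :: nat)" using pN by simp
      fix q
      show "of_bool (out_col v (T c) = k \<and> ?p < Suc q \<and> Suc q \<le> ?p') + of_bool (sg e q = 2) * b q =
         of_bool (out_col v (T c) = k \<and> ?p < q \<and> q \<le> ?p') + of_bool (sg e q = 1) * b q"
        unfolding o i match[symmetric] using pp by (auto simp: less_Suc_eq)
    qed auto
  qed
  have "b q \<le> 1 \<and> (knd q = 0 \<longrightarrow> b q = 0) \<and> (knd q \<noteq> 0 \<and> knd q \<noteq> 1 \<longrightarrow> b q = 1)" if q: "q < N * g" for q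
  proof -
    let ?c = "q div g"
    have c: "?c < N" by (rule qdiv[OF q])
    have "b q = 0" if "knd q = 0"
    proof (rule ccontr)
      assume "b q \<noteq> 0"
      then have "q mod g = ix ?c" by (simp add: b_def)
      moreover have "kn (cls ! ?c) (T ?c) \<noteq> 0" using T c unfolding tiling_def by blast
      ultimately show False using that ix[OF c] by (simp add: knd_def)
    qed
    moreover have "b q = 1" if "knd q \<noteq> 0" "knd q \<noteq> 1"
    proof -
      have c0: "?c = 0" using free[of ?c "all_tiles cl ! (q mod g)"] c that unfolding knd_def by (metis le_Suc_eq le_zero_eq not_gr_zero One_nat_def)
      then have "all_tiles cl ! (q mod g) = start" using start(3) that unfolding knd_def by metis
      moreover have "T ?c = start" using T c start(3) c0 unfolding tiling_def by metis
      moreover have "q mod g < g" using g0 by simp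
      ultimately have "q mod g = ix ?c" using ix[OF c] d unfolding g_def by (metis nth_eq_iff_index_eq)
      then show ?thesis by (simp add: b_def)
    qed
    ultimately show ?thesis by (auto simp: b_def)
  qed
  then have "bits_ok b" unfolding bits_ok_def using row by blast
  then show ?thesis by blast
qed

theorem yes_iff_tiling: "ednr_yes I \<longleftrightarrow> (\<exists>T. tiling T)"
  unfolding yes_iff_bits using bits_imp_tiling tiling_imp_bits by blast

end

section \<open>Computation tableaux as tilings\<close>

definition move :: "direction \<Rightarrow> int" where
  "move d = (case d of Go_Left \<Rightarrow> -1 | Stay \<Rightarrow> 0 | Go_Right \<Rightarrow> 1)"

lemma act_move: "act (w, d) (h, c) = (h + move d, c(h := w))"
  by (cases d) (auto simp: move_def)

text \<open>
  \<open>HC q ss o i e\<close> is the colour of a vertical border: the state and the scanned symbols, which are the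
  same along a whole row; for each tape whether its head crosses the border to the right or to the left;
  and, in the first row, whether the end of the certificate has been passed. \<open>VC q sy hh\<close> is the colour of a
  horizontal border: the state, and for each tape the symbol in the cell and whether the head is there.
\<close>

datatype color = Sep | HC nat "nat list" "bool list" "bool list" bool | VC nat "nat list" "bool list"

text \<open>The first symbol has classes of its own because it marks the origin, where all heads
  start and where the answer is read.\<close>

definition input_classes :: "bool list \<Rightarrow> nat list" where
  "input_classes y = (if hd y then 4 else 3) # map (\<lambda>b. if b then 6 else 5) (tl y)"

text \<open>In the \<open>P + 1\<close> steps of a tableau the heads stay within distance
  \<open>P + 1\<close> of the origin. These margins keep them in the window, and the extra blank on
  the left keeps them off the cell beside the separator.\<close>

definition template :: "bool list \<Rightarrow> nat \<Rightarrow> nat \<Rightarrow> nat list" where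
  "template x P n = 1 # replicate (P + 2) 2 @ input_classes (delimit x) @ replicate n 7 @ replicate (P + 1) 2"

definition classes :: "bool list \<Rightarrow> nat \<Rightarrow> nat \<Rightarrow> nat list" where
  "classes x P n = template x P n @ concat (replicate P (map ((+) 7) (template x P n))) @ map ((+) 14) (template x P n)"

locale tableau =
  fixes M :: turing_machine
  assumes wf: "wf_tm M"
begin

abbreviation "k \<equiv> tapes M"
abbreviation "Q \<equiv> states M"
abbreviation "G \<equiv> symbols M"

definition symbol_lists :: "nat list set" where
  "symbol_lists = {xs. set xs \<subseteq> {..<G} \<and> length xs = k}"

lemma symbol_nth: "xs \<in> symbol_lists \<Longrightarrow> \<tau> < k \<Longrightarrow> xs ! \<tau> < G"
  unfolding symbol_lists_def by (metis (mono_tags, lifting) lessThan_iff mem_Collect_eq nth_mem subsetD)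

definition flags :: "bool list set" where
  "flags = {xs. length xs = k}"

definition colors :: "color set" where
  "colors = {Sep} \<union> (\<lambda>(q, ss, a, b, e). HC q ss a b e) ` ({..Q} \<times> symbol_lists \<times> flags \<times> flags \<times> UNIV) \<union>
     (\<lambda>(q, sy, hh). VC q sy hh) ` ({..Q} \<times> symbol_lists \<times> flags)"

lemma finite_colors: "finite colors"
proof -
  have "finite symbol_lists" unfolding symbol_lists_def by (rule finite_lists_length_eq) simp
  moreover have "flags = {xs. set xs \<subseteq> UNIV \<and> length xs = k}" by (simp add: flags_def)
  then have "finite flags" using finite_lists_length_eq[of "UNIV :: bool set" k] by simp
  ultimately show ?thesis by (auto simp: colors_def)
qed

text \<open>In the halting state the scanned symbols are rewritten, so a machine that halts early
  still fills all rows.\<close>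

definition tr :: "nat \<Rightarrow> nat list \<Rightarrow> nat \<times> (nat \<times> direction) list" where
  "tr q ss = (if q = Q then (Q, map (\<lambda>s. (s, Stay)) ss) else delta M q ss)"

definition wr :: "nat \<Rightarrow> nat list \<Rightarrow> nat \<Rightarrow> nat" where "wr q ss \<tau> = fst (snd (tr q ss) ! \<tau>)"
definition dr :: "nat \<Rightarrow> nat list \<Rightarrow> nat \<Rightarrow> direction" where "dr q ss \<tau> = snd (snd (tr q ss) ! \<tau>)"

lemma tr_wf:
  assumes "q \<le> Q" "ss \<in> symbol_lists"
  shows "fst (tr q ss) \<le> Q" "length (snd (tr q ss)) = k" "\<tau> < k \<Longrightarrow> wr q ss \<tau> < G"
proof -
  have w: "q < Q \<Longrightarrow> fst (delta M q ss) \<le> Q \<and> length (snd (delta M q ss)) = k \<and> fst ` set (snd (delta M q ss)) \<subseteq> {..<G}"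
    using wf assms(2) unfolding wf_tm_def symbol_lists_def by blast
  show "fst (tr q ss) \<le> Q" using w assms by (cases "q = Q") (auto simp: tr_def)
  show l: "length (snd (tr q ss)) = k" using w assms by (cases "q = Q") (auto simp: tr_def symbol_lists_def)
  assume \<tau>: "\<tau> < k"
  show "wr q ss \<tau> < G"
  proof (cases "q = Q")
    case True
    then show ?thesis using \<tau> assms(2) symbol_nth[OF assms(2) \<tau>] by (auto simp: wr_def tr_def symbol_lists_def)
  next
    case False
    then have "snd (delta M q ss) ! \<tau> \<in> set (snd (delta M q ss))" using w assms \<tau> by auto
    then show ?thesis using False w assms by (auto simp: wr_def tr_def)
  qed
qed

definition flag_list :: "(nat \<Rightarrow> bool) \<Rightarrow> bool list" where "flag_list f = map f [0..<k]"

definition none :: "bool list" where "none = flag_list (\<lambda>_. False)"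

text \<open>The scanned symbols \<open>ss\<close> are guessed for a whole row, and a cell that holds
  a head vouches for the component of that tape. The flag \<open>f\<close> marks the cell beside the
  separator, whose left side no head may cross.\<close>

definition cell_ok :: "nat \<Rightarrow> nat list \<Rightarrow> nat list \<Rightarrow> bool list \<Rightarrow> bool list \<Rightarrow> bool list \<Rightarrow> bool \<Rightarrow> bool" where
  "cell_ok q ss sy hh iL iR f \<longleftrightarrow> q \<le> Q \<and> ss \<in> symbol_lists \<and> sy \<in> symbol_lists \<and> hh \<in> flags \<and> iL \<in> flags \<and> iR \<in> flags \<and>
     (\<forall>\<tau> < k. hh ! \<tau> \<longrightarrow> sy ! \<tau> = ss ! \<tau>) \<and>
     (f \<longrightarrow> (\<forall>\<tau> < k. \<not> iL ! \<tau> \<and> \<not> (hh ! \<tau> \<and> dr q ss \<tau> = Go_Left)))"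

text \<open>\<open>iL\<close> and \<open>iR\<close> are the heads that arrive from the left and from
  the right during the step. Heads that leave are computed from \<open>hh\<close>, and equality of
  the border colours identifies them with the arrivals next door.\<close>

definition cell :: "nat \<Rightarrow> nat list \<Rightarrow> nat list \<Rightarrow> bool list \<Rightarrow> bool list \<Rightarrow> bool list \<Rightarrow> bool \<Rightarrow> bool \<Rightarrow> bool \<Rightarrow> color tile" where
  "cell q ss sy hh iL iR e e' f =
    (if f then Sep else HC q ss iL (flag_list (\<lambda>\<tau>. hh ! \<tau> \<and> dr q ss \<tau> = Go_Left)) e,
     HC q ss (flag_list (\<lambda>\<tau>. hh ! \<tau> \<and> dr q ss \<tau> = Go_Right)) iR e',
     VC q sy hh,
     VC (fst (tr q ss)) (map (\<lambda>\<tau>. if hh ! \<tau> then wr q ss \<tau> else sy ! \<tau>) [0..<k])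
       (flag_list (\<lambda>\<tau>. hh ! \<tau> \<and> dr q ss \<tau> = Stay \<or> iL ! \<tau> \<or> iR ! \<tau>)))"

text \<open>In certificate cells (class 7) the flag, once raised at a blank, stays raised, so blanks
  form a final segment and the guess is a string of length at most the number of these
  cells.\<close>

definition init_ok :: "nat \<Rightarrow> nat \<Rightarrow> nat list \<Rightarrow> bool list \<Rightarrow> bool \<Rightarrow> bool \<Rightarrow> bool" where
  "init_ok \<kappa> q sy hh e e' \<longleftrightarrow> q = 0 \<and> (\<forall>\<tau> < k. \<tau> \<noteq> 0 \<longrightarrow> sy ! \<tau> = 0) \<and> (\<forall>\<tau> < k. hh ! \<tau> = (\<kappa> = 3 \<or> \<kappa> = 4)) \<and>
     (if \<kappa> = 7 then sy ! 0 \<le> 2 \<and> (e' \<longleftrightarrow> sy ! 0 = 0) \<and> (e \<longrightarrow> e')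
      else \<not> e' \<and> sy ! 0 = (if \<kappa> = 3 \<or> \<kappa> = 5 then 1 else if \<kappa> = 4 \<or> \<kappa> = 6 then 2 else 0))"

text \<open>The last tape must hold exactly the string \<open>[True]\<close>: symbol 2 at the origin
  and blanks in all other cells.\<close>

definition fin_ok :: "nat \<Rightarrow> nat \<Rightarrow> nat list \<Rightarrow> bool" where
  "fin_ok \<kappa> q sy \<longleftrightarrow> q = Q \<and> sy ! (k - 1) = (if \<kappa> = 3 \<or> \<kappa> = 4 then 2 else 0)"

definition start :: "color tile" where "start = (Sep, Sep, Sep, Sep)"

definition allowed_cell :: "nat \<Rightarrow> nat \<Rightarrow> color tile \<Rightarrow> bool" where
  "allowed_cell \<rho> \<kappa> x \<longleftrightarrow> (\<exists>q ss sy hh iL iR e e' f. cell_ok q ss sy hh iL iR f \<and> x = cell q ss sy hh iL iR e e' f \<and>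
     (\<rho> = 0 \<longrightarrow> init_ok \<kappa> q sy hh e e') \<and> (\<rho> = 2 \<longrightarrow> fin_ok \<kappa> q sy))"

text \<open>
  Symbol \<open>\<kappa> + 7 \<rho>\<close> stands for a site in a column of class \<open>\<kappa>\<close> (1: separator, 2: blank, 3 and 4: first
  symbol of the input, 5 and 6: other symbols of the input, 7: certificate) in the first (\<open>\<rho> = 0\<close>), a
  middle (\<open>\<rho> = 1\<close>) or the last (\<open>\<rho> = 2\<close>) row.
\<close>

definition kn :: "nat \<Rightarrow> color tile \<Rightarrow> nat" where
  "kn s x = (let \<kappa> = (s - 1) mod 7 + 1; \<rho> = (s - 1) div 7 in
     if \<kappa> = 1 then (if \<rho> = 0 then 2 * of_bool (x = start) else of_bool (\<exists>q ss e. x = (HC q ss none none e, Sep, Sep, Sep)))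
     else of_bool (allowed_cell \<rho> \<kappa> x))"

lemma cell_colors:
  assumes "cell_ok q ss sy hh iL iR f"
  shows "left_of (cell q ss sy hh iL iR e e' f) \<in> colors" "right_of (cell q ss sy hh iL iR e e' f) \<in> colors"
    "top_of (cell q ss sy hh iL iR e e' f) \<in> colors" "bottom_of (cell q ss sy hh iL iR e e' f) \<in> colors"
proof -
  have a: "q \<le> Q" "ss \<in> symbol_lists" "sy \<in> symbol_lists" "hh \<in> flags" "iL \<in> flags" "iR \<in> flags"
    using assms by (auto simp: cell_ok_def)
  have fl: "flag_list h \<in> flags" for h by (simp add: flag_list_def flags_def)
  have HCc: "HC q ss b1 b2 e \<in> colors" if "b1 \<in> flags" "b2 \<in> flags" for b1 b2 e
    unfolding colors_def using a that by (intro UnI1[OF UnI2] image_eqI[of _ _ "(q, ss, b1, b2, e)"]) auto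
  have VCc: "VC q' s h \<in> colors" if "q' \<le> Q" "s \<in> symbol_lists" "h \<in> flags" for q' s h
    unfolding colors_def using that by (intro UnI2 image_eqI[of _ _ "(q', s, h)"]) auto
  have "sy ! \<tau> < G" if "\<tau> < k" for \<tau> by (rule symbol_nth[OF a(3) that])
  then have "map (\<lambda>\<tau>. if hh ! \<tau> then wr q ss \<tau> else sy ! \<tau>) [0..<k] \<in> symbol_lists"
    using tr_wf(3)[OF a(1,2)] by (auto simp: symbol_lists_def)
  then show "bottom_of (cell q ss sy hh iL iR e e' f) \<in> colors"
    using VCc[OF tr_wf(1)[OF a(1,2)] _ fl] by (simp add: bottom_of_def cell_def)
  show "left_of (cell q ss sy hh iL iR e e' f) \<in> colors"
    using HCc[OF a(5) fl] by (simp add: left_of_def cell_def colors_def)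
  show "right_of (cell q ss sy hh iL iR e e' f) \<in> colors" using HCc[OF fl a(6)] by (simp add: right_of_def cell_def)
  show "top_of (cell q ss sy hh iL iR e e' f) \<in> colors" using VCc[OF a(1,3,4)] by (simp add: top_of_def cell_def)
qed

section \<open>Configurations of the machine over time\<close>

definition cfg :: "bool list \<Rightarrow> nat \<Rightarrow> nat \<times> tape list" where
  "cfg y t = (tm_step M ^^ t) (tm_init M y)"

definition qs :: "bool list \<Rightarrow> nat \<Rightarrow> nat" where "qs y t = fst (cfg y t)"
definition hp :: "bool list \<Rightarrow> nat \<Rightarrow> nat \<Rightarrow> int" where "hp y t \<tau> = fst (snd (cfg y t) ! \<tau>)"
definition cc :: "bool list \<Rightarrow> nat \<Rightarrow> nat \<Rightarrow> int \<Rightarrow> nat" where "cc y t \<tau> = snd (snd (cfg y t) ! \<tau>)"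
definition scan :: "bool list \<Rightarrow> nat \<Rightarrow> nat list" where "scan y t = map (\<lambda>\<tau>. cc y t \<tau> (hp y t \<tau>)) [0..<k]"

lemma k1: "1 \<le> k" "1 \<le> Q" "3 \<le> G" using wf by (auto simp: wf_tm_def)

lemma cfg_0: "qs y 0 = 0" "\<tau> < k \<Longrightarrow> hp y 0 \<tau> = 0" "\<tau> < k \<Longrightarrow> cc y 0 \<tau> = (if \<tau> = 0 then string_contents y else string_contents [])"
  "length (snd (cfg y 0)) = k"
  using k1(1) by (auto simp: cfg_def qs_def hp_def cc_def tm_init_def nth_Cons split: nat.split)

definition cfg_ok :: "bool list \<Rightarrow> nat \<Rightarrow> bool" where
  "cfg_ok y t \<longleftrightarrow> length (snd (cfg y t)) = k \<and> qs y t \<le> Q \<and> (\<forall>\<tau> < k. \<forall>p. cc y t \<tau> p < G)"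

lemma cfg_Suc:
  assumes "cfg_ok y t"
  shows "scan y t \<in> symbol_lists" "qs y (Suc t) = fst (tr (qs y t) (scan y t))"
    "\<tau> < k \<Longrightarrow> hp y (Suc t) \<tau> = hp y t \<tau> + move (dr (qs y t) (scan y t) \<tau>)"
    "\<tau> < k \<Longrightarrow> cc y (Suc t) \<tau> = (cc y t \<tau>)(hp y t \<tau> := wr (qs y t) (scan y t) \<tau>)"
    "cfg_ok y (Suc t)"
proof -
  obtain q ts where c: "cfg y t = (q, ts)" by (cases "cfg y t")
  have l: "length ts = k" and qQ: "q \<le> Q" and G: "\<And>\<tau> p. \<tau> < k \<Longrightarrow> cc y t \<tau> p < G"
    using assms c by (auto simp: cfg_ok_def qs_def)
  show sc: "scan y t \<in> symbol_lists" using G by (auto simp: symbol_lists_def scan_def)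
  have sm: "map (\<lambda>(h, c). c h) ts = scan y t"
    unfolding scan_def using l c by (intro nth_equalityI) (auto simp: hp_def cc_def split_beta)
  have qs: "qs y t = q" using c by (simp add: qs_def)
  have act_stay: "act (snd z (fst z), Stay) z = z" for z by (cases z) simp
  have st: "cfg y (Suc t) = (fst (tr q (scan y t)), map2 act (snd (tr q (scan y t))) ts)"
  proof (cases "q = Q")
    case True
    have "map2 act (map (\<lambda>s. (s, Stay)) (scan y t)) ts = ts"
      unfolding sm[symmetric] using l by (intro nth_equalityI) (auto simp: split_beta act_stay)
    then show ?thesis using True c by (simp add: cfg_def tm_step_def tr_def)
  next
    case False
    then show ?thesis using c sm by (simp add: cfg_def tm_step_def tr_def split_beta)
  qed
  have lt: "length (snd (tr q (scan y t))) = k" using tr_wf(2)[OF qQ sc] .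
  have nt: "snd (cfg y (Suc t)) ! \<tau> = (hp y t \<tau> + move (dr q (scan y t) \<tau>), (cc y t \<tau>)(hp y t \<tau> := wr q (scan y t) \<tau>))"
    if "\<tau> < k" for \<tau>
  proof -
    have "snd (cfg y (Suc t)) ! \<tau> = act (snd (tr q (scan y t)) ! \<tau>) (ts ! \<tau>)" using st l lt that by simp
    also have "\<dots> = act (wr q (scan y t) \<tau>, dr q (scan y t) \<tau>) (hp y t \<tau>, cc y t \<tau>)"
      using c by (simp add: wr_def dr_def hp_def cc_def)
    finally show ?thesis by (simp only: act_move)
  qed
  show q': "qs y (Suc t) = fst (tr (qs y t) (scan y t))" using st qs by (simp add: qs_def)
  show h': "\<tau> < k \<Longrightarrow> hp y (Suc t) \<tau> = hp y t \<tau> + move (dr (qs y t) (scan y t) \<tau>)" for \<tau>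
    using nt qs by (simp add: hp_def[of y "Suc t"])
  show c': "\<tau> < k \<Longrightarrow> cc y (Suc t) \<tau> = (cc y t \<tau>)(hp y t \<tau> := wr (qs y t) (scan y t) \<tau>)" for \<tau>
    using nt qs by (simp add: cc_def[of y "Suc t"])
  show "cfg_ok y (Suc t)"
    unfolding cfg_ok_def
  proof (intro conjI allI impI)
    show "length (snd (cfg y (Suc t))) = k" using st l lt by simp
    show "qs y (Suc t) \<le> Q" unfolding q' qs by (rule tr_wf(1)[OF qQ sc])
    show "cc y (Suc t) \<tau> p < G" if "\<tau> < k" for \<tau> p
      unfolding c'[OF that] qs using tr_wf(3)[OF qQ sc that] G[OF that] by simp
  qed
qed

lemma cfg_ok: "cfg_ok y t"
proof (induction t)
  case 0
  show ?case using cfg_0 k1(3) by (auto simp: cfg_ok_def string_contents_def)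
qed (rule cfg_Suc)

lemmas cfg_props = cfg_Suc(1-4)[OF cfg_ok]

lemma head_bound: "\<tau> < k \<Longrightarrow> \<bar>hp y t \<tau>\<bar> \<le> int t"
proof (induction t)
  case (Suc t)
  have "\<bar>move d\<bar> \<le> 1" for d by (cases d) (auto simp: move_def)
  from this[of "dr (qs y t) (scan y t) \<tau>"] show ?case
    unfolding cfg_props(3)[OF Suc.prems] using Suc.IH[OF Suc.prems] by simp
qed (simp add: cfg_0)

text \<open>The last row checks only the cells of the window; other cells need this argument: they
  were blank at the beginning and no head has come near them.\<close>

lemma blank_outside:
  assumes "\<tau> < k" "p < - int t \<or> int t < p" "p < 0 \<or> int (length y) \<le> p"
  shows "cc y t \<tau> p = 0"
  using assms(2)
proof (induction t)
  case 0
  then show ?case using assms by (auto simp: cfg_0 string_contents_def)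
next
  case (Suc t)
  then have "p \<noteq> hp y t \<tau>" using head_bound[OF assms(1), of y t] by auto
  then show ?case using Suc cfg_props(4)[OF assms(1)] by auto
qed

end

lemma nth_concat_uniform:
  assumes "\<And>xs. xs \<in> set xss \<Longrightarrow> length xs = b" "t < length xss" "i < b"
  shows "concat xss ! (t * b + i) = xss ! t ! i"
  using assms
proof (induction xss arbitrary: t)
  case (Cons xs xss)
  then show ?case
  proof (cases t)
    case (Suc t')
    have l: "length xs = b" using Cons.prems by simp
    have "concat (xs # xss) ! (t * b + i) = concat xss ! (t' * b + i)"
      using Suc l by (simp add: nth_append)
    then show ?thesis using Cons Suc by simp
  qed (auto simp: nth_append)
qed simp

lemma length_concat_uniform:
  "(\<And>xs. xs \<in> set xss \<Longrightarrow> length xs = b) \<Longrightarrow> length (concat xss) = length xss * b"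
  by (induction xss) auto

locale tableau_input = tableau +
  fixes x :: "bool list" and P n :: nat
begin

abbreviation "tm \<equiv> template x P n"
abbreviation "dl \<equiv> length (delimit x)"

definition W :: nat where "W = length tm"
definition N :: nat where "N = (P + 2) * W"
text \<open>The origin of all tapes is column \<open>P + 3\<close>, behind the separator and
  \<open>P + 2\<close> blanks.\<close>

definition pos :: "nat \<Rightarrow> int" where "pos i = int i - int (P + 3)"
definition rho :: "nat \<Rightarrow> nat" where "rho t = (if t = 0 then 0 else if t = P + 1 then 2 else 1)"

lemma delimit_ne: "1 \<le> dl" by (simp add: delimit_def)

lemma W_eq: "W = 2 * P + 4 + dl + n"
  using delimit_ne by (simp add: W_def template_def input_classes_def)

lemma template_nth:
  shows "tm ! 0 = 1"
    and "1 \<le> i \<Longrightarrow> i < P + 3 \<Longrightarrow> tm ! i = 2"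
    and "j < dl \<Longrightarrow> tm ! (P + 3 + j) = (if j = 0 then 3 else 5) + of_bool (delimit x ! j)"
    and "j < n \<Longrightarrow> tm ! (P + 3 + dl + j) = 7"
    and "P + 3 + dl + n \<le> i \<Longrightarrow> i < W \<Longrightarrow> tm ! i = 2"
proof -
  have d: "delimit x \<noteq> []" using delimit_ne by auto
  have li: "length (input_classes (delimit x)) = dl" using delimit_ne by (simp add: input_classes_def)
  have ic: "input_classes (delimit x) ! j = (if j = 0 then 3 else 5) + of_bool (delimit x ! j)" if "j < dl" for j
    using d that by (cases j) (auto simp: input_classes_def hd_conv_nth nth_tl)
  show "tm ! 0 = 1" by (simp add: template_def)
  show "1 \<le> i \<Longrightarrow> i < P + 3 \<Longrightarrow> tm ! i = 2"
    by (cases i) (auto simp: template_def nth_append simp del: replicate.simps replicate_Suc)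
  have sh: "tm ! (P + 3 + j) = (input_classes (delimit x) @ replicate n 7 @ replicate (P + 1) 2) ! j" for j
    using nth_append_length_plus[of "1 # replicate (P + 2) 2" _ j] by (simp add: template_def add.commute add.left_commute)
  show "j < dl \<Longrightarrow> tm ! (P + 3 + j) = (if j = 0 then 3 else 5) + of_bool (delimit x ! j)"
    unfolding sh using ic li by (simp add: nth_append)
  show "j < n \<Longrightarrow> tm ! (P + 3 + dl + j) = 7"
    using sh[of "dl + j"] li by (simp add: nth_append add.assoc)
  assume i: "P + 3 + dl + n \<le> i" "i < W"
  then obtain j where j: "i = P + 3 + (dl + n + j)" by (metis add.assoc le_Suc_ex)
  have "j < P + 1" using i j by (simp add: W_eq)
  then show "tm ! i = 2" unfolding j sh using li by (simp add: nth_append nth_replicate del: replicate.simps replicate_Suc)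
qed

lemma template_range: "i < W \<Longrightarrow> 1 \<le> tm ! i \<and> tm ! i \<le> 7 \<and> (tm ! i = 1 \<longleftrightarrow> i = 0)"
proof -
  assume i: "i < W"
  consider "i = 0" | "1 \<le> i" "i < P + 3" | j where "j < dl" "i = P + 3 + j" | j where "j < n" "i = P + 3 + dl + j" | "P + 3 + dl + n \<le> i"
    by (metis le_Suc_ex linorder_not_le nat_add_left_cancel_less not_less_eq_eq One_nat_def less_one add.assoc)
  then show ?thesis using template_nth i by cases auto
qed

lemma org_iff: "i < W \<Longrightarrow> (tm ! i = 3 \<or> tm ! i = 4) \<longleftrightarrow> pos i = 0"
proof -
  assume i: "i < W"
  consider "i = 0" | "1 \<le> i" "i < P + 3" | j where "j < dl" "i = P + 3 + j" | j where "j < n" "i = P + 3 + dl + j" | "P + 3 + dl + n \<le> i"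
    by (metis le_Suc_ex linorder_not_le nat_add_left_cancel_less not_less_eq_eq One_nat_def less_one add.assoc)
  then show ?thesis using template_nth i delimit_ne by cases (auto simp: pos_def)
qed

lemma class_nth:
  assumes "t < P + 2" "i < W"
  shows "classes x P n ! (t * W + i) = tm ! i + 7 * rho t"
proof -
  let ?xs = "tm # replicate P (map ((+) 7) tm) @ [map ((+) 14) tm]"
  have "classes x P n = concat ?xs" by (simp add: classes_def)
  moreover have "concat ?xs ! (t * W + i) = ?xs ! t ! i"
    using assms by (intro nth_concat_uniform) (auto simp: W_def)
  moreover have "?xs ! t ! i = tm ! i + 7 * rho t"
    using assms by (cases t) (auto simp: rho_def nth_append W_def)
  ultimately show ?thesis by simp
qed

lemma length_classes: "length (classes x P n) = N"
  unfolding classes_def N_def by (simp add: length_concat sum_list_replicate W_def)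

lemma kn_class:
  assumes "t < P + 2" "i < W"
  shows "kn (classes x P n ! (t * W + i)) z = (if i = 0 then (if t = 0 then 2 * of_bool (z = start)
      else of_bool (\<exists>q ss e. z = (HC q ss none none e, Sep, Sep, Sep))) else of_bool (allowed_cell (rho t) (tm ! i) z))"
proof -
  have r: "1 \<le> tm ! i" "tm ! i \<le> 7" "tm ! i = 1 \<longleftrightarrow> i = 0" using template_range[OF assms(2)] by auto
  obtain d where d: "tm ! i = Suc d" "d < 7" using r(1,2) by (cases "tm ! i") auto
  have "(tm ! i + 7 * rho t - 1) div 7 = rho t" "(tm ! i + 7 * rho t - 1) mod 7 + 1 = tm ! i"
    unfolding d(1) using d(2) by auto
  moreover have "rho t = 0 \<longleftrightarrow> t = 0" by (simp add: rho_def)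
  ultimately show ?thesis unfolding kn_def class_nth[OF assms] Let_def using r(3) by (simp only:)
qed

definition accepts :: "bool list \<Rightarrow> bool" where
  "accepts u \<longleftrightarrow> length u \<le> n \<and> qs (delimit x @ u) (P + 1) = Q \<and> cc (delimit x @ u) (P + 1) (k - 1) = string_contents [True]"

definition site_ok :: "color list \<Rightarrow> (nat \<Rightarrow> color tile) \<Rightarrow> bool" where
  "site_ok cl T \<longleftrightarrow> (\<forall>c < N. T c \<in> set (all_tiles cl) \<and> kn (classes x P n ! c) (T c) \<noteq> 0) \<and>
     (\<forall>c. c + 1 < N \<longrightarrow> right_of (T c) = left_of (T (c + 1))) \<and>
     (\<forall>c. c + W < N \<longrightarrow> bottom_of (T c) = top_of (T (c + W)))"

lemma site_less: "t < P + 2 \<Longrightarrow> i < W \<Longrightarrow> t * W + i < N"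
proof -
  assume t: "t < P + 2" "i < W"
  have "t * W + i < Suc t * W" using t by simp
  also have "\<dots> \<le> N" unfolding N_def using t by (intro mult_le_mono1) auto
  finally show ?thesis .
qed

lemma pos_cover: "\<bar>p\<bar> \<le> int (P + 1) \<Longrightarrow> \<exists>i. 1 \<le> i \<and> i < W \<and> pos i = p"
  by (rule exI[of _ "nat (p + int (P + 3))"]) (use delimit_ne in \<open>auto simp: pos_def W_eq\<close>)

text \<open>Row \<open>t\<close> is shown to be the configuration at time \<open>t\<close>. All
  heads are inside the window, so every scanned symbol is confirmed by some cell; hence all cells of
  the row apply the true transition, and the crossing flags place each head correctly in the next
  row.\<close>

lemma soundness:
  assumes T: "site_ok cl T"
  shows "\<exists>u. accepts u"
proof -
  define X where "X t i = T (t * W + i)" for t i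
  have W2: "2 \<le> W" by (simp add: W_eq)
  have H: "right_of (X t i) = left_of (X t (Suc i))" if "t < P + 2" "Suc i < W" for t i
    using T site_less[OF that] unfolding site_ok_def X_def by simp
  have Hs: "right_of (X t (W - 1)) = left_of (X (Suc t) 0)" if "Suc t < P + 2" for t
  proof -
    have "t * W + (W - 1) + 1 = Suc t * W + 0" using W2 by simp
    moreover have "Suc t * W + 0 < N" by (rule site_less) (use that W2 in auto)
    ultimately show ?thesis using T unfolding site_ok_def X_def by metis
  qed
  have V: "bottom_of (X t i) = top_of (X (Suc t) i)" if "Suc t < P + 2" "i < W" for t i
  proof -
    have "t * W + i + W = Suc t * W + i" by simp
    then show ?thesis using T site_less[OF that] unfolding site_ok_def X_def by metis
  qed
  have kn: "kn (classes x P n ! (t * W + i)) (X t i) \<noteq> 0" if "t < P + 2" "i < W" for t i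
    using T site_less[OF that] unfolding site_ok_def X_def by blast
  have "allowed_cell (rho t) (tm ! i) (X t i)" if "t < P + 2" "1 \<le> i" "i < W" for t i
    using kn[OF that(1,3)] kn_class[OF that(1,3)] that(2) by (auto split: if_splits)
  then have "\<forall>t i. \<exists>q ss sy hh iL iR e e' f. t < P + 2 \<longrightarrow> 1 \<le> i \<longrightarrow> i < W \<longrightarrow> cell_ok q ss sy hh iL iR f \<and>
     X t i = cell q ss sy hh iL iR e e' f \<and> (rho t = 0 \<longrightarrow> init_ok (tm ! i) q sy hh e e') \<and> (rho t = 2 \<longrightarrow> fin_ok (tm ! i) q sy)"
    unfolding allowed_cell_def by metis
  then obtain q ss sy hh iL iR e e' f where
    C: "\<And>t i. t < P + 2 \<Longrightarrow> 1 \<le> i \<Longrightarrow> i < W \<Longrightarrow> cell_ok (q t i) (ss t i) (sy t i) (hh t i) (iL t i) (iR t i) (f t i) \<and>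
     X t i = cell (q t i) (ss t i) (sy t i) (hh t i) (iL t i) (iR t i) (e t i) (e' t i) (f t i) \<and>
     (rho t = 0 \<longrightarrow> init_ok (tm ! i) (q t i) (sy t i) (hh t i) (e t i) (e' t i)) \<and> (rho t = 2 \<longrightarrow> fin_ok (tm ! i) (q t i) (sy t i))"
    by metis
  have sep: "right_of (X t 0) = Sep" if "t < P + 2" for t
    using kn[OF that, of 0] kn_class[OF that, of 0] W2 by (auto simp: right_of_def start_def split: if_splits)
  have sepl: "\<exists>q ss e. left_of (X t 0) = HC q ss none none e" if "t < P + 2" "0 < t" for t
    using kn[OF that(1), of 0] kn_class[OF that(1), of 0] W2 that(2) by (auto simp: left_of_def split: if_splits)
  have first: "f t 1" if "t < P + 2" for t
    using H[OF that, of 0] sep[OF that] C[OF that, of 1] W2 by (auto simp: left_of_def cell_def split: if_splits)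
  have iL1: "\<not> iL t 1 ! \<tau>" if "t < P + 2" "\<tau> < k" for t \<tau>
    using first[OF that(1)] C[OF that(1), of 1] W2 that(2) by (auto simp: cell_ok_def)
  have adj: "q t (Suc i) = q t i \<and> ss t (Suc i) = ss t i \<and> e t (Suc i) = e' t i \<and>
      iL t (Suc i) = flag_list (\<lambda>\<tau>. hh t i ! \<tau> \<and> dr (q t i) (ss t i) \<tau> = Go_Right) \<and>
      iR t i = flag_list (\<lambda>\<tau>. hh t (Suc i) ! \<tau> \<and> dr (q t i) (ss t i) \<tau> = Go_Left)"
    if "t < P + 2" "1 \<le> i" "Suc i < W" for t i
  proof -
    have "right_of (X t i) = HC (q t i) (ss t i) (flag_list (\<lambda>\<tau>. hh t i ! \<tau> \<and> dr (q t i) (ss t i) \<tau> = Go_Right)) (iR t i) (e' t i)"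
      using C[OF that(1,2)] that(3) by (simp add: cell_def right_of_def)
    moreover have "left_of (X t (Suc i)) = (if f t (Suc i) then Sep else HC (q t (Suc i)) (ss t (Suc i)) (iL t (Suc i))
        (flag_list (\<lambda>\<tau>. hh t (Suc i) ! \<tau> \<and> dr (q t (Suc i)) (ss t (Suc i)) \<tau> = Go_Left)) (e t (Suc i)))"
      using C[OF that(1) _ that(3)] by (simp add: cell_def left_of_def)
    ultimately show ?thesis using H[OF that(1,3)] by (auto split: if_splits)
  qed
  \<comment> \<open>By the wrap-around, the last cell of a row borders on the separator of the next
    row, whose left colour admits no crossing head.\<close>
  have iRl: "\<not> iR t (W - 1) ! \<tau>" if "Suc t < P + 2" "\<tau> < k" for t \<tau>
  proof -
    have "t < P + 2" "1 \<le> W - 1" "W - 1 < W" using that W2 by auto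
    from C[OF this] have "right_of (X t (W - 1)) = HC (q t (W - 1)) (ss t (W - 1)) (flag_list (\<lambda>\<tau>. hh t (W - 1) ! \<tau> \<and>
        dr (q t (W - 1)) (ss t (W - 1)) \<tau> = Go_Right)) (iR t (W - 1)) (e' t (W - 1))" by (simp add: cell_def right_of_def)
    then have "iR t (W - 1) = none" using Hs[OF that(1)] sepl[OF that(1)] by auto
    then show ?thesis using that(2) by (simp add: none_def flag_list_def)
  qed
  have row: "q t i = q t 1 \<and> ss t i = ss t 1" if "t < P + 2" "1 \<le> i" "i < W" for t i
    using that(2,3)
  proof (induction i rule: dec_induct)
    case (step i)
    then show ?case using adj[OF that(1), of i] by auto
  qed simp
  have down: "q (Suc t) i = fst (tr (q t i) (ss t i)) \<and>
      sy (Suc t) i = map (\<lambda>\<tau>. if hh t i ! \<tau> then wr (q t i) (ss t i) \<tau> else sy t i ! \<tau>) [0..<k] \<and>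
      hh (Suc t) i = flag_list (\<lambda>\<tau>. hh t i ! \<tau> \<and> dr (q t i) (ss t i) \<tau> = Stay \<or> iL t i ! \<tau> \<or> iR t i ! \<tau>)"
    if "Suc t < P + 2" "1 \<le> i" "i < W" for t i
  proof -
    have t: "t < P + 2" using that by simp
    have "bottom_of (X t i) = VC (fst (tr (q t i) (ss t i))) (map (\<lambda>\<tau>. if hh t i ! \<tau> then wr (q t i) (ss t i) \<tau> else sy t i ! \<tau>) [0..<k])
       (flag_list (\<lambda>\<tau>. hh t i ! \<tau> \<and> dr (q t i) (ss t i) \<tau> = Stay \<or> iL t i ! \<tau> \<or> iR t i ! \<tau>))"
      using C[OF t that(2,3)] by (simp add: cell_def bottom_of_def)
    moreover have "top_of (X (Suc t) i) = VC (q (Suc t) i) (sy (Suc t) i) (hh (Suc t) i)"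
      using C[OF that] by (simp add: cell_def top_of_def)
    ultimately show ?thesis using V[OF that(1,3)] by simp
  qed
  define cert where "cert j = sy 0 (P + 3 + dl + j) ! 0" for j
  have i0: "init_ok (tm ! i) (q 0 i) (sy 0 i) (hh 0 i) (e 0 i) (e' 0 i)" if "1 \<le> i" "i < W" for i
    using C[of 0 i] that by (simp add: rho_def)
  have cert7: "cert j \<le> 2 \<and> (e' 0 (P + 3 + dl + j) \<longleftrightarrow> cert j = 0) \<and> (e 0 (P + 3 + dl + j) \<longrightarrow> e' 0 (P + 3 + dl + j))" if "j < n" for j
    using i0[of "P + 3 + dl + j"] template_nth(4)[OF that] that by (auto simp: init_ok_def cert_def W_eq)
  have cert_end: "cert (Suc j) = 0" if "cert j = 0" "Suc j < n" for j
    using adj[of 0 "P + 3 + dl + j"] cert7[of j] cert7[of "Suc j"] that by (auto simp: W_eq)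
  \<comment> \<open>The length of the certificate: the first blank certificate cell, or
    \<open>n\<close> if there is none.\<close>
  define L where "L = (LEAST j. j = n \<or> cert j = 0)"
  have L: "L = n \<or> cert L = 0" "L \<le> n" unfolding L_def by (rule LeastI[of _ n], simp) (rule Least_le, simp)
  have before: "cert j = 1 \<or> cert j = 2" if "j < L" for j
    using not_less_Least[of j "\<lambda>j. j = n \<or> cert j = 0"] that L(2) cert7[of j] unfolding L_def[symmetric]
    by (auto simp: le_Suc_eq numeral_2_eq_2)
  have after: "cert j = 0" if "L \<le> j" "j < n" for j
    using that
  proof (induction j rule: dec_induct)
    case base
    then show ?case using L by auto
  next
    case (step j)
    then show ?case using cert_end by auto
  qed
  define u where "u = map (\<lambda>j. cert j = 2) [0..<L]"
  define y where "y = delimit x @ u"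
  have lu: "length u = L" by (simp add: u_def)
  have inv: "\<forall>i. 1 \<le> i \<and> i < W \<longrightarrow> q t i = qs y t \<and> (\<forall>\<tau> < k. sy t i ! \<tau> = cc y t \<tau> (pos i) \<and> (hh t i ! \<tau> \<longleftrightarrow> hp y t \<tau> = pos i))"
    if "t < P + 2" for t
    using that
  proof (induction t)
    case 0
    show ?case
    proof (intro allI impI conjI; elim conjE)
      fix i assume i: "1 \<le> i" "i < W"
      note I = i0[OF i]
      show "q 0 i = qs y 0" using I by (simp add: init_ok_def cfg_0)
      fix \<tau> assume \<tau>: "\<tau> < k"
      show "hh 0 i ! \<tau> \<longleftrightarrow> hp y 0 \<tau> = pos i" using I \<tau> org_iff[OF i(2)] by (auto simp: init_ok_def cfg_0)
      show "sy 0 i ! \<tau> = cc y 0 \<tau> (pos i)"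
      proof (cases "\<tau> = 0")
        case False
        then show ?thesis using I \<tau> by (simp add: init_ok_def cfg_0 string_contents_def)
      next
        case True
        consider "i < P + 3" | j where "j < dl" "i = P + 3 + j" | j where "j < n" "i = P + 3 + dl + j" | "P + 3 + dl + n \<le> i"
          by (metis le_Suc_ex linorder_not_le nat_add_left_cancel_less add.assoc)
        then show ?thesis
        proof cases
          case 1
          then have "tm ! i = 2" "pos i < 0" using template_nth(2) i by (auto simp: pos_def)
          then show ?thesis using I True \<tau> by (simp add: init_ok_def cfg_0 string_contents_def)
        next
          case (2 j)
          then have "tm ! i = (if j = 0 then 3 else 5) + of_bool (delimit x ! j)" "pos i = int j" using template_nth(3) by (auto simp: pos_def)
          then show ?thesis using I True \<tau> 2 by (auto simp: init_ok_def cfg_0 string_contents_def y_def nth_append split: if_splits)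
        next
          case (3 j)
          then have p: "pos i = int (dl + j)" by (simp add: pos_def)
          have "sy 0 i ! 0 = cert j" using 3 by (simp add: cert_def)
          moreover have "cc y 0 0 (pos i) = cert j"
          proof (cases "j < L")
            case True
            then show ?thesis using before[OF True] \<tau> \<open>\<tau> = 0\<close> unfolding p cfg_0(3)[OF \<open>\<tau> < k\<close>[unfolded \<open>\<tau> = 0\<close>]]
              by (auto simp: string_contents_def y_def lu nth_append u_def simp del: of_nat_add)
          next
            case False
            then show ?thesis using after[of j] 3 unfolding p cfg_0(3)[OF \<open>\<tau> < k\<close>[unfolded \<open>\<tau> = 0\<close>]]
              by (auto simp: string_contents_def y_def lu)
          qed
          ultimately show ?thesis using True by simp
        next
          case 4
          then have "tm ! i = 2" "int (dl + n) \<le> pos i" using template_nth(5) i by (auto simp: pos_def)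
          then show ?thesis using I True \<tau> L(2) by (simp add: init_ok_def cfg_0 string_contents_def y_def lu)
        qed
      qed
    qed
  next
    case (Suc t)
    then have t: "t < P + 2" "t \<le> P" by auto
    note IH = Suc.IH[OF t(1)]
    \<comment> \<open>Each head stands in some cell of the window, and that cell ties the guessed
      component of \<open>ss\<close> to its contents.\<close>
    have sc: "ss t 1 = scan y t"
    proof (rule nth_equalityI)
      have "ss t 1 \<in> symbol_lists" using C[OF t(1), of 1] W2 by (auto simp: cell_ok_def)
      then show "length (ss t 1) = length (scan y t)" by (simp add: symbol_lists_def scan_def)
      fix \<tau> assume "\<tau> < length (ss t 1)"
      then have \<tau>: "\<tau> < k" using \<open>ss t 1 \<in> symbol_lists\<close> by (simp add: symbol_lists_def)
      obtain i where i: "1 \<le> i" "i < W" "pos i = hp y t \<tau>" using pos_cover[of "hp y t \<tau>"] head_bound[OF \<tau>, of y t] t by auto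
      then have "hh t i ! \<tau>" using IH \<tau> by auto
      then have "sy t i ! \<tau> = ss t i ! \<tau>" using C[OF t(1) i(1,2)] \<tau> by (simp add: cell_ok_def)
      then show "ss t 1 ! \<tau> = scan y t ! \<tau>" using row[OF t(1) i(1,2)] IH i \<tau> by (simp add: scan_def)
    qed
    show ?case
    proof (intro allI impI; elim conjE)
      fix i assume i: "1 \<le> i" "i < W"
      have q: "q t i = qs y t" "ss t i = scan y t" using IH i row[OF t(1) i] sc by auto
      note D = down[OF Suc.prems i, unfolded q]
      have "q (Suc t) i = qs y (Suc t)" using D cfg_props(2) by simp
      moreover have "sy (Suc t) i ! \<tau> = cc y (Suc t) \<tau> (pos i) \<and> (hh (Suc t) i ! \<tau> \<longleftrightarrow> hp y (Suc t) \<tau> = pos i)" if \<tau>: "\<tau> < k" for \<tau>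
      proof
        have old: "sy t i ! \<tau> = cc y t \<tau> (pos i)" "hh t i ! \<tau> \<longleftrightarrow> hp y t \<tau> = pos i" using IH i \<tau> by auto
        show "sy (Suc t) i ! \<tau> = cc y (Suc t) \<tau> (pos i)" using D \<tau> old unfolding cfg_props(4)[OF \<tau>] by auto
        let ?d = "dr (qs y t) (scan y t) \<tau>"
        have hb: "\<bar>hp y t \<tau>\<bar> \<le> int P" using head_bound[OF \<tau>, of y t] t by auto
        have L1: "iL t i ! \<tau> \<longleftrightarrow> hp y t \<tau> = pos i - 1 \<and> ?d = Go_Right"
        proof (cases "i = 1")
          case True
          then show ?thesis using iL1[OF t(1) \<tau>] hb by (auto simp: pos_def)
        next
          case False
          then obtain i' where i': "i = Suc i'" "1 \<le> i'" using i by (cases i) auto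
          have "pos i' = pos i - 1" using i' by (simp add: pos_def)
          moreover have "hh t i' ! \<tau> \<longleftrightarrow> hp y t \<tau> = pos i'" "q t i' = qs y t" "ss t i' = scan y t"
            using IH i' i \<tau> row[OF t(1), of i'] sc by auto
          ultimately show ?thesis using adj[OF t(1) i'(2)] i' i \<tau> by (simp add: flag_list_def)
        qed
        have R1: "iR t i ! \<tau> \<longleftrightarrow> hp y t \<tau> = pos i + 1 \<and> ?d = Go_Left"
        proof (cases "i = W - 1")
          case True
          then show ?thesis using iRl[OF Suc.prems \<tau>] hb by (auto simp: pos_def W_eq)
        next
          case False
          then have i': "Suc i < W" using i by auto
          have "pos (Suc i) = pos i + 1" by (simp add: pos_def)
          moreover have "hh t (Suc i) ! \<tau> \<longleftrightarrow> hp y t \<tau> = pos (Suc i)" using IH i' \<tau> by auto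
          ultimately show ?thesis using adj[OF t(1) i(1) i'] \<tau> q by (simp add: flag_list_def)
        qed
        have "hh (Suc t) i ! \<tau> \<longleftrightarrow> hp y t \<tau> = pos i \<and> ?d = Stay \<or> hp y t \<tau> = pos i - 1 \<and> ?d = Go_Right \<or> hp y t \<tau> = pos i + 1 \<and> ?d = Go_Left"
          using D \<tau> old L1 R1 by (simp add: flag_list_def)
        also have "\<dots> \<longleftrightarrow> hp y t \<tau> + move ?d = pos i" by (cases ?d) (auto simp: move_def)
        finally show "hh (Suc t) i ! \<tau> \<longleftrightarrow> hp y (Suc t) \<tau> = pos i" unfolding cfg_props(3)[OF \<tau>] .
      qed
      ultimately show "q (Suc t) i = qs y (Suc t) \<and> (\<forall>\<tau> < k. sy (Suc t) i ! \<tau> = cc y (Suc t) \<tau> (pos i) \<and> (hh (Suc t) i ! \<tau> \<longleftrightarrow> hp y (Suc t) \<tau> = pos i))"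
        by blast
    qed
  qed
  have F: "fin_ok (tm ! i) (q (P + 1) i) (sy (P + 1) i)" if "1 \<le> i" "i < W" for i
    using C[of "P + 1" i] that by (simp add: rho_def)
  have "qs y (P + 1) = Q" using F[of 1] inv[of "P + 1"] W2 by (auto simp: fin_ok_def)
  moreover have "cc y (P + 1) (k - 1) = string_contents [True]"
  proof
    fix p
    have k: "k - 1 < k" using k1(1) by simp
    show "cc y (P + 1) (k - 1) p = string_contents [True] p"
    proof (cases "- int (P + 2) \<le> p \<and> p < int (dl + n + P + 1)")
      case True
      define i where "i = nat (p + int (P + 3))"
      have i: "1 \<le> i" "i < W" "pos i = p" using True by (auto simp: i_def W_eq pos_def)
      have "cc y (P + 1) (k - 1) p = sy (P + 1) i ! (k - 1)" using inv[of "P + 1"] i k by auto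
      also have "\<dots> = (if p = 0 then 2 else 0)" using F[OF i(1,2)] org_iff[OF i(2)] i(3) by (simp add: fin_ok_def)
      finally show ?thesis by (auto simp: string_contents_def)
    next
      case False
      then have "cc y (P + 1) (k - 1) p = 0" using L(2) delimit_ne by (intro blank_outside[OF k]) (auto simp: y_def lu)
      then show ?thesis using False by (auto simp: string_contents_def)
    qed
  qed
  ultimately have "accepts u" unfolding accepts_def y_def using lu L(2) by simp
  then show ?thesis by blast
qed

lemma string_contents_after: "0 \<le> p \<Longrightarrow> string_contents y p = 0 \<Longrightarrow> string_contents y (p + 1) = 0"
  by (auto simp: string_contents_def split: if_splits)

text \<open>The accepting computation itself is the tiling; the distance of the heads from both
  margins ensures that suppressing the crossing flags there loses nothing.\<close>

lemma completeness:
  assumes u: "accepts u" and cl: "set cl = colors"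
  shows "\<exists>T. site_ok cl T"
proof -
  define y where "y = delimit x @ u"
  have lu: "length u \<le> n" and acc: "qs y (P + 1) = Q" "cc y (P + 1) (k - 1) = string_contents [True]"
    using u by (auto simp: accepts_def y_def)
  have ly: "length y = dl + length u" by (simp add: y_def)
  let ?d = "\<lambda>t \<tau>. dr (qs y t) (scan y t) \<tau>"
  define sy where "sy t i = map (\<lambda>\<tau>. cc y t \<tau> (pos i)) [0..<k]" for t i
  define hh where "hh t i = flag_list (\<lambda>\<tau>. hp y t \<tau> = pos i)" for t i
  define iL where "iL t i = flag_list (\<lambda>\<tau>. 1 < i \<and> hp y t \<tau> = pos i - 1 \<and> ?d t \<tau> = Go_Right)" for t i
  define iR where "iR t i = flag_list (\<lambda>\<tau>. Suc i < W \<and> hp y t \<tau> = pos i + 1 \<and> ?d t \<tau> = Go_Left)" for t i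
  \<comment> \<open>The flag is raised in certificate cells of the first row only, since
    \<open>init_ok\<close> wants it off in all other cells of that row.\<close>
  define e' where "e' t i = (t = 0 \<and> tm ! i = 7 \<and> cc y 0 0 (pos i) = 0)" for t i :: nat
  define e where "e t i = (1 < i \<and> e' t (i - 1))" for t i
  \<comment> \<open>A separator below the first row has to repeat the right colour of the last cell
    of the row before, to which it is adjacent in the numbering of sites.\<close>
  define X where "X t i = (if i = 0 then (if t = 0 then start else (HC (qs y (t - 1)) (scan y (t - 1)) none none (e' (t - 1) (W - 1)), Sep, Sep, Sep))
     else cell (qs y t) (scan y t) (sy t i) (hh t i) (iL t i) (iR t i) (e t i) (e' t i) (i = 1))" for t i
  have W2: "2 \<le> W" by (simp add: W_eq)
  have fl [simp]: "\<tau> < k \<Longrightarrow> flag_list h ! \<tau> = h \<tau>" for h \<tau> by (simp add: flag_list_def)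
  have flags: "flag_list h \<in> flags" for h by (simp add: flag_list_def flags_def)
  have flag_cong: "(\<And>\<tau>. \<tau> < k \<Longrightarrow> h \<tau> = h' \<tau>) \<Longrightarrow> flag_list h = flag_list h'" for h h' by (simp add: flag_list_def)
  have ok: "cfg_ok y t" for t by (rule cfg_ok)
  have qQ: "qs y t \<le> Q" for t using ok by (simp add: cfg_ok_def)
  have cok: "cell_ok (qs y t) (scan y t) (sy t i) (hh t i) (iL t i) (iR t i) (i = 1)" if "t < P + 2" "1 \<le> i" "i < W" for t i
  proof -
    have "sy t i \<in> symbol_lists" using ok[of t] by (auto simp: sy_def symbol_lists_def cfg_ok_def)
    moreover have "hp y t \<tau> \<noteq> pos 1" if "\<tau> < k" for \<tau>
      using head_bound[OF that, of y t] \<open>t < P + 2\<close> by (auto simp: pos_def)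
    ultimately show ?thesis
      unfolding cell_ok_def using qQ cfg_props(1) flags
      by (auto simp: hh_def iL_def iR_def sy_def scan_def)
  qed
  have init: "init_ok (tm ! i) (qs y 0) (sy 0 i) (hh 0 i) (e 0 i) (e' 0 i)" if i: "1 \<le> i" "i < W" for i
  proof -
    have k0: "0 < k" using k1(1) by simp
    have c0: "cc y 0 0 = string_contents y" using cfg_0(3)[OF k0, of y] by simp
    have le2: "string_contents y p \<le> 2" for p by (simp add: string_contents_def)
    have common: "qs y 0 = 0" "\<forall>\<tau> < k. \<tau> \<noteq> 0 \<longrightarrow> sy 0 i ! \<tau> = 0" "\<forall>\<tau> < k. hh 0 i ! \<tau> = (tm ! i = 3 \<or> tm ! i = 4)"
      "sy 0 i ! 0 = string_contents y (pos i)"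
      using org_iff[OF i(2)] k0 by (auto simp: cfg_0 sy_def hh_def string_contents_def)
    consider "i < P + 3" | j where "j < dl" "i = P + 3 + j" | j where "j < n" "i = P + 3 + dl + j" | "P + 3 + dl + n \<le> i"
      by (metis le_Suc_ex linorder_not_le nat_add_left_cancel_less add.assoc)
    then show ?thesis
    proof cases
      case 1
      then have "tm ! i = 2" "pos i < 0" using template_nth(2) i by (auto simp: pos_def)
      then show ?thesis unfolding init_ok_def using common by (auto simp: e'_def string_contents_def)
    next
      case (2 j)
      then have t: "tm ! i = (if j = 0 then 3 else 5) + of_bool (delimit x ! j)" and p: "pos i = int j" using template_nth(3) by (auto simp: pos_def)
      have "string_contents y (pos i) = (if delimit x ! j then 2 else 1)" unfolding p using 2 by (simp add: string_contents_def y_def nth_append)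
      then show ?thesis unfolding init_ok_def using common t by (auto simp: e'_def)
    next
      case (3 j)
      then have t: "tm ! i = 7" using template_nth(4) by auto
      have p: "pos (i - 1) + 1 = pos i" "0 \<le> pos (i - 1)" using 3 delimit_ne by (auto simp: pos_def)
      have "e 0 i \<longrightarrow> e' 0 i" using string_contents_after[OF p(2), of y] t p(1) by (auto simp: e_def e'_def c0)
      then show ?thesis unfolding init_ok_def using common t le2 by (auto simp: e'_def c0)
    next
      case 4
      then have "tm ! i = 2" "int (length y) \<le> pos i" using template_nth(5) i lu ly by (auto simp: pos_def)
      then show ?thesis unfolding init_ok_def using common by (auto simp: e'_def string_contents_def)
    qed
  qed
  have fin: "fin_ok (tm ! i) (qs y (P + 1)) (sy (P + 1) i)" if i: "1 \<le> i" "i < W" for i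
    unfolding fin_ok_def using acc org_iff[OF i(2)] k1(1) by (auto simp: sy_def string_contents_def)
  have all: "X t i \<in> set (all_tiles cl) \<and> kn (classes x P n ! (t * W + i)) (X t i) \<noteq> 0" if t: "t < P + 2" and i: "i < W" for t i
  proof (cases "i = 0")
    case True
    have "HC (qs y s) (scan y s) none none b \<in> colors" for s b
      unfolding colors_def none_def using qQ cfg_props(1) flags
      by (intro UnI1[OF UnI2] image_eqI[of _ _ "(qs y s, scan y s, flag_list (\<lambda>_. False), flag_list (\<lambda>_. False), b)"]) auto
    moreover have "Sep \<in> colors" by (simp add: colors_def)
    ultimately have "X t i \<in> set (all_tiles cl)" using True by (auto simp: X_def start_def all_tiles_def cl)
    moreover have "kn (classes x P n ! (t * W + i)) (X t i) \<noteq> 0" unfolding kn_class[OF t i] using True by (auto simp: X_def)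
    ultimately show ?thesis by blast
  next
    case False
    then have i1: "1 \<le> i" by simp
    note c = cok[OF t i1 i]
    have Xi: "X t i = cell (qs y t) (scan y t) (sy t i) (hh t i) (iL t i) (iR t i) (e t i) (e' t i) (i = 1)" using False by (simp add: X_def)
    have "allowed_cell (rho t) (tm ! i) (X t i)"
    proof -
      have "rho t = 0 \<longrightarrow> init_ok (tm ! i) (qs y t) (sy t i) (hh t i) (e t i) (e' t i)" using init[OF i1 i] by (auto simp: rho_def)
      moreover have "rho t = 2 \<longrightarrow> fin_ok (tm ! i) (qs y t) (sy t i)" using fin[OF i1 i] by (auto simp: rho_def)
      ultimately show ?thesis
        unfolding allowed_cell_def using c Xi
        by (intro exI[of _ "qs y t"] exI[of _ "scan y t"] exI[of _ "sy t i"] exI[of _ "hh t i"] exI[of _ "iL t i"]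
            exI[of _ "iR t i"] exI[of _ "e t i"] exI[of _ "e' t i"] exI[of _ "i = 1"] conjI)
    qed
    moreover have "X t i \<in> set (all_tiles cl)" using cell_colors[OF c, of "e t i" "e' t i"] unfolding Xi[symmetric]
      by (cases "X t i") (auto simp: all_tiles_def cl left_of_def right_of_def top_of_def bottom_of_def)
    ultimately show ?thesis unfolding kn_class[OF t i] using False by simp
  qed
  have H: "right_of (X t i) = left_of (X t (Suc i))" if "t < P + 2" "Suc i < W" for t i
  proof (cases "i = 0")
    case True
    then show ?thesis by (simp add: X_def cell_def left_of_def right_of_def start_def)
  next
    case False
    have "pos (Suc i) = pos i + 1" by (simp add: pos_def)
    then have "flag_list (\<lambda>\<tau>. hh t i ! \<tau> \<and> ?d t \<tau> = Go_Right) = iL t (Suc i)"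
      "iR t i = flag_list (\<lambda>\<tau>. hh t (Suc i) ! \<tau> \<and> ?d t \<tau> = Go_Left)"
      unfolding iL_def iR_def using False that by (auto intro!: flag_cong simp: hh_def)
    moreover have "e t (Suc i) = e' t i" using False by (simp add: e_def)
    ultimately show ?thesis using False by (simp add: X_def cell_def left_of_def right_of_def)
  qed
  have Hs: "right_of (X t (W - 1)) = left_of (X (Suc t) 0)" if "Suc t < P + 2" for t
  proof -
    have "hp y t \<tau> \<noteq> pos (W - 1)" if "\<tau> < k" for \<tau>
      using head_bound[OF that, of y t] \<open>Suc t < P + 2\<close> delimit_ne by (auto simp: pos_def W_eq)
    then have "flag_list (\<lambda>\<tau>. hh t (W - 1) ! \<tau> \<and> ?d t \<tau> = Go_Right) = none" "iR t (W - 1) = none"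
      unfolding none_def iR_def by (auto intro!: flag_cong simp: hh_def)
    then show ?thesis using W2 by (simp add: X_def cell_def left_of_def right_of_def)
  qed
  have V: "bottom_of (X t i) = top_of (X (Suc t) i)" if t: "Suc t < P + 2" and i: "i < W" for t i
  proof (cases "i = 0")
    case True
    then show ?thesis by (simp add: X_def top_of_def bottom_of_def start_def)
  next
    case False
    have "fst (tr (qs y t) (scan y t)) = qs y (Suc t)" using cfg_props(2) by simp
    moreover have "map (\<lambda>\<tau>. if hh t i ! \<tau> then wr (qs y t) (scan y t) \<tau> else sy t i ! \<tau>) [0..<k] = sy (Suc t) i"
      unfolding sy_def using cfg_props(4) by (auto simp: hh_def)
    moreover have "flag_list (\<lambda>\<tau>. hh t i ! \<tau> \<and> ?d t \<tau> = Stay \<or> iL t i ! \<tau> \<or> iR t i ! \<tau>) = hh (Suc t) i"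
      unfolding hh_def[of "Suc t"]
    proof (rule flag_cong)
      fix \<tau> assume \<tau>: "\<tau> < k"
      have hb: "\<bar>hp y t \<tau>\<bar> \<le> int P" using head_bound[OF \<tau>, of y t] t by auto
      have "hh t i ! \<tau> \<and> ?d t \<tau> = Stay \<or> iL t i ! \<tau> \<or> iR t i ! \<tau> \<longleftrightarrow> hp y t \<tau> = pos i \<and> ?d t \<tau> = Stay \<or>
          1 < i \<and> hp y t \<tau> = pos i - 1 \<and> ?d t \<tau> = Go_Right \<or> Suc i < W \<and> hp y t \<tau> = pos i + 1 \<and> ?d t \<tau> = Go_Left"
        using \<tau> by (simp add: hh_def iL_def iR_def)
      also have "\<dots> \<longleftrightarrow> hp y t \<tau> + move (?d t \<tau>) = pos i"
      proof -
        have "hp y t \<tau> \<noteq> pos i - 1" if "\<not> 1 < i" using that hb False by (auto simp: pos_def)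
        moreover have "hp y t \<tau> \<noteq> pos i + 1" if "\<not> Suc i < W" using that hb i by (auto simp: pos_def W_eq)
        ultimately show ?thesis by (cases "?d t \<tau>") (simp_all add: move_def, (smt (verit))+)
      qed
      finally show "(hh t i ! \<tau> \<and> ?d t \<tau> = Stay \<or> iL t i ! \<tau> \<or> iR t i ! \<tau>) = (hp y (Suc t) \<tau> = pos i)"
        unfolding cfg_props(3)[OF \<tau>] .
    qed
    ultimately show ?thesis using False by (simp add: X_def cell_def top_of_def bottom_of_def)
  qed
  define T where "T c = X (c div W) (c mod W)" for c
  have W0: "0 < W" using W2 by simp
  have dm: "c div W < P + 2" "c mod W < W" if "c < N" for c
    using that W0 unfolding N_def by (auto simp: less_mult_imp_div_less)
  have "site_ok cl T"
    unfolding site_ok_def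
  proof (intro conjI allI impI)
    fix c assume "c < N"
    then show "T c \<in> set (all_tiles cl)" "kn (classes x P n ! c) (T c) \<noteq> 0"
      using all[of "c div W" "c mod W"] dm[of c] by (simp_all add: T_def)
  next
    fix c assume c: "c + 1 < N"
    then have c': "c < N" by simp
    show "right_of (T c) = left_of (T (c + 1))"
    proof (cases "Suc (c mod W) < W")
      case True
      then have "(c + 1) div W = c div W" "(c + 1) mod W = Suc (c mod W)"
        by (auto simp: mod_Suc div_Suc)
      then show ?thesis using H[OF dm(1)[OF c'] True] by (simp add: T_def)
    next
      case False
      then have m: "c mod W = W - 1" using dm(2)[OF c'] by simp
      then have "(c + 1) div W = Suc (c div W)" "(c + 1) mod W = 0" using W0 by (auto simp: mod_Suc div_Suc)
      moreover have "Suc (c div W) < P + 2" using dm(1)[OF c] calculation(1) by simp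
      ultimately show ?thesis using Hs m by (simp add: T_def)
    qed
  next
    fix c assume c: "c + W < N"
    then have "(c + W) div W = Suc (c div W)" "(c + W) mod W = c mod W" using W0 by auto
    moreover have "Suc (c div W) < P + 2" using dm(1)[OF c] calculation(1) by simp
    ultimately show "bottom_of (T c) = top_of (T (c + W))" using V[of "c div W" "c mod W"] W0 by (simp add: T_def)
  qed
  then show ?thesis by blast
qed

end

section \<open>Loop programs on registers\<close>

text \<open>The only branching is that the body of a loop may depend on the symbol being read. Every
  register becomes a tape, and the nonzero tape symbols are its possible entries.\<close>

datatype prog = Skip | Append nat nat | Pop nat | Inc nat | Seq prog prog | For nat "nat \<Rightarrow> prog"

type_synonym store = "nat \<Rightarrow> nat list"

text \<open>Binary increment with the least significant digit first; 1 stands for the digit zero and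
  2 for the digit one, because 0 is the blank.\<close>

fun inc_digits :: "nat list \<Rightarrow> nat list" where
  "inc_digits [] = [2]"
| "inc_digits (b # bs) = (if b = 2 then 1 # inc_digits bs else 2 # bs)"

primrec eval :: "prog \<Rightarrow> store \<Rightarrow> store" where
  "eval Skip = (\<lambda>\<sigma>. \<sigma>)"
| "eval (Append r s) = (\<lambda>\<sigma>. \<sigma>(r := \<sigma> r @ [s]))"
| "eval (Pop r) = (\<lambda>\<sigma>. \<sigma>(r := butlast (\<sigma> r)))"
| "eval (Inc r) = (\<lambda>\<sigma>. \<sigma>(r := inc_digits (\<sigma> r)))"
| "eval (Seq a b) = (\<lambda>\<sigma>. eval b (eval a \<sigma>))"
| "eval (For r b) = (\<lambda>\<sigma>. fold (\<lambda>s. eval (b s)) (\<sigma> r) \<sigma>)"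

text \<open>The two additional steps per round are the jump into the body for the current symbol and
  the move to the next symbol.\<close>

fun fold_steps :: "(nat \<Rightarrow> store \<Rightarrow> store) \<Rightarrow> (nat \<Rightarrow> store \<Rightarrow> nat) \<Rightarrow> nat list \<Rightarrow> store \<Rightarrow> nat" where
  "fold_steps e t [] \<sigma> = 0"
| "fold_steps e t (s # ss) \<sigma> = t s \<sigma> + 2 + fold_steps e t ss (e s \<sigma>)"

primrec steps :: "prog \<Rightarrow> store \<Rightarrow> nat" where
  "steps Skip = (\<lambda>\<sigma>. 0)"
| "steps (Append r s) = (\<lambda>\<sigma>. 1)"
| "steps (Pop r) = (\<lambda>\<sigma>. 2)"
| "steps (Inc r) = (\<lambda>\<sigma>. length (\<sigma> r) + 3 + length (inc_digits (\<sigma> r)))"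
| "steps (Seq a b) = (\<lambda>\<sigma>. steps a \<sigma> + steps b (eval a \<sigma>))"
| "steps (For r b) = (\<lambda>\<sigma>. length (\<sigma> r) + 3 +
     fold_steps (\<lambda>s. eval (b s)) (\<lambda>s. steps (b s)) (\<sigma> r) \<sigma>)"

text \<open>
  \<open>A\<close> collects the registers over which an enclosing loop runs. A loop body may only modify
  registers with larger indices; this stratification is what keeps all running times polynomial.
\<close>

primrec wf_prog :: "nat \<Rightarrow> nat \<Rightarrow> prog \<Rightarrow> nat set \<Rightarrow> bool" where
  "wf_prog k S Skip = (\<lambda>A. True)"
| "wf_prog k S (Append r s) = (\<lambda>A. r < k \<and> (\<forall>a \<in> A. a < r) \<and> 0 < s \<and> s < S)"
| "wf_prog k S (Pop r) = (\<lambda>A. r < k \<and> (\<forall>a \<in> A. a < r))"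
| "wf_prog k S (Inc r) = (\<lambda>A. r < k \<and> (\<forall>a \<in> A. a < r))"
| "wf_prog k S (Seq a b) = (\<lambda>A. wf_prog k S a A \<and> wf_prog k S b A)"
| "wf_prog k S (For r b) = (\<lambda>A. r < k \<and> r \<notin> A \<and>
     (\<forall>s. 0 < s \<and> s < S \<longrightarrow> wf_prog k S (b s) (insert r A)))"

definition valid :: "nat \<Rightarrow> store \<Rightarrow> bool" where
  "valid S \<sigma> \<longleftrightarrow> (\<forall>r. \<forall>s \<in> set (\<sigma> r). 0 < s \<and> s < S)"

lemma set_inc_digits: "set (inc_digits xs) \<subseteq> {1, 2} \<union> set xs"
  by (induction xs) auto

lemma length_inc_digits: "length (inc_digits xs) \<le> Suc (length xs)"
  by (induction xs) auto

lemma fold_invariant':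
  assumes "P \<sigma>" "\<And>s \<sigma>. s \<in> set xs \<Longrightarrow> P \<sigma> \<Longrightarrow> P (f s \<sigma>)"
  shows "P (fold f xs \<sigma>)"
  using assms by (induction xs arbitrary: \<sigma>) auto

lemma valid_eval:
  assumes "3 \<le> S" "wf_prog k S p A" "valid S \<sigma>"
  shows "valid S (eval p \<sigma>)"
  using assms(2,3)
proof (induction p arbitrary: A \<sigma>)
  case (Pop r)
  then show ?case by (auto simp: valid_def dest: in_set_butlastD)
next
  case (Inc r)
  have "0 < s \<and> s < S" if "s \<in> set (inc_digits (\<sigma> r))" for s
    using subsetD[OF set_inc_digits that] assms(1) Inc.prems by (auto simp: valid_def)
  then show ?case using Inc.prems by (auto simp: valid_def)
next
  case (For r b)
  have "s \<in> set (\<sigma> r) \<Longrightarrow> valid S \<tau> \<Longrightarrow> valid S (eval (b s) \<tau>)" for s \<tau>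
    using For.IH[of "b s" "insert r A" \<tau>] For.prems by (auto simp: valid_def[of S \<sigma>])
  then show ?case using fold_invariant'[of "valid S" \<sigma> "\<sigma> r" "\<lambda>s. eval (b s)"] For.prems by simp
next
  case (Seq p1 p2)
  then show ?case by (metis eval.simps(5) wf_prog.simps(5))
qed (auto simp: valid_def)

text \<open>The semantic content of the stratification: inside loops over \<open>A\<close> nothing
  changes in a register at or below any of their registers.\<close>

lemma eval_unmodified:
  assumes "wf_prog k S p A" "valid S \<sigma>" "3 \<le> S" "k \<le> r \<or> (\<exists>a \<in> A. r \<le> a)"
  shows "eval p \<sigma> r = \<sigma> r"
  using assms(1,2,4)
proof (induction p arbitrary: A \<sigma>)
  case (Seq p1 p2)
  then show ?case using valid_eval[OF assms(3)] by (metis eval.simps(5) wf_prog.simps(5))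
next
  case (For q b)
  have "valid S (fold (\<lambda>s. eval (b s)) (\<sigma> q) \<sigma>) \<and> fold (\<lambda>s. eval (b s)) (\<sigma> q) \<sigma> r = \<sigma> r"
  proof (rule fold_invariant'[where P = "\<lambda>\<tau>. valid S \<tau> \<and> \<tau> r = \<sigma> r"])
    fix s \<tau> assume s: "s \<in> set (\<sigma> q)" and t: "valid S \<tau> \<and> \<tau> r = \<sigma> r"
    then have w: "wf_prog k S (b s) (insert q A)" using For.prems by (auto simp: valid_def)
    then show "valid S (eval (b s) \<tau>) \<and> eval (b s) \<tau> r = \<sigma> r"
    proof -
      have "eval (b s) \<tau> r = \<tau> r" by (rule For.IH[OF _ w]) (use For.prems(3) t in auto)
      then show ?thesis using t valid_eval[OF assms(3) w] by auto
    qed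
  qed (use For.prems in auto)
  then show ?case by simp
qed auto

section \<open>Polynomial bounds on lengths and running times\<close>

lemma poly_mono_nat: "m \<le> n \<Longrightarrow> poly (p :: nat poly) m \<le> poly p n"
  by (induction p) (auto intro!: add_mono mult_mono)

text \<open>Induction upwards from the loop register. Once the registers below \<open>r'\<close> are
  bounded during the entire loop, each round adds a bounded amount to \<open>r'\<close>. The list
  \<open>xs\<close> is arbitrary so that the bound is available after every prefix of the
  rounds.\<close>

lemma fold_length_bound:
  fixes G :: "nat poly"
  assumes wf: "wf_prog k S (For r b) A" and S: "3 \<le> S"
    and G: "\<And>s \<sigma> r' n. 0 < s \<Longrightarrow> s < S \<Longrightarrow> valid S \<sigma> \<Longrightarrow> (\<And>r''. r'' < r' \<Longrightarrow> length (\<sigma> r'') \<le> n) \<Longrightarrow>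
      length (eval (b s) \<sigma> r') \<le> length (\<sigma> r') + poly G n"
  shows "\<exists>H. \<forall>xs \<sigma> q n. valid S \<sigma> \<longrightarrow> set xs \<subseteq> {0<..<S} \<longrightarrow> length xs \<le> n \<longrightarrow>
      (\<forall>r' < q. length (\<sigma> r') \<le> n) \<longrightarrow>
      (\<forall>r' < q. r' \<le> r + d \<longrightarrow> length (fold (\<lambda>s. eval (b s)) xs \<sigma> r') \<le> poly H n)"
proof (induction d)
  case 0
  show ?case
  proof (intro exI[of _ "[:0, 1:]"] allI impI)
    fix xs \<sigma> q n r'
    assume h: "valid S \<sigma>" "set xs \<subseteq> {0<..<S}" "\<forall>r' < q. length (\<sigma> r') \<le> n" "r' < q" "r' \<le> r + 0"
    have "valid S (fold (\<lambda>s. eval (b s)) xs \<sigma>) \<and> fold (\<lambda>s. eval (b s)) xs \<sigma> r' = \<sigma> r'"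
    proof (rule fold_invariant'[where P = "\<lambda>\<tau>. valid S \<tau> \<and> \<tau> r' = \<sigma> r'"])
      fix s \<tau> assume s: "s \<in> set xs" and t: "valid S \<tau> \<and> \<tau> r' = \<sigma> r'"
      then have w: "wf_prog k S (b s) (insert r A)" using wf h by auto
      show "valid S (eval (b s) \<tau>) \<and> eval (b s) \<tau> r' = \<sigma> r'"
        using eval_unmodified[OF w _ S, of \<tau> r'] valid_eval[OF S w] t h by auto
    qed (use h in auto)
    then show "length (fold (\<lambda>s. eval (b s)) xs \<sigma> r') \<le> poly [:0, 1:] n" using h by simp
  qed
next
  case (Suc d)
  then obtain H where H: "\<And>xs \<sigma> q n r'. valid S \<sigma> \<Longrightarrow> set xs \<subseteq> {0<..<S} \<Longrightarrow> length xs \<le> n \<Longrightarrow>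
      (\<forall>r' < q. length (\<sigma> r') \<le> n) \<Longrightarrow> r' < q \<Longrightarrow> r' \<le> r + d \<Longrightarrow>
      length (fold (\<lambda>s. eval (b s)) xs \<sigma> r') \<le> poly H n" by metis
  \<comment> \<open>The old bound, the initial length, and the number of rounds times the growth in
    one round.\<close>
  let ?H = "H + [:0, 1:] + [:0, 1:] * pcompose G H"
  show ?case
  proof (intro exI[of _ ?H] allI impI)
    fix xs \<sigma> q n r'
    assume h: "valid S \<sigma>" "set xs \<subseteq> {0<..<S}" "length xs \<le> n" "\<forall>r' < q. length (\<sigma> r') \<le> n"
      "r' < q" "r' \<le> r + Suc d"
    let ?f = "\<lambda>xs. fold (\<lambda>s. eval (b s)) xs \<sigma>"
    show "length (?f xs r') \<le> poly ?H n"
    proof (cases "r' \<le> r + d")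
      case True
      then show ?thesis using H[OF h(1-5)] by (simp add: trans_le_add1)
    next
      case False
      have "valid S (?f xs) \<and> length (?f xs r') \<le> length (\<sigma> r') + length xs * poly G (poly H n)"
        using h(2,3)
      proof (induction xs rule: rev_induct)
        case Nil
        then show ?case using h(1) by simp
      next
        case (snoc s xs)
        then have IH: "valid S (?f xs)" "length (?f xs r') \<le> length (\<sigma> r') + length xs * poly G (poly H n)"
          by auto
        have s: "0 < s" "s < S" using snoc.prems by auto
        have w: "wf_prog k S (b s) (insert r A)" using wf s by auto
        have "length (eval (b s) (?f xs) r') \<le> length (?f xs r') + poly G (poly H n)"
        proof (rule G[OF s IH(1)])
          fix r'' assume "r'' < r'"
          then show "length (?f xs r'') \<le> poly H n"
            using H[OF h(1) _ _ h(4), of xs r''] snoc.prems h False by auto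
        qed
        then show ?case using IH valid_eval[OF S w] by simp
      qed
      then have "length (?f xs r') \<le> n + length xs * poly G (poly H n)" using h(4,5) by fastforce
      also have "\<dots> \<le> n + n * poly G (poly H n)" using h(3) by simp
      finally show ?thesis by (simp add: poly_pcompose)
    qed
  qed
qed

text \<open>The body of a loop varies with the symbol; since there are finitely many symbols, the
  polynomials for all of them can be added.\<close>

lemma uniform_poly_bound:
  assumes "\<And>s :: nat. 0 < s \<Longrightarrow> s < S \<Longrightarrow> \<exists>G :: nat poly. Q s G"
    and mono: "\<And>s G G'. Q s G \<Longrightarrow> Q s (G + G')"
  shows "\<exists>G. \<forall>s. 0 < s \<longrightarrow> s < S \<longrightarrow> Q s G"
proof -
  have "\<exists>G. \<forall>s. 0 < s \<longrightarrow> s < T \<longrightarrow> Q s G" if "T \<le> S" for T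
    using that
  proof (induction T)
    case (Suc T)
    then obtain G where G: "\<And>s. 0 < s \<Longrightarrow> s < T \<Longrightarrow> Q s G" by auto
    obtain G' where "0 < T \<Longrightarrow> Q T G'" using assms(1)[of T] Suc.prems by auto
    then show ?case using mono[OF G, of _ G'] mono[of T G' G]
      by (intro exI[of _ "G + G'"]) (auto simp: less_Suc_eq add.commute)
  qed auto
  then show ?thesis by blast
qed

text \<open>The form is what makes the induction work: growth is additive and depends on lower
  registers only. A multiplicative bound would become exponential in a loop.\<close>

lemma growth_bound:
  assumes S: "3 \<le> S" and "wf_prog k S p A"
  shows "\<exists>G :: nat poly. \<forall>\<sigma> r n. valid S \<sigma> \<longrightarrow> (\<forall>r' < r. length (\<sigma> r') \<le> n) \<longrightarrow>
    length (eval p \<sigma> r) \<le> length (\<sigma> r) + poly G n"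
  using assms(2)
proof (induction p arbitrary: A)
  case Skip
  then show ?case by auto
next
  case (Append q s)
  show ?case by (intro exI[of _ "[:1:]"]) auto
next
  case (Pop q)
  show ?case by auto
next
  case (Inc q)
  show ?case using length_inc_digits by (intro exI[of _ "[:1:]"]) auto
next
  case (Seq p1 p2)
  then obtain G1 G2 :: "nat poly" where G:
    "\<And>\<sigma> r n. valid S \<sigma> \<Longrightarrow> (\<forall>r' < r. length (\<sigma> r') \<le> n) \<Longrightarrow> length (eval p1 \<sigma> r) \<le> length (\<sigma> r) + poly G1 n"
    "\<And>\<sigma> r n. valid S \<sigma> \<Longrightarrow> (\<forall>r' < r. length (\<sigma> r') \<le> n) \<Longrightarrow> length (eval p2 \<sigma> r) \<le> length (\<sigma> r) + poly G2 n"
    by (metis wf_prog.simps(5))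
  show ?case
  proof (intro exI[of _ "G1 + pcompose G2 ([:0, 1:] + G1)"] allI impI)
    fix \<sigma> r n assume h: "valid S \<sigma>" "\<forall>r' < r. length (\<sigma> r') \<le> n"
    have v: "valid S (eval p1 \<sigma>)" using valid_eval[OF S] Seq.prems h(1) by auto
    have "\<forall>r' < r. length (eval p1 \<sigma> r') \<le> n + poly G1 n"
    proof (intro allI impI)
      fix r' assume "r' < r"
      then show "length (eval p1 \<sigma> r') \<le> n + poly G1 n"
        using G(1)[OF h(1), of r' n] h(2) by (meson add_le_mono1 le_trans less_trans)
    qed
    then have "length (eval p2 (eval p1 \<sigma>) r) \<le> length (eval p1 \<sigma> r) + poly G2 (n + poly G1 n)"
      by (rule G(2)[OF v])
    then show "length (eval (Seq p1 p2) \<sigma> r) \<le> length (\<sigma> r) + poly (G1 + pcompose G2 ([:0, 1:] + G1)) n"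
      using G(1)[OF h] by (simp add: poly_pcompose)
  qed
next
  case (For r b)
  let ?Q = "\<lambda>s G. \<forall>\<sigma> r n. valid S \<sigma> \<longrightarrow> (\<forall>r' < r. length (\<sigma> r') \<le> n) \<longrightarrow>
    length (eval (b s) \<sigma> r) \<le> length (\<sigma> r) + poly G n"
  have "\<exists>G. \<forall>s. 0 < s \<longrightarrow> s < S \<longrightarrow> ?Q s G"
  proof (rule uniform_poly_bound)
    fix s assume "0 < s" "s < S"
    then show "\<exists>G. ?Q s G" using For.IH[of "b s" "insert r A"] For.prems by auto
  next
    fix s and G G' :: "nat poly" assume "?Q s G" then show "?Q s (G + G')"
      by (simp add: add.assoc[symmetric] trans_le_add1)
  qed
  then obtain G :: "nat poly" where G: "\<And>s \<sigma> r' n. 0 < s \<Longrightarrow> s < S \<Longrightarrow> valid S \<sigma> \<Longrightarrow>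
      (\<And>r''. r'' < r' \<Longrightarrow> length (\<sigma> r'') \<le> n) \<Longrightarrow> length (eval (b s) \<sigma> r') \<le> length (\<sigma> r') + poly G n"
    by metis
  have "\<exists>H. \<forall>xs \<sigma> q n. valid S \<sigma> \<longrightarrow> set xs \<subseteq> {0<..<S} \<longrightarrow> length xs \<le> n \<longrightarrow>
      (\<forall>r' < q. length (\<sigma> r') \<le> n) \<longrightarrow>
      (\<forall>r' < q. r' \<le> r + k \<longrightarrow> length (fold (\<lambda>s. eval (b s)) xs \<sigma> r') \<le> poly H n)"
    by (rule fold_length_bound[OF For.prems S]) (rule G)
  then obtain H where H: "\<And>xs \<sigma> q n r'. valid S \<sigma> \<Longrightarrow> set xs \<subseteq> {0<..<S} \<Longrightarrow> length xs \<le> n \<Longrightarrow>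
      (\<forall>r' < q. length (\<sigma> r') \<le> n) \<Longrightarrow> r' < q \<Longrightarrow> r' \<le> r + k \<Longrightarrow>
      length (fold (\<lambda>s. eval (b s)) xs \<sigma> r') \<le> poly H n"
    by metis
  show ?case
  proof (intro exI[of _ "[:0, 1:] * pcompose G H"] allI impI)
    fix \<sigma> q n assume h: "valid S \<sigma>" "\<forall>r' < q. length (\<sigma> r') \<le> n"
    show "length (eval (For r b) \<sigma> q) \<le> length (\<sigma> q) + poly ([:0, 1:] * pcompose G H) n"
    proof (cases "q \<le> r \<or> k \<le> q")
      case True
      then have "eval (For r b) \<sigma> q = \<sigma> q"
      proof
        assume "k \<le> q" then show ?thesis using eval_unmodified[OF For.prems h(1) S] by blast
      next
        assume q: "q \<le> r"
        have "valid S (fold (\<lambda>s. eval (b s)) (\<sigma> r) \<sigma>) \<and> fold (\<lambda>s. eval (b s)) (\<sigma> r) \<sigma> q = \<sigma> q"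
        proof (rule fold_invariant'[where P = "\<lambda>\<tau>. valid S \<tau> \<and> \<tau> q = \<sigma> q"])
          fix s \<tau> assume s: "s \<in> set (\<sigma> r)" and t: "valid S \<tau> \<and> \<tau> q = \<sigma> q"
          then have w: "wf_prog k S (b s) (insert r A)" using For.prems h(1) by (auto simp: valid_def)
          show "valid S (eval (b s) \<tau>) \<and> eval (b s) \<tau> q = \<sigma> q"
            using eval_unmodified[OF w _ S, of \<tau> q] valid_eval[OF S w] t q by auto
        qed (use h in auto)
        then show ?thesis by simp
      qed
      then show ?thesis by simp
    next
      case False
      let ?f = "\<lambda>xs. fold (\<lambda>s. eval (b s)) xs \<sigma>"
      have "valid S (?f xs) \<and> length (?f xs q) \<le> length (\<sigma> q) + length xs * poly G (poly H n)"
        if "set xs \<subseteq> {0<..<S}" "length xs \<le> n" for xs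
        using that
      proof (induction xs rule: rev_induct)
        case Nil
        then show ?case using h(1) by simp
      next
        case (snoc s xs)
        then have IH: "valid S (?f xs)" "length (?f xs q) \<le> length (\<sigma> q) + length xs * poly G (poly H n)"
          by auto
        have s: "0 < s" "s < S" using snoc.prems by auto
        have w: "wf_prog k S (b s) (insert r A)" using For.prems s by auto
        have "length (eval (b s) (?f xs) q) \<le> length (?f xs q) + poly G (poly H n)"
        proof (rule G[OF s IH(1)])
          fix r'' assume "r'' < q"
          then show "length (?f xs r'') \<le> poly H n"
            using H[OF h(1) _ _ h(2), of xs r''] snoc.prems False by auto
        qed
        then show ?case using IH valid_eval[OF S w] by simp
      qed
      moreover have "set (\<sigma> r) \<subseteq> {0<..<S}" using h(1) by (auto simp: valid_def)
      moreover have lr: "length (\<sigma> r) \<le> n" using h(2) False by auto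
      ultimately have "length (eval (For r b) \<sigma> q) \<le> length (\<sigma> q) + length (\<sigma> r) * poly G (poly H n)"
        by auto
      also have "\<dots> \<le> length (\<sigma> q) + n * poly G (poly H n)" using lr by simp
      finally show ?thesis by (simp add: poly_pcompose)
    qed
  qed
qed

text \<open>Register lengths stay polynomial in every round by \<open>fold_length_bound\<close>, so
  a loop costs polynomially many rounds of polynomial time.\<close>

lemma steps_bound:
  assumes S: "3 \<le> S" and "wf_prog k S p A"
  shows "\<exists>H :: nat poly. \<forall>\<sigma> n. valid S \<sigma> \<longrightarrow> (\<forall>r < k. length (\<sigma> r) \<le> n) \<longrightarrow> steps p \<sigma> \<le> poly H n"
  using assms(2)
proof (induction p arbitrary: A)
  case (Append q s)
  show ?case by (intro exI[of _ "[:1:]"]) auto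
next
  case (Pop q)
  show ?case by (intro exI[of _ "[:2:]"]) auto
next
  case (Inc q)
  have "length xs + 3 + length (inc_digits xs) \<le> poly [:4, 2:] n" if "length xs \<le> n" for n xs
    using length_inc_digits[of xs] that by simp
  then show ?case using Inc by (intro exI[of _ "[:4, 2:]"]) auto
next
  case (Seq p1 p2)
  then have w: "wf_prog k S p1 A" "wf_prog k S p2 A" by auto
  obtain H1 H2 :: "nat poly" where H:
    "\<And>\<sigma> n. valid S \<sigma> \<Longrightarrow> (\<forall>r < k. length (\<sigma> r) \<le> n) \<Longrightarrow> steps p1 \<sigma> \<le> poly H1 n"
    "\<And>\<sigma> n. valid S \<sigma> \<Longrightarrow> (\<forall>r < k. length (\<sigma> r) \<le> n) \<Longrightarrow> steps p2 \<sigma> \<le> poly H2 n"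
    using Seq.IH w by metis
  obtain G :: "nat poly" where G: "\<And>\<sigma> r n. valid S \<sigma> \<Longrightarrow> (\<forall>r' < r. length (\<sigma> r') \<le> n) \<Longrightarrow>
      length (eval p1 \<sigma> r) \<le> length (\<sigma> r) + poly G n"
    using growth_bound[OF S w(1)] by metis
  show ?case
  proof (intro exI[of _ "H1 + pcompose H2 ([:0, 1:] + G)"] allI impI)
    fix \<sigma> n assume h: "valid S \<sigma>" "\<forall>r < k. length (\<sigma> r) \<le> n"
    have "\<forall>r < k. length (eval p1 \<sigma> r) \<le> n + poly G n"
    proof (intro allI impI)
      fix r assume "r < k"
      then have "length (eval p1 \<sigma> r) \<le> length (\<sigma> r) + poly G n" using G[OF h(1), of r n] h(2) by auto
      then show "length (eval p1 \<sigma> r) \<le> n + poly G n" using h(2) \<open>r < k\<close> by (meson add_le_mono1 le_trans)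
    qed
    then have "steps p2 (eval p1 \<sigma>) \<le> poly H2 (n + poly G n)"
      by (rule H(2)[OF valid_eval[OF S w(1) h(1)]])
    then show "steps (Seq p1 p2) \<sigma> \<le> poly (H1 + pcompose H2 ([:0, 1:] + G)) n"
      using H(1)[OF h] by (simp add: poly_pcompose)
  qed
next
  case (For r b)
  let ?Q = "\<lambda>s G. \<forall>\<sigma> n. valid S \<sigma> \<longrightarrow> (\<forall>r < k. length (\<sigma> r) \<le> n) \<longrightarrow> steps (b s) \<sigma> \<le> poly G n"
  have "\<exists>G. \<forall>s. 0 < s \<longrightarrow> s < S \<longrightarrow> ?Q s G"
  proof (rule uniform_poly_bound)
    fix s assume "0 < s" "s < S"
    then show "\<exists>G. ?Q s G" using For.IH[of "b s" "insert r A"] For.prems by auto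
  qed (simp add: trans_le_add1)
  then obtain T :: "nat poly" where T: "\<And>s \<sigma> n. 0 < s \<Longrightarrow> s < S \<Longrightarrow> valid S \<sigma> \<Longrightarrow>
      (\<forall>r < k. length (\<sigma> r) \<le> n) \<Longrightarrow> steps (b s) \<sigma> \<le> poly T n" by metis
  let ?Q' = "\<lambda>s G. \<forall>\<sigma> r n. valid S \<sigma> \<longrightarrow> (\<forall>r' < r. length (\<sigma> r') \<le> n) \<longrightarrow>
    length (eval (b s) \<sigma> r) \<le> length (\<sigma> r) + poly G n"
  have "\<exists>G. \<forall>s. 0 < s \<longrightarrow> s < S \<longrightarrow> ?Q' s G"
  proof (rule uniform_poly_bound)
    fix s assume "0 < s" "s < S"
    then show "\<exists>G. ?Q' s G" using growth_bound[OF S, of k "b s" "insert r A"] For.prems by auto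
  next
    fix s and G G' :: "nat poly" assume "?Q' s G" then show "?Q' s (G + G')"
      by (simp add: add.assoc[symmetric] trans_le_add1)
  qed
  then obtain G :: "nat poly" where G: "\<And>s \<sigma> r' n. 0 < s \<Longrightarrow> s < S \<Longrightarrow> valid S \<sigma> \<Longrightarrow>
      (\<And>r''. r'' < r' \<Longrightarrow> length (\<sigma> r'') \<le> n) \<Longrightarrow> length (eval (b s) \<sigma> r') \<le> length (\<sigma> r') + poly G n"
    by metis
  have "\<exists>H. \<forall>xs \<sigma> q n. valid S \<sigma> \<longrightarrow> set xs \<subseteq> {0<..<S} \<longrightarrow> length xs \<le> n \<longrightarrow>
      (\<forall>r' < q. length (\<sigma> r') \<le> n) \<longrightarrow>
      (\<forall>r' < q. r' \<le> r + k \<longrightarrow> length (fold (\<lambda>s. eval (b s)) xs \<sigma> r') \<le> poly H n)"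
    by (rule fold_length_bound[OF For.prems S]) (rule G)
  then obtain H where H: "\<And>xs \<sigma> q n r'. valid S \<sigma> \<Longrightarrow> set xs \<subseteq> {0<..<S} \<Longrightarrow> length xs \<le> n \<Longrightarrow>
      (\<forall>r' < q. length (\<sigma> r') \<le> n) \<Longrightarrow> r' < q \<Longrightarrow> r' \<le> r + k \<Longrightarrow>
      length (fold (\<lambda>s. eval (b s)) xs \<sigma> r') \<le> poly H n"
    by metis
  show ?case
  proof (intro exI[of _ "[:3, 1:] + [:0, 1:] * ([:2:] + pcompose T H)"] allI impI)
    fix \<sigma> n assume h: "valid S \<sigma>" "\<forall>r < k. length (\<sigma> r) \<le> n"
    let ?f = "\<lambda>xs. fold (\<lambda>s. eval (b s)) xs \<sigma>"
    \<comment> \<open>The remaining rounds \<open>ys\<close> are counted from the store reached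
      after the rounds \<open>xs\<close>; the length bound refers to the store before the
      loop.\<close>
    have "fold_steps (\<lambda>s. eval (b s)) (\<lambda>s. steps (b s)) ys (?f xs) \<le> length ys * (2 + poly T (poly H n))"
      if "set (xs @ ys) \<subseteq> {0<..<S}" "length (xs @ ys) \<le> n" for xs ys
      using that
    proof (induction ys arbitrary: xs)
      case (Cons s ys)
      have s: "0 < s" "s < S" using Cons.prems by auto
      have v: "valid S (?f xs)"
      proof (rule fold_invariant'[of "valid S"])
        fix s \<tau> assume "s \<in> set xs" "valid S \<tau>"
        then show "valid S (eval (b s) \<tau>)"
          using valid_eval[OF S, of k "b s" "insert r A"] For.prems Cons.prems by auto
      qed (rule h)
      have "steps (b s) (?f xs) \<le> poly T (poly H n)"
        using T[OF s v] H[OF h(1) _ _ h(2), of xs] Cons.prems by auto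
      then show ?case using Cons.IH[of "xs @ [s]"] Cons.prems by simp
    qed simp
    moreover have "set (\<sigma> r) \<subseteq> {0<..<S}" using h(1) by (auto simp: valid_def)
    ultimately have "fold_steps (\<lambda>s. eval (b s)) (\<lambda>s. steps (b s)) (\<sigma> r) \<sigma> \<le> length (\<sigma> r) * (2 + poly T (poly H n))"
      using h(2) For.prems by (metis append_Nil fold_simps(1) wf_prog.simps(6))
    also have "\<dots> \<le> n * (2 + poly T (poly H n))"
      by (rule mult_le_mono1) (use h For.prems in simp)
    finally have "steps (For r b) \<sigma> \<le> length (\<sigma> r) + 3 + n * (2 + poly T (poly H n))" by simp
    moreover have "length (\<sigma> r) \<le> n" using h For.prems by simp
    ultimately show "steps (For r b) \<sigma> \<le> poly ([:3, 1:] + [:0, 1:] * ([:2:] + pcompose T H)) n"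
      by (simp add: poly_pcompose)
  qed
qed auto

section \<open>Compiling loop programs to Turing machines\<close>

primrec psize :: "nat \<Rightarrow> prog \<Rightarrow> nat" where
  "psize S Skip = 0"
| "psize S (Append r s) = 1"
| "psize S (Pop r) = 2"
| "psize S (Inc r) = 4"
| "psize S (Seq a b) = psize S a + psize S b"
| "psize S (For r b) = 3 + (\<Sum>i < S - 1. psize S (b (Suc i)) + 1)"

text \<open>Three control states come first; then each symbol has the code of its body and one more
  state that moves to the next symbol. Block \<open>n\<close> belongs to symbol
  \<open>n + 1\<close>.\<close>

definition block_start :: "nat \<Rightarrow> (nat \<Rightarrow> prog) \<Rightarrow> nat \<Rightarrow> nat" where
  "block_start S b n = 3 + (\<Sum>i < n. psize S (b (Suc i)) + 1)"

type_synonym instr = "nat \<times> (nat \<Rightarrow> nat \<times> nat \<times> direction)"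

definition relocate :: "nat \<Rightarrow> instr \<Rightarrow> instr" where
  "relocate a I = (fst I, \<lambda>x. let (q, w, d) = snd I x in (a + q, w, d))"

text \<open>
  An instruction names the tape it works on and maps the symbol read there to the next state,
  the symbol written and the head move. Idle heads stand on the blank behind the contents of their
  tape; a loop rewinds its tape and has passed over it completely when it ends.
\<close>

primrec code :: "nat \<Rightarrow> prog \<Rightarrow> nat \<Rightarrow> instr" where
  "code S Skip = (\<lambda>pc. (0, \<lambda>x. (0, x, Stay)))"
| "code S (Append r s) = (\<lambda>pc. (r, \<lambda>x. (1, s, Go_Right)))"
| "code S (Pop r) = (\<lambda>pc. if pc = 0 then (r, \<lambda>x. (1, x, Go_Left))
     else (r, \<lambda>x. if x = 0 then (2, 0, Go_Right) else (2, 0, Stay)))"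
| "code S (Inc r) = (\<lambda>pc. if pc = 0 then (r, \<lambda>x. (1, x, Go_Left))
     else if pc = 1 then (r, \<lambda>x. if x = 0 then (2, 0, Go_Right) else (1, x, Go_Left))
     else if pc = 2 then (r, \<lambda>x. if x = 2 then (2, 1, Go_Right) else (3, 2, Go_Right))
     else (r, \<lambda>x. if x = 0 then (4, 0, Stay) else (3, x, Go_Right)))"
| "code S (Seq a b) = (\<lambda>pc. if pc < psize S a then code S a pc
     else relocate (psize S a) (code S b (pc - psize S a)))"
| "code S (For r b) = (\<lambda>pc. if pc = 0 then (r, \<lambda>x. (1, x, Go_Left))
     else if pc = 1 then (r, \<lambda>x. if x = 0 then (2, 0, Go_Right) else (1, x, Go_Left))
     else if pc = 2 then (r, \<lambda>x. (block_start S b (if x = 0 then S - 1 else x - 1), x, Stay))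
     else let i = (LEAST i. pc < block_start S b (Suc i)) in
       if pc = block_start S b i + psize S (b (Suc i)) then (r, \<lambda>x. (2, x, Go_Right))
       else relocate (block_start S b i) (code S (b (Suc i)) (pc - block_start S b i)))"

lemma psize_For: "psize S (For r b) = block_start S b (S - 1)"
  by (simp add: block_start_def)

lemma block_start_Suc: "block_start S b (Suc n) = block_start S b n + psize S (b (Suc n)) + 1"
  by (simp add: block_start_def)

lemma block_start_mono: "m \<le> n \<Longrightarrow> block_start S b m \<le> block_start S b n"
  unfolding block_start_def by (intro add_left_mono sum_mono2) auto

text \<open>Identifies the block that \<open>code\<close> selects by \<open>LEAST\<close> for a
  given program counter.\<close>

lemma Least_block:
  assumes "block_start S b i \<le> pc" "pc < block_start S b (Suc i)"
  shows "(LEAST i. pc < block_start S b (Suc i)) = i"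
proof (rule Least_equality)
  fix j assume "pc < block_start S b (Suc j)"
  then show "i \<le> j" using assms(1) block_start_mono[of "Suc j" i] by (metis leI le_trans not_less Suc_leI)
qed (rule assms)

lemma block_cases:
  assumes "3 \<le> pc" "pc < block_start S b n"
  obtains i where "i < n" "block_start S b i \<le> pc" "pc < block_start S b (Suc i)"
proof -
  have "\<exists>i < n. block_start S b i \<le> pc \<and> pc < block_start S b (Suc i)"
    using assms(2)
  proof (induction n)
    case 0
    then show ?case using assms(1) by (simp add: block_start_def)
  next
    case (Suc n)
    then show ?case by (metis less_Suc_eq linorder_not_le)
  qed
  then show ?thesis using that by blast
qed

lemma code_block:
  assumes "j \<le> psize S (b (Suc i))"
  shows "code S (For r b) (block_start S b i + j) = (if j = psize S (b (Suc i)) then (r, \<lambda>x. (2, x, Go_Right))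
    else relocate (block_start S b i) (code S (b (Suc i)) j))"
proof -
  define pc where "pc = block_start S b i + j"
  have "(LEAST i. pc < block_start S b (Suc i)) = i"
    by (rule Least_block) (use assms in \<open>auto simp: pc_def block_start_Suc\<close>)
  moreover have "pc \<noteq> 0" "pc \<noteq> 1" "pc \<noteq> 2" by (auto simp: pc_def block_start_def)
  ultimately have "code S (For r b) pc = (if pc = block_start S b i + psize S (b (Suc i)) then (r, \<lambda>x. (2, x, Go_Right))
    else relocate (block_start S b i) (code S (b (Suc i)) (pc - block_start S b i)))"
    by (simp add: Let_def del: psize.simps)
  then show ?thesis by (simp add: pc_def del: psize.simps code.simps)
qed

lemma code_wf:
  assumes "3 \<le> S" "wf_prog k S p A" "pc < psize S p" "x < S"
  shows "fst (code S p pc) < k \<and> fst (snd (code S p pc) x) \<le> psize S p \<and> fst (snd (snd (code S p pc) x)) < S"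
  using assms(2,3)
proof (induction p arbitrary: A pc)
  case (Seq p1 p2)
  show ?case
  proof (cases "pc < psize S p1")
    case True
    then show ?thesis using Seq.IH(1)[of A pc] Seq.prems by auto
  next
    case False
    then show ?thesis using Seq.IH(2)[of A "pc - psize S p1"] Seq.prems
      by (auto simp: relocate_def split: prod.splits)
  qed
next
  case (For r b)
  have small: "block_start S b (if x = 0 then S - 1 else x - 1) \<le> psize S (For r b)"
    "3 \<le> psize S (For r b)"
    unfolding psize_For using assms(4) by (auto intro: block_start_mono) (simp add: block_start_def)
  consider "pc = 0 \<or> pc = 1" | "pc = 2" | "3 \<le> pc" by linarith
  then show ?case
  proof cases
    case 1
    then show ?thesis using For.prems(1) assms(1,4) by auto
  next
    case 2
    then show ?thesis using small(1) For.prems(1) assms(4) by (simp del: psize.simps)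
  next
    case 3
    then obtain i where i: "i < S - 1" "block_start S b i \<le> pc" "pc < block_start S b (Suc i)"
      using For.prems(2) block_cases unfolding psize_For by metis
    have le: "block_start S b (Suc i) \<le> psize S (For r b)"
      unfolding psize_For using i(1) by (intro block_start_mono) auto
    have w: "wf_prog k S (b (Suc i)) (insert r A)" using For.prems(1) i(1) by auto
    show ?thesis
    proof (cases "pc = block_start S b i + psize S (b (Suc i))")
      case True
      then show ?thesis using 3 small(2) For.prems(1) assms(4) Least_block[OF i(2,3)]
        by (simp add: Let_def del: psize.simps)
    next
      case False
      then have *: "pc - block_start S b i < psize S (b (Suc i))" using i by (simp add: block_start_Suc)
      have "code S (For r b) pc = relocate (block_start S b i) (code S (b (Suc i)) (pc - block_start S b i))"
        using 3 False by (simp add: Let_def Least_block[OF i(2,3)] del: psize.simps)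
      with For.IH[OF _ w *] le[unfolded block_start_Suc] show ?thesis
        by (simp add: relocate_def split_beta del: psize.simps code.simps)
    qed
  qed
qed (use assms in \<open>auto split: if_splits\<close>)

section \<open>Tapes, head positions and runs of the compiled machine\<close>

definition contents :: "nat list \<Rightarrow> int \<Rightarrow> nat" where
  "contents xs i = (if 0 \<le> i \<and> i < int (length xs) then xs ! nat i else 0)"

lemma contents_nth [simp]: "n < length xs \<Longrightarrow> contents xs (int n) = xs ! n"
  by (simp add: contents_def)

lemma contents_length [simp]: "contents xs (int (length xs)) = 0"
  by (simp add: contents_def)

lemma contents_neg [simp]: "i < 0 \<Longrightarrow> contents xs i = 0"
  by (simp add: contents_def)

lemma contents_append: "(contents xs)(int (length xs) := s) = contents (xs @ [s])"
  by (rule ext) (auto simp: contents_def nth_append nat_less_iff)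

lemma contents_butlast: "xs \<noteq> [] \<Longrightarrow> (contents xs)(int (length xs) - 1 := 0) = contents (butlast xs)"
  by (rule ext) (auto simp: contents_def nth_butlast nat_less_iff)

lemma contents_update: "n < length xs \<Longrightarrow> (contents xs)(int n := s) = contents (xs[n := s])"
  by (rule ext) (auto simp: contents_def nth_list_update nat_less_iff)

definition conf :: "nat \<Rightarrow> nat \<Rightarrow> (nat \<Rightarrow> int) \<Rightarrow> (nat \<Rightarrow> int \<Rightarrow> nat) \<Rightarrow> nat \<times> tape list" where
  "conf k q h c = (q, map (\<lambda>r. (h r, c r)) [0..<k])"

text \<open>\<open>A\<close> holds the tapes of the loops in progress. Their head positions
  \<open>h\<close> are not determined by the store, in contrast to those of the idle tapes.\<close>

definition head_pos :: "nat set \<Rightarrow> (nat \<Rightarrow> int) \<Rightarrow> store \<Rightarrow> nat \<Rightarrow> int" where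
  "head_pos A h \<sigma> r = (if r \<in> A then h r else int (length (\<sigma> r)))"

definition program_delta :: "nat \<Rightarrow> (nat \<Rightarrow> instr) \<Rightarrow> nat \<Rightarrow> nat list \<Rightarrow> nat \<times> (nat \<times> direction) list" where
  "program_delta k I q ss = (let (r, f) = I q; (q', w, d) = f (ss ! r) in
     (q', map (\<lambda>i. if i = r then (w, d) else (ss ! i, Stay)) [0..<k]))"

locale machine =
  fixes k S :: nat and I :: "nat \<Rightarrow> instr" and Q :: nat
  assumes S3: "3 \<le> S"
begin

definition M :: turing_machine where
  "M = \<lparr>tapes = k, states = Q, symbols = S, delta = program_delta k I\<rparr>"

lemma tm_step_conf:
  assumes "q < Q" "I q = (r, f)" "r < k" "f (c r (h r)) = (q', w, d)"
  shows "tm_step M (conf k q h c) = conf k q' (h(r := h r + move d)) (c(r := (c r)(h r := w)))"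
proof -
  have "map2 act (map (\<lambda>i. if i = r then (w, d) else (map (\<lambda>(h, c). c h) (map (\<lambda>r. (h r, c r)) [0..<k]) ! i, Stay)) [0..<k])
      (map (\<lambda>r. (h r, c r)) [0..<k]) =
    map (\<lambda>i. ((h(r := h r + move d)) i, (c(r := (c r)(h r := w))) i)) [0..<k]"
    by (rule nth_equalityI) (auto simp: act_move move_def)
  then show ?thesis
    using assms by (simp add: tm_step_def conf_def M_def program_delta_def Let_def)
qed

definition run :: "nat \<Rightarrow> nat \<times> tape list \<Rightarrow> nat \<times> tape list \<Rightarrow> bool" where
  "run n x y \<longleftrightarrow> (tm_step M ^^ n) x = y"

lemma run_trans: "run m x y \<Longrightarrow> run n y z \<Longrightarrow> run (m + n) x z"
  unfolding run_def by (subst add.commute) (simp add: funpow_add)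

lemma run_step:
  assumes "q < Q" "I q = (r, f)" "r < k" "f (c r (h r)) = (q', w, d)"
  shows "run 1 (conf k q h c) (conf k q' (h(r := h r + move d)) (c(r := (c r)(h r := w))))"
  using tm_step_conf[where c = c and h = h, OF assms(1-3)] assms(4) by (simp add: run_def)

definition embedded :: "nat \<Rightarrow> prog \<Rightarrow> bool" where
  "embedded a p \<longleftrightarrow> a + psize S p \<le> Q \<and> (\<forall>pc < psize S p. I (a + pc) = relocate a (code S p pc))"

lemma rewind_loop:
  assumes "q < Q" "r < k" "I q = (r, \<lambda>x. if x = 0 then (q', 0, Go_Right) else (q, x, Go_Left))"
    and "c r = contents xs" "\<forall>x \<in> set xs. 0 < x" "n \<le> length xs" "h r = int n - 1"
  shows "run (n + 1) (conf k q h c) (conf k q' (h(r := 0)) c)"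
  using assms(6,7)
proof (induction n arbitrary: h)
  case 0
  then have "c r (h r) = 0" using assms(4) by simp
  from run_step[where c = c and h = h and w = 0 and d = Go_Right and q' = q', OF assms(1,3,2)] this 0
  have "run 1 (conf k q h c) (conf k q' (h(r := 0)) c)" by (simp add: move_def fun_upd_idem)
  then show ?case by (simp add: fun_upd_def)
next
  case (Suc n)
  then have x: "c r (h r) = xs ! n" "0 < xs ! n" using assms(4,5) by auto
  from run_step[where c = c and h = h and w = "xs ! n" and d = Go_Left and q' = q, OF assms(1,3,2)] x
  have "run 1 (conf k q h c) (conf k q (h(r := h r - 1)) c)" by (simp add: move_def fun_upd_idem)
  moreover have "run (n + 1) (conf k q (h(r := h r - 1)) c) (conf k q' (h(r := 0)) c)"
    using Suc.IH[of "h(r := h r - 1)"] Suc.prems by (simp add: fun_upd_def cong: if_cong)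
  ultimately show ?case using run_trans by (metis Suc_eq_plus1 add.commute)
qed

lemma forward_loop:
  assumes "q < Q" "r < k" "I q = (r, \<lambda>x. if x = 0 then (q', 0, Stay) else (q, x, Go_Right))"
    and "c r = contents xs" "\<forall>x \<in> set xs. 0 < x" "n \<le> length xs" "h r = int (length xs - n)"
  shows "run (n + 1) (conf k q h c) (conf k q' (h(r := int (length xs))) c)"
  using assms(6,7)
proof (induction n arbitrary: h)
  case 0
  then have "c r (h r) = 0" using assms(4) by simp
  from run_step[where c = c and h = h and w = 0 and d = Stay and q' = q', OF assms(1,3,2)] this 0
  have "run 1 (conf k q h c) (conf k q' (h(r := int (length xs))) c)" by (simp add: move_def fun_upd_idem)
  then show ?case by (simp add: fun_upd_def)
next
  case (Suc n)
  let ?m = "length xs - Suc n"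
  have m: "?m < length xs" using Suc.prems by simp
  have "c r (h r) = contents xs (int ?m)" using assms(4) Suc.prems(2) by (simp only:)
  then have x: "c r (h r) = xs ! ?m" "0 < xs ! ?m" using m assms(5) by auto
  from run_step[where c = c and h = h and w = "xs ! ?m" and d = Go_Right and q' = q, OF assms(1,3,2)] x
  have "run 1 (conf k q h c) (conf k q (h(r := h r + 1)) c)" by (simp add: move_def fun_upd_idem)
  moreover have "run (n + 1) (conf k q (h(r := h r + 1)) c) (conf k q' (h(r := int (length xs))) c)"
    using Suc.IH[of "h(r := h r + 1)"] Suc.prems by (simp add: fun_upd_def cong: if_cong)
  ultimately show ?case using run_trans by (metis Suc_eq_plus1 add.commute)
qed

text \<open>\<open>xs\<close> are the digits already passed. The blank behind the last digit is
  treated like a zero digit and overwritten by 2, which is how the numeral gets longer.\<close>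

lemma carry_loop:
  assumes "q < Q" "r < k" "I q = (r, \<lambda>x. if x = 2 then (q, 1, Go_Right) else (q', 2, Go_Right))"
    and "c r = contents (xs @ ys)" "h r = int (length xs)"
  shows "\<exists>n \<le> length (inc_digits ys). n \<noteq> 0 \<and> run n (conf k q h c)
    (conf k q' (h(r := int (length xs + n))) (c(r := contents (xs @ inc_digits ys))))"
  using assms(4,5)
proof (induction ys arbitrary: xs h c)
  case Nil
  then have "c r (h r) = 0" by simp
  from run_step[where c = c and h = h and w = 2 and d = Go_Right and q' = q', OF assms(1,3,2)] this Nil
  have "run 1 (conf k q h c) (conf k q' (h(r := int (length xs) + 1)) (c(r := contents (xs @ [2]))))"
    by (simp add: move_def contents_append[of xs])
  then show ?case by (intro exI[of _ 1]) (simp add: fun_upd_def add.commute)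
next
  case (Cons y ys)
  have y: "c r (h r) = y" using Cons.prems by (simp add: nth_append)
  have upd: "(contents (xs @ y # ys))(int (length xs) := z) = contents (xs @ z # ys)" for y z
    using contents_update[of "length xs" "xs @ y # ys" z] by simp
  show ?case
  proof (cases "y = 2")
    case True
    from run_step[where c = c and h = h and w = 1 and d = Go_Right and q' = q, OF assms(1,3,2)] y True Cons.prems
    have 1: "run 1 (conf k q h c) (conf k q (h(r := int (length xs) + 1)) (c(r := contents ((xs @ [1]) @ ys))))"
      by (simp add: move_def upd)
    obtain n where n: "n \<le> length (inc_digits ys)" "n \<noteq> 0"
      "run n (conf k q (h(r := int (length xs) + 1)) (c(r := contents ((xs @ [1]) @ ys))))
        (conf k q' (h(r := int (length (xs @ [1]) + n))) (c(r := contents ((xs @ [1]) @ inc_digits ys))))"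
      using Cons.IH[of "c(r := contents ((xs @ [1]) @ ys))" "xs @ [1]" "h(r := int (length xs) + 1)"]
      by (auto simp: fun_upd_def cong: if_cong)
    show ?thesis using run_trans[OF 1 n(3)] n(1) True by (intro exI[of _ "1 + n"]) (simp add: add.assoc fun_upd_def)
  next
    case False
    from run_step[where c = c and h = h and w = 2 and d = Go_Right and q' = q', OF assms(1,3,2)] y False Cons.prems
    have "run 1 (conf k q h c) (conf k q' (h(r := int (length xs) + 1)) (c(r := contents (xs @ 2 # ys))))"
      by (simp add: move_def upd)
    then show ?thesis using False by (intro exI[of _ 1]) (simp add: fun_upd_def add.commute)
  qed
qed

definition st :: "nat \<Rightarrow> nat set \<Rightarrow> (nat \<Rightarrow> int) \<Rightarrow> store \<Rightarrow> nat \<times> tape list" where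
  "st q A h \<sigma> = conf k q (head_pos A h \<sigma>) (\<lambda>r. contents (\<sigma> r))"

text \<open>\<open>A\<close> and \<open>h\<close> are generalised because a loop body runs while the
  head of the loop tape is in mid-tape; the body neither moves this head nor changes the contents
  below it.\<close>

lemma run_prog:
  assumes "embedded a p" "wf_prog k S p A" "valid S \<sigma>"
  shows "run (steps p \<sigma>) (st a A h \<sigma>) (st (a + psize S p) A h (eval p \<sigma>))"
  using assms
proof (induction p arbitrary: a A \<sigma> h)
  case Skip
  then show ?case by (simp add: run_def)
next
  case (Append r s)
  have I: "I a = (r, \<lambda>x. (a + 1, s, Go_Right))" "a < Q"
    using Append.prems by (auto simp: embedded_def relocate_def dest: spec[of _ 0])
  have "r \<notin> A" using Append.prems by auto
  then have "head_pos A h (\<sigma>(r := \<sigma> r @ [s])) = (head_pos A h \<sigma>)(r := head_pos A h \<sigma> r + 1)"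
    "(\<lambda>r'. contents ((\<sigma>(r := \<sigma> r @ [s])) r')) = (\<lambda>r. contents (\<sigma> r))(r := (contents (\<sigma> r))(head_pos A h \<sigma> r := s))"
    by (auto simp: head_pos_def contents_append)
  then show ?case
    using run_step[where c = "\<lambda>r. contents (\<sigma> r)" and h = "head_pos A h \<sigma>", OF I(2) I(1)] Append.prems
    unfolding st_def eval.simps steps.simps psize.simps by (simp add: move_def del: fun_upd_apply)
next
  case (Pop r)
  let ?h = "head_pos A h \<sigma>" and ?c = "\<lambda>r. contents (\<sigma> r)"
  have I: "I a = (r, \<lambda>x. (a + 1, x, Go_Left))"
      "I (a + 1) = (r, \<lambda>x. if x = 0 then (a + 2, 0, Go_Right) else (a + 2, 0, Stay))" "a + 1 < Q"
    using Pop.prems spec[of "\<lambda>pc. pc < 2 \<longrightarrow> I (a + pc) = relocate a (code S (Pop r) pc)" 0]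
      spec[of "\<lambda>pc. pc < 2 \<longrightarrow> I (a + pc) = relocate a (code S (Pop r) pc)" 1]
    by (auto simp: embedded_def relocate_def if_distrib cong: if_cong)
  have r: "r < k" "r \<notin> A" using Pop.prems by auto
  have hr: "?h r = int (length (\<sigma> r))" using r by (simp add: head_pos_def)
  have 1: "run 1 (conf k a ?h ?c) (conf k (a + 1) (?h(r := int (length (\<sigma> r)) - 1)) ?c)"
    using run_step[where c = ?c and h = ?h, OF _ I(1) r(1)] I(3) hr by (simp add: move_def fun_upd_idem)
  have "run 1 (conf k (a + 1) (?h(r := int (length (\<sigma> r)) - 1)) ?c)
    (conf k (a + 2) (head_pos A h (\<sigma>(r := butlast (\<sigma> r)))) (\<lambda>r'. contents ((\<sigma>(r := butlast (\<sigma> r))) r')))"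
  proof (cases "\<sigma> r = []")
    \<comment> \<open>The register is empty: the head has stepped onto the blank at position -1 and
      goes back to the right.\<close>
    case True
    then have "\<sigma>(r := butlast (\<sigma> r)) = \<sigma>" by auto
    then show ?thesis
      using run_step[where c = ?c and h = "?h(r := int (length (\<sigma> r)) - 1)", OF I(3,2) r(1)] True hr
      by (simp add: move_def fun_upd_idem)
  next
    case False
    let ?n = "length (\<sigma> r) - 1"
    have n: "int (length (\<sigma> r)) - 1 = int ?n" "?n < length (\<sigma> r)"
      using False by (cases "\<sigma> r"; simp)+
    have "\<sigma> r ! ?n \<in> set (\<sigma> r)" using n by simp
    then have "contents (\<sigma> r) (int (length (\<sigma> r)) - 1) \<noteq> 0"
      unfolding n(1) using n(2) Pop.prems(3) by (auto simp: valid_def simp del: nth_mem of_nat_diff)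
    moreover have "head_pos A h (\<sigma>(r := butlast (\<sigma> r))) = ?h(r := int (length (\<sigma> r)) - 1)"
    proof
      fix r'
      show "head_pos A h (\<sigma>(r := butlast (\<sigma> r))) r' = (?h(r := int (length (\<sigma> r)) - 1)) r'"
        using r(2) False by (cases "r' = r") (auto simp: head_pos_def of_nat_diff Suc_le_eq)
    qed
    moreover have "(\<lambda>r'. contents ((\<sigma>(r := butlast (\<sigma> r))) r')) =
        ?c(r := (?c r)(int (length (\<sigma> r)) - 1 := 0))"
      using contents_butlast[OF False] by auto
    ultimately show ?thesis
      using run_step[where c = ?c and h = "?h(r := int (length (\<sigma> r)) - 1)", OF I(3,2) r(1)] by (simp add: move_def)
  qed
  from run_trans[OF 1 this] show ?case by (simp add: st_def fun_upd_def numeral_2_eq_2)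
next
  case (Inc r)
  let ?h = "head_pos A h \<sigma>" and ?c = "\<lambda>r. contents (\<sigma> r)" and ?P = "\<lambda>pc. pc < 4 \<longrightarrow> I (a + pc) = relocate a (code S (Inc r) pc)"
  let ?n = "length (\<sigma> r)" and ?ys = "inc_digits (\<sigma> r)"
  have I: "I a = (r, \<lambda>x. (a + 1, x, Go_Left))"
      "I (a + 1) = (r, \<lambda>x. if x = 0 then (a + 2, 0, Go_Right) else (a + 1, x, Go_Left))"
      "I (a + 2) = (r, \<lambda>x. if x = 2 then (a + 2, 1, Go_Right) else (a + 3, 2, Go_Right))"
      "I (a + 3) = (r, \<lambda>x. if x = 0 then (a + 4, 0, Stay) else (a + 3, x, Go_Right))" "a + 3 < Q"
  proof -
    have P: "?P pc" for pc using Inc.prems(1) by (simp add: embedded_def)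
    show "I a = (r, \<lambda>x. (a + 1, x, Go_Left))" using P[of 0] by (simp add: relocate_def)
    show "I (a + 1) = (r, \<lambda>x. if x = 0 then (a + 2, 0, Go_Right) else (a + 1, x, Go_Left))"
      using P[of 1] by (auto simp: relocate_def)
    show "I (a + 2) = (r, \<lambda>x. if x = 2 then (a + 2, 1, Go_Right) else (a + 3, 2, Go_Right))"
      using P[of 2] by (auto simp: relocate_def)
    show "I (a + 3) = (r, \<lambda>x. if x = 0 then (a + 4, 0, Stay) else (a + 3, x, Go_Right))"
      using P[of 3] by (auto simp: relocate_def)
    show "a + 3 < Q" using Inc.prems(1) by (simp add: embedded_def)
  qed
  have r: "r < k" "r \<notin> A" using Inc.prems by auto
  have hr: "?h r = int ?n" using r by (simp add: head_pos_def)
  have pos: "\<forall>x \<in> set (\<sigma> r). 0 < x" using Inc.prems by (auto simp: valid_def)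
  then have pos': "\<forall>x \<in> set ?ys. 0 < x" using set_inc_digits[of "\<sigma> r"] by fastforce
  have 1: "run 1 (conf k a ?h ?c) (conf k (a + 1) (?h(r := int ?n - 1)) ?c)"
    using run_step[where c = ?c and h = ?h, OF _ I(1) r(1)] I(5) hr by (simp add: move_def fun_upd_idem)
  have 2: "run (?n + 1) (conf k (a + 1) (?h(r := int ?n - 1)) ?c) (conf k (a + 2) (?h(r := 0)) ?c)"
    using rewind_loop[OF _ r(1) I(2), of ?c "\<sigma> r" ?n "?h(r := int ?n - 1)"] I(5) pos by simp
  obtain m where m: "m \<le> length ?ys" "m \<noteq> 0"
    "run m (conf k (a + 2) (?h(r := 0)) ?c) (conf k (a + 3) (?h(r := int m)) (?c(r := contents ?ys)))"
    using carry_loop[OF _ r(1) I(3), of ?c "[]" "\<sigma> r" "?h(r := 0)"] I(5) by auto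
  have 4: "run (length ?ys - m + 1) (conf k (a + 3) (?h(r := int m)) (?c(r := contents ?ys)))
    (conf k (a + 4) (?h(r := int (length ?ys))) (?c(r := contents ?ys)))"
    using forward_loop[OF I(5) r(1) I(4), of "?c(r := contents ?ys)" ?ys "length ?ys - m" "?h(r := int m)"] m pos'
    by simp
  have "?h(r := int (length ?ys)) = head_pos A h (\<sigma>(r := ?ys))"
    "?c(r := contents ?ys) = (\<lambda>r'. contents ((\<sigma>(r := ?ys)) r'))" using r by (auto simp: head_pos_def)
  with run_trans[OF run_trans[OF run_trans[OF 1 2] m(3)] 4] m(1) show ?case
    unfolding st_def eval.simps steps.simps psize.simps
    by (simp add: numeral_3_eq_3 del: fun_upd_apply)
next
  case (Seq p1 p2)
  have e1: "embedded a p1" and e2: "embedded (a + psize S p1) p2"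
  proof -
    have P: "I (a + pc) = relocate a (code S (Seq p1 p2) pc)" if "pc < psize S p1 + psize S p2" for pc
      using Seq.prems(1) that by (simp add: embedded_def)
    show "embedded a p1" using Seq.prems(1) P by (auto simp: embedded_def)
    have "I (a + psize S p1 + pc) = relocate (a + psize S p1) (code S p2 pc)" if "pc < psize S p2" for pc
      using P[of "psize S p1 + pc"] that by (auto simp: relocate_def add.assoc split: prod.splits)
    then show "embedded (a + psize S p1) p2" using Seq.prems(1) by (auto simp: embedded_def)
  qed
  have w: "wf_prog k S p1 A" "wf_prog k S p2 A" using Seq.prems by auto
  show ?case
    using run_trans[OF Seq.IH(1)[OF e1 w(1) Seq.prems(3)] Seq.IH(2)[OF e2 w(2) valid_eval[OF S3 w(1) Seq.prems(3)]]]
    by (simp add: add.assoc)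
next
  case (For r b)
  let ?h = "head_pos A h \<sigma>" and ?c = "\<lambda>r. contents (\<sigma> r)" and ?n = "length (\<sigma> r)"
  let ?B = "\<lambda>i. a + block_start S b i"
  have P: "I (a + pc) = relocate a (code S (For r b) pc)" if "pc < psize S (For r b)" for pc
    using For.prems(1) that unfolding embedded_def by blast
  have sz: "a + psize S (For r b) \<le> Q" using For.prems(1) by (simp add: embedded_def)
  have I: "I a = (r, \<lambda>x. (a + 1, x, Go_Left))"
      "I (a + 1) = (r, \<lambda>x. if x = 0 then (a + 2, 0, Go_Right) else (a + 1, x, Go_Left))"
      "I (a + 2) = (r, \<lambda>x. (?B (if x = 0 then S - 1 else x - 1), x, Stay))" "a + 2 < Q"
  proof -
    show "I a = (r, \<lambda>x. (a + 1, x, Go_Left))" using P[of 0] by (simp add: relocate_def)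
    show "I (a + 1) = (r, \<lambda>x. if x = 0 then (a + 2, 0, Go_Right) else (a + 1, x, Go_Left))"
      using P[of 1] by (auto simp: relocate_def)
    show "I (a + 2) = (r, \<lambda>x. (?B (if x = 0 then S - 1 else x - 1), x, Stay))"
      using P[of 2] by (auto simp: relocate_def)
    show "a + 2 < Q" using sz by simp
  qed
  have r: "r < k" "r \<notin> A" using For.prems by auto
  have hr: "?h r = int ?n" using r by (simp add: head_pos_def)
  have pos: "\<forall>x \<in> set (\<sigma> r). 0 < x" using For.prems by (auto simp: valid_def)
  have 1: "run 1 (conf k a ?h ?c) (conf k (a + 1) (?h(r := int ?n - 1)) ?c)"
    using run_step[where c = ?c and h = ?h, OF _ I(1) r(1)] I(4) hr by (simp add: move_def fun_upd_idem)
  have 2: "run (?n + 1) (conf k (a + 1) (?h(r := int ?n - 1)) ?c) (conf k (a + 2) (?h(r := 0)) ?c)"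
    using rewind_loop[OF _ r(1) I(2), of ?c "\<sigma> r" ?n "?h(r := int ?n - 1)"] I(4) pos by simp
  \<comment> \<open>One round: dispatch on the symbol under the loop head, run its block, step to
    the right.\<close>
  have body: "run (steps (b s) \<tau> + 2) (st (a + 2) (insert r A) (h(r := int n)) \<tau>)
      (st (a + 2) (insert r A) (h(r := int (Suc n))) (eval (b s) \<tau>)) \<and>
      valid S (eval (b s) \<tau>) \<and> eval (b s) \<tau> r = \<sigma> r"
    if \<tau>: "valid S \<tau>" "\<tau> r = \<sigma> r" and n: "n < ?n" and s: "s = \<sigma> r ! n" for s \<tau> n
  proof -
    have "s \<in> set (\<sigma> r)" using s n by simp
    then have s0: "0 < s" "s < S" using For.prems(3) by (auto simp: valid_def)
    let ?i = "s - 1"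
    have Si: "Suc ?i = s" using s0 by simp
    have bs: "block_start S b (Suc ?i) = block_start S b ?i + psize S (b s) + 1"
      using block_start_Suc[of S b ?i] by (simp only: Si)
    have w: "wf_prog k S (b s) (insert r A)" using For.prems(2) s0 by auto
    have le: "block_start S b (Suc ?i) \<le> psize S (For r b)"
      unfolding psize_For using s0 by (intro block_start_mono) auto
    have blk: "I (?B ?i + j) = (if j = psize S (b s) then (r, \<lambda>x. (a + 2, x, Go_Right))
        else relocate (?B ?i) (code S (b s) j))" if "j \<le> psize S (b s)" for j
    proof -
      have "block_start S b ?i + j < psize S (For r b)" using that le[unfolded bs] by simp
      from P[OF this] show ?thesis using code_block[of j S b ?i r] that unfolding Si
        by (auto simp: relocate_def add.assoc split_beta simp del: code.simps psize.simps)
    qed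
    have "embedded (?B ?i) (b s)"
      using blk le[unfolded bs] sz by (auto simp: embedded_def)
    note B = For.IH[OF _ this w \<tau>(1), of "h(r := int n)"]
    let ?\<tau>' = "eval (b s) \<tau>"
    have \<tau>'r: "?\<tau>' r = \<sigma> r" using eval_unmodified[OF w \<tau>(1) S3, of r] \<tau>(2) by auto
    have hp: "head_pos (insert r A) (h(r := int n)) \<rho> r = int n" for \<rho> by (simp add: head_pos_def)
    have d: "run 1 (st (a + 2) (insert r A) (h(r := int n)) \<tau>) (st (?B ?i) (insert r A) (h(r := int n)) \<tau>)"
      using run_step[where c = "\<lambda>r. contents (\<tau> r)" and h = "head_pos (insert r A) (h(r := int n)) \<tau>", OF I(4,3) r(1)] \<tau>(2) n s s0
      by (simp add: st_def hp move_def fun_upd_idem)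
    have fin: "run 1 (st (?B ?i + psize S (b s)) (insert r A) (h(r := int n)) ?\<tau>') (st (a + 2) (insert r A) (h(r := int (Suc n))) ?\<tau>')"
    proof -
      have *: "?B ?i + psize S (b s) < Q" using le[unfolded bs] sz by simp
      have "(head_pos (insert r A) (h(r := int n)) ?\<tau>')(r := int n + 1) = head_pos (insert r A) (h(r := int (Suc n))) ?\<tau>'"
        by (auto simp: head_pos_def)
      then show ?thesis
        using run_step[where f = "\<lambda>x. (a + 2, x, Go_Right)" and c = "\<lambda>r. contents (?\<tau>' r)" and h = "head_pos (insert r A) (h(r := int n)) ?\<tau>'", OF * _ r(1)]
          blk[of "psize S (b s)"]
        by (simp add: st_def hp move_def fun_upd_idem)
    qed
    show ?thesis
      using run_trans[OF run_trans[OF d B] fin] \<tau>'r valid_eval[OF S3 w \<tau>(1)] by simp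
  qed
  have "run (fold_steps (\<lambda>s. eval (b s)) (\<lambda>s. steps (b s)) ys \<tau>) (st (a + 2) (insert r A) (h(r := int (length xs))) \<tau>)
      (st (a + 2) (insert r A) (h(r := int ?n)) (fold (\<lambda>s. eval (b s)) ys \<tau>)) \<and>
      fold (\<lambda>s. eval (b s)) ys \<tau> r = \<sigma> r"
    if "\<sigma> r = xs @ ys" "valid S \<tau>" "\<tau> r = \<sigma> r" for xs ys \<tau>
    using that
  proof (induction ys arbitrary: xs \<tau>)
    case Nil
    then show ?case by (simp add: run_def)
  next
    case (Cons s ys)
    have "length xs < ?n" "s = \<sigma> r ! length xs" using Cons.prems(1) by auto
    note b = body[OF Cons.prems(2,3) this]
    have "\<sigma> r = (xs @ [s]) @ ys" using Cons.prems(1) by simp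
    note IH = Cons.IH[OF this b[THEN conjunct2, THEN conjunct1] b[THEN conjunct2, THEN conjunct2]]
    have "length (xs @ [s]) = Suc (length xs)" by simp
    from run_trans[OF b[THEN conjunct1] IH[THEN conjunct1, unfolded this]] IH[THEN conjunct2]
    show ?case by (simp only: fold_steps.simps fold_simps(2) simp_thms)
  qed
  note L = this[of "[]" "\<sigma> r" \<sigma>, OF _ For.prems(3) refl]
  have 3: "run (fold_steps (\<lambda>s. eval (b s)) (\<lambda>s. steps (b s)) (\<sigma> r) \<sigma>) (st (a + 2) (insert r A) (h(r := 0)) \<sigma>)
      (st (a + 2) (insert r A) (h(r := int ?n)) (eval (For r b) \<sigma>))" and er: "eval (For r b) \<sigma> r = \<sigma> r"
    using L by simp_all
  have 4: "run 1 (st (a + 2) (insert r A) (h(r := int ?n)) (eval (For r b) \<sigma>)) (st (a + psize S (For r b)) A h (eval (For r b) \<sigma>))"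
  proof -
    have *: "head_pos (insert r A) (h(r := int ?n)) (eval (For r b) \<sigma>) = head_pos A h (eval (For r b) \<sigma>)"
    proof
      fix r'
      show "head_pos (insert r A) (h(r := int ?n)) (eval (For r b) \<sigma>) r' = head_pos A h (eval (For r b) \<sigma>) r'"
        using er r(2) by (cases "r' = r") (simp_all add: head_pos_def del: eval.simps)
    qed
    have "head_pos A h (eval (For r b) \<sigma>) r = int ?n" using er r by (simp add: head_pos_def del: eval.simps)
    then show ?thesis
      using run_step[where c = "\<lambda>r'. contents (eval (For r b) \<sigma> r')" and h = "head_pos A h (eval (For r b) \<sigma>)", OF I(4,3) r(1)] er
      unfolding st_def * psize_For by (simp add: move_def fun_upd_idem del: eval.simps)
  qed
  have "?h(r := 0) = head_pos (insert r A) (h(r := 0)) \<sigma>" by (auto simp: head_pos_def)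
  then have "conf k (a + 2) (?h(r := 0)) ?c = st (a + 2) (insert r A) (h(r := 0)) \<sigma>" by (simp add: st_def)
  note R = run_trans[OF run_trans[OF run_trans[OF 1 2[unfolded this]] 3] 4]
  have "1 + (?n + 1) + fold_steps (\<lambda>s. eval (b s)) (\<lambda>s. steps (b s)) (\<sigma> r) \<sigma> + 1 = steps (For r b) \<sigma>" by simp
  with R show ?case by (simp only: st_def)
qed

end

definition bsym :: "bool \<Rightarrow> nat" where "bsym b = (if b then 2 else 1)"

definition input_store :: "bool list \<Rightarrow> store" where
  "input_store x = (\<lambda>r. if r = 0 then map bsym x else [])"

lemma string_contents_bits: "string_contents x = contents (map bsym x)"
  by (rule ext) (auto simp: string_contents_def contents_def bsym_def nat_less_iff)

text \<open>The machine begins with the input head at the left end, so an additional state 0 first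
  moves it behind the input to make it idle. Output is expected in register \<open>k - 1\<close>
  because it is read off the last tape.\<close>

theorem poly_time_prog:
  assumes S: "3 \<le> S" and k: "1 \<le> k" and wf: "wf_prog k S p {}"
    and out: "\<And>x. eval p (input_store x) (k - 1) = map bsym (f x)"
  shows "poly_time f"
proof -
  define I where "I q = (if q = 0 then (0, \<lambda>x. if x = 0 then (1, 0, Stay) else (0, x, Go_Right))
    else relocate 1 (code S p (q - 1)))" for q :: nat
  interpret machine k S I "Suc (psize S p)" by unfold_locales (rule S)
  have "wf_tm M"
    unfolding wf_tm_def
  proof (intro conjI allI impI)
    fix q ss assume h: "q < states M \<and> length ss = tapes M \<and> set ss \<subseteq> {..<symbols M}"
    obtain r g where I: "I q = (r, g)" by (cases "I q")
    have r: "r < k \<and> fst (g x) \<le> 1 + psize S p \<and> fst (snd (g x)) < S" if "x < S" for x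
    proof (cases "q = 0")
      case True
      then show ?thesis using I k S that by (auto simp: I_def)
    next
      case False
      then show ?thesis using code_wf[OF S wf, of "q - 1" x] h I that
        by (auto simp: I_def M_def relocate_def split: prod.splits)
    qed
    have "r < k" using r[of 0] S by simp
    then have x: "ss ! r < S" using h by (metis M_def lessThan_iff nth_mem subsetD turing_machine.select_convs(1,3))
    obtain q' w d where g: "g (ss ! r) = (q', w, d)" by (cases "g (ss ! r)")
    have D: "delta M q ss = (q', map (\<lambda>i. if i = r then (w, d) else (ss ! i, Stay)) [0..<k])"
      using I g by (simp add: M_def program_delta_def)
    show "fst (delta M q ss) \<le> states M" unfolding D using r[OF x] g by (simp add: M_def)
    show "length (snd (delta M q ss)) = tapes M" unfolding D by (simp add: M_def)
    have "ss ! i < S" if "i < k" for i using h that by (metis M_def lessThan_iff nth_mem subsetD turing_machine.select_convs(1,3))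
    then show "fst ` set (snd (delta M q ss)) \<subseteq> {..<symbols M}" unfolding D using r[OF x] g by (auto simp: M_def)
  qed (use S k in \<open>auto simp: M_def\<close>)
  moreover obtain H :: "nat poly" where H:
    "\<And>\<sigma> n. valid S \<sigma> \<Longrightarrow> (\<forall>r < k. length (\<sigma> r) \<le> n) \<Longrightarrow> steps p \<sigma> \<le> poly H n"
    using steps_bound[OF S wf] by metis
  have "computes_in_time M f (poly ([:1, 1:] + H))"
    unfolding computes_in_time_def
  proof
    fix x
    let ?\<sigma> = "input_store x"
    have v: "valid S ?\<sigma>" using S by (auto simp: valid_def input_store_def bsym_def)
    have init: "tm_init M x = conf k 0 (\<lambda>_. 0) (\<lambda>r. contents (?\<sigma> r))"
      unfolding tm_init_def conf_def M_def
      using k by (intro prod_eqI nth_equalityI) (auto simp: string_contents_bits input_store_def nth_Cons split: nat.split)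
    have bpos: "\<forall>y \<in> set (map bsym x). 0 < y" by (auto simp: bsym_def)
    have 1: "run (length x + 1) (conf k 0 (\<lambda>_. 0) (\<lambda>r. contents (?\<sigma> r))) (conf k 1 ((\<lambda>_. 0)(0 := int (length x))) (\<lambda>r. contents (?\<sigma> r)))"
      using forward_loop[of 0 0 1 "\<lambda>r. contents (?\<sigma> r)" "map bsym x" "length x" "\<lambda>_. 0"] k
        bpos by (simp add: I_def input_store_def)
    have "(\<lambda>_. 0)(0 := int (length x)) = head_pos {} h ?\<sigma>" for h by (auto simp: head_pos_def input_store_def)
    then have 2: "conf k 1 ((\<lambda>_. 0)(0 := int (length x))) (\<lambda>r. contents (?\<sigma> r)) = st 1 {} (\<lambda>_. 0) ?\<sigma>"
      by (simp add: st_def)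
    have "embedded 1 p" by (auto simp: embedded_def I_def)
    from run_prog[OF this wf v, of "\<lambda>_. 0"] 1
    have R: "run (length x + 1 + steps p ?\<sigma>) (tm_init M x) (st (Suc (psize S p)) {} (\<lambda>_. 0) (eval p ?\<sigma>))"
      unfolding init 2 using run_trans by (metis plus_1_eq_Suc)
    have "steps p ?\<sigma> \<le> poly H (length x)" using H[OF v] by (auto simp: input_store_def)
    moreover have "snd (last (snd (st (Suc (psize S p)) {} (\<lambda>_. 0) (eval p ?\<sigma>)))) = string_contents (f x)"
      using k out by (simp add: st_def conf_def last_map string_contents_bits)
    ultimately show "\<exists>t \<le> poly ([:1, 1:] + H) (length x). \<exists>ts.
        (tm_step M ^^ t) (tm_init M x) = (states M, ts) \<and> snd (last ts) = string_contents (f x)"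
      using R unfolding run_def
      by (intro exI[of _ "length x + 1 + steps p ?\<sigma>"]) (auto simp: st_def conf_def M_def)
  qed
  ultimately show ?thesis unfolding poly_time_def by blast
qed

section \<open>Printing an instance\<close>

definition seqs :: "prog list \<Rightarrow> prog" where "seqs ps = foldr Seq ps Skip"

definition app :: "nat \<Rightarrow> nat list \<Rightarrow> prog" where "app r xs = seqs (map (Append r) xs)"

lemma eval_seqs [simp]: "eval (seqs []) \<sigma> = \<sigma>" "eval (seqs (p # ps)) \<sigma> = eval (seqs ps) (eval p \<sigma>)"
  by (simp_all add: seqs_def)

lemma wf_seqs [simp]: "wf_prog k S (seqs ps) A \<longleftrightarrow> (\<forall>p \<in> set ps. wf_prog k S p A)"
  by (induction ps) (auto simp: seqs_def)

lemma eval_app [simp]: "eval (app r xs) \<sigma> = \<sigma>(r := \<sigma> r @ xs)"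
proof (induction xs arbitrary: \<sigma>)
  case (Cons a xs)
  have "eval (app r (a # xs)) \<sigma> = eval (app r xs) (eval (Append r a) \<sigma>)" by (simp add: app_def)
  then show ?case using Cons.IH by (simp add: fun_eq_iff)
qed (simp add: app_def)

lemma wf_app [simp]: "wf_prog k S (app r xs) A \<longleftrightarrow> xs = [] \<or> r < k \<and> (\<forall>a \<in> A. a < r) \<and> (\<forall>s \<in> set xs. 0 < s \<and> s < S)"
  by (induction xs) (auto simp: app_def)

lemma fold_app: "fold (\<lambda>s. eval (app r (f s))) xs \<sigma> = \<sigma>(r := \<sigma> r @ concat (map f xs))"
  by (induction xs arbitrary: \<sigma>) auto

lemma eval_For_app [simp]: "eval (For q (\<lambda>s. app r (f s))) \<sigma> = \<sigma>(r := \<sigma> r @ concat (map f (\<sigma> q)))"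
  by (simp add: fold_app del: eval_app)

definition digits :: "nat \<Rightarrow> nat list" where "digits v = map bsym (binary v)"

lemma digits_0: "digits 0 = []" by (simp add: digits_def binary.simps)

lemma inc_digits_digits: "inc_digits (digits v) = digits (Suc v)"
proof (induction v rule: less_induct)
  case (less v)
  show ?case
  proof (cases "v = 0")
    case True
    then show ?thesis by (simp add: digits_def binary.simps[of 0] binary.simps[of "Suc 0"] bsym_def)
  next
    case False
    have d: "digits v = bsym (odd v) # digits (v div 2)" using False by (simp add: digits_def binary.simps[of v])
    have d': "digits (Suc v) = bsym (odd (Suc v)) # digits (Suc v div 2)" by (simp add: digits_def binary.simps[of "Suc v"])
    show ?thesis
    proof (cases "odd v")
      case True
      then have "Suc v div 2 = Suc (v div 2)" by presburger
      then show ?thesis using d d' True less[of "v div 2"] False by (simp add: bsym_def)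
    next
      case c: False
      then have "Suc v div 2 = v div 2" by presburger
      then show ?thesis using d d' c by (simp add: bsym_def)
    qed
  qed
qed

text \<open>With 2 for \<open>True\<close> and 1 for \<open>False\<close> this writes the
  self-delimiting code of the numeral in register \<open>r\<close>.\<close>

definition print :: "nat \<Rightarrow> nat \<Rightarrow> prog" where
  "print out r = seqs [For r (\<lambda>b. app out [2, b]), app out [1]]"

lemma eval_print:
  assumes "\<sigma> r = digits v"
  shows "eval (print out r) \<sigma> = \<sigma>(out := \<sigma> out @ map bsym (delimit (binary v)))"
proof -
  have "concat (map (\<lambda>b. [2, b]) (map bsym bs)) = map bsym (concat (map (\<lambda>b. [True, b]) bs))" for bs
    by (induction bs) (auto simp: bsym_def)
  then show ?thesis using assms by (simp add: print_def digits_def delimit_def bsym_def[of False] del: eval.simps(6) map_map)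
qed

text \<open>
  A vertex is described by the symbol \<open>1 + 2 \<kappa> + d\<close> with its demand \<open>d\<close> and one of nine kinds \<open>\<kappa>\<close>, which
  determines the resistances of the edges to its right and lower neighbours.
\<close>

definition vsym :: "nat \<Rightarrow> nat \<Rightarrow> nat" where "vsym \<kappa> d = 1 + 2 * \<kappa> + d"

definition kind :: "nat \<Rightarrow> nat" where "kind s = (s - 1) div 2"
definition dem :: "nat \<Rightarrow> nat" where "dem s = (s - 1) mod 2"

lemma kind_dem [simp]: "d \<le> 1 \<Longrightarrow> kind (vsym \<kappa> d) = \<kappa>" "d \<le> 1 \<Longrightarrow> dem (vsym \<kappa> d) = d"
  by (auto simp: kind_def dem_def vsym_def le_Suc_eq)

text \<open>In even rows, kind 0 is an even column, 1 a value column, 2 a negation column, and 3 and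
  4 the last column of the top row and of later ones. Kinds 5 and 6 belong to a free row and its
  last column, 7 and 8 to the last row and its last column.\<close>

definition has_h :: "nat \<Rightarrow> bool" where "has_h \<kappa> \<longleftrightarrow> \<kappa> \<noteq> 3 \<and> \<kappa> \<noteq> 4 \<and> \<kappa> \<noteq> 6 \<and> \<kappa> \<noteq> 8"
definition has_v :: "nat \<Rightarrow> bool" where "has_v \<kappa> \<longleftrightarrow> \<kappa> < 7"
definition h_of :: "nat \<Rightarrow> nat \<Rightarrow> nat" where "h_of B \<kappa> = (if \<kappa> < 5 then Suc B else 0)"
definition v_of :: "nat \<Rightarrow> nat \<Rightarrow> nat" where "v_of B \<kappa> = (if \<kappa> = 1 \<or> \<kappa> = 2 then 1 else if \<kappa> < 5 then Suc B else 0)"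

definition links_of :: "nat \<Rightarrow> nat \<Rightarrow> nat list \<Rightarrow> (nat \<times> nat \<times> nat) list" where
  "links_of B W zs = concat (map (\<lambda>i.
     (if has_h (kind (zs ! i)) then [(i, i + 1, h_of B (kind (zs ! i)))] else []) @
     (if has_v (kind (zs ! i)) then [(i, i + W, v_of B (kind (zs ! i)))] else [])) [0..<length zs])"

text \<open>The bound is accumulated while scanning the text: each variable is charged
  \<open>t^2 + (t + 1)^2\<close> at its value column, and the last column of an even row passes to
  the next layer, two units higher after the top row and three units higher later.\<close>

fun bound_step :: "nat \<Rightarrow> nat \<times> nat \<Rightarrow> nat \<times> nat" where
  "bound_step s (t, v) = (if kind s = 1 then (t, v + (2 * t\<^sup>2 + 2 * t + 1)) else if kind s = 3 then (t + 2, v)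
     else if kind s = 4 then (t + 3, v) else (t, v))"

definition bound_of :: "nat list \<Rightarrow> nat" where "bound_of zs = snd (fold bound_step zs (0, 0))"
definition width_of :: "nat list \<Rightarrow> nat" where "width_of zs = length (filter (\<lambda>s. \<not> has_v (kind s)) zs)"

text \<open>The text determines all numbers of the instance. The root is the first vertex of the
  last row, so its number counts the vertices with a lower neighbour, and the width counts those
  without.\<close>

definition inst_of :: "nat list \<Rightarrow> ednr" where
  "inst_of zs = \<lparr>num_verts = length zs, root = length (filter (\<lambda>s. has_v (kind s)) zs), demands = map dem zs,
     links = links_of (bound_of zs) (width_of zs) zs, bound = bound_of zs\<rparr>"

text \<open>\<open>t\<close> is kept in unary, in two copies because nested loops must run over
  different registers. Registers \<open>z + 3\<close>, \<open>z + 4\<close>, \<open>z + 5\<close>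
  and \<open>z + 9\<close> are binary counters for the vertices, the root, the bound and the
  width.\<close>

definition count_prog :: "nat \<Rightarrow> nat \<Rightarrow> prog" where
  "count_prog z s = seqs [Inc (z + 3), Inc (if has_v (kind s) then z + 4 else z + 9),
     if kind s = 1 then seqs [For (z + 1) (\<lambda>_. seqs [For (z + 2) (\<lambda>_. seqs [Inc (z + 5), Inc (z + 5)]), Inc (z + 5), Inc (z + 5)]), Inc (z + 5)]
     else if kind s = 3 then seqs [app (z + 1) [1, 1], app (z + 2) [1, 1]]
     else if kind s = 4 then seqs [app (z + 1) [1, 1, 1], app (z + 2) [1, 1, 1]] else Skip]"

definition print_weight :: "nat \<Rightarrow> nat \<Rightarrow> prog" where
  "print_weight z j = (if j = 0 then app (z + 10) [1] else if j = 1 then app (z + 10) [2, 2, 1] else print (z + 10) (z + 6))"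

text \<open>Registers \<open>z + 7\<close>, \<open>z + 8\<close> and \<open>z + 9\<close> hold the
  current vertex and its right and lower neighbours, and \<open>z + 6\<close> the infinite
  resistance. The width left in \<open>z + 9\<close> is the lower neighbour of vertex 0.\<close>

definition link_prog :: "nat \<Rightarrow> nat \<Rightarrow> prog" where
  "link_prog z s = seqs [
     if has_h (kind s) then seqs [print (z + 10) (z + 7), print (z + 10) (z + 8), print_weight z (if kind s < 5 then 2 else 0)] else Skip,
     if has_v (kind s) then seqs [print (z + 10) (z + 7), print (z + 10) (z + 9),
        print_weight z (if kind s = 1 \<or> kind s = 2 then 1 else if kind s < 5 then 2 else 0)] else Skip,
     Inc (z + 7), Inc (z + 8), Inc (z + 9)]"

definition output_prog :: "nat \<Rightarrow> prog" where
  "output_prog z = seqs [For z (count_prog z), For (z + 5) (\<lambda>b. app (z + 6) [b]), Inc (z + 6), Inc (z + 8),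
     print (z + 10) (z + 3), print (z + 10) (z + 4), print (z + 10) (z + 5),
     For z (\<lambda>s. app (z + 10) (if dem s = 0 then [1] else [2, 2, 1])), For z (link_prog z)]"

lemma wf_output: "k = z + 11 \<Longrightarrow> 3 \<le> S \<Longrightarrow> wf_prog k S (output_prog z) {}"
  by (auto simp: output_prog_def count_prog_def link_prog_def print_def print_weight_def)

lemma binary_1: "binary (Suc 0) = [True]" "binary 0 = []"
  by (simp_all add: binary.simps[of "Suc 0"] binary.simps[of 0])

definition counted :: "nat \<Rightarrow> store \<Rightarrow> nat \<Rightarrow> nat \<Rightarrow> nat \<Rightarrow> nat \<times> nat \<Rightarrow> store" where
  "counted z \<sigma> v r w tb = \<sigma>(z + 1 := replicate (fst tb) 1, z + 2 := replicate (fst tb) 1, z + 3 := digits v,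
     z + 4 := digits r, z + 9 := digits w, z + 5 := digits (snd tb))"

lemma eval_incs: "\<sigma> r = digits v \<Longrightarrow> eval (seqs [Inc r, Inc r]) \<sigma> = \<sigma>(r := digits (v + 2))"
  by (simp add: inc_digits_digits)

text \<open>\<open>t\<close> rounds of \<open>2 * t + 2\<close> increments, followed by one
  more.\<close>

lemma eval_square_loop:
  assumes "\<sigma> (z + 1) = replicate t 1" "\<sigma> (z + 2) = replicate t 1" "\<sigma> (z + 5) = digits v"
  shows "eval (seqs [For (z + 1) (\<lambda>_. seqs [For (z + 2) (\<lambda>_. seqs [Inc (z + 5), Inc (z + 5)]), Inc (z + 5), Inc (z + 5)]), Inc (z + 5)]) \<sigma> =
    \<sigma>(z + 5 := digits (v + (2 * t\<^sup>2 + 2 * t + 1)))"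
proof -
  have inner: "eval (For (z + 2) (\<lambda>_. seqs [Inc (z + 5), Inc (z + 5)])) \<rho> = \<rho>(z + 5 := digits (v + 2 * t))"
    if "\<rho> (z + 2) = replicate t 1" "\<rho> (z + 5) = digits v" for \<rho> v
  proof -
    have "fold (\<lambda>_. eval (seqs [Inc (z + 5), Inc (z + 5)])) xs \<rho> = \<rho>(z + 5 := digits (v + 2 * length xs))"
      if "\<rho> (z + 5) = digits v" for xs :: "nat list" and \<rho> v
      using that
    proof (induction xs arbitrary: \<rho> v)
      case (Cons a xs)
      have "fold (\<lambda>_. eval (seqs [Inc (z + 5), Inc (z + 5)])) (a # xs) \<rho> =
          fold (\<lambda>_. eval (seqs [Inc (z + 5), Inc (z + 5)])) xs (\<rho>(z + 5 := digits (v + 2)))"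
        using eval_incs[of \<rho> "z + 5" v] Cons.prems by (simp del: eval_seqs)
      also have "\<dots> = \<rho>(z + 5 := digits (v + 2 * length (a # xs)))"
        by (subst Cons.IH[of _ "v + 2"]) (auto simp: add.assoc)
      finally show ?case .
    qed auto
    from this[where \<rho> = \<rho> and v = v and xs = "\<rho> (z + 2)", OF that(2)] show ?thesis using that(1) by simp
  qed
  let ?b = "seqs [For (z + 2) (\<lambda>_. seqs [Inc (z + 5), Inc (z + 5)]), Inc (z + 5), Inc (z + 5)]"
  have body: "eval ?b \<rho> = \<rho>(z + 5 := digits (v + (2 * t + 2)))" if "\<rho> (z + 2) = replicate t 1" "\<rho> (z + 5) = digits v" for \<rho> v
    using inner[OF that] by (simp add: inc_digits_digits del: eval.simps(6))
  have "fold (\<lambda>_. eval ?b) xs \<rho> = \<rho>(z + 5 := digits (v + length xs * (2 * t + 2)))"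
    if "\<rho> (z + 2) = replicate t 1" "\<rho> (z + 5) = digits v" for xs :: "nat list" and \<rho> v
    using that
  proof (induction xs arbitrary: \<rho> v)
    case (Cons a xs)
    have "fold (\<lambda>_. eval ?b) (a # xs) \<rho> = fold (\<lambda>_. eval ?b) xs (\<rho>(z + 5 := digits (v + (2 * t + 2))))"
      unfolding fold_simps body[OF Cons.prems] ..
    also have "\<dots> = \<rho>(z + 5 := digits (v + length (a # xs) * (2 * t + 2)))"
      using Cons.prems by (subst Cons.IH[of _ "v + (2 * t + 2)"]) (auto simp: algebra_simps)
    finally show ?case .
  qed (auto simp: fun_upd_idem)
  from this[where \<rho> = \<sigma> and v = v and xs = "\<sigma> (z + 1)", OF assms(2,3)]
  have "eval (For (z + 1) (\<lambda>_. ?b)) \<sigma> = \<sigma>(z + 5 := digits (v + t * (2 * t + 2)))"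
    using assms(1) by simp
  then show ?thesis by (simp add: inc_digits_digits power2_eq_square algebra_simps del: eval.simps(6))
qed

lemma eval_count:
  "eval (count_prog z s) (counted z \<sigma> v r w tb) =
    counted z \<sigma> (Suc v) (r + of_bool (has_v (kind s))) (w + of_bool (\<not> has_v (kind s))) (bound_step s tb)"
proof -
  obtain t b where tb: "tb = (t, b)" by (cases tb)
  let ?\<sigma> = "counted z \<sigma> (Suc v) (r + of_bool (has_v (kind s))) (w + of_bool (\<not> has_v (kind s))) tb"
  have 1: "eval (seqs [Inc (z + 3), Inc (if has_v (kind s) then z + 4 else z + 9)]) (counted z \<sigma> v r w tb) = ?\<sigma>"
    by (auto simp: counted_def inc_digits_digits fun_eq_iff)
  have c: "?\<sigma> (z + 1) = replicate t 1" "?\<sigma> (z + 2) = replicate t 1" "?\<sigma> (z + 5) = digits b"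
    by (auto simp: counted_def tb)
  have "eval (count_prog z s) (counted z \<sigma> v r w tb) = eval (
     if kind s = 1 then seqs [For (z + 1) (\<lambda>_. seqs [For (z + 2) (\<lambda>_. seqs [Inc (z + 5), Inc (z + 5)]), Inc (z + 5), Inc (z + 5)]), Inc (z + 5)]
     else if kind s = 3 then seqs [app (z + 1) [1, 1], app (z + 2) [1, 1]]
     else if kind s = 4 then seqs [app (z + 1) [1, 1, 1], app (z + 2) [1, 1, 1]] else Skip) ?\<sigma>"
    unfolding count_prog_def 1[symmetric] by (simp only: eval_seqs)
  also have "\<dots> = counted z \<sigma> (Suc v) (r + of_bool (has_v (kind s))) (w + of_bool (\<not> has_v (kind s))) (bound_step s tb)"
  proof (cases "kind s = 1")
    case True
    have "?\<sigma>(z + 5 := digits (b + (2 * t\<^sup>2 + 2 * t + 1))) =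
        counted z \<sigma> (Suc v) (r + of_bool (has_v (kind s))) (w + of_bool (\<not> has_v (kind s))) (bound_step s tb)"
      using True by (simp add: counted_def tb)
    then show ?thesis unfolding if_P[OF True] eval_square_loop[OF c] .
  next
    case False
    have ap: "eval (seqs [app (z + 1) (replicate n 1), app (z + 2) (replicate n 1)]) ?\<sigma> =
        counted z \<sigma> (Suc v) (r + of_bool (has_v (kind s))) (w + of_bool (\<not> has_v (kind s))) (t + n, b)" for n
      using c by (simp add: counted_def tb replicate_add fun_eq_iff)
    have rep: "[1, 1] = replicate 2 (1 :: nat)" "[1, 1, 1] = replicate 3 (1 :: nat)" by (simp_all add: numeral_2_eq_2 numeral_3_eq_3)
    consider "kind s = 3" | "kind s = 4" | "kind s \<noteq> 1" "kind s \<noteq> 3" "kind s \<noteq> 4" using False by blast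
    then show ?thesis
    proof cases
      case 1
      then show ?thesis using ap[of 2] False unfolding rep tb bound_step.simps by (simp del: eval_seqs)
    next
      case 2
      then show ?thesis using ap[of 3] False unfolding rep(2) tb bound_step.simps by (simp del: eval_seqs)
    qed (simp add: tb)
  qed
  finally show ?thesis .
qed

lemma fold_count:
  "fold (\<lambda>s. eval (count_prog z s)) zs (counted z \<sigma> v r w tb) =
    counted z \<sigma> (v + length zs) (r + length (filter (\<lambda>s. has_v (kind s)) zs)) (w + width_of zs) (fold bound_step zs tb)"
  by (induction zs arbitrary: v r w tb) (auto simp: eval_count width_of_def)

definition linked :: "nat \<Rightarrow> store \<Rightarrow> nat \<Rightarrow> nat \<Rightarrow> nat list \<Rightarrow> store" where
  "linked z \<sigma> W i out = \<sigma>(z + 7 := digits i, z + 8 := digits (i + 1), z + 9 := digits (i + W), z + 10 := out)"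

definition enc :: "nat list \<Rightarrow> bool list" where "enc vs = concat (map (delimit \<circ> binary) vs)"

definition link_list :: "nat \<Rightarrow> nat \<Rightarrow> nat \<Rightarrow> nat \<Rightarrow> (nat \<times> nat \<times> nat) list" where
  "link_list B W i s = (if has_h (kind s) then [(i, i + 1, h_of B (kind s))] else []) @
     (if has_v (kind s) then [(i, i + W, v_of B (kind s))] else [])"

lemma eval_print': "\<sigma> r = digits v \<Longrightarrow> \<sigma> (z + 10) = out \<Longrightarrow>
    eval (print (z + 10) r) \<sigma> = \<sigma>(z + 10 := out @ map bsym (enc [v]))"
  by (simp add: eval_print enc_def)

lemma eval_print_weight: "\<sigma> (z + 6) = digits B \<Longrightarrow> \<sigma> (z + 10) = out \<Longrightarrow>
    eval (print_weight z j) \<sigma> = \<sigma>(z + 10 := out @ map bsym (enc [if j = 0 then 0 else if j = 1 then 1 else B]))"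
  by (simp add: print_weight_def eval_print enc_def binary_1 delimit_def bsym_def)

lemma enc_append: "enc (xs @ ys) = enc xs @ enc ys" by (simp add: enc_def)

lemma eval_link:
  assumes "\<sigma> (z + 6) = digits (Suc B)"
  shows "eval (link_prog z s) (linked z \<sigma> W i out) =
    linked z \<sigma> W (Suc i) (out @ map bsym (enc (concat (map (\<lambda>(u, v, w). [u, v, w]) (link_list B W i s)))))"
proof -
  have l: "linked z \<sigma> W i out (z + 7) = digits i" "linked z \<sigma> W i out (z + 8) = digits (i + 1)"
    "linked z \<sigma> W i out (z + 9) = digits (i + W)" "linked z \<sigma> W i out (z + 10) = out" "linked z \<sigma> W i out (z + 6) = digits (Suc B)" for out
    using assms by (auto simp: linked_def)
  have upd: "(linked z \<sigma> W i out)(z + 10 := out') = linked z \<sigma> W i out'" for out out' by (simp add: linked_def)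
  have three: "eval (seqs [print (z + 10) (z + 7), print (z + 10) r, print_weight z j]) (linked z \<sigma> W i out) =
      linked z \<sigma> W i (out @ map bsym (enc [i, v, if j = 0 then 0 else if j = 1 then 1 else Suc B]))"
    if "\<And>out. linked z \<sigma> W i out r = digits v" for r v j out
  proof -
    have e3: "enc [a, b, c] = enc [a] @ enc [b] @ enc [c]" for a b c by (simp add: enc_def)
    show ?thesis
      unfolding eval_seqs eval_print'[OF l(1,4)] upd eval_print'[OF that l(4)] eval_print_weight[OF l(5,4)] e3 by simp
  qed
  have h: "eval (if has_h (kind s) then seqs [print (z + 10) (z + 7), print (z + 10) (z + 8), print_weight z (if kind s < 5 then 2 else 0)] else Skip) (linked z \<sigma> W i out) =
      linked z \<sigma> W i (out @ map bsym (enc (concat (map (\<lambda>(u, v, w). [u, v, w]) (if has_h (kind s) then [(i, i + 1, h_of B (kind s))] else [])))))" for out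
    using three[OF l(2), of "if kind s < 5 then 2 else 0" out] by (simp add: h_of_def enc_def del: eval_seqs)
  have v: "eval (if has_v (kind s) then seqs [print (z + 10) (z + 7), print (z + 10) (z + 9),
        print_weight z (if kind s = 1 \<or> kind s = 2 then 1 else if kind s < 5 then 2 else 0)] else Skip) (linked z \<sigma> W i out) =
      linked z \<sigma> W i (out @ map bsym (enc (concat (map (\<lambda>(u, v, w). [u, v, w]) (if has_v (kind s) then [(i, i + W, v_of B (kind s))] else [])))))" for out
    using three[OF l(3), of "if kind s = 1 \<or> kind s = 2 then 1 else if kind s < 5 then 2 else 0" out] by (simp add: v_of_def enc_def del: eval_seqs)
  have inc: "eval (seqs [Inc (z + 7), Inc (z + 8), Inc (z + 9)]) (linked z \<sigma> W i out) = linked z \<sigma> W (Suc i) out" for out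
    by (auto simp: linked_def inc_digits_digits fun_eq_iff)
  have "eval (link_prog z s) (linked z \<sigma> W i out) = eval (seqs [Inc (z + 7), Inc (z + 8), Inc (z + 9)])
     (eval (if has_v (kind s) then seqs [print (z + 10) (z + 7), print (z + 10) (z + 9),
        print_weight z (if kind s = 1 \<or> kind s = 2 then 1 else if kind s < 5 then 2 else 0)] else Skip)
     (eval (if has_h (kind s) then seqs [print (z + 10) (z + 7), print (z + 10) (z + 8), print_weight z (if kind s < 5 then 2 else 0)] else Skip) (linked z \<sigma> W i out)))"
    unfolding link_prog_def by (simp only: eval_seqs)
  also have "\<dots> = linked z \<sigma> W (Suc i) (out @ map bsym (enc (concat (map (\<lambda>(u, v, w). [u, v, w]) (link_list B W i s)))))"
    unfolding h v inc link_list_def by (simp add: enc_append)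
  finally show ?thesis .
qed

lemma fold_link:
  assumes "\<sigma> (z + 6) = digits (Suc B)"
  shows "fold (\<lambda>s. eval (link_prog z s)) ys (linked z \<sigma> W i out) =
    linked z \<sigma> W (i + length ys) (out @ map bsym (enc (concat (map (\<lambda>(u, v, w). [u, v, w])
      (concat (map (\<lambda>j. link_list B W (i + j) (ys ! j)) [0..<length ys]))))))"
proof (induction ys arbitrary: i out)
  case (Cons s ys)
  have u: "[0..<length (s # ys)] = 0 # map Suc [0..<length ys]" by (simp add: upt_conv_Cons map_Suc_upt del: upt_Suc)
  show ?case unfolding fold_simps eval_link[of \<sigma> z B, OF assms] Cons u by (simp add: enc_append comp_def)
qed (simp add: enc_def)

lemma eval_output:
  assumes "\<sigma> z = zs" "\<And>r. z < r \<Longrightarrow> \<sigma> r = []"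
  shows "eval (output_prog z) \<sigma> (z + 10) = map bsym (encode (inst_of zs))"
proof -
  let ?c = "\<lambda>b. concat (map (\<lambda>s. if dem s = 0 then [1] else [2, 2, 1]) zs)"
  let ?B = "bound_of zs" and ?W = "width_of zs" and ?R = "length (filter (\<lambda>s. has_v (kind s)) zs)"
  have s0: "\<sigma> = counted z \<sigma> 0 0 0 (0, 0)" using assms(2) by (auto simp: counted_def digits_0 fun_eq_iff)
  have "eval (For z (count_prog z)) \<sigma> = fold (\<lambda>s. eval (count_prog z s)) zs (counted z \<sigma> 0 0 0 (0, 0))"
    using assms(1) s0 by simp
  also have "\<dots> = counted z \<sigma> (length zs) ?R ?W (fold bound_step zs (0, 0))" unfolding fold_count by simp
  finally have 1: "eval (For z (count_prog z)) \<sigma> = counted z \<sigma> (length zs) ?R ?W (fold bound_step zs (0, 0))" .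
  define \<sigma>1 where "\<sigma>1 = counted z \<sigma> (length zs) ?R ?W (fold bound_step zs (0, 0))"
  have v1: "\<sigma>1 z = zs" "\<sigma>1 (z + 3) = digits (length zs)" "\<sigma>1 (z + 4) = digits ?R" "\<sigma>1 (z + 5) = digits ?B" "\<sigma>1 (z + 6) = []"
    "\<sigma>1 (z + 7) = []" "\<sigma>1 (z + 8) = []" "\<sigma>1 (z + 9) = digits ?W" "\<sigma>1 (z + 10) = []"
    using assms(1,2) by (auto simp: \<sigma>1_def counted_def bound_of_def)
  define \<sigma>2 where "\<sigma>2 = \<sigma>1(z + 6 := digits (Suc ?B), z + 8 := digits 1)"
  have 2: "eval (seqs [For (z + 5) (\<lambda>b. app (z + 6) [b]), Inc (z + 6), Inc (z + 8)]) \<sigma>1 = \<sigma>2"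
    proof -
    have "inc_digits [] = digits 1" using inc_digits_digits[of 0] by (simp add: digits_0)
    then show ?thesis using v1 by (simp add: \<sigma>2_def inc_digits_digits concat_map_singleton del: eval.simps(6) inc_digits.simps)
  qed
  have v2: "\<sigma>2 z = zs" "\<sigma>2 (z + 3) = digits (length zs)" "\<sigma>2 (z + 4) = digits ?R" "\<sigma>2 (z + 5) = digits ?B" "\<sigma>2 (z + 6) = digits (Suc ?B)"
    "\<sigma>2 (z + 7) = []" "\<sigma>2 (z + 8) = digits 1" "\<sigma>2 (z + 9) = digits ?W" "\<sigma>2 (z + 10) = []"
    using v1 by (auto simp: \<sigma>2_def)
  have dm: "concat (map (\<lambda>s. if dem s = 0 then [1] else [2, 2, 1]) zs) = map bsym (enc (map dem zs))"
  proof -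
    have "(if dem s = 0 then [1] else [2, 2, 1]) = map bsym (delimit (binary (dem s)))" for s
    proof -
      have "dem s = 0 \<or> dem s = 1" unfolding dem_def by presburger
      then show ?thesis by (auto simp: binary_1 delimit_def bsym_def)
    qed
    then show ?thesis by (simp add: enc_def map_concat comp_def)
  qed
  let ?o = "map bsym (enc ([length zs, ?R, ?B] @ map dem zs))"
  have 3: "eval (seqs [print (z + 10) (z + 3), print (z + 10) (z + 4), print (z + 10) (z + 5),
     For z (\<lambda>s. app (z + 10) (if dem s = 0 then [1] else [2, 2, 1]))]) \<sigma>2 = \<sigma>2(z + 10 := ?o)"
    using v2 by (simp add: eval_print dm enc_def del: eval.simps(6))
  have l: "\<sigma>2(z + 10 := ?o) = linked z \<sigma>2 ?W 0 ?o" using v2 by (auto simp: linked_def digits_0 fun_eq_iff)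
  have 4: "eval (For z (link_prog z)) (\<sigma>2(z + 10 := ?o)) = linked z \<sigma>2 ?W (length zs)
      (?o @ map bsym (enc (concat (map (\<lambda>(u, v, w). [u, v, w]) (links_of ?B ?W zs)))))"
  proof -
    have "eval (For z (link_prog z)) (\<sigma>2(z + 10 := ?o)) = fold (\<lambda>s. eval (link_prog z s)) zs (linked z \<sigma>2 ?W 0 ?o)"
      unfolding l[symmetric] by (simp add: v2(1))
    then show ?thesis unfolding fold_link[of \<sigma>2 z ?B, OF v2(5)] by (simp add: links_of_def link_list_def)
  qed
  have "eval (output_prog z) \<sigma> = eval (For z (link_prog z)) (eval (seqs [print (z + 10) (z + 3), print (z + 10) (z + 4), print (z + 10) (z + 5),
     For z (\<lambda>s. app (z + 10) (if dem s = 0 then [1] else [2, 2, 1]))])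
     (eval (seqs [For (z + 5) (\<lambda>b. app (z + 6) [b]), Inc (z + 6), Inc (z + 8)]) (eval (For z (count_prog z)) \<sigma>)))"
    unfolding output_prog_def by (simp only: eval_seqs)
  also have "\<dots> = linked z \<sigma>2 ?W (length zs) (?o @ map bsym (enc (concat (map (\<lambda>(u, v, w). [u, v, w]) (links_of ?B ?W zs)))))"
    unfolding 1 \<sigma>1_def[symmetric] 2 3 4 ..
  finally show ?thesis by (simp add: linked_def encode_def inst_of_def enc_def)
qed

section \<open>The grid as a text of vertex symbols\<close>

type_synonym quadruple = "nat \<times> nat \<times> nat \<times> nat"

text \<open>
  The kinds \<open>(s, a, b, l)\<close> of the vertices in a grid row: \<open>a\<close> and \<open>b\<close> in the columns \<open>4 q + 1\<close> and
  \<open>4 q + 3\<close>, \<open>l\<close> in the last column, and \<open>s\<close> in all other ones.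
\<close>

fun block :: "quadruple \<Rightarrow> quadruple \<Rightarrow> nat list" where
  "block (s, a, b, l) (x, y, z, w) = [vsym a x, vsym s y, vsym b z, vsym s w]"

lemma length_block: "length (block \<kappa> q) = 4" by (cases \<kappa>; cases q) simp

text \<open>The last entry of the last block is dropped because the last column has a kind and a
  demand of its own.\<close>

definition line :: "quadruple \<Rightarrow> nat \<Rightarrow> nat \<Rightarrow> quadruple list \<Rightarrow> nat list" where
  "line \<kappa> d d' qs = vsym (fst \<kappa>) d # butlast (concat (map (block \<kappa>) qs)) @ [vsym (snd (snd (snd \<kappa>))) d']"

fun kind_at :: "nat \<Rightarrow> quadruple \<Rightarrow> nat \<Rightarrow> nat" where
  "kind_at m (s, a, b, l) x =
    (if x = 0 then s else if x = 4 * m then l else if x mod 4 = 1 then a else if x mod 4 = 3 then b else s)"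

lemma fold_bound_step_other:
  "(\<And>s. s \<in> set xs \<Longrightarrow> kind s \<notin> {1, 3, 4}) \<Longrightarrow> fold bound_step xs tb = tb"
  by (induction xs arbitrary: tb) (auto split: prod.splits)

lemma fold_bound_step_blocks:
  "(\<And>a b c d. (a, b, c, d) \<in> set qs \<Longrightarrow> a \<le> 1 \<and> b \<le> 1 \<and> c \<le> 1 \<and> d \<le> 1) \<Longrightarrow>
    fold bound_step (concat (map (block (0, 1, 2, l)) qs)) (t, v) = (t, v + length qs * (2 * t\<^sup>2 + 2 * t + 1))"
proof (induction qs arbitrary: v)
  case (Cons q qs)
  obtain a b c d where q: "q = (a, b, c, d)" by (cases q)
  have le: "a \<le> 1" "b \<le> 1" "c \<le> 1" "d \<le> 1" using Cons.prems[of a b c d] q by auto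
  have "fold bound_step (block (0, 1, 2, l) q) (t, v) = (t, v + (2 * t\<^sup>2 + 2 * t + 1))"
    using kind_dem(1)[OF le(1), of 1] kind_dem(1)[OF le(2), of 0] kind_dem(1)[OF le(3), of 2] kind_dem(1)[OF le(4), of 0]
    by (simp add: q)
  moreover have "fold bound_step (concat (map (block (0, 1, 2, l)) qs)) (t, v + (2 * t\<^sup>2 + 2 * t + 1)) =
      (t, v + (2 * t\<^sup>2 + 2 * t + 1) + length qs * (2 * t\<^sup>2 + 2 * t + 1))"
    by (rule Cons.IH) (use Cons.prems in auto)
  ultimately show ?case by (simp add: algebra_simps)
qed simp

text \<open>Makes the dropped entry of a line irrelevant for the bound: in an even row it has kind
  0.\<close>

lemma fold_butlast: "(\<And>\<sigma>. xs \<noteq> [] \<Longrightarrow> f (last xs) \<sigma> = \<sigma>) \<Longrightarrow> fold f (butlast xs) \<sigma> = fold f xs \<sigma>"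
  by (cases xs rule: rev_cases) auto

context constraint_grid
begin

definition row_kinds :: "nat \<Rightarrow> quadruple" where
  "row_kinds y = (if Suc y = 2 * R then (7, 7, 7, 8) else if odd y then (5, 5, 5, 6)
     else (0, 1, 2, if y = 0 then 3 else 4))"

definition row :: "nat \<Rightarrow> nat list" where
  "row y = line (row_kinds y) (lft y) (rgt y) (map (quad y) [0..<m])"

definition grid_text :: "nat list" where "grid_text = concat (map row [0..<2 * R])"

lemma row_eq: "row y = map (\<lambda>x. vsym (kind_at m (row_kinds y) x) (D y x)) [0..<4 * m + 1]"
proof (rule nth_equalityI)
  let ?bs = "map (block (row_kinds y)) (map (quad y) [0..<m])"
  have lb: "\<And>xs. xs \<in> set ?bs \<Longrightarrow> length xs = 4" by (auto simp: length_block)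
  have lc: "length (concat ?bs) = 4 * m" using length_concat_uniform[of ?bs 4, OF lb] by simp
  then have l: "length (row y) = 4 * m + 1" unfolding row_def line_def using m by simp
  then show "length (row y) = length (map (\<lambda>x. vsym (kind_at m (row_kinds y) x) (D y x)) [0..<4 * m + 1])" by simp
  fix x assume "x < length (row y)"
  then have x: "x \<le> 4 * m" using l by simp
  obtain s a b e where k: "row_kinds y = (s, a, b, e)" by (cases "row_kinds y")
  have "row y ! x = vsym (kind_at m (row_kinds y) x) (D y x)"
  proof -
    consider "x = 0" | "x = 4 * m" | "0 < x" "x < 4 * m" using x by linarith
    then show ?thesis
    proof cases
      case 1
      then show ?thesis using m by (simp add: row_def line_def k D_def)
    next
      case 2
      then show ?thesis using m lc by (simp add: row_def line_def k D_def nth_append nth_Cons')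
    next
      case 3
      define i where "i = x - 1"
      have i: "x = Suc i" "i < 4 * m - 1" "i div 4 < m" using 3 by (auto simp: i_def)
      obtain p q u v where qd: "quad y (i div 4) = (p, q, u, v)" by (cases "quad y (i div 4)")
      have "row y ! x = butlast (concat ?bs) ! i" using i lc by (simp add: row_def line_def nth_append)
      also have "\<dots> = concat ?bs ! i" using i lc by (simp add: nth_butlast)
      also have "\<dots> = concat ?bs ! (i div 4 * 4 + i mod 4)" by simp
      also have "\<dots> = ?bs ! (i div 4) ! (i mod 4)" by (rule nth_concat_uniform[OF lb]) (use i in auto)
      also have "\<dots> = block (s, a, b, e) (p, q, u, v) ! (i mod 4)" using i k qd by simp
      finally have *: "row y ! x = block (s, a, b, e) (p, q, u, v) ! (i mod 4)" .
      have D: "D y x = (if i mod 4 = 0 then p else if i mod 4 = 1 then q else if i mod 4 = 2 then u else v)"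
        using i qd 3 by (simp add: D_def)
      have "i mod 4 < 4" by simp
      then consider "i mod 4 = 0" | "i mod 4 = 1" | "i mod 4 = 2" | "i mod 4 = 3" by linarith
      then show ?thesis unfolding k kind_at.simps using 3 * D i(1) by cases (auto simp: mod_Suc)
    qed
  qed
  then show "row y ! x = map (\<lambda>x. vsym (kind_at m (row_kinds y) x) (D y x)) [0..<4 * m + 1] ! x" using x by (simp del: upt_Suc)
qed

abbreviation "Wd \<equiv> 4 * m + 1"

lemma text_eq: "grid_text = map (\<lambda>v. vsym (kind_at m (row_kinds (v div Wd)) (v mod Wd)) (D (v div Wd) (v mod Wd))) [0..<2 * R * Wd]"
proof (rule nth_equalityI)
  have u: "\<And>xs. xs \<in> set (map row [0..<2 * R]) \<Longrightarrow> length xs = Wd" by (auto simp: row_eq)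
  show l: "length grid_text = length (map (\<lambda>v. vsym (kind_at m (row_kinds (v div Wd)) (v mod Wd)) (D (v div Wd) (v mod Wd))) [0..<2 * R * Wd])"
    unfolding grid_text_def using length_concat_uniform[of "map row [0..<2 * R]" Wd, OF u] by simp
  fix v assume v: "v < length grid_text"
  then have v': "v < 2 * R * Wd" using l by simp
  then have d: "v div Wd < 2 * R" by (simp add: less_mult_imp_div_less)
  have "grid_text ! v = grid_text ! (v div Wd * Wd + v mod Wd)" unfolding div_mult_mod_eq ..
  also have "\<dots> = map row [0..<2 * R] ! (v div Wd) ! (v mod Wd)"
    unfolding grid_text_def by (rule nth_concat_uniform[OF u]) (use d in simp_all)
  also have "\<dots> = row (v div Wd) ! (v mod Wd)" using d by simp
  also have "\<dots> = vsym (kind_at m (row_kinds (v div Wd)) (v mod Wd)) (D (v div Wd) (v mod Wd))"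
  proof -
    have "v mod Wd < Wd" by simp
    then show ?thesis unfolding row_eq by (metis (no_types, lifting) add_0 diff_zero length_upt nth_map nth_upt)
  qed
  finally show "grid_text ! v = map (\<lambda>v. vsym (kind_at m (row_kinds (v div Wd)) (v mod Wd)) (D (v div Wd) (v mod Wd))) [0..<2 * R * Wd] ! v"
    using v' by simp
qed

lemma kind_D: "kind (vsym \<kappa> (D y x)) = \<kappa>" "dem (vsym \<kappa> (D y x)) = D y x"
  by (rule kind_dem[OF D_le])+

lemma R_pos: "2 \<le> R" by (simp add: R_def)

lemma has_v_kind_at: "y < 2 * R \<Longrightarrow> has_v (kind_at m (row_kinds y) x) \<longleftrightarrow> Suc y < 2 * R"
  by (auto simp: row_kinds_def has_v_def)

lemma has_h_kind_at: "has_h (kind_at m (row_kinds y) x) \<longleftrightarrow> x \<noteq> 4 * m"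
  using m by (auto simp: row_kinds_def has_h_def)

lemma odd_last: "Suc y = 2 * R \<Longrightarrow> odd y" by presburger

lemma h_of_kind_at: "x \<noteq> 4 * m \<Longrightarrow> h_of B (kind_at m (row_kinds y) x) = hres B y"
  using odd_last[of y] by (auto simp: row_kinds_def h_of_def hres_def)

lemma v_of_kind_at: "Suc y \<noteq> 2 * R \<Longrightarrow> v_of B (kind_at m (row_kinds y) x) = vres B y x"
proof -
  assume y: "Suc y \<noteq> 2 * R"
  have "x mod 4 = 1 \<or> x mod 4 = 3 \<longleftrightarrow> odd x" by presburger
  moreover have "x mod 4 = 1 \<Longrightarrow> x \<noteq> 4 * m \<and> x \<noteq> 0" "x mod 4 = 3 \<Longrightarrow> x \<noteq> 4 * m \<and> x \<noteq> 0" by presburger+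
  ultimately show ?thesis using y by (auto simp: row_kinds_def v_of_def vres_def)
qed

lemma fold_row_even:
  assumes "even y" "y < 2 * R"
  shows "fold bound_step (row y) (t, v) = (t + (if y = 0 then 2 else 3), v + m * (2 * t\<^sup>2 + 2 * t + 1))"
proof -
  have k: "row_kinds y = (0, 1, 2, if y = 0 then 3 else 4)" using assms odd_last[of y] by (auto simp: row_kinds_def)
  let ?bs = "concat (map (block (row_kinds y)) (map (quad y) [0..<m]))"
  have le: "lft y \<le> 1" "rgt y \<le> 1" by (auto simp: lft_def rgt_def)
  have ql: "(a, b, c, d) \<in> set (map (quad y) [0..<m]) \<Longrightarrow> a \<le> 1 \<and> b \<le> 1 \<and> c \<le> 1 \<and> d \<le> 1" for a b c d
    using quad_le[of y, where a = a and b = b and c = c and d = d] by (metis imageE set_map)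
  obtain m' where m': "m = Suc m'" using m by (cases m) auto
  obtain a b c d where q: "quad y m' = (a, b, c, d)" by (cases "quad y m'")
  have d1: "d \<le> 1" using quad_le[OF q] by simp
  have "last ?bs = vsym 0 d" by (simp add: m' k q)
  then have "fold bound_step (butlast ?bs) tb = fold bound_step ?bs tb" for tb
    by (intro fold_butlast) (use d1 in \<open>auto split: prod.splits\<close>)
  moreover have "fold bound_step ?bs (t, v) = (t, v + length (map (quad y) [0..<m]) * (2 * t\<^sup>2 + 2 * t + 1))"
    unfolding k by (rule fold_bound_step_blocks) (rule ql)
  ultimately have "fold bound_step (butlast ?bs) (t, v) = (t, v + m * (2 * t\<^sup>2 + 2 * t + 1))" by (simp del: map_map)
  then show ?thesis using le unfolding row_def line_def by (simp add: k)
qed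

lemma fold_row_odd: "odd y \<Longrightarrow> fold bound_step (row y) tb = tb"
  proof (rule fold_bound_step_other)
  fix s assume y: "odd y" and "s \<in> set (row y)"
  then obtain x where "kind s = kind_at m (row_kinds y) x" unfolding row_eq using kind_D by auto
  then show "kind s \<notin> {1, 3, 4}" using y by (auto simp: row_kinds_def)
qed

lemma bound_of_text: "bound_of grid_text = B"
proof -
  \<comment> \<open>After \<open>h\<close> pairs of rows the counter stands at the base load
    \<open>3 * h - 1\<close> of the next layer.\<close>
  have "h \<le> R \<Longrightarrow> fold bound_step (concat (map row [0..<2 * h])) (0, 0) =
      (3 * h - 1, \<Sum>i < h. m * (2 * (3 * i - 1)\<^sup>2 + 2 * (3 * i - 1) + 1))" for h
  proof (induction h)
    case (Suc h)
    have "fold bound_step (concat (map row [0..<2 * Suc h])) (0, 0) =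
        fold bound_step (row (2 * h + 1)) (fold bound_step (row (2 * h)) (fold bound_step (concat (map row [0..<2 * h])) (0, 0)))"
      by simp
    then show ?case using Suc by (auto simp: fold_row_even fold_row_odd)
  qed simp
  from this[of R] show ?thesis unfolding bound_of_def grid_text_def B_def by simp
qed

lemma filter_concat_rows:
  "k \<le> 2 * R \<Longrightarrow> length (filter (\<lambda>s. has_v (kind s)) (concat (map row [0..<k]))) = min k (2 * R - 1) * Wd"
proof (induction k)
  case (Suc k)
  have "filter (\<lambda>s. has_v (kind s)) (row k) = (if Suc k < 2 * R then row k else [])"
    unfolding row_eq filter_map comp_def kind_D using Suc.prems has_v_kind_at[of k] by simp
  then have "length (filter (\<lambda>s. has_v (kind s)) (row k)) = (if Suc k < 2 * R then Wd else 0)" by (simp add: row_eq)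
  moreover have "min (Suc k) (2 * R - 1) = (if Suc k < 2 * R then k + 1 else k)" "min k (2 * R - 1) = k" using Suc.prems by auto
  ultimately show ?case using Suc by (simp add: algebra_simps)
qed simp

text \<open>The bridge from printing to combinatorics: kinds yield the same resistances as
  \<open>hres\<close> and \<open>vres\<close>, and the scanned bound is \<open>B\<close>.\<close>

lemma inst_of_text: "inst_of grid_text = grid_inst (2 * R) Wd D B"
proof -
  have len: "length grid_text = 2 * R * Wd" by (simp add: text_eq)
  have rt: "length (filter (\<lambda>s. has_v (kind s)) grid_text) = (2 * R - 1) * Wd"
    using filter_concat_rows[of "2 * R"] unfolding grid_text_def by simp
  have "length (filter (\<lambda>s. has_v (kind s)) grid_text) + width_of grid_text = length grid_text"
    unfolding width_of_def by (rule sum_length_filter_compl)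
  then have w: "width_of grid_text = Wd" unfolding rt len using R_pos by (cases "2 * R") auto
  have at: "grid_text ! v = vsym (kind_at m (row_kinds (v div Wd)) (v mod Wd)) (D (v div Wd) (v mod Wd))" if "v < 2 * R * Wd" for v
    using that unfolding text_eq by simp
  have dm: "map dem grid_text = map (\<lambda>v. D (v div Wd) (v mod Wd)) [0..<2 * R * Wd]"
    unfolding text_eq by (simp only: map_map comp_def kind_D)
  have lk: "links_of B Wd grid_text = concat (map (\<lambda>v.
      (if Suc (v mod Wd) < Wd then [(v, v + 1, hres B (v div Wd))] else []) @
      (if Suc (v div Wd) < 2 * R then [(v, v + Wd, vres B (v div Wd) (v mod Wd))] else [])) [0..<2 * R * Wd])"
    unfolding links_of_def len
  proof (intro arg_cong[of _ _ concat] map_cong refl)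
    fix v assume "v \<in> set [0..<2 * R * Wd]"
    then have v: "v < 2 * R * Wd" by simp
    then have d: "v div Wd < 2 * R" by (simp add: less_mult_imp_div_less)
    have x: "v mod Wd < Wd" by simp
    have k: "kind (grid_text ! v) = kind_at m (row_kinds (v div Wd)) (v mod Wd)" unfolding at[OF v] kind_D ..
    have e: "v mod Wd \<noteq> 4 * m \<longleftrightarrow> Suc (v mod Wd) < Wd" using x by linarith
    have hh: "Suc (v mod Wd) < Wd \<Longrightarrow> h_of B (kind_at m (row_kinds (v div Wd)) (v mod Wd)) = hres B (v div Wd)"
      by (rule h_of_kind_at) (simp only: e)
    have vv: "Suc (v div Wd) < 2 * R \<Longrightarrow> v_of B (kind_at m (row_kinds (v div Wd)) (v mod Wd)) = vres B (v div Wd) (v mod Wd)"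
      by (rule v_of_kind_at) (erule less_imp_neq)
    show "(if has_h (kind (grid_text ! v)) then [(v, v + 1, h_of B (kind (grid_text ! v)))] else []) @
         (if has_v (kind (grid_text ! v)) then [(v, v + Wd, v_of B (kind (grid_text ! v)))] else []) =
         (if Suc (v mod Wd) < Wd then [(v, v + 1, hres B (v div Wd))] else []) @
         (if Suc (v div Wd) < 2 * R then [(v, v + Wd, vres B (v div Wd) (v mod Wd))] else [])"
      unfolding k has_h_kind_at has_v_kind_at[OF d] e by (simp only: hh vv cong: if_cong)
  qed
  show ?thesis unfolding inst_of_def grid_inst_def bound_of_text w rt dm lk len ..
qed

end

section \<open>Writing the grid row by row\<close>

text \<open>Quantifying over the old contents of \<open>z\<close> makes the relation composable:
  such programs can be sequenced and looped while all other registers stay fixed.\<close>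

definition appends :: "prog \<Rightarrow> store \<Rightarrow> nat \<Rightarrow> nat list \<Rightarrow> bool" where
  "appends p \<sigma> z t \<longleftrightarrow> (\<forall>zs. eval p (\<sigma>(z := zs)) = \<sigma>(z := zs @ t))"

lemma appends_eval: "appends p \<sigma> z t \<Longrightarrow> eval p \<sigma> = \<sigma>(z := \<sigma> z @ t)"
  unfolding appends_def by (metis fun_upd_triv)

lemma appends_app: "appends (app z t) \<sigma> z t"
  by (simp add: appends_def)

lemma appends_seqs:
  "(\<And>i. i \<in> set is \<Longrightarrow> appends (f i) \<sigma> z (t i)) \<Longrightarrow> appends (seqs (map f is)) \<sigma> z (concat (map t is))"
  by (induction "is") (auto simp: appends_def)

lemma appends_Nil: "appends (seqs []) \<sigma> z []" by (simp add: appends_def)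

lemma appends_Cons: "appends p \<sigma> z t \<Longrightarrow> appends (seqs ps) \<sigma> z t' \<Longrightarrow> appends (seqs (p # ps)) \<sigma> z (t @ t')"
  by (simp add: appends_def)

lemma appends_For:
  assumes "q \<noteq> z" "\<And>s. s \<in> set (\<sigma> q) \<Longrightarrow> appends (p s) \<sigma> z (t s)"
  shows "appends (For q p) \<sigma> z (concat (map t (\<sigma> q)))"
proof -
  have "fold (\<lambda>s. eval (p s)) xs (\<sigma>(z := zs)) = \<sigma>(z := zs @ concat (map t xs))" if "set xs \<subseteq> set (\<sigma> q)" for xs zs
    using that assms(2) by (induction xs arbitrary: zs) (auto simp: appends_def)
  then show ?thesis using assms(1) by (simp add: appends_def)
qed

lemma appends_mark: "q \<noteq> z \<Longrightarrow> appends (For q (\<lambda>_. app z [a])) \<sigma> z (replicate (length (\<sigma> q)) a)"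
  using appends_For[of q z \<sigma> "\<lambda>_. app z [a]" "\<lambda>_. [a]"] by (simp add: appends_app map_replicate_const)

lemma appends_mark2:
  assumes "q \<noteq> z" "q' \<noteq> z"
  shows "appends (For q (\<lambda>_. For q' (\<lambda>_. app z [a]))) \<sigma> z (replicate (length (\<sigma> q) * length (\<sigma> q')) a)"
proof -
  have "concat (map (\<lambda>_. replicate n a) xs) = replicate (length xs * n) a" for xs :: "nat list" and n
    by (induction xs) (auto simp: replicate_add)
  then show ?thesis
    using appends_For[of q z \<sigma> "\<lambda>_. For q' (\<lambda>_. app z [a])" "\<lambda>_. replicate (length (\<sigma> q')) a"] assms
    by (simp add: appends_mark)
qed

lemma butlast_replicate': "butlast (replicate n a) = replicate (n - 1) a"
proof (cases n)
  case (Suc k)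
  have "replicate n a = replicate k a @ [a]" by (simp add: Suc replicate_append_same)
  then show ?thesis using Suc by simp
qed simp

text \<open>Horner's scheme in unary. Every coefficient takes a new register, since a loop over
  \<open>r\<close> may only write into registers above \<open>r\<close>.\<close>

lemma poly_prog_exists:
  fixes q :: "nat poly"
  assumes "1 \<le> b"
  shows "\<exists>p r. b \<le> r \<and> (\<forall>k S. r < k \<longrightarrow> 3 \<le> S \<longrightarrow> wf_prog k S p {}) \<and>
    (\<forall>\<sigma>. (\<forall>i \<ge> b. \<sigma> i = []) \<longrightarrow> eval p \<sigma> r = replicate (poly q (length (\<sigma> 0))) 1 \<and>
      (\<forall>i. i < b \<or> r < i \<longrightarrow> eval p \<sigma> i = \<sigma> i))"
proof (induction q)
  case 0
  show ?case by (intro exI[of _ Skip] exI[of _ b]) auto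
next
  case (pCons a q)
  from pCons.IH obtain p r where p1: "b \<le> r" and p2: "\<forall>k S. r < k \<longrightarrow> 3 \<le> S \<longrightarrow> wf_prog k S p {}"
    and p3: "\<forall>\<sigma>. (\<forall>i \<ge> b. \<sigma> i = []) \<longrightarrow> eval p \<sigma> r = replicate (poly q (length (\<sigma> 0))) 1 \<and>
      (\<forall>i. i < b \<or> r < i \<longrightarrow> eval p \<sigma> i = \<sigma> i)" by (elim exE conjE)
  have p: "b \<le> r" "\<And>k S. r < k \<Longrightarrow> 3 \<le> S \<Longrightarrow> wf_prog k S p {}"
    "\<And>\<sigma>. (\<forall>i \<ge> b. \<sigma> i = []) \<Longrightarrow> eval p \<sigma> r = replicate (poly q (length (\<sigma> 0))) 1"
    "\<And>\<sigma> i. (\<forall>i \<ge> b. \<sigma> i = []) \<Longrightarrow> i < b \<or> r < i \<Longrightarrow> eval p \<sigma> i = \<sigma> i"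
    using p1 p2 mp[OF spec[OF p3]] by blast+
  let ?p = "seqs [p, app (r + 1) (replicate a 1), For 0 (\<lambda>_. For r (\<lambda>_. app (r + 1) [1]))]"
  show ?case
  proof (intro exI[of _ ?p] exI[of _ "r + 1"] conjI allI impI)
    show "b \<le> r + 1" using p by simp
    show "wf_prog k S ?p {}" if "r + 1 < k" "3 \<le> S" for k S using that p(1) p(2)[of k S] assms by auto
    fix \<sigma> :: store assume s: "\<forall>i \<ge> b. \<sigma> i = []"
    let ?\<tau> = "(eval p \<sigma>)(r + 1 := eval p \<sigma> (r + 1) @ replicate a 1)"
    have v: "eval p \<sigma> 0 = \<sigma> 0" "eval p \<sigma> (r + 1) = []" "eval p \<sigma> r = replicate (poly q (length (\<sigma> 0))) 1"
      using p(1) p(3)[OF s] p(4)[OF s, of 0] p(4)[OF s, of "r + 1"] s assms by auto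
    have "eval ?p \<sigma> = eval (For 0 (\<lambda>_. For r (\<lambda>_. app (r + 1) [1]))) ?\<tau>"
      by (simp only: eval_seqs eval_app)
    also have "\<dots> = ?\<tau>(r + 1 := ?\<tau> (r + 1) @ replicate (length (?\<tau> 0) * length (?\<tau> r)) 1)"
      by (rule appends_eval[OF appends_mark2]) auto
    finally have e: "eval ?p \<sigma> = ?\<tau>(r + 1 := ?\<tau> (r + 1) @ replicate (length (?\<tau> 0) * length (?\<tau> r)) 1)" .
    show "eval ?p \<sigma> (r + 1) = replicate (poly (pCons a q) (length (\<sigma> 0))) 1"
      unfolding e using v by (simp add: replicate_add)
    show "eval ?p \<sigma> i = \<sigma> i" if "i < b \<or> r + 1 < i" for i
      unfolding e using that p(1) p(4)[OF s, of i] by auto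
  qed
qed

definition site_text :: "quadruple \<Rightarrow> ('x \<Rightarrow> quadruple) \<Rightarrow> 'x list \<Rightarrow> nat list" where
  "site_text \<kappa> f xs = concat (map (\<lambda>x. block \<kappa> (f x)) xs)"

definition line_prog :: "nat \<Rightarrow> quadruple \<Rightarrow> nat \<Rightarrow> nat \<Rightarrow> prog \<Rightarrow> prog" where
  "line_prog z \<kappa> d d' p = seqs [app z [vsym (fst \<kappa>) d], p, Pop z, app z [vsym (snd (snd (snd \<kappa>))) d']]"

lemma appends_line:
  assumes "appends p \<sigma> z (concat (map (block \<kappa>) qs))" "qs \<noteq> []"
  shows "appends (line_prog z \<kappa> d d' p) \<sigma> z (line \<kappa> d d' qs)"
proof -
  have "appends (line_prog z \<kappa> d d' p) \<sigma> z (vsym (fst \<kappa>) d # butlast t @ [vsym (snd (snd (snd \<kappa>))) d'])"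
    if "appends p \<sigma> z t" "t \<noteq> []" for t
    using that by (simp add: appends_def line_prog_def butlast_append)
  moreover have "concat (map (block \<kappa>) qs) \<noteq> []" using assms(2) length_block[of \<kappa> "hd qs"] by (cases qs) auto
  ultimately show ?thesis using assms(1) unfolding line_def by blast
qed

definition sites_prog :: "nat \<Rightarrow> nat \<Rightarrow> quadruple \<Rightarrow> (nat \<Rightarrow> 'x \<Rightarrow> quadruple) \<Rightarrow> 'x list \<Rightarrow> prog" where
  "sites_prog q z \<kappa> f xs = line_prog z \<kappa> 0 0 (For q (\<lambda>s. app z (site_text \<kappa> (f s) xs)))"

lemma blocks_sites: "concat (map (block \<kappa>) (concat (map (\<lambda>s. map (f s) xs) ss))) = concat (map (\<lambda>s. site_text \<kappa> (f s) xs) ss)"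
  by (induction ss) (auto simp: site_text_def comp_def)

lemma appends_sites:
  assumes "q \<noteq> z" "\<sigma> q \<noteq> []" "xs \<noteq> []"
  shows "appends (sites_prog q z \<kappa> f xs) \<sigma> z (line \<kappa> 0 0 (concat (map (\<lambda>s. map (f s) xs) (\<sigma> q))))"
  unfolding sites_prog_def
proof (rule appends_line)
  show "concat (map (\<lambda>s. map (f s) xs) (\<sigma> q)) \<noteq> []" using assms(2,3) by (cases "\<sigma> q") auto
  show "appends (For q (\<lambda>s. app z (site_text \<kappa> (f s) xs))) \<sigma> z (concat (map (block \<kappa>) (concat (map (\<lambda>s. map (f s) xs) (\<sigma> q)))))"
    unfolding blocks_sites by (rule appends_For[OF assms(1)]) (rule appends_app)
qed

definition phase_quad :: "nat \<Rightarrow> nat \<Rightarrow> quadruple" where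
  "phase_quad j s = (if j = 0 then (of_bool (s = 1), 1, 0, 1) else if j = 1 then (1, 1, of_bool (s \<noteq> 2), 1)
     else if j = 2 then (0, 1, of_bool (s = 2), 1) else (of_bool (s \<noteq> 1), 1, 1, 1))"

definition phase_kinds :: "nat \<Rightarrow> quadruple" where
  "phase_kinds j = (if even j then (5, 5, 5, 6) else (0, 1, 2, 4))"

definition constraint_text :: "'c tile list \<Rightarrow> nat \<Rightarrow> nat \<times> nat \<times> bool \<times> 'c \<Rightarrow> nat list" where
  "constraint_text xs N e = concat (map (\<lambda>j. line (phase_kinds j) (of_bool (2 \<le> j)) (of_bool (j < 2))
     (concat (map (\<lambda>s. map (\<lambda>x. phase_quad j (sign e s x)) xs) [0..<N]))) [0..<4])"

text \<open>\<open>d\<close>, \<open>h\<close> and \<open>r\<close> count in unary the sites before,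
  between and after the two sites of a constraint; all of these get the same text
  \<open>t\<close>.\<close>

definition phase_sites :: "nat \<Rightarrow> nat \<Rightarrow> nat \<Rightarrow> nat \<Rightarrow> nat list \<Rightarrow> nat list \<Rightarrow> nat list \<Rightarrow> prog" where
  "phase_sites d h r z t x y = seqs [For d (\<lambda>_. app z t), app z x, For h (\<lambda>_. app z t), app z y, For r (\<lambda>_. app z t)]"

lemma appends_phase_sites:
  assumes "d \<noteq> z" "h \<noteq> z" "r \<noteq> z"
  shows "appends (phase_sites d h r z t x y) \<sigma> z (concat (replicate (length (\<sigma> d)) t) @ x @ concat (replicate (length (\<sigma> h)) t) @ y @
    concat (replicate (length (\<sigma> r)) t))"
proof -
  have l: "appends (For q (\<lambda>_. app z t)) \<sigma> z (concat (replicate (length (\<sigma> q)) t))" if "q \<noteq> z" for q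
    using appends_For[OF that, of \<sigma> "\<lambda>_. app z t" "\<lambda>_. t"] by (simp add: appends_app map_replicate_const)
  have "appends (phase_sites d h r z t x y) \<sigma> z (concat (replicate (length (\<sigma> d)) t) @ x @ concat (replicate (length (\<sigma> h)) t) @ y @
    concat (replicate (length (\<sigma> r)) t) @ [])"
    unfolding phase_sites_def by (intro appends_Cons appends_Nil appends_app l assms)
  then show ?thesis by simp
qed

definition constraint_prog :: "nat \<Rightarrow> nat \<Rightarrow> nat \<Rightarrow> nat \<Rightarrow> 'c tile list \<Rightarrow> bool \<Rightarrow> 'c \<Rightarrow> prog" where
  "constraint_prog d h r z xs v k = seqs (map (\<lambda>j. line_prog z (phase_kinds j) (of_bool (2 \<le> j)) (of_bool (j < 2))
     (phase_sites d h r z (site_text (phase_kinds j) (\<lambda>x. phase_quad j 0) xs)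
        (site_text (phase_kinds j) (\<lambda>x. phase_quad j (of_bool (out_col v x = k))) xs)
        (site_text (phase_kinds j) (\<lambda>x. phase_quad j (2 * of_bool (in_col v x = k))) xs))) [0..<4])"

lemma map_split_two:
  assumes "c < c'" "c' < N" "\<And>s. s \<noteq> c \<Longrightarrow> s \<noteq> c' \<Longrightarrow> f s = a"
  shows "map f [0..<N] = replicate c a @ [f c] @ replicate (c' - c - 1) a @ [f c'] @ replicate (N - 1 - c') a"
proof -
  have "[0..<N] = [0..<c] @ [c] @ [Suc c..<c'] @ [c'] @ [Suc c'..<N]"
  proof -
    have "[i..<k] = [i..<j] @ [j] @ [Suc j..<k]" if "i \<le> j" "j < k" for i j k :: nat
      using that upt_add_eq_append[of i j "k - j"] by (simp add: upt_conv_Cons)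
    from this[of 0 c N] this[of "Suc c" c' N] show ?thesis using assms(1,2) by simp
  qed
  moreover have "map f [i..<j] = replicate (j - i) a" if "\<And>s. i \<le> s \<Longrightarrow> s < j \<Longrightarrow> s \<noteq> c \<and> s \<noteq> c'" for i j
    using that assms(3) by (intro nth_equalityI) auto
  ultimately show ?thesis using assms(1,2) by simp
qed

lemma appends_constraint:
  assumes "d \<noteq> z" "h \<noteq> z" "r \<noteq> z" "length (\<sigma> d) = c" "length (\<sigma> h) = \<delta> - 1" "length (\<sigma> r) = N - 1 - \<delta> - c"
    and \<delta>: "1 \<le> \<delta>" "c + \<delta> < N" and xs: "xs \<noteq> []"
  shows "appends (constraint_prog d h r z xs v k) \<sigma> z (constraint_text xs N (c, c + \<delta>, v, k))"
  unfolding constraint_prog_def constraint_text_def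
proof (rule appends_seqs, rule appends_line)
  fix j
  let ?f = "\<lambda>s. site_text (phase_kinds j) (\<lambda>x. phase_quad j (sign (c, c + \<delta>, v, k) s x)) xs"
  show "concat (map (\<lambda>s. map (\<lambda>x. phase_quad j (sign (c, c + \<delta>, v, k) s x)) xs) [0..<N]) \<noteq> []"
    using xs \<delta> by (auto simp: not_le)
  have "map ?f [0..<N] = replicate c (site_text (phase_kinds j) (\<lambda>x. phase_quad j 0) xs) @ [?f c] @
      replicate (c + \<delta> - c - 1) (site_text (phase_kinds j) (\<lambda>x. phase_quad j 0) xs) @ [?f (c + \<delta>)] @
      replicate (N - 1 - (c + \<delta>)) (site_text (phase_kinds j) (\<lambda>x. phase_quad j 0) xs)"
    by (rule map_split_two) (use \<delta> in \<open>auto simp: sign_def\<close>)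
  then have "concat (map ?f [0..<N]) = concat (replicate (length (\<sigma> d)) (site_text (phase_kinds j) (\<lambda>x. phase_quad j 0) xs)) @
      site_text (phase_kinds j) (\<lambda>x. phase_quad j (of_bool (out_col v x = k))) xs @
      concat (replicate (length (\<sigma> h)) (site_text (phase_kinds j) (\<lambda>x. phase_quad j 0) xs)) @
      site_text (phase_kinds j) (\<lambda>x. phase_quad j (2 * of_bool (in_col v x = k))) xs @
      concat (replicate (length (\<sigma> r)) (site_text (phase_kinds j) (\<lambda>x. phase_quad j 0) xs))"
    using \<delta> assms(4-6) by (simp add: sign_def add.commute)
  then show "appends (phase_sites d h r z (site_text (phase_kinds j) (\<lambda>x. phase_quad j 0) xs)
        (site_text (phase_kinds j) (\<lambda>x. phase_quad j (of_bool (out_col v x = k))) xs)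
        (site_text (phase_kinds j) (\<lambda>x. phase_quad j (2 * of_bool (in_col v x = k))) xs)) \<sigma> z
      (concat (map (block (phase_kinds j)) (concat (map (\<lambda>s. map (\<lambda>x. phase_quad j (sign (c, c + \<delta>, v, k) s x)) xs) [0..<N]))))"
    unfolding blocks_sites using appends_phase_sites[OF assms(1-3)] by simp
qed

text \<open>For the next constraint one more site lies before and one fewer after, while the number
  in between is fixed by the offset. The last round pops an empty register, matching truncated
  subtraction.\<close>

definition offset_prog :: "nat \<Rightarrow> nat \<Rightarrow> nat \<Rightarrow> nat \<Rightarrow> nat \<Rightarrow> 'c tile list \<Rightarrow> 'c list \<Rightarrow> bool \<Rightarrow> prog" where
  "offset_prog cr d h r z xs cl v = For cr (\<lambda>_. seqs [seqs (map (constraint_prog d h r z xs v) cl), app d [1], Pop r])"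

lemma eval_offset:
  assumes z: "cr \<noteq> z" "d \<noteq> z" "h \<noteq> z" "r \<noteq> z" "d \<noteq> r" "h \<noteq> d" "h \<noteq> r"
    and \<sigma>: "\<sigma> d = []" "length (\<sigma> h) = \<delta> - 1" "\<sigma> r = replicate (N - 1 - \<delta>) 1" "length (\<sigma> cr) = N - \<delta>"
    and \<delta>: "1 \<le> \<delta>" and xs: "xs \<noteq> []"
  shows "eval (offset_prog cr d h r z xs cl v) \<sigma> = \<sigma>(d := replicate (N - \<delta>) 1, r := replicate (N - 1 - \<delta> - (N - \<delta>)) 1,
    z := \<sigma> z @ concat (map (constraint_text xs N) (offset_constraints cl \<delta> v (N - \<delta>))))"
proof -
  let ?b = "seqs [seqs (map (constraint_prog d h r z xs v) cl), app d [1], Pop r]"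
  let ?t = "\<lambda>c. concat (map (\<lambda>k. constraint_text xs N (c, c + \<delta>, v, k)) cl)"
  define st where "st c zs = \<sigma>(d := replicate c 1, r := replicate (N - 1 - \<delta> - c) 1, z := zs)" for c zs
  have b: "eval ?b (st c zs) = st (Suc c) (zs @ ?t c)" if "c + \<delta> < N" for c zs
  proof -
    have "appends (seqs (map (constraint_prog d h r z xs v) cl)) (st c zs) z (?t c)"
      by (rule appends_seqs, rule appends_constraint[OF z(2-4)]) (use that z \<sigma> \<delta> xs in \<open>auto simp: st_def\<close>)
    from appends_eval[OF this] have "eval (seqs (map (constraint_prog d h r z xs v) cl)) (st c zs) = st c (zs @ ?t c)"
      by (simp add: st_def)
    then show ?thesis using z by (auto simp: st_def fun_eq_iff butlast_replicate' replicate_append_same)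
  qed
  have "fold (\<lambda>_. eval ?b) ys (st c zs) = st (c + length ys) (zs @ concat (map ?t [c..<c + length ys]))"
    if "c + length ys \<le> N - \<delta>" for ys :: "nat list" and c zs
    using that
  proof (induction ys arbitrary: c zs)
    case (Cons y ys)
    have "[c..<c + length (y # ys)] = c # [Suc c..<Suc c + length ys]" by (simp add: upt_conv_Cons del: upt_Suc)
    moreover have "eval ?b (st c zs) = st (Suc c) (zs @ ?t c)" using Cons.prems by (intro b) auto
    moreover have "fold (\<lambda>_. eval ?b) ys (st (Suc c) (zs @ ?t c)) =
        st (Suc c + length ys) ((zs @ ?t c) @ concat (map ?t [Suc c..<Suc c + length ys]))"
      by (rule Cons.IH) (use Cons.prems in simp)
    ultimately show ?case unfolding fold_simps by (simp only: list.map concat.simps append_assoc list.size add_Suc add_Suc_right add_0_right)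
  qed simp
  from this[of 0 "\<sigma> cr" "\<sigma> z"] \<sigma>(4)
  have "fold (\<lambda>_. eval ?b) (\<sigma> cr) (st 0 (\<sigma> z)) = st (N - \<delta>) (\<sigma> z @ concat (map ?t [0..<N - \<delta>]))" by simp
  moreover have "st 0 (\<sigma> z) = \<sigma>" using \<sigma> by (auto simp: st_def fun_eq_iff)
  moreover have "concat (map ?t cs) = concat (map (constraint_text xs N) (concat (map (\<lambda>c. map (\<lambda>k. (c, c + \<delta>, v, k)) cl) cs)))" for cs
    by (induction cs) (auto simp: comp_def)
  moreover have "eval (offset_prog cr d h r z xs cl v) \<sigma> = fold (\<lambda>_. eval ?b) (\<sigma> cr) \<sigma>"
    unfolding offset_prog_def eval.simps ..
  ultimately show ?thesis unfolding offset_constraints_def st_def by (simp only:)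
qed

section \<open>Site classes and unary counters from the input\<close>

lemma eval_mark2:
  "q \<noteq> r \<Longrightarrow> q' \<noteq> r \<Longrightarrow>
    eval (For q (\<lambda>_. For q' (\<lambda>_. app r [a]))) \<sigma> = \<sigma>(r := \<sigma> r @ replicate (length (\<sigma> q) * length (\<sigma> q')) a)"
  by (rule appends_eval[OF appends_mark2])

lemma eval_mark: "eval (For q (\<lambda>_. app r [a])) \<sigma> = \<sigma>(r := \<sigma> r @ replicate (length (\<sigma> q)) a)"
  by (simp add: map_replicate_const del: eval.simps(6))

text \<open>The flags in registers \<open>b\<close> and \<open>b + 1\<close> tell whether the next symbol of the input is its first one.\<close>

definition input_body :: "nat \<Rightarrow> nat \<Rightarrow> prog" where
  "input_body b s = seqs [For b (\<lambda>_. app (b + 2) [4]), For (b + 1) (\<lambda>_. app (b + 2) [6]),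
     For b (\<lambda>_. app (b + 1) [1]), Pop b, app (b + 2) [if s = 2 then 6 else 5]]"

definition template_prog :: "nat \<Rightarrow> nat \<Rightarrow> nat \<Rightarrow> prog" where
  "template_prog b r1 r2 = seqs [
     seqs [app b [1], app (b + 2) [1], For r2 (\<lambda>_. app (b + 2) [2]), app (b + 2) [2, 2]],
     For 0 (input_body b),
     seqs [For b (\<lambda>_. app (b + 2) [3]), For (b + 1) (\<lambda>_. app (b + 2) [5])],
     seqs [For r1 (\<lambda>_. app (b + 2) [7]), For r2 (\<lambda>_. app (b + 2) [2]), app (b + 2) [2]]]"

lemma eval_template_prog:
  assumes \<sigma>: "\<sigma> 0 = map bsym x" "length (\<sigma> r1) = n" "length (\<sigma> r2) = P" "\<sigma> b = []" "\<sigma> (b + 1) = []" "\<sigma> (b + 2) = []"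
    and b: "0 < b" "r1 < b" "r2 < b"
  shows "\<exists>J K. eval (template_prog b r1 r2) \<sigma> = \<sigma>(b := J, b + 1 := K, b + 2 := template x P n)"
proof -
  define st where "st J K T = \<sigma>(b := J, b + 1 := K, b + 2 := T)" for J K T
  let ?c = "\<lambda>c. if c then 6 else 5 :: nat"
  let ?T = "1 # replicate (P + 2) 2 :: nat list"
  have ne: "r1 \<noteq> b" "r1 \<noteq> b + 1" "r1 \<noteq> b + 2" "r2 \<noteq> b" "r2 \<noteq> b + 1" "r2 \<noteq> b + 2" using b by auto
  have st0: "st J K T 0 = map bsym x" "length (st J K T r1) = n" "length (st J K T r2) = P" "st J K T b = J" "st J K T (b + 1) = K" "st J K T (b + 2) = T" for J K T
    using \<sigma> b ne by (auto simp: st_def)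
  have upd: "(st J K T)(b := J') = st J' K T" "(st J K T)(b + 1 := K') = st J K' T" "(st J K T)(b + 2 := T') = st J K T'" for J K T J' K' T'
    by (auto simp: st_def fun_eq_iff)
  have s0: "\<sigma> = st [] [] []" using \<sigma> by (auto simp: st_def fun_eq_iff)
  have T: "[1] @ replicate P 2 @ [2, 2] = ?T" by (induction P) auto
  have 1: "eval (seqs [app b [1], app (b + 2) [1], For r2 (\<lambda>_. app (b + 2) [2]), app (b + 2) [2, 2]]) \<sigma> = st [1] [] ?T"
    unfolding s0 eval_seqs eval_app eval_mark st0 upd append_Nil append_assoc T ..
  have L: "eval (input_body b (bsym c)) (st [1] [] T) = st [] [1] (T @ [4, ?c c])"
    "eval (input_body b (bsym c)) (st [] [1] T) = st [] [1] (T @ [6, ?c c])" for T c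
    unfolding input_body_def eval_seqs eval_app eval_mark st0 upd eval.simps(3) by (simp_all add: bsym_def)
  have L2: "fold (\<lambda>s. eval (input_body b s)) (map bsym xs) (st [] [1] T) = st [] [1] (T @ concat (map (\<lambda>c. [6, ?c c]) xs))" for xs T
  proof (induction xs arbitrary: T)
    case (Cons c xs)
    show ?case unfolding list.map fold_simps L(2) Cons.IH by simp
  qed simp
  have ic: "map (\<lambda>c. if c then 6 else 5 :: nat) (concat (map (\<lambda>b. [True, b]) xs)) = concat (map (\<lambda>c. [6, ?c c]) xs)" for xs
    by (induction xs) auto
  have "\<exists>J K. eval (seqs [For b (\<lambda>_. app (b + 2) [3]), For (b + 1) (\<lambda>_. app (b + 2) [5])]) (eval (For 0 (input_body b)) (st [1] [] ?T)) =
      st J K (?T @ input_classes (delimit x))"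
  proof (cases x)
    \<comment> \<open>Only for the empty input is the closing \<open>False\<close> of
      \<open>delimit\<close> itself the first symbol, of class 3.\<close>
    case Nil
    have "eval (For 0 (input_body b)) (st [1] [] ?T) = st [1] [] ?T" unfolding eval.simps(6) st0(1) Nil by simp
    then have "eval (seqs [For b (\<lambda>_. app (b + 2) [3]), For (b + 1) (\<lambda>_. app (b + 2) [5])]) (eval (For 0 (input_body b)) (st [1] [] ?T)) = st [1] [] (?T @ [3])"
      unfolding eval_seqs eval_mark by (simp only: st0 upd) simp
    then show ?thesis using Nil by (auto simp: input_classes_def delimit_def)
  next
    case (Cons c xs)
    have "eval (For 0 (input_body b)) (st [1] [] ?T) = st [] [1] ((?T @ [4, ?c c]) @ concat (map (\<lambda>c. [6, ?c c]) xs))"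
      unfolding eval.simps(6) st0(1) Cons list.map fold_simps L(1) L2 ..
    then have "eval (seqs [For b (\<lambda>_. app (b + 2) [3]), For (b + 1) (\<lambda>_. app (b + 2) [5])]) (eval (For 0 (input_body b)) (st [1] [] ?T)) =
        st [] [1] (((?T @ [4, ?c c]) @ concat (map (\<lambda>c. [6, ?c c]) xs)) @ [5])"
      unfolding eval_seqs eval_mark by (simp only: st0 upd) simp
    moreover have "((?T @ [4, ?c c]) @ concat (map (\<lambda>c. [6, ?c c]) xs)) @ [5] = ?T @ input_classes (delimit x)"
      unfolding Cons input_classes_def delimit_def by (simp add: ic)
    ultimately show ?thesis by metis
  qed
  then obtain J K where 2: "eval (seqs [For b (\<lambda>_. app (b + 2) [3]), For (b + 1) (\<lambda>_. app (b + 2) [5])]) (eval (For 0 (input_body b)) (st [1] [] ?T)) =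
      st J K (?T @ input_classes (delimit x))" by blast
  have P1: "replicate (P + 1) 2 = replicate P 2 @ [2 :: nat]" by (simp add: replicate_append_same)
  have 3: "eval (seqs [For r1 (\<lambda>_. app (b + 2) [7]), For r2 (\<lambda>_. app (b + 2) [2]), app (b + 2) [2]]) (st J K U) =
      st J K (U @ replicate n 7 @ replicate (P + 1) 2)" for U
    unfolding eval_seqs eval_app eval_mark st0 upd append_assoc P1 ..
  have "eval (template_prog b r1 r2) \<sigma> = eval (seqs [For r1 (\<lambda>_. app (b + 2) [7]), For r2 (\<lambda>_. app (b + 2) [2]), app (b + 2) [2]])
     (eval (seqs [For b (\<lambda>_. app (b + 2) [3]), For (b + 1) (\<lambda>_. app (b + 2) [5])]) (eval (For 0 (input_body b))
      (eval (seqs [app b [1], app (b + 2) [1], For r2 (\<lambda>_. app (b + 2) [2]), app (b + 2) [2, 2]]) \<sigma>)))"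
    unfolding template_prog_def by (simp only: eval_seqs)
  also have "\<dots> = st J K (template x P n)" unfolding 1 2 3 template_def by simp
  finally show ?thesis unfolding st_def by blast
qed

text \<open>Reduction modulo 7 keeps the written symbols below 22 for every symbol a register might
  hold, as \<open>wf_prog\<close> requires; on the actual classes 1 to 7 it amounts to adding 7 or
  14.\<close>

definition classes_prog :: "nat \<Rightarrow> nat \<Rightarrow> prog" where
  "classes_prog b r2 = seqs [For (b + 2) (\<lambda>s. app (b + 3) [s]),
     For r2 (\<lambda>_. For (b + 2) (\<lambda>s. app (b + 3) [(s - 1) mod 7 + 8])), For (b + 2) (\<lambda>s. app (b + 3) [(s - 1) mod 7 + 15])]"

lemma eval_classes_prog:
  assumes "\<sigma> (b + 2) = tm" "\<sigma> (b + 3) = []" "length (\<sigma> r2) = P" "r2 < b" "\<forall>s \<in> set tm. 1 \<le> s \<and> s \<le> 7"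
  shows "eval (classes_prog b r2) \<sigma> = \<sigma>(b + 3 := tm @ concat (replicate P (map ((+) 7) tm)) @ map ((+) 14) tm)"
proof -
  have m: "map (\<lambda>s. (s - 1) mod 7 + 8) tm = map ((+) 7) tm" "map (\<lambda>s. (s - 1) mod 7 + 15) tm = map ((+) 14) tm"
    using assms(5) by (auto simp: Suc_le_eq)
  have f: "appends (For (b + 2) (\<lambda>s. app (b + 3) [h s])) \<sigma> (b + 3) (map h tm)" for h
    using appends_For[of "b + 2" "b + 3" \<sigma> "\<lambda>s. app (b + 3) [h s]" "\<lambda>s. [h s]"] assms(1) by (simp add: appends_app)
  have g: "appends (For r2 (\<lambda>_. For (b + 2) (\<lambda>s. app (b + 3) [h s]))) \<sigma> (b + 3) (concat (replicate P (map h tm)))" for h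
    using appends_For[of r2 "b + 3" \<sigma> "\<lambda>_. For (b + 2) (\<lambda>s. app (b + 3) [h s])" "\<lambda>_. map h tm"] f assms(3,4)
    by (simp add: map_replicate_const)
  have "appends (classes_prog b r2) \<sigma> (b + 3) (map (\<lambda>s. s) tm @ concat (replicate P (map (\<lambda>s. (s - 1) mod 7 + 8) tm)) @ map (\<lambda>s. (s - 1) mod 7 + 15) tm @ [])"
    unfolding classes_prog_def by (intro appends_Cons appends_Nil f g)
  from appends_eval[OF this] show ?thesis unfolding m assms(2) by simp
qed

text \<open>For offset 1, \<open>b + 4\<close> gives the number of rounds and \<open>b + 5\<close>
  the sites behind the first constraint; for offset \<open>W\<close> these are \<open>b + 7\<close>
  and \<open>b + 8\<close>. The number of sites in between is \<open>W - 1\<close> in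
  \<open>b + 11\<close>, and 0 in the register \<open>b + 10\<close>, which stays empty.\<close>

definition counters_prog :: "nat \<Rightarrow> nat \<Rightarrow> prog" where
  "counters_prog b r2 = seqs [For (b + 3) (\<lambda>_. app (b + 4) [1]), Pop (b + 4),
     For (b + 3) (\<lambda>_. app (b + 5) [1]), Pop (b + 5), Pop (b + 5),
     For (b + 2) (\<lambda>_. app (b + 7) [1]), For r2 (\<lambda>_. For (b + 2) (\<lambda>_. app (b + 7) [1])),
     For (b + 2) (\<lambda>_. app (b + 8) [1]), For r2 (\<lambda>_. For (b + 2) (\<lambda>_. app (b + 8) [1])), Pop (b + 8),
     For (b + 2) (\<lambda>_. app (b + 11) [1]), Pop (b + 11)]"

lemma eval_counters_prog:
  assumes "length (\<sigma> (b + 2)) = W" "length (\<sigma> (b + 3)) = N" "length (\<sigma> r2) = P" "r2 < b" "N = (P + 2) * W"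
    "\<And>i. b + 3 < i \<Longrightarrow> \<sigma> i = []"
  shows "eval (counters_prog b r2) \<sigma> = \<sigma>(b + 4 := replicate (N - 1) 1, b + 5 := replicate (N - 1 - 1) 1,
    b + 7 := replicate (N - W) 1, b + 8 := replicate (N - 1 - W) 1, b + 11 := replicate (W - 1) 1)"
proof -
  have e: "\<sigma> (b + 4) = []" "\<sigma> (b + 5) = []" "\<sigma> (b + 7) = []" "\<sigma> (b + 8) = []" "\<sigma> (b + 11) = []" using assms(6) by auto
  have ne: "r2 \<noteq> b + i" for i using assms(4) by simp
  have r: "replicate W (1 :: nat) @ replicate (P * W) 1 = replicate (N - W) 1" using assms(5) by (simp flip: replicate_add)
  have "eval (counters_prog b r2) \<sigma> = \<sigma>(b + 4 := replicate (N - 1) 1, b + 5 := replicate (N - 1 - 1) 1,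
    b + 7 := replicate W 1 @ replicate (P * W) 1, b + 8 := butlast (replicate W 1 @ replicate (P * W) 1), b + 11 := replicate (W - 1) 1)"
    unfolding counters_prog_def by (simp add: eval_mark eval_mark2 assms(1-3) assms(1)[simplified] ne e butlast_replicate' del: eval.simps(6) eval_For_app)
  also have "\<dots> = \<sigma>(b + 4 := replicate (N - 1) 1, b + 5 := replicate (N - 1 - 1) 1,
    b + 7 := replicate (N - W) 1, b + 8 := replicate (N - 1 - W) 1, b + 11 := replicate (W - 1) 1)"
    unfolding r butlast_replicate' by (simp add: diff_commute)
  finally show ?thesis .
qed

definition guess0 :: "nat \<Rightarrow> quadruple" where "guess0 w = (if w = 0 then (0, 0, 1, 0) else (1, 0, 0, 0))"
definition guess1 :: "nat \<Rightarrow> quadruple" where "guess1 w = (if w = 1 then (0, 1, 1, 0) else (1, 0, 1, 0))"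

definition emit_text :: "(nat \<Rightarrow> 'c tile \<Rightarrow> nat) \<Rightarrow> 'c list \<Rightarrow> nat list \<Rightarrow> nat \<Rightarrow> nat \<Rightarrow> nat list" where
  "emit_text kn cl cls N W = (let xs = all_tiles cl in
     line (0, 1, 2, 3) 0 0 (concat (map (\<lambda>s. map (\<lambda>x. guess0 (kn s x)) xs) cls)) @
     line (5, 5, 5, 6) 0 0 (concat (map (\<lambda>s. map (\<lambda>x. guess1 (kn s x)) xs) cls)) @
     line (0, 1, 2, 4) 0 0 (concat (map (\<lambda>s. map (\<lambda>x. (1, 0, 1, 0)) xs) cls)) @
     concat (map (constraint_text xs N) (offset_constraints cl 1 False (N - 1))) @
     concat (map (constraint_text xs N) (offset_constraints cl W True (N - W))) @
     line (7, 7, 7, 8) 0 0 (concat (map (\<lambda>s. map (\<lambda>x. (0, 0, 0, 0)) xs) cls)))"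

definition emit_prog :: "(nat \<Rightarrow> 'c tile \<Rightarrow> nat) \<Rightarrow> 'c list \<Rightarrow> nat \<Rightarrow> nat \<Rightarrow> nat \<Rightarrow> prog" where
  "emit_prog kn cl b r1 r2 = (let xs = all_tiles cl; z = b + 12 in seqs [template_prog b r1 r2, classes_prog b r2, counters_prog b r2,
     seqs [sites_prog (b + 3) z (0, 1, 2, 3) (\<lambda>s x. guess0 (kn s x)) xs, sites_prog (b + 3) z (5, 5, 5, 6) (\<lambda>s x. guess1 (kn s x)) xs,
       sites_prog (b + 3) z (0, 1, 2, 4) (\<lambda>s x. (1, 0, 1, 0)) xs],
     offset_prog (b + 4) (b + 6) (b + 10) (b + 5) z xs cl False, offset_prog (b + 7) (b + 9) (b + 11) (b + 8) z xs cl True,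
     sites_prog (b + 3) z (7, 7, 7, 8) (\<lambda>s x. (0, 0, 0, 0)) xs])"

lemma eval_emit:
  assumes \<sigma>: "\<sigma> 0 = map bsym x" "length (\<sigma> r1) = n" "length (\<sigma> r2) = P" "\<And>i. b \<le> i \<Longrightarrow> \<sigma> i = []"
    and b: "0 < b" "r1 < b" "r2 < b" and cl: "cl \<noteq> []"
    and W: "W = length (template x P n)" and N: "N = (P + 2) * W"
  shows "eval (emit_prog kn cl b r1 r2) \<sigma> (b + 12) = emit_text kn cl (classes x P n) N W"
    "b + 12 < i \<Longrightarrow> eval (emit_prog kn cl b r1 r2) \<sigma> i = []"
proof -
  let ?tm = "template x P n" and ?cls = "classes x P n" and ?xs = "all_tiles cl"
  have xs: "?xs \<noteq> []" using cl by (simp add: all_tiles_def flip: length_greater_0_conv)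
  obtain J K where "eval (template_prog b r1 r2) \<sigma> = \<sigma>(b := J, b + 1 := K, b + 2 := ?tm)"
    using eval_template_prog[of \<sigma> x r1 n r2 P b] assms by auto
  define \<sigma>1 where "\<sigma>1 = \<sigma>(b := J, b + 1 := K, b + 2 := ?tm)"
  have e1: "eval (template_prog b r1 r2) \<sigma> = \<sigma>1" unfolding \<sigma>1_def by fact
  have r: "\<forall>s \<in> set ?tm. 1 \<le> s \<and> s \<le> 7" by (auto simp: template_def input_classes_def)
  define \<sigma>2 where "\<sigma>2 = \<sigma>1(b + 3 := ?cls)"
  have e2: "eval (classes_prog b r2) \<sigma>1 = \<sigma>2"
    unfolding \<sigma>2_def classes_def by (rule eval_classes_prog) (use \<sigma> b r in \<open>auto simp: \<sigma>1_def\<close>)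
  have lc: "length ?cls = N" unfolding classes_def N W by (simp add: length_concat sum_list_replicate)
  have W1: "1 \<le> W" "2 \<le> N" by (auto simp: W N template_def)
  define \<sigma>3 where "\<sigma>3 = \<sigma>2(b + 4 := replicate (N - 1) 1, b + 5 := replicate (N - 1 - 1) 1,
    b + 7 := replicate (N - W) 1, b + 8 := replicate (N - 1 - W) 1, b + 11 := replicate (W - 1) 1)"
  have e3: "eval (counters_prog b r2) \<sigma>2 = \<sigma>3" unfolding \<sigma>3_def
    by (rule eval_counters_prog[where P = P]) (use \<sigma> b lc W N in \<open>auto simp: \<sigma>1_def \<sigma>2_def\<close>)
  have v: "\<sigma>3 (b + 3) = ?cls" "\<sigma>3 (b + 4) = replicate (N - 1) 1" "\<sigma>3 (b + 5) = replicate (N - 1 - 1) 1"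
    "\<sigma>3 (b + 6) = []" "\<sigma>3 (b + 7) = replicate (N - W) 1" "\<sigma>3 (b + 8) = replicate (N - 1 - W) 1" "\<sigma>3 (b + 9) = []" "\<sigma>3 (b + 10) = []"
    "\<sigma>3 (b + 11) = replicate (W - 1) 1" "\<And>i. b + 12 \<le> i \<Longrightarrow> \<sigma>3 i = []"
    using \<sigma>(4) by (auto simp: \<sigma>1_def \<sigma>2_def \<sigma>3_def)
  have cls: "?cls \<noteq> []" using lc W1 by auto
  let ?t0 = "line (0, 1, 2, 3) 0 0 (concat (map (\<lambda>s. map (\<lambda>x. guess0 (kn s x)) ?xs) ?cls))"
  let ?t1 = "line (5, 5, 5, 6) 0 0 (concat (map (\<lambda>s. map (\<lambda>x. guess1 (kn s x)) ?xs) ?cls))"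
  let ?t2 = "line (0, 1, 2, 4) 0 0 (concat (map (\<lambda>s. map (\<lambda>x. (1, 0, 1, 0)) ?xs) ?cls))"
  let ?t3 = "line (7, 7, 7, 8) 0 0 (concat (map (\<lambda>s. map (\<lambda>x. (0, 0, 0, 0)) ?xs) ?cls))"
  let ?u = "\<lambda>\<delta> v. concat (map (constraint_text ?xs N) (offset_constraints cl \<delta> v (N - \<delta>)))"
  have ap: "appends (sites_prog (b + 3) (b + 12) \<kappa> f ?xs) \<tau> (b + 12) (line \<kappa> 0 0 (concat (map (\<lambda>s. map (f s) ?xs) ?cls)))"
    if "\<tau> (b + 3) = ?cls" for \<tau> \<kappa> f
    using appends_sites[of "b + 3" "b + 12" \<tau> ?xs \<kappa> f] that cls xs by simp
  have "appends (seqs [sites_prog (b + 3) (b + 12) (0, 1, 2, 3) (\<lambda>s x. guess0 (kn s x)) ?xs, sites_prog (b + 3) (b + 12) (5, 5, 5, 6) (\<lambda>s x. guess1 (kn s x)) ?xs,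
       sites_prog (b + 3) (b + 12) (0, 1, 2, 4) (\<lambda>s x. (1, 0, 1, 0)) ?xs]) \<sigma>3 (b + 12) (?t0 @ ?t1 @ ?t2 @ [])"
    by (intro appends_Cons appends_Nil ap v(1))
  from appends_eval[OF this] have e4: "eval (seqs [sites_prog (b + 3) (b + 12) (0, 1, 2, 3) (\<lambda>s x. guess0 (kn s x)) ?xs, sites_prog (b + 3) (b + 12) (5, 5, 5, 6) (\<lambda>s x. guess1 (kn s x)) ?xs,
       sites_prog (b + 3) (b + 12) (0, 1, 2, 4) (\<lambda>s x. (1, 0, 1, 0)) ?xs]) \<sigma>3 = \<sigma>3(b + 12 := ?t0 @ ?t1 @ ?t2)" using v(10)[of "b + 12"] by simp
  define \<sigma>4 where "\<sigma>4 = \<sigma>3(b + 12 := ?t0 @ ?t1 @ ?t2)"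
  define \<sigma>5 where "\<sigma>5 = \<sigma>4(b + 6 := replicate (N - 1) 1, b + 5 := replicate (N - 1 - 1 - (N - 1)) 1, b + 12 := \<sigma>4 (b + 12) @ ?u 1 False)"
  have e5: "eval (offset_prog (b + 4) (b + 6) (b + 10) (b + 5) (b + 12) ?xs cl False) \<sigma>4 = \<sigma>5"
    unfolding \<sigma>5_def by (rule eval_offset) (use v xs in \<open>auto simp: \<sigma>4_def\<close>)
  define \<sigma>6 where "\<sigma>6 = \<sigma>5(b + 9 := replicate (N - W) 1, b + 8 := replicate (N - 1 - W - (N - W)) 1, b + 12 := \<sigma>5 (b + 12) @ ?u W True)"
  have e6: "eval (offset_prog (b + 7) (b + 9) (b + 11) (b + 8) (b + 12) ?xs cl True) \<sigma>5 = \<sigma>6"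
    unfolding \<sigma>6_def by (rule eval_offset) (use v xs W1 in \<open>auto simp: \<sigma>4_def \<sigma>5_def\<close>)
  have "\<sigma>6 (b + 3) = ?cls" using v(1) by (simp add: \<sigma>4_def \<sigma>5_def \<sigma>6_def)
  then have "appends (sites_prog (b + 3) (b + 12) (7, 7, 7, 8) (\<lambda>s x. (0, 0, 0, 0)) ?xs) \<sigma>6 (b + 12) ?t3" by (rule ap)
  from appends_eval[OF this] have e7: "eval (sites_prog (b + 3) (b + 12) (7, 7, 7, 8) (\<lambda>s x. (0, 0, 0, 0)) ?xs) \<sigma>6 = \<sigma>6(b + 12 := \<sigma>6 (b + 12) @ ?t3)" .
  have e: "eval (emit_prog kn cl b r1 r2) \<sigma> = \<sigma>6(b + 12 := \<sigma>6 (b + 12) @ ?t3)"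
    unfolding emit_prog_def Let_def eval_seqs e1 e2 e3 e4[unfolded eval_seqs] \<sigma>4_def[symmetric] e5 e6 e7 ..
  have "\<sigma>6 (b + 12) @ ?t3 = emit_text kn cl ?cls N W"
    by (simp add: \<sigma>6_def \<sigma>5_def \<sigma>4_def emit_text_def Let_def)
  then show "eval (emit_prog kn cl b r1 r2) \<sigma> (b + 12) = emit_text kn cl ?cls N W" unfolding e by simp
  show "b + 12 < i \<Longrightarrow> eval (emit_prog kn cl b r1 r2) \<sigma> i = []" unfolding e using v(10)[of i] by (simp add: \<sigma>6_def \<sigma>5_def \<sigma>4_def)
qed

section \<open>Well-formedness of the printing programs\<close>

fun small :: "nat \<Rightarrow> quadruple \<Rightarrow> bool" where
  "small n (a, b, c, d) \<longleftrightarrow> a \<le> n \<and> b \<le> n \<and> c \<le> n \<and> d \<le> n"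

text \<open>Kinds up to 8 and demands up to 1 give vertex symbols up to 18. The limit 22 comes from
  the 21 site classes, seven for each type of row.\<close>

lemma site_text_range:
  assumes "small 8 \<kappa>" "\<And>x. small 1 (f x)" "s \<in> set (site_text \<kappa> f xs)"
  shows "0 < s \<and> s < 22"
proof -
  obtain x where "s \<in> set (block \<kappa> (f x))" using assms(3) by (auto simp: site_text_def)
  then show ?thesis using assms(1) assms(2)[of x] by (cases \<kappa>; cases "f x") (auto simp: vsym_def)
qed

lemma wf_line: "small 8 \<kappa> \<Longrightarrow> d \<le> 1 \<Longrightarrow> d' \<le> 1 \<Longrightarrow> z < k \<Longrightarrow> (\<forall>a \<in> A. a < z) \<Longrightarrow> wf_prog k 22 p A \<Longrightarrow>
    wf_prog k 22 (line_prog z \<kappa> d d' p) A"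
  by (cases \<kappa>) (auto simp: line_prog_def vsym_def)

lemma wf_sites: "small 8 \<kappa> \<Longrightarrow> (\<And>s x. small 1 (f s x)) \<Longrightarrow> z < k \<Longrightarrow> q < z \<Longrightarrow> wf_prog k 22 (sites_prog q z \<kappa> f xs) {}"
  unfolding sites_prog_def by (rule wf_line) (auto dest: site_text_range[rotated 2])

lemma small_phase: "small 1 (phase_quad j s)" "small 8 (phase_kinds j)"
  by (auto simp: phase_quad_def phase_kinds_def)

lemma wf_constraint:
  assumes "z < k" "d < z" "h < z" "r < z" "d \<notin> A" "h \<notin> A" "r \<notin> A" "\<forall>a \<in> A. a < z"
  shows "wf_prog k 22 (constraint_prog d h r z xs v c) A"
proof -
  have t: "wf_prog k 22 (app z (site_text (phase_kinds j) (\<lambda>x. phase_quad j (f x)) xs)) A'" if "\<forall>a \<in> A'. a < z" for j A' and f :: "'a tile \<Rightarrow> nat"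
    using that assms(1) site_text_range[of "phase_kinds j" "\<lambda>x. phase_quad j (f x)" _ xs] small_phase by auto
  have "wf_prog k 22 (phase_sites d h r z (site_text (phase_kinds j) (\<lambda>x. phase_quad j 0) xs)
        (site_text (phase_kinds j) (\<lambda>x. phase_quad j (of_bool (out_col v x = c))) xs)
        (site_text (phase_kinds j) (\<lambda>x. phase_quad j (2 * of_bool (in_col v x = c))) xs)) A" for j
    unfolding phase_sites_def using assms by (auto simp del: wf_app intro!: t)
  then show ?thesis unfolding constraint_prog_def using assms by (auto intro!: wf_line small_phase)
qed

lemma wf_offset:
  assumes "z < k" "cr < d" "cr < r" "cr < h" "d < z" "h < z" "r < z"
  shows "wf_prog k 22 (offset_prog cr d h r z xs cl v) {}"
proof -
  have "wf_prog k 22 (constraint_prog d h r z xs v c) {cr}" for c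
    by (rule wf_constraint) (use assms in auto)
  then show ?thesis unfolding offset_prog_def using assms by auto
qed

lemma wf_emit:
  assumes "0 < b" "r1 < b" "r2 < b" "b + 12 < k"
  shows "wf_prog k 22 (emit_prog kn cl b r1 r2) {}"
proof -
  have 1: "wf_prog k 22 (template_prog b r1 r2) {}" using assms by (auto simp: template_prog_def input_body_def)
  have "(s - 1) mod 7 + 8 < 22 \<and> (s - 1) mod 7 + 15 < (22 :: nat)" for s
    using mod_less_divisor[of 7 "s - 1"] by linarith
  then have 2: "wf_prog k 22 (classes_prog b r2) {}" using assms by (auto simp: classes_prog_def)
  have 3: "wf_prog k 22 (counters_prog b r2) {}" using assms by (auto simp: counters_prog_def)
  have 4: "wf_prog k 22 (sites_prog (b + 3) (b + 12) \<kappa> f xs) {}" if "small 8 \<kappa>" "\<And>s x. small 1 (f s x)" for \<kappa> f and xs :: "'a tile list"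
    by (rule wf_sites[OF that]) (use assms in auto)
  show ?thesis unfolding emit_prog_def Let_def wf_seqs
    using 1 2 3 assms by (auto intro!: 4 wf_offset simp: guess0_def guess1_def)
qed

section \<open>The reduction\<close>

lemma map_div_mod:
  assumes "g = length xs"
  shows "map (\<lambda>q. F (q div g) (xs ! (q mod g))) [0..<N * g] = concat (map (\<lambda>c. map (F c) xs) [0..<N])"
proof (rule nth_equalityI)
  have u: "\<And>ys. ys \<in> set (map (\<lambda>c. map (F c) xs) [0..<N]) \<Longrightarrow> length ys = g" using assms by auto
  show l: "length (map (\<lambda>q. F (q div g) (xs ! (q mod g))) [0..<N * g]) = length (concat (map (\<lambda>c. map (F c) xs) [0..<N]))"
    using length_concat_uniform[of "map (\<lambda>c. map (F c) xs) [0..<N]" g, OF u] by simp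
  fix q assume "q < length (map (\<lambda>q. F (q div g) (xs ! (q mod g))) [0..<N * g])"
  then have q: "q < N * g" by simp
  then have g: "0 < g" by (cases g) auto
  have d: "q div g < N" using q by (simp add: less_mult_imp_div_less)
  have "concat (map (\<lambda>c. map (F c) xs) [0..<N]) ! (q div g * g + q mod g) = map (\<lambda>c. map (F c) xs) [0..<N] ! (q div g) ! (q mod g)"
    by (rule nth_concat_uniform[OF u]) (use d g in auto)
  then show "map (\<lambda>q. F (q div g) (xs ! (q mod g))) [0..<N * g] ! q = concat (map (\<lambda>c. map (F c) xs) [0..<N]) ! q"
    using q d g assms by simp
qed

context constraint_grid
begin

lemma grid_text_split:
  "grid_text = row 0 @ row 1 @ row 2 @
     concat (map (\<lambda>e. row (3 + 4 * e) @ row (4 + 4 * e) @ row (5 + 4 * e) @ row (6 + 4 * e)) [0..<E]) @ row (3 + 4 * E)"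
proof -
  have "concat (map row [0..<3 + 4 * e]) = row 0 @ row 1 @ row 2 @
     concat (map (\<lambda>e. row (3 + 4 * e) @ row (4 + 4 * e) @ row (5 + 4 * e) @ row (6 + 4 * e)) [0..<e])" for e
  proof (induction e)
    case (Suc e)
    have "[0..<3 + 4 * Suc e] = [0..<3 + 4 * e] @ [3 + 4 * e, 4 + 4 * e, 5 + 4 * e, 6 + 4 * e]"
      using upt_add_eq_append[of 0 "3 + 4 * e" 4] by (simp add: upt_rec)
    then show ?case using Suc by simp
  qed (simp add: upt_rec numeral_3_eq_3 numeral_2_eq_2)
  moreover have "2 * R = Suc (3 + 4 * E)" by (simp add: R_def)
  then have "[0..<2 * R] = [0..<3 + 4 * E] @ [3 + 4 * E]" by (simp only: upt_Suc) simp
  ultimately show ?thesis unfolding grid_text_def by (simp only: map_append concat_append list.map concat.simps append_assoc append_Nil2)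
qed

text \<open>With \<open>3 * h - 1\<close> at most \<open>3 * R\<close>, a summand is at most
  \<open>18 * R^2 + 6 * R + 1\<close>, hence the constant 25.\<close>

lemma B_le: "B \<le> 25 * R ^ 3 * m"
proof -
  have "B \<le> (\<Sum>h < R. m * (25 * R\<^sup>2))"
    unfolding B_def
  proof (intro sum_mono mult_le_mono2)
    fix h assume "h \<in> {..<R}"
    then have h: "3 * h - 1 \<le> 3 * R" by simp
    have "2 * (3 * h - 1)\<^sup>2 + 2 * (3 * h - 1) + 1 \<le> 2 * (3 * R)\<^sup>2 + 2 * (3 * R) + 1"
      using h power_mono[OF h, of 2] by simp
    also have "\<dots> \<le> 25 * R\<^sup>2" using R_pos by (cases R) (auto simp: power2_eq_square algebra_simps)
    finally show "2 * (3 * h - 1)\<^sup>2 + 2 * (3 * h - 1) + 1 \<le> 25 * R\<^sup>2" .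
  qed
  also have "\<dots> = 25 * R ^ 3 * m" by (simp add: power2_eq_square power3_eq_cube)
  finally show ?thesis .
qed

text \<open>Every number costs at least its end mark, so the code is at least as long as the number
  of vertices.\<close>

lemma length_encode_ge: "length (demands J) \<le> length (encode J)"
proof -
  have "length xs \<le> length (concat (map (delimit \<circ> binary) xs))" for xs
    by (induction xs) (auto simp: delimit_def)
  from this[of "demands J"] show ?thesis by (simp add: encode_def)
qed

text \<open>\<open>Suc B\<close> is the resistance that stands for infinity. Both \<open>R\<close>
  and \<open>m\<close> are bounded by the number of vertices, hence by the length of the code, so
  \<open>Suc B\<close> is at most 26 times its fourth power.\<close>

lemma in_restricted: "I \<in> restricted_grid_ednr (monom 26 4)"
  unfolding restricted_grid_ednr_def
proof (intro CollectI conjI ballI)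
  let ?l = "length (encode I)"
  show "ednr_instance I" using D_root0 by (intro grid_ednr_instance)
  show "\<exists>n m. grid_graph n m (verts I) (edges I)" using grid_is_grid by blast
  show "demands I ! v \<in> {0, 1}" if "v \<in> verts I - {root I}" for v
  proof -
    have "demands I ! v \<le> 1" using that D_le by (simp add: grid_inst_def verts_def)
    then show ?thesis by auto
  qed
  have "2 * R * (2 * (2 * m) + 1) \<le> ?l" using length_encode_ge[of I] by (simp add: grid_inst_def)
  moreover have "R * 1 \<le> 2 * R * (2 * (2 * m) + 1)" "1 * m \<le> 2 * R * (2 * (2 * m) + 1)"
    using R_pos by (intro mult_le_mono; simp)+
  ultimately have l: "R \<le> ?l" "m \<le> ?l" by auto
  have "B \<le> 25 * R ^ 3 * m" by (rule B_le)
  also have "\<dots> \<le> 25 * ?l ^ 3 * ?l" using l by (intro mult_le_mono power_mono) auto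
  also have "\<dots> = 25 * ?l ^ 4"
  proof -
    have "a ^ 4 = a ^ 3 * a" for a :: nat by (simp add: eval_nat_numeral)
    then show ?thesis by (simp only: mult.assoc)
  qed
  finally have "B \<le> 25 * ?l ^ 4" .
  moreover have "1 \<le> ?l ^ 4" using l(1) R_pos by (intro one_le_power) linarith
  ultimately have "Suc B \<le> 26 * ?l ^ 4" by linarith
  then have "Suc B \<le> poly (monom 26 4) ?l" by (simp add: poly_monom)
  moreover have "bound I < Suc B" by (simp add: grid_inst_def)
  moreover have "resistance I e \<in> {0, 1, Suc B}" if e: "e \<in> edges I" for e
  proof -
    obtain u v w where uv: "(u, v, w) \<in> set (links I)" "e = {u, v}" using e by (auto simp: edges_def)
    have "ednr_instance I" using D_root0 by (intro grid_ednr_instance)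
    then have "resistance I e = w" unfolding uv(2) using uv(1)
      by (intro resistance_link) (auto simp: ednr_instance_def)
    moreover have "hres B y \<in> {0, 1, Suc B}" "vres B y x \<in> {0, 1, Suc B}" for x y by (auto simp: hres_def vres_def)
    ultimately show ?thesis using uv(1) unfolding in_links by metis
  qed
  ultimately show "\<exists>M>bound I. M \<le> poly (monom 26 4) ?l \<and> (\<forall>e\<in>edges I. resistance I e \<in> {0, 1, M})" by blast
qed

end

context tiling_problem
begin

text \<open>Indexing bits by \<open>q div g\<close> and \<open>q mod g\<close> unfolds into a loop
  over sites and an inner list of tiles, which is the shape in which the program writes a row; the
  four rows of a constraint are grouped together.\<close>

lemma emit_text_eq:
  assumes "length cls = N"
  shows "emit_text kn cl cls N W = grid_text"
proof -
  let ?xs = "all_tiles cl" and ?E = "length constraints"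
  have rw: "map (quad y) [0..<N * g] = concat (map (\<lambda>c. map (F c) ?xs) [0..<N])"
    if "\<And>q. quad y q = F (q div g) (?xs ! (q mod g))" for y F
    unfolding map_div_mod[OF g_def, symmetric] using that by simp
  have cl: "concat (map (\<lambda>c. map (\<lambda>x. h (kn (cls ! c) x)) ?xs) [0..<N]) = concat (map (\<lambda>s. map (\<lambda>x. h (kn s x)) ?xs) cls)" for h :: "nat \<Rightarrow> quadruple"
  proof -
    have "map (\<lambda>c. map (\<lambda>x. h (kn (cls ! c) x)) ?xs) [0..<N] = map (\<lambda>s. map (\<lambda>x. h (kn s x)) ?xs) (map ((!) cls) [0..<length cls])"
      using assms by simp
    then show ?thesis unfolding map_nth by simp
  qed
  have lr: "lft y = 0" "rgt y = 0" if "y < 3 \<or> 3 + 4 * ?E \<le> y" for y using that by (auto simp: lft_def rgt_def)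
  have R: "2 * R = 4 + 4 * ?E" by (simp add: R_def)
  have k: "row_kinds 0 = (0, 1, 2, 3)" "row_kinds 1 = (5, 5, 5, 6)" "row_kinds 2 = (0, 1, 2, 4)" "row_kinds (3 + 4 * ?E) = (7, 7, 7, 8)"
    by (auto simp: row_kinds_def R)
  have "quad 0 q = guess0 (kn (cls ! (q div g)) (?xs ! (q mod g)))" for q unfolding guess_rows knd_def guess0_def ..
  note 0 = rw[OF this, unfolded cl[of guess0]]
  have "quad 1 q = guess1 (kn (cls ! (q div g)) (?xs ! (q mod g)))" for q unfolding guess_rows knd_def guess1_def ..
  note 1 = rw[OF this, unfolded cl[of guess1]]
  have "quad 2 q = (\<lambda>_. (1, 0, 1, 0)) (kn (cls ! (q div g)) (?xs ! (q mod g)))" for q unfolding guess_rows ..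
  note 2 = rw[OF this, unfolded cl[of "\<lambda>_. (1, 0, 1, 0)"]]
  have "quad (3 + 4 * ?E) q = (\<lambda>_. (0, 0, 0, 0)) (kn (cls ! (q div g)) (?xs ! (q mod g)))" for q by (simp add: quad_def)
  note 3 = rw[OF this, unfolded cl[of "\<lambda>_. (0, 0, 0, 0)"]]
  have ph: "row (3 + 4 * e) @ row (4 + 4 * e) @ row (5 + 4 * e) @ row (6 + 4 * e) = constraint_text ?xs N (constraints ! e)" if e: "e < ?E" for e
  proof -
    have r: "row (3 + j + 4 * e) = line (phase_kinds j) (of_bool (2 \<le> j)) (of_bool (j < 2))
       (concat (map (\<lambda>s. map (\<lambda>x. phase_quad j (sign (constraints ! e) s x)) ?xs) [0..<N]))" if j: "j < 4" for j
    proof -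
      have *: "quad (3 + j + 4 * e) q = phase_quad j (sign (constraints ! e) (q div g) (?xs ! (q mod g)))"
        "lft (3 + j + 4 * e) = of_bool (2 \<le> j)" "rgt (3 + j + 4 * e) = of_bool (j < 2)" for q
      proof -
        have "j = 0 \<or> j = 1 \<or> j = 2 \<or> j = 3" using j by auto
        then show "quad (3 + j + 4 * e) q = phase_quad j (sign (constraints ! e) (q div g) (?xs ! (q mod g)))"
          "lft (3 + j + 4 * e) = of_bool (2 \<le> j)" "rgt (3 + j + 4 * e) = of_bool (j < 2)"
          using phase_rows(1-4)[OF e, of q] phase_rows(5-12)[OF e] by (auto simp: phase_quad_def sg_def)
      qed
      have "row_kinds (3 + j + 4 * e) = phase_kinds j" using e j by (auto simp: row_kinds_def R phase_kinds_def)
      then show ?thesis unfolding row_def rw[OF *(1)] *(2,3) by simp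
    qed
    have "[0..<4] = [0, 1, 2, 3 :: nat]" by (simp add: upt_rec)
    then show ?thesis unfolding constraint_text_def using r[of 0] r[of 1] r[of 2] r[of 3] by simp
  qed
  have "map (\<lambda>e. row (3 + 4 * e) @ row (4 + 4 * e) @ row (5 + 4 * e) @ row (6 + 4 * e)) [0..<?E] = map (constraint_text ?xs N) (map ((!) constraints) [0..<?E])"
    using ph by simp
  then have c: "concat (map (\<lambda>e. row (3 + 4 * e) @ row (4 + 4 * e) @ row (5 + 4 * e) @ row (6 + 4 * e)) [0..<?E]) =
      concat (map (constraint_text ?xs N) (offset_constraints cl 1 False (N - 1))) @
      concat (map (constraint_text ?xs N) (offset_constraints cl W True (N - W)))"
    unfolding map_nth by (simp add: constraints_def)
  have lr': "lft 0 = 0" "rgt 0 = 0" "lft 1 = 0" "rgt 1 = 0" "lft 2 = 0" "rgt 2 = 0" "lft (3 + 4 * ?E) = 0" "rgt (3 + 4 * ?E) = 0"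
    by (rule lr; simp)+
  have r: "row 0 = line (0, 1, 2, 3) 0 0 (concat (map (\<lambda>s. map (\<lambda>x. guess0 (kn s x)) ?xs) cls))"
    "row 1 = line (5, 5, 5, 6) 0 0 (concat (map (\<lambda>s. map (\<lambda>x. guess1 (kn s x)) ?xs) cls))"
    "row 2 = line (0, 1, 2, 4) 0 0 (concat (map (\<lambda>s. map (\<lambda>x. (1, 0, 1, 0)) ?xs) cls))"
    "row (3 + 4 * ?E) = line (7, 7, 7, 8) 0 0 (concat (map (\<lambda>s. map (\<lambda>x. (0, 0, 0, 0)) ?xs) cls))"
    unfolding row_def k lr' 0 1 2 3 by (rule refl)+
  show ?thesis unfolding grid_text_split c r emit_text_def Let_def append_assoc ..
qed

lemma reduction:
  assumes "length cls = N"
  shows "inst_of (emit_text kn cl cls N W) \<in> restricted_grid_ednr (monom 26 4)"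
    "ednr_yes (inst_of (emit_text kn cl cls N W)) \<longleftrightarrow> (\<exists>T. tiling T)"
proof -
  have "2 * (2 * (N * g)) + 1 = 4 * (N * g) + 1" by simp
  then have "inst_of (emit_text kn cl cls N W) = I" unfolding emit_text_eq[OF assms] inst_of_text by (simp only:)
  then show "inst_of (emit_text kn cl cls N W) \<in> restricted_grid_ednr (monom 26 4)"
    "ednr_yes (inst_of (emit_text kn cl cls N W)) \<longleftrightarrow> (\<exists>T. tiling T)"
    using in_restricted yes_iff_tiling by simp_all
qed

end

context tableau_input
begin

lemma tiling_problem_classes:
  assumes "distinct cl" "set cl = colors"
  shows "tiling_problem cl N W (classes x P n) kn start"
proof
  have S: "Sep \<in> set cl" using assms(2) by (auto simp: colors_def)
  show "distinct cl" "cl \<noteq> []" using assms S by auto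
  have W: "1 \<le> W" by (simp add: W_eq)
  then show "1 \<le> N" "1 \<le> W" by (auto simp: N_def)
  show "start \<in> set (all_tiles cl)" using S by (simp add: start_def all_tiles_def)
  have 0: "kn (classes x P n ! 0) y = 2 * of_bool (y = start)" for y using kn_class[of 0 0 y] W by simp
  show "kn (classes x P n ! 0) start = 2" "\<And>y. y \<noteq> start \<Longrightarrow> kn (classes x P n ! 0) y = 0" unfolding 0 by simp_all
  fix c y assume c: "0 < c" "c < N"
  have t: "c div W < P + 2" using c by (simp add: N_def less_mult_imp_div_less)
  have i: "c mod W < W" using W by simp
  have "c div W \<noteq> 0 \<or> c mod W \<noteq> 0" using c(1) div_mult_mod_eq[of c W] by auto
  then have "kn (classes x P n ! (c div W * W + c mod W)) y \<le> 1" unfolding kn_class[OF t i] by auto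
  then show "kn (classes x P n ! c) y \<le> 1" by simp
qed

lemma reduction_accepts:
  assumes "distinct cl" "set cl = colors"
  shows "inst_of (emit_text kn cl (classes x P n) N W) \<in> restricted_grid_ednr (monom 26 4)"
    "ednr_yes (inst_of (emit_text kn cl (classes x P n) N W)) \<longleftrightarrow> (\<exists>u. accepts u)"
proof -
  interpret tp: tiling_problem cl N W "classes x P n" kn start by (rule tiling_problem_classes[OF assms])
  show "inst_of (emit_text kn cl (classes x P n) N W) \<in> restricted_grid_ednr (monom 26 4)"
    by (rule tp.reduction(1)[OF length_classes])
  have "tp.tiling T \<longleftrightarrow> site_ok cl T" for T unfolding tp.tiling_def site_ok_def ..
  then show "ednr_yes (inst_of (emit_text kn cl (classes x P n) N W)) \<longleftrightarrow> (\<exists>u. accepts u)"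
    unfolding tp.reduction(2)[OF length_classes] using soundness completeness[OF _ assms(2)] by blast
qed

end

lemma string_contents_inject: "string_contents y = string_contents y' \<Longrightarrow> y = y'"
proof -
  assume eq: "string_contents y = string_contents y'"
  have pos: "string_contents w (int i) \<noteq> 0 \<longleftrightarrow> i < length w" for w i by (simp add: string_contents_def)
  have "i < length y \<longleftrightarrow> i < length y'" for i using pos[of y i] pos[of y' i] eq by simp
  then have l: "length y = length y'" by (metis linorder_neqE_nat less_irrefl)
  have "y ! i = y' ! i" if "i < length y" for i
    using fun_cong[OF eq, of "int i"] that l by (auto simp: string_contents_def split: if_splits)
  then show "y = y'" using l by (intro nth_equalityI) auto
qed

lemma tm_halted: "(tm_step M ^^ t) (tm_init M y) = (states M, ts) \<Longrightarrow> t \<le> t' \<Longrightarrow> (tm_step M ^^ t') (tm_init M y) = (states M, ts)"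
proof -
  assume h: "(tm_step M ^^ t) (tm_init M y) = (states M, ts)" and "t \<le> t'"
  then obtain d where "t' = d + t" using le_Suc_ex by (metis add.commute)
  moreover have "(tm_step M ^^ (d + t)) (tm_init M y) = (states M, ts)"
  proof (induction d)
    case (Suc d)
    then show ?case by (simp add: tm_step_def[of M])
  qed (simp add: h)
  ultimately show ?thesis by simp
qed

text \<open>The verifier has halted by time \<open>P + 1\<close> and its configuration no longer
  changes; the contents of its last tape determine the output string.\<close>

lemma (in tableau_input) accepts_iff:
  assumes M: "computes_in_time M V (poly T)" and P: "poly T (2 * length x + 1 + n) \<le> P + 1"
  shows "accepts u \<longleftrightarrow> length u \<le> n \<and> V (delimit x @ u) = [True]"
proof (cases "length u \<le> n")
  case True
  let ?y = "delimit x @ u"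
  obtain t ts where t: "t \<le> poly T (length ?y)" "(tm_step M ^^ t) (tm_init M ?y) = (Q, ts)" "snd (last ts) = string_contents (V ?y)"
    using M unfolding computes_in_time_def by blast
  have "length (concat (map (\<lambda>b. [True, b]) w)) = 2 * length w" for w by (induction w) auto
  then have "length ?y \<le> 2 * length x + 1 + n" using True by (simp add: delimit_def)
  then have "t \<le> P + 1" using t(1) P poly_mono_nat[of "length ?y" _ T] by (meson le_trans)
  then have c: "cfg ?y (P + 1) = (Q, ts)" unfolding cfg_def using tm_halted[OF t(2)] by blast
  then have "length ts = k" using cfg_ok[of ?y "P + 1"] by (simp add: cfg_ok_def)
  then have "last ts = ts ! (k - 1)" using k1(1) by (subst last_conv_nth) auto
  then have "cc ?y (P + 1) (k - 1) = string_contents (V ?y)" using t(3) c by (simp add: cc_def)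
  then show ?thesis using True c string_contents_inject by (auto simp: accepts_def qs_def)
qed (simp add: accepts_def)

text \<open>The numbers \<open>n\<close> and \<open>P\<close> are prepared in unary in
  \<open>r1\<close> and \<open>r2\<close>. The grid text ends up in register \<open>?b + 12\<close>
  with all registers above it empty, as the printer expects, and the printer writes to the last
  register.\<close>

lemma poly_time_emit:
  fixes p q :: "nat poly"
  assumes "cl \<noteq> []"
  shows "poly_time (\<lambda>x. let n = poly p (length x); P = poly q (length x); W = length (template x P n)
    in encode (inst_of (emit_text kn cl (classes x P n) ((P + 2) * W) W)))" (is "poly_time ?f")
proof -
  obtain p1 r1 where 1: "1 \<le> r1" "\<forall>k S. r1 < k \<longrightarrow> 3 \<le> S \<longrightarrow> wf_prog k S p1 {}"
    "\<forall>\<sigma>. (\<forall>i \<ge> 1. \<sigma> i = []) \<longrightarrow> eval p1 \<sigma> r1 = replicate (poly p (length (\<sigma> 0))) 1 \<and>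
      (\<forall>i. i < 1 \<or> r1 < i \<longrightarrow> eval p1 \<sigma> i = \<sigma> i)"
    using poly_prog_exists[of 1 p, OF order_refl] by (elim exE conjE)
  obtain p2 r2 where 2: "r1 + 1 \<le> r2" "\<forall>k S. r2 < k \<longrightarrow> 3 \<le> S \<longrightarrow> wf_prog k S p2 {}"
    "\<forall>\<sigma>. (\<forall>i \<ge> r1 + 1. \<sigma> i = []) \<longrightarrow> eval p2 \<sigma> r2 = replicate (poly q (length (\<sigma> 0))) 1 \<and>
      (\<forall>i. i < r1 + 1 \<or> r2 < i \<longrightarrow> eval p2 \<sigma> i = \<sigma> i)"
    using poly_prog_exists[of "r1 + 1" q, OF le_add2] by (elim exE conjE)
  let ?b = "r2 + 1"
  let ?prog = "seqs [p1, p2, emit_prog kn cl ?b r1 r2, output_prog (?b + 12)]"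
  show ?thesis
  proof (rule poly_time_prog[of 22 "?b + 12 + 11" ?prog])
    show "(3 :: nat) \<le> 22" "1 \<le> ?b + 12 + 11" by simp_all
    have "wf_prog (?b + 12 + 11) 22 p1 {}" "wf_prog (?b + 12 + 11) 22 p2 {}" using 1(2) 2(1,2) by simp_all
    moreover have "wf_prog (?b + 12 + 11) 22 (emit_prog kn cl ?b r1 r2) {}" by (rule wf_emit) (use 2(1) in auto)
    moreover have "wf_prog (?b + 12 + 11) 22 (output_prog (?b + 12)) {}" by (rule wf_output) auto
    ultimately show "wf_prog (?b + 12 + 11) 22 ?prog {}" by simp
    fix x
    let ?\<sigma> = "input_store x" and ?n = "poly p (length x)" and ?P = "poly q (length x)"
    define \<sigma>1 where "\<sigma>1 = eval p1 ?\<sigma>"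
    define \<sigma>2 where "\<sigma>2 = eval p2 \<sigma>1"
    define \<sigma>3 where "\<sigma>3 = eval (emit_prog kn cl ?b r1 r2) \<sigma>2"
    have s1: "\<sigma>1 r1 = replicate ?n 1" "\<sigma>1 0 = map bsym x" "\<And>i. r1 < i \<Longrightarrow> \<sigma>1 i = []"
      using mp[OF spec[OF 1(3), of ?\<sigma>]] 1(1) by (auto simp: \<sigma>1_def input_store_def)
    have s2: "\<sigma>2 r2 = replicate ?P 1" "\<sigma>2 r1 = replicate ?n 1" "\<sigma>2 0 = map bsym x" "\<And>i. r2 < i \<Longrightarrow> \<sigma>2 i = []"
      using mp[OF spec[OF 2(3), of \<sigma>1]] s1 2(1) by (auto simp: \<sigma>2_def)
    have s3: "\<sigma>3 (?b + 12) = emit_text kn cl (classes x ?P ?n) ((?P + 2) * length (template x ?P ?n)) (length (template x ?P ?n))"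
      "\<And>i. ?b + 12 < i \<Longrightarrow> \<sigma>3 i = []"
      unfolding \<sigma>3_def using eval_emit[of \<sigma>2 x r1 ?n r2 ?P ?b cl, OF s2(3) _ _ _ _ _ _ assms refl refl, where kn = kn] s2 2(1) by auto
    have "eval (output_prog (?b + 12)) \<sigma>3 (?b + 12 + 10) = map bsym (?f x)"
      using eval_output[of \<sigma>3 "?b + 12", OF s3] by (simp add: Let_def)
    then show "eval ?prog ?\<sigma> (?b + 12 + 11 - 1) = map bsym (?f x)"
      by (simp add: \<sigma>1_def \<sigma>2_def \<sigma>3_def)
  qed
qed

theorem theorem2:
  "\<exists>p :: nat poly.
     NP_hard (encode ` restricted_grid_ednr p)
             (encode ` {I \<in> restricted_grid_ednr p. ednr_yes I})"
  unfolding NP_hard_def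
proof (intro exI[of _ "monom 26 4"] ballI)
  fix L assume "L \<in> NP"
  then obtain V and p :: "nat poly" where V: "poly_time V"
    and L: "\<And>x. x \<in> L \<longleftrightarrow> (\<exists>u. length u \<le> poly p (length x) \<and> V (delimit x @ u) = [True])"
    unfolding NP_def by auto
  obtain M and T :: "nat poly" where M: "wf_tm M" "computes_in_time M V (poly T)"
    using V unfolding poly_time_def by blast
  interpret tableau M by standard (rule M(1))
  obtain cl where cl: "set cl = colors" "distinct cl" using finite_distinct_list[OF finite_colors] by blast
  have ne: "cl \<noteq> []" using cl(1) by (auto simp: colors_def)
  \<comment> \<open>\<open>q\<close> bounds the running time of the verifier on
    \<open>delimit x @ u\<close>, whose length is at most \<open>2 * length x + 1\<close> plus the
    length of the certificate.\<close>
  define q where "q = pcompose T ([:1, 2:] + p)"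
  define f where "f x = (let n = poly p (length x); P = poly q (length x); W = length (template x P n)
    in inst_of (emit_text kn cl (classes x P n) ((P + 2) * W) W))" for x
  have f: "f x \<in> restricted_grid_ednr (monom 26 4) \<and> (x \<in> L \<longleftrightarrow> ednr_yes (f x))" for x
  proof -
    interpret ti: tableau_input M x "poly q (length x)" "poly p (length x)" ..
    have fx: "f x = inst_of (emit_text kn cl (classes x (poly q (length x)) (poly p (length x))) ti.N ti.W)"
      by (simp add: f_def Let_def ti.N_def ti.W_def)
    have "poly T (2 * length x + 1 + poly p (length x)) = poly q (length x)"
    proof -
      have "poly ([:1, 2:] + p) (length x) = 2 * length x + 1 + poly p (length x)" by simp
      then show ?thesis unfolding q_def poly_pcompose by (rule arg_cong[OF sym])
    qed
    then have "ti.accepts u \<longleftrightarrow> length u \<le> poly p (length x) \<and> V (delimit x @ u) = [True]" for u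
      by (intro ti.accepts_iff[OF M(2)]) simp
    then show ?thesis unfolding fx using ti.reduction_accepts[OF cl(2,1)] L by simp
  qed
  \<comment> \<open>Yes-instances are compared through their codes, so injectivity of
    \<open>encode\<close> on instances is needed to exclude that a no-instance shares the code of a
    yes-instance.\<close>
  have inj: "encode J \<in> encode ` {I \<in> restricted_grid_ednr (monom 26 4). ednr_yes I} \<longleftrightarrow> ednr_yes J"
    if "J \<in> restricted_grid_ednr (monom 26 4)" for J
    using that encode_inject unfolding restricted_grid_ednr_def by blast
  show "\<exists>f. poly_time f \<and> (\<forall>x. f x \<in> encode ` restricted_grid_ednr (monom 26 4) \<and>
      (x \<in> L \<longleftrightarrow> f x \<in> encode ` {I \<in> restricted_grid_ednr (monom 26 4). ednr_yes I}))"
  proof (intro exI[of _ "\<lambda>x. encode (f x)"] conjI allI)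
    show "poly_time (\<lambda>x. encode (f x))"
      using poly_time_emit[OF ne, of p q kn] by (simp add: f_def Let_def)
    show "encode (f x) \<in> encode ` restricted_grid_ednr (monom 26 4)" for x using f by blast
    show "x \<in> L \<longleftrightarrow> encode (f x) \<in> encode ` {I \<in> restricted_grid_ednr (monom 26 4). ednr_yes I}" for x
      using f[of x] inj by simp
  qed
qed

end
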